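(* Let $1<p<4/3$. There is a constant $C_p>0$, depending only on $p$ (in particular independent of $V$, $k$ and $m$), such that the following holds for every $m\ge 0$ and every potential $V:\mathbb{R}^2\to\mathbb{C}^{2\times 2}$ as in the context. If $k\in\mathbb{C}\setminus\sigma(D_m)$ is an eigenvalue of the operator $D=D_m+V$, and $\mu\in\mathbb{C}$ satisfies $\mu^2=k^2-m^2$, then $$ \frac{C_p\int_{\mathbb{R}^2}|V(x)|^p\,dx}{|\mu|^{p-1}}\left(\sqrt{\left|\frac{k-m}{k+m}\right|}+\sqrt{\left|\frac{k+m}{k-m}\right|}+1\right)^p\ge 1 . $$ In particular, if $m=0$, then $$ |k|^{p-1}\le 3^p C_p\int_{\mathbb{R}^2}|V(x)|^p\,dx . $$
   Context: For $m\ge 0$, $D_m$ is the operator in $L^2(\mathbb{R}^2;\mathbb{C}^2)$ with domain the Sobolev space $\mathcal{H}^2(\mathbb{R}^2;\mathbb{C}^2)$ given by $$ D_m=\begin{pmatrix} m & 4\partial_{\bar z}^2\\ 4\partial_z^2 & -m\end{pmatrix},\qquad \partial_{\bar z}=\tfrac12\Bigl(\tfrac{\partial}{\partial x_1}+\tfrac1i\tfrac{\partial}{\partial x_2}\Bigr),\qquad \partial_z=\tfrac12\Bigl(\tfrac{\partial}{\partial x_1}-\tfrac1i\tfrac{\partial}{\partial x_2}\Bigr). $$ One has $D_m^2=\Delta^2+m^2$ and $\sigma(D_m)=(-\infty,-m]\cup[m,\infty)$. The potential $V=(V_{i,j})_{i,j=1,2}$ is a measurable function with values in the complex $2\times2$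 matrices, not necessarily self-adjoint, and $|V(x)|=\bigl(\sum_{i,j=1,2}|V_{i,j}(x)|^2\bigr)^{1/2}$. The operator $D=D_m+V$ acts in $L^2(\mathbb{R}^2;\mathbb{C}^2)$ with domain $\mathcal{H}^2(\mathbb{R}^2;\mathbb{C}^2)$ (so $V$ is such that $Vu\in L^2$ for all $u\in\mathcal{H}^2$). A number $k\in\mathbb{C}$ is an eigenvalue of $D$ if $Du=ku$ for some nonzero $u\in\mathcal{H}^2(\mathbb{R}^2;\mathbb{C}^2)$. The integral $\int|V|^p$ is allowed to be $+\infty$, in which case the inequalities are trivial. *)

theory Defs
  imports "HOL-Analysis.Analysis"
begin

text \<open>Elements of \<open>L\<^sup>2\<close> are represented by Lebesgue measurable functions; two of them are the
  same element iff they agree almost everywhere. The norm on \<^typ>\<open>complex ^ 2\<close> is the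
  Euclidean one.\<close>

definition L2 :: "(real ^ 2 \<Rightarrow> 'b::euclidean_space) set" where
  "L2 = {f. f \<in> borel_measurable lebesgue \<and> integrable lebesgue (\<lambda>x. (norm (f x))\<^sup>2)}"

definition L2_norm :: "(real ^ 2 \<Rightarrow> 'b::euclidean_space) \<Rightarrow> real" where
  "L2_norm f = sqrt (LINT x|lebesgue. (norm (f x))\<^sup>2)"

definition pderiv_dir :: "2 \<Rightarrow> (real ^ 2 \<Rightarrow> complex) \<Rightarrow> (real ^ 2 \<Rightarrow> complex)" where
  "pderiv_dir i f = (\<lambda>x. frechet_derivative f (at x) (axis i 1))"

text \<open>Multi-indices are lists of coordinate directions: \<open>[i, j]\<close> stands for
  \<open>\<partial>\<^sub>i \<partial>\<^sub>j\<close>.\<close>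

definition pderivs :: "2 list \<Rightarrow> (real ^ 2 \<Rightarrow> complex) \<Rightarrow> (real ^ 2 \<Rightarrow> complex)" where
  "pderivs is f = foldr pderiv_dir is f"

text \<open>\<open>C\<^sub>c\<^sup>\<infinity>\<close>: all iterated partial derivatives are (Frechet) differentiable, hence
  continuous.\<close>

definition test_functions :: "(real ^ 2 \<Rightarrow> complex) set" where
  "test_functions = {\<phi>. (\<forall>is. pderivs is \<phi> differentiable_on UNIV) \<and>
                        (\<exists>K. compact K \<and> (\<forall>x. x \<notin> K \<longrightarrow> \<phi> x = 0))}"

definition has_weak_deriv ::
    "2 list \<Rightarrow> (real ^ 2 \<Rightarrow> complex) \<Rightarrow> (real ^ 2 \<Rightarrow> complex) \<Rightarrow> bool" where
  "has_weak_deriv is f g \<longleftrightarrow>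
     (\<forall>\<phi>\<in>test_functions. (LINT x|lebesgue. f x * pderivs is \<phi> x) =
                           (-1) ^ length is * (LINT x|lebesgue. g x * \<phi> x))"

text \<open>The Sobolev space \<open>\<H>\<^sup>2\<close>, for scalar functions and for \<open>\<complex>\<^sup>2\<close>-valued ones.\<close>

definition H2_scalar :: "(real ^ 2 \<Rightarrow> complex) set" where
  "H2_scalar = {f \<in> L2. \<forall>is. length is \<le> 2 \<longrightarrow> (\<exists>g\<in>L2. has_weak_deriv is f g)}"

definition H2 :: "(real ^ 2 \<Rightarrow> complex ^ 2) set" where
  "H2 = {u. \<forall>i. (\<lambda>x. u x $ i) \<in> H2_scalar}"

text \<open>A representative of the weak partial derivative in \<open>L\<^sup>2\<close>. It is unique up to null sets, and
  unspecified if there is none; the operators below are only used on \<^const>\<open>H2\<close>, where all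
  the derivatives involved exist.\<close>

definition weak_pd :: "2 \<Rightarrow> (real ^ 2 \<Rightarrow> complex) \<Rightarrow> (real ^ 2 \<Rightarrow> complex)" where
  "weak_pd i f = (SOME g. g \<in> L2 \<and> has_weak_deriv [i] f g)"

definition d_zbar :: "(real ^ 2 \<Rightarrow> complex) \<Rightarrow> (real ^ 2 \<Rightarrow> complex)" where
  "d_zbar f = (\<lambda>x. 1 / 2 * (weak_pd 1 f x + 1 / \<i> * weak_pd 2 f x))"

definition d_z :: "(real ^ 2 \<Rightarrow> complex) \<Rightarrow> (real ^ 2 \<Rightarrow> complex)" where
  "d_z f = (\<lambda>x. 1 / 2 * (weak_pd 1 f x - 1 / \<i> * weak_pd 2 f x))"

definition D_free :: "real \<Rightarrow> (real ^ 2 \<Rightarrow> complex ^ 2) \<Rightarrow> (real ^ 2 \<Rightarrow> complex ^ 2)" where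
  "D_free m u = (\<lambda>x. vector
     [of_real m * u x $ 1 + 4 * d_zbar (d_zbar (\<lambda>y. u y $ 2)) x,
      4 * d_z (d_z (\<lambda>y. u y $ 1)) x - of_real m * u x $ 2])"

text \<open>Spectrum of an operator \<open>A\<close> in \<open>L\<^sup>2\<close> with domain \<open>\<D>\<close>: \<open>k\<close> is in the resolvent set
  iff \<open>A - k\<close> maps \<open>\<D>\<close> bijectively onto \<open>L\<^sup>2\<close> with bounded inverse. The norm estimate
  expresses both injectivity and boundedness of the inverse.\<close>

definition resolvent_set ::
    "(real ^ 2 \<Rightarrow> complex ^ 2) set \<Rightarrow> ((real ^ 2 \<Rightarrow> complex ^ 2) \<Rightarrow> (real ^ 2 \<Rightarrow> complex ^ 2))
      \<Rightarrow> complex set" where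
  "resolvent_set \<D> A = {k.
     (\<forall>f\<in>L2. \<exists>u\<in>\<D>. AE x in lebesgue. A u x - k *s u x = f x) \<and>
     (\<exists>c. \<forall>u\<in>\<D>. L2_norm u \<le> c * L2_norm (\<lambda>x. A u x - k *s u x))}"

definition spectrum ::
    "(real ^ 2 \<Rightarrow> complex ^ 2) set \<Rightarrow> ((real ^ 2 \<Rightarrow> complex ^ 2) \<Rightarrow> (real ^ 2 \<Rightarrow> complex ^ 2))
      \<Rightarrow> complex set" where
  "spectrum \<D> A = - resolvent_set \<D> A"

definition eigenvalue ::
    "(real ^ 2 \<Rightarrow> complex ^ 2) set \<Rightarrow> ((real ^ 2 \<Rightarrow> complex ^ 2) \<Rightarrow> (real ^ 2 \<Rightarrow> complex ^ 2))
      \<Rightarrow> complex \<Rightarrow> bool" where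
  "eigenvalue \<D> A k \<longleftrightarrow>
     (\<exists>u\<in>\<D>. \<not> (AE x in lebesgue. u x = 0) \<and> (AE x in lebesgue. A u x = k *s u x))"

definition potential :: "(real ^ 2 \<Rightarrow> complex ^ 2 ^ 2) \<Rightarrow> bool" where
  "potential V \<longleftrightarrow> V \<in> borel_measurable lebesgue \<and> (\<forall>u\<in>H2. (\<lambda>x. V x *v u x) \<in> L2)"

definition D_pert ::
    "real \<Rightarrow> (real ^ 2 \<Rightarrow> complex ^ 2 ^ 2) \<Rightarrow> (real ^ 2 \<Rightarrow> complex ^ 2) \<Rightarrow> (real ^ 2 \<Rightarrow> complex ^ 2)"
  where
  "D_pert m V u = (\<lambda>x. D_free m u x + V x *v u x)"

definition mat_norm :: "complex ^ 2 ^ 2 \<Rightarrow> real" where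
  "mat_norm M = sqrt (\<Sum>i\<in>UNIV. \<Sum>j\<in>UNIV. (cmod (M $ i $ j))\<^sup>2)"

definition potential_integral :: "real \<Rightarrow> (real ^ 2 \<Rightarrow> complex ^ 2 ^ 2) \<Rightarrow> ennreal" where
  "potential_integral p V = (\<integral>\<^sup>+ x. ennreal (mat_norm (V x) powr p) \<partial>lebesgue)"

end

theory Submission
  imports Defs "HOL-Real_Asymp.Real_Asymp"
begin

text \<open>The resolvent of the free operator has an integral kernel which, up to an explicit factor, is
  bounded by a function in \<open>L\<^sup>s\<close> with \<open>s = p / (p - 1)\<close>, and Hoelder's inequality alone then
  bounds an eigenfunction in \<open>L\<^sup>\<infinity>\<close> by a multiple of itself. The multiple cannot be less than \<open>1\<close>.

  For the kernel, write \<open>L = 4 \<partial>\<^sub>z\<^sup>2\<close> and \<open>L' = 4 \<partial>\<^bsub>zbar\<^esub>\<^sup>2\<close>, so that \<open>L L' = \<Delta>\<^sup>2\<close>. Eliminating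
  one component from \<open>(D\<^sub>m - \<kappa>) u = g\<close> gives \<open>(\<Delta>\<^sup>2 - \<mu>\<^sup>2) u\<^sub>1 = (\<kappa> + m) g\<^sub>1 + L' g\<^sub>2\<close> and
  \<open>(\<Delta>\<^sup>2 - \<mu>\<^sup>2) u\<^sub>2 = (\<kappa> - m) g\<^sub>2 + L g\<^sub>1\<close> with \<open>\<mu>\<^sup>2 = \<kappa>\<^sup>2 - m\<^sup>2\<close>. By partial fractions the Green
  function of \<open>\<Delta>\<^sup>2 - \<mu>\<^sup>2\<close> is a multiple of \<open>(K\<^sub>0(\<omega>\<^sub>1 r) - K\<^sub>0(\<omega>\<^sub>2 r)) / \<mu>\<close>, where \<open>\<omega>\<^sub>1\<^sup>2 = - \<mu>\<close>,
  \<open>\<omega>\<^sub>2\<^sup>2 = \<mu>\<close> and \<open>K\<^sub>0\<close> is the modified Bessel function. The logarithmic singularities of the two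
  terms cancel, and for large \<open>r\<close> each of them is \<open>O((|\<mu>|\<^bsup>1/2\<^esup> r)\<^bsup>-1/2\<^esup>)\<close>. The second derivatives of
  the difference also stay bounded in the combinations \<open>L\<close> and \<open>L'\<close>: these symbols are
  traceless, and what they leave of the Hessian is a factor of modulus \<open>1\<close> times the difference
  of the radial functions \<open>\<omega>\<^sup>2 K\<^sub>2(\<omega> r)\<close>, whose \<open>1 / r\<^sup>2\<close> singularities cancel. So all entries of
  the resolvent kernel are dominated by \<open>(|\<kappa> \<plusminus> m| / |\<mu>| + 1) min(1, (|\<mu>|\<^bsup>1/2\<^esup> r)\<^bsup>-1/2\<^esup>)\<close>, uniformly
  in the distance to the spectrum (\<open>norm_cosh_moment_0_diff_le_decay\<close>,
  \<open>norm_bessel_w2K2_diff_le_decay\<close>, \<open>representation\<close>, \<open>resolvent_pointwise_bound\<close>).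

  Turning to the eigenfunction, \<open>min(1, r\<^bsup>-1/2\<^esup>)\<close> lies in \<open>L\<^sup>s\<close> of the plane iff \<open>s > 4\<close>, that is,
  iff \<open>p < 4/3\<close>, and scaling gives the norm a factor \<open>|\<mu>|\<^bsup>-1/s\<^esup>\<close> (\<open>integral_decay_powr_le\<close>). If
  \<open>(D\<^sub>m + V) u = k u\<close>, then formally \<open>u = - (D\<^sub>m - k)\<^bsup>-1\<^esup> V u\<close>, and Hoelder's inequality yields
  \<open>\<parallel>u\<parallel>\<^sub>\<infinity> \<le> C S |\<mu>|\<^bsup>-1/s\<^esup> \<parallel>V\<parallel>\<^sub>p \<parallel>u\<parallel>\<^sub>\<infinity>\<close>, where \<open>S\<close> is the bracket in the claim: since
  \<open>|\<mu>|\<^sup>2 = |k - m| |k + m|\<close>, the square roots in \<open>S\<close> are the quotients \<open>|k \<plusminus> m| / |\<mu>|\<close>. Dividing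
  by the norm of \<open>u\<close> and taking \<open>p\<close>-th powers proves the theorem, because \<open>p / s = p - 1\<close>.

  To make this rigorous one moves \<open>k\<close> to \<open>\<kappa> = k \<plusminus> \<i> \<delta>\<close>. This keeps \<open>\<mu>\<close> off the real axis, so
  that the kernel decays exponentially and is square integrable, and costs the extra term
  \<open>(k - \<kappa>) u\<close>. For fixed \<open>\<delta>\<close> the kernel bound shows that \<open>u\<close> is essentially bounded; as \<open>\<delta>\<close>
  tends to \<open>0\<close>, the extra term vanishes, since its coefficient is \<open>\<delta>\<close> while the \<open>L\<^sup>2\<close> norm of the
  kernel grows only like \<open>\<delta>\<^bsup>-1/2\<^esup>\<close> (\<open>eigenvalue_inequality\<close>). Two values of \<open>k\<close> remain, \<open>k = \<plusminus> m\<close>,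
  where \<open>\<mu> = 0\<close>; there it suffices that \<open>V\<close> does not vanish, which holds as \<open>k\<close> would otherwise
  be an eigenvalue of \<open>D\<^sub>m\<close> itself (\<open>potential_integral_pos\<close>).\<close>

section \<open>Integrals with a parameter and over unbounded intervals\<close>

lemma vector_derivative_slope_bound:
  fixes f :: "real \<Rightarrow> 'a::banach"
  assumes "\<And>s. \<bar>s - s0\<bar> < d \<Longrightarrow> (f has_vector_derivative f' s) (at s)"
    and "\<And>s. \<bar>s - s0\<bar> < d \<Longrightarrow> norm (f' s) \<le> B" and "\<bar>t - s0\<bar> < d"
  shows "norm (f t - f s0) \<le> B * \<bar>t - s0\<bar>"
proof -
  have "d > 0" using assms(3) by linarith
  have "norm (f t - f s0) \<le> B * norm (t - s0)"
  proof (rule differentiable_bound[of "ball s0 d" f "\<lambda>s h. h *\<^sub>R f' s"])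
    fix s assume "s \<in> ball s0 d"
    then have s: "\<bar>s - s0\<bar> < d" by (auto simp: dist_real_def)
    show "(f has_derivative (\<lambda>h. h *\<^sub>R f' s)) (at s within ball s0 d)"
      using assms(1)[OF s] by (auto simp: has_vector_derivative_def intro: has_derivative_at_withinI)
    have bn: "bounded_linear (\<lambda>h::real. h *\<^sub>R f' s)" by (rule bounded_linear_scaleR_left)
    show "onorm (\<lambda>h. h *\<^sub>R f' s) \<le> B"
    proof (rule onorm_le)
      show "norm (x *\<^sub>R f' s) \<le> B * norm x" for x
        using mult_left_mono[OF assms(2)[OF s] abs_ge_zero[of x]] by (simp add: mult.commute)
    qed
  qed (use assms(3) \<open>d > 0\<close> in \<open>auto simp: dist_real_def\<close>)
  then show ?thesis by simp
qed

text \<open>Dominated convergence of the difference quotients, which the mean value inequality bounds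
  by the majorant of the derivatives.\<close>
lemma has_vector_derivative_integral:
  fixes f :: "real \<Rightarrow> 'b \<Rightarrow> complex"
  assumes d: "d > 0"
    and int: "\<And>s. \<bar>s - s0\<bar> < d \<Longrightarrow> integrable M (f s)"
    and der: "\<And>s x. \<bar>s - s0\<bar> < d \<Longrightarrow> ((\<lambda>s. f s x) has_vector_derivative f' s x) (at s)"
    and bnd: "\<And>s x. \<bar>s - s0\<bar> < d \<Longrightarrow> norm (f' s x) \<le> B x"
    and B: "integrable M B" and meas: "f' s0 \<in> borel_measurable M"
  shows "((\<lambda>s. LINT x|M. f s x) has_vector_derivative (LINT x|M. f' s0 x)) (at s0)"
proof -
  let ?F = "\<lambda>s. LINT x|M. f s x"
  have "((\<lambda>h. (?F (s0 + h) - ?F s0) /\<^sub>R h) \<longlongrightarrow> (LINT x|M. f' s0 x)) (at 0)"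
    unfolding tendsto_at_iff_sequentially
  proof (intro allI impI)
    fix X :: "nat \<Rightarrow> real" assume X0: "\<forall>i. X i \<in> UNIV - {0}" and X: "X \<longlonglongrightarrow> 0"
    have "eventually (\<lambda>i. \<bar>X i\<bar> < d) sequentially"
      using X d by (auto dest!: tendstoD[of X 0 _ d] simp: dist_real_def)
    then obtain N where N: "\<And>i. i \<ge> N \<Longrightarrow> \<bar>X i\<bar> < d"
      by (auto simp: eventually_sequentially)
    define Y where "Y = (\<lambda>i. X (i + N))"
    have Yd: "\<bar>Y i\<bar> < d" and Y0: "Y i \<noteq> 0" for i using N X0 by (auto simp: Y_def)
    have Y: "Y \<longlonglongrightarrow> 0" unfolding Y_def using X by (rule LIMSEQ_ignore_initial_segment)
    have "(\<lambda>i. LINT x|M. (f (s0 + Y i) x - f s0 x) /\<^sub>R Y i) \<longlonglongrightarrow> (LINT x|M. f' s0 x)"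
    proof (rule integral_dominated_convergence[where w = B])
      show "(\<lambda>x. (f (s0 + Y i) x - f s0 x) /\<^sub>R Y i) \<in> borel_measurable M" for i
        using int[of "s0 + Y i"] int[of s0] Yd[of i] d by (intro borel_measurable_integrable) auto
      show "AE x in M. (\<lambda>i. (f (s0 + Y i) x - f s0 x) /\<^sub>R Y i) \<longlonglongrightarrow> f' s0 x"
      proof (rule AE_I2)
        fix x
        have "((\<lambda>s. f s x) has_derivative (\<lambda>h. h *\<^sub>R f' s0 x)) (at s0)"
          using der[of s0 x] d by (simp add: has_vector_derivative_def)
        then have "((\<lambda>h. norm (f (s0 + h) x - f s0 x - h *\<^sub>R f' s0 x) / norm h) \<longlongrightarrow> 0) (at 0)"
          by (simp add: has_derivative_at)
        then have "(\<lambda>i. norm (f (s0 + Y i) x - f s0 x - Y i *\<^sub>R f' s0 x) / norm (Y i)) \<longlonglongrightarrow> 0"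
          using Y Y0 unfolding tendsto_at_iff_sequentially comp_def by auto
        moreover have "norm (f (s0 + Y i) x - f s0 x - Y i *\<^sub>R f' s0 x) / norm (Y i)
            = norm ((f (s0 + Y i) x - f s0 x) /\<^sub>R Y i - f' s0 x)" for i
        proof -
          have "(f (s0 + Y i) x - f s0 x) /\<^sub>R Y i - f' s0 x
              = (f (s0 + Y i) x - f s0 x - Y i *\<^sub>R f' s0 x) /\<^sub>R Y i"
            using Y0[of i] by (simp add: scaleR_right_diff_distrib)
          then show ?thesis by (simp add: divide_inverse mult.commute)
        qed
        ultimately have "(\<lambda>i. norm ((f (s0 + Y i) x - f s0 x) /\<^sub>R Y i - f' s0 x)) \<longlonglongrightarrow> 0" by simp
        then show "(\<lambda>i. (f (s0 + Y i) x - f s0 x) /\<^sub>R Y i) \<longlonglongrightarrow> f' s0 x"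
          by (metis LIM_zero_iff tendsto_norm_zero_iff)
      qed
      show "AE x in M. norm ((f (s0 + Y i) x - f s0 x) /\<^sub>R Y i) \<le> B x" for i
      proof (rule AE_I2)
        fix x
        have "norm (f (s0 + Y i) x - f s0 x) \<le> B x * \<bar>(s0 + Y i) - s0\<bar>"
          by (rule vector_derivative_slope_bound[of s0 d "\<lambda>s. f s x" "\<lambda>s. f' s x"])
            (use der bnd Yd in auto)
        then show "norm ((f (s0 + Y i) x - f s0 x) /\<^sub>R Y i) \<le> B x"
          using Y0[of i] unfolding norm_scaleR abs_inverse add_diff_cancel_left'
          by (subst mult.commute, subst divide_inverse[symmetric], subst pos_divide_le_eq) auto
      qed
    qed (use B meas in auto)
    moreover have "(LINT x|M. (f (s0 + Y i) x - f s0 x) /\<^sub>R Y i) = (?F (s0 + Y i) - ?F s0) /\<^sub>R Y i" for i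
      using int[of "s0 + Y i"] int[of s0] Yd[of i] d
      by (subst integral_scaleR_right, subst Bochner_Integration.integral_diff) auto
    ultimately have "(\<lambda>i. (?F (s0 + X (i + N)) - ?F s0) /\<^sub>R X (i + N)) \<longlonglongrightarrow> (LINT x|M. f' s0 x)"
      by (simp only: Y_def)
    then show "((\<lambda>h. (?F (s0 + h) - ?F s0) /\<^sub>R h) \<circ> X) \<longlonglongrightarrow> (LINT x|M. f' s0 x)"
      unfolding comp_def using LIMSEQ_offset by fastforce
  qed
  then have "((\<lambda>h. norm ((?F (s0 + h) - ?F s0) /\<^sub>R h - (LINT x|M. f' s0 x))) \<longlongrightarrow> 0) (at 0)"
    by (simp add: LIM_zero_iff tendsto_norm_zero_iff)
  then have "((\<lambda>h. norm (?F (s0 + h) - ?F s0 - h *\<^sub>R (LINT x|M. f' s0 x)) / norm h) \<longlongrightarrow> 0) (at 0)"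
  proof (rule Lim_transform_eventually)
    show "\<forall>\<^sub>F h in at 0. norm ((?F (s0 + h) - ?F s0) /\<^sub>R h - (LINT x|M. f' s0 x))
         = norm (?F (s0 + h) - ?F s0 - h *\<^sub>R (LINT x|M. f' s0 x)) / norm h"
      unfolding eventually_at_filter
    proof (intro always_eventually allI impI)
      fix h :: real assume "h \<noteq> 0"
      then have "(?F (s0 + h) - ?F s0) /\<^sub>R h - (LINT x|M. f' s0 x)
          = (?F (s0 + h) - ?F s0 - h *\<^sub>R (LINT x|M. f' s0 x)) /\<^sub>R h"
        by (simp add: scaleR_right_diff_distrib)
      then show "norm ((?F (s0 + h) - ?F s0) /\<^sub>R h - (LINT x|M. f' s0 x))
         = norm (?F (s0 + h) - ?F s0 - h *\<^sub>R (LINT x|M. f' s0 x)) / norm h"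
        by (simp add: divide_inverse mult.commute)
    qed
  qed
  then show ?thesis
    by (simp add: has_vector_derivative_def has_derivative_at bounded_linear_scaleR_left)
qed

lemma integral_FTC_Ici:
  fixes G g :: "real \<Rightarrow> 'a::euclidean_space"
  assumes der: "\<And>t. t \<ge> a \<Longrightarrow> (G has_vector_derivative g t) (at t)"
    and int: "set_integrable lborel {a..} g" and lim: "(G \<longlongrightarrow> L) at_top"
  shows "(LINT t:{a..}|lborel. g t) = L - G a"
proof -
  have "((\<lambda>b. LINT t:{a..b}|lborel. g t) \<longlongrightarrow> (LINT t:{a..}|lborel. g t)) at_top"
    by (rule tendsto_set_lebesgue_integral_at_top) (use int in auto)
  moreover have "\<forall>\<^sub>F b in at_top. (LINT t:{a..b}|lborel. g t) = G b - G a"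
    using eventually_ge_at_top[of a]
  proof eventually_elim
    case (elim b)
    have "(g has_integral (G b - G a)) {a..b}"
      by (rule fundamental_theorem_of_calculus)
        (use elim der in \<open>auto intro: has_vector_derivative_at_within\<close>)
    moreover have "set_integrable lborel {a..b} g"
      by (rule set_integrable_subset[OF int]) auto
    ultimately show ?case
      using set_borel_integral_eq_integral(2) integral_unique by metis
  qed
  ultimately have "((\<lambda>b. G b - G a) \<longlongrightarrow> (LINT t:{a..}|lborel. g t)) at_top"
    by (rule Lim_transform_eventually)
  moreover have "((\<lambda>b. G b - G a) \<longlongrightarrow> L - G a) at_top"
    by (intro tendsto_intros lim)
  ultimately show ?thesis
    using tendsto_unique by force
qed

text \<open>The difference \<open>G b - G (- b)\<close> tends to the integral of \<open>g\<close>, but it is also an integrable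
  function of \<open>b\<close>, so its limit can only be \<open>0\<close>. Integrability of \<open>G\<close> thus takes the place of
  decay at infinity, which along almost every line of the plane is all that Fubini's theorem
  provides.\<close>
lemma integral_derivative_eq_0:
  fixes G g :: "real \<Rightarrow> complex"
  assumes der: "\<And>t. (G has_vector_derivative g t) (at t)"
    and G: "integrable lborel G" and g: "integrable lborel g"
  shows "(LINT t|lborel. g t) = 0"
proof (rule ccontr)
  let ?I = "LINT t|lborel. g t"
  assume "?I \<noteq> 0"
  define H where "H = (\<lambda>b. G b - G (- b))"
  have Heq: "(LINT t:{-b..b}|lborel. g t) = H b" if "b \<ge> 0" for b
  proof -
    have "(g has_integral (G b - G (-b))) {-b..b}"
      by (rule fundamental_theorem_of_calculus)
        (use that der in \<open>auto intro: has_vector_derivative_at_within\<close>)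
    moreover have "set_integrable lborel {-b..b} g"
      unfolding set_integrable_def by (intro integrable_mult_indicator g) auto
    ultimately show ?thesis unfolding H_def
      using set_borel_integral_eq_integral(2) integral_unique by metis
  qed
  have "((\<lambda>b. LINT t|lborel. indicator {-b..b} t *\<^sub>R g t) \<longlongrightarrow> ?I) at_top"
  proof (rule integral_dominated_convergence_at_top[where w = "\<lambda>t. norm (g t)"])
    show "AE t in lborel. ((\<lambda>b. indicator {-b..b} t *\<^sub>R g t) \<longlongrightarrow> g t) at_top"
    proof (rule AE_I2)
      fix t :: real
      have "\<forall>\<^sub>F b in at_top. indicator {-b..b} t *\<^sub>R g t = g t"
        using eventually_ge_at_top[of "\<bar>t\<bar>"] by eventually_elim (auto simp: indicator_def)
      then show "((\<lambda>b. indicator {-b..b} t *\<^sub>R g t) \<longlongrightarrow> g t) at_top"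
        by (rule tendsto_eventually)
    qed
    show "\<forall>\<^sub>F b in at_top. AE t in lborel. norm (indicator {-b..b} t *\<^sub>R g t) \<le> norm (g t)"
      by (auto simp: indicator_def)
  qed (use g in auto)
  then have "(H \<longlongrightarrow> ?I) at_top"
    by (rule Lim_transform_eventually)
      (rule eventually_mono[OF eventually_ge_at_top[of 0]], use Heq in \<open>simp add: set_lebesgue_integral_def\<close>)
  then have "\<forall>\<^sub>F b in at_top. dist (H b) ?I < norm ?I / 2"
    using \<open>?I \<noteq> 0\<close> by (intro tendstoD) auto
  then obtain b0 where b0: "\<And>b. b \<ge> b0 \<Longrightarrow> dist (H b) ?I < norm ?I / 2"
    by (auto simp: eventually_at_top_linorder)
  have big: "norm (H b) \<ge> norm ?I / 2" if "b \<ge> b0" for b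
    using b0[OF that] norm_triangle_ineq2[of ?I "H b"] by (simp add: dist_norm norm_minus_commute)
  \<comment> \<open>Beyond some point H stays at distance at least half of the limit from 0, although it is
    integrable.\<close>
  have "integrable lborel H"
    unfolding H_def using lborel_integrable_real_affine[OF G, of "-1" 0] G by auto
  then have "integrable lborel (\<lambda>b. norm ?I / 2 * indicator {b0..} b)"
    by (rule Bochner_Integration.integrable_bound) (use big in \<open>auto simp: indicator_def\<close>)
  then have "integrable lborel (indicator {b0..} :: real \<Rightarrow> real)"
    using \<open>?I \<noteq> 0\<close> by (subst (asm) integrable_mult_left_iff) auto
  then have fin: "emeasure lborel {b0..} < \<infinity>" by (simp add: integrable_indicator_iff)
  then obtain c where c: "emeasure lborel {b0..} = ennreal c" "c \<ge> 0"
    by (metis infinity_ennreal_def less_irrefl ennreal_cases)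
  obtain n :: nat where n: "real n > c" using reals_Archimedean2 by blast
  have "emeasure lborel {b0..b0 + real n} \<le> emeasure lborel {b0..}"
    by (intro emeasure_mono) auto
  then show False using c n by simp
qed

section \<open>Modified Bessel functions of complex argument\<close>

definition bessel_integrand :: "nat \<Rightarrow> complex \<Rightarrow> real \<Rightarrow> complex" where
  "bessel_integrand j w t = indicator {0..} t *\<^sub>R (of_real (cosh t ^ j) * exp (- w * of_real (cosh t)))"

text \<open>The Bessel function \<open>K\<^sub>0\<close> and the derivatives \<open>(-1)\<^sup>j K\<^sub>0\<^bsup>(j)\<^esup>\<close> in the half plane of positive
  real part. In particular \<open>K\<^sub>1\<close> is the moment of order \<open>1\<close>.\<close>
definition cosh_moment :: "nat \<Rightarrow> complex \<Rightarrow> complex" where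
  "cosh_moment j w = (LINT t|lborel. bessel_integrand j w t)"

lemma integrable_exp_minus_Ici: "integrable lborel (\<lambda>t::real. indicator {0..} t *\<^sub>R exp (- t))"
proof -
  have "(\<lambda>t::real. exp (- t)) absolutely_integrable_on {0..}"
    using integrable_on_exp_minus_to_infinity[of 1 0]
    by (intro nonnegative_absolutely_integrable_1) auto
  then have "integrable lebesgue (\<lambda>t::real. indicator {0..} t *\<^sub>R exp (- t))"
    by (simp add: set_integrable_def)
  then show ?thesis by (subst (asm) integrable_completion) auto
qed

lemma integral_exp_minus_Ici: "(LINT t|lborel. indicator {0..} t *\<^sub>R exp (- t::real)) = 1"
proof -
  have "(LINT t:{0..}|lborel. exp (-t::real)) = integral {0..} (\<lambda>t. exp (- t))"
    using integrable_exp_minus_Ici by (intro set_borel_integral_eq_integral) (simp add: set_integrable_def)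
  also have "\<dots> = 1"
    using has_integral_exp_minus_to_infinity[of 1 0] by (auto intro: integral_unique)
  finally show ?thesis by (simp add: set_lebesgue_integral_def)
qed

lemma cosh_ge_half_exp: "cosh (t::real) \<ge> exp t / 2"
  by (simp add: cosh_def)

lemma cosh_power_exp_bound:
  assumes "a > 0"
  obtains C where "C \<ge> 0" "\<And>t::real. cosh t ^ j * exp (- a * cosh t) \<le> C * exp (- t)"
proof -
  have "((\<lambda>x::real. x ^ Suc j * exp (- a * x)) \<longlongrightarrow> 0) at_top"
    using assms by real_asymp
  then have "\<forall>\<^sub>F x in at_top. x ^ Suc j * exp (- a * x) < 1"
    by (rule order_tendstoD) simp
  then obtain X where X: "\<And>x. x \<ge> X \<Longrightarrow> x ^ Suc j * exp (- a * x) < 1"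
    by (auto simp: eventually_at_top_linorder)
  define C where "C = max 1 (\<bar>X\<bar> ^ Suc j)"
  have C: "x ^ Suc j * exp (- a * x) \<le> C" if "x \<ge> 0" for x
  proof (cases "x \<ge> X")
    case True then show ?thesis using X[of x] by (simp add: C_def)
  next
    case False
    have "x ^ Suc j * exp (- a * x) \<le> \<bar>X\<bar> ^ Suc j * 1"
      using False that assms by (intro mult_mono power_mono) auto
    then show ?thesis by (simp add: C_def)
  qed
  show ?thesis
  proof
    show "2 * C \<ge> 0" by (simp add: C_def)
    fix t :: real
    have "cosh t ^ j * exp (- a * cosh t) = (cosh t ^ Suc j * exp (- a * cosh t)) / cosh t"
      by simp
    also have "\<dots> \<le> C / cosh t"
      by (intro divide_right_mono C) auto
    also have "\<dots> \<le> C / (exp t / 2)"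
      by (intro divide_left_mono cosh_ge_half_exp) (auto simp: C_def)
    finally show "cosh t ^ j * exp (- a * cosh t) \<le> 2 * C * exp (- t)"
      by (simp add: exp_minus field_simps)
  qed
qed

lemma norm_bessel_integrand:
  "cmod (bessel_integrand j w t) = indicator {0..} t * (cosh t ^ j * exp (- Re w * cosh t))"
  by (simp add: bessel_integrand_def norm_mult norm_power norm_exp_eq_Re indicator_def)

lemma bessel_integrand_measurable [measurable]: "bessel_integrand j w \<in> borel_measurable borel"
proof -
  have "cosh \<in> borel_measurable (borel :: real measure)"
    by (intro borel_measurable_continuous_onI continuous_intros)
  then show ?thesis unfolding bessel_integrand_def by measurable
qed

lemma integrable_bessel_dominant:
  assumes "a > 0"
  shows "integrable lborel (\<lambda>t. indicator {0..} t * (cosh t ^ j * exp (- a * cosh (t::real))))"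
proof -
  obtain C where C: "C \<ge> 0" "\<And>t::real. cosh t ^ j * exp (- a * cosh t) \<le> C * exp (- t)"
    using cosh_power_exp_bound[OF assms] by metis
  have [measurable]: "cosh \<in> borel_measurable (borel :: real measure)"
    by (intro borel_measurable_continuous_onI continuous_intros)
  show ?thesis
  proof (rule Bochner_Integration.integrable_bound)
    show "integrable lborel (\<lambda>t::real. C * (indicator {0..} t *\<^sub>R exp (- t)))"
      by (intro integrable_mult_right integrable_exp_minus_Ici)
  qed (use C in \<open>auto simp: indicator_def abs_mult\<close>)
qed

lemma integrable_bessel:
  assumes "Re w > 0" shows "integrable lborel (bessel_integrand j w)"
  by (rule Bochner_Integration.integrable_bound[OF integrable_bessel_dominant[OF assms, of j]])
     (auto simp: norm_bessel_integrand)

lemma cosh_moment_has_derivative: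
  assumes "Re (om * of_real r) > 0" "r > 0"
  shows "((\<lambda>r. cosh_moment j (om * of_real r)) has_vector_derivative
            - om * cosh_moment (Suc j) (om * of_real r)) (at r)"
proof -
  have om: "Re om > 0" using assms by (simp add: zero_less_mult_iff)
  have "((\<lambda>s. LINT t|lborel. bessel_integrand j (om * of_real s) t) has_vector_derivative
      (LINT t|lborel. - om * bessel_integrand (Suc j) (om * of_real r) t)) (at r)"
  proof (rule has_vector_derivative_integral[where d = "r / 2"
      and B = "\<lambda>t. cmod om * (indicator {0..} t * (cosh t ^ Suc j * exp (- (Re om * (r/2)) * cosh t)))"])
    show "r / 2 > 0" using assms by simp
    fix s assume "\<bar>s - r\<bar> < r / 2"
    then have s: "s > r / 2" by linarith
    then have "Re om * s > 0" using om assms by (intro mult_pos_pos) auto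
    then show "integrable lborel (bessel_integrand j (om * of_real s))"
      by (intro integrable_bessel) simp
    show "((\<lambda>s. bessel_integrand j (om * of_real s) t) has_vector_derivative
        - om * bessel_integrand (Suc j) (om * of_real s) t) (at s)" for t
    proof -
      let ?c = "indicator {0..} t *\<^sub>R (of_real (cosh t ^ j)) :: complex"
      have "((\<lambda>z. ?c * exp (- (om * z) * of_real (cosh t))) has_field_derivative
          ?c * (- om * of_real (cosh t) * exp (- (om * of_real s) * of_real (cosh t)))) (at (of_real s))"
        by (auto intro!: derivative_eq_intros)
      from has_vector_derivative_real_field[OF this] show ?thesis
        by (simp add: bessel_integrand_def comp_def mult_ac)
    qed
    show "cmod (- om * bessel_integrand (Suc j) (om * of_real s) t)
      \<le> cmod om * (indicator {0..} t * (cosh t ^ Suc j * exp (- (Re om * (r/2)) * cosh t)))" for t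
      unfolding norm_mult norm_bessel_integrand norm_minus_cancel
      using s om by (intro mult_left_mono) (auto intro!: mult_left_mono mult_right_mono)
  next
    show "integrable lborel (\<lambda>t. cmod om * (indicator {0..} t * (cosh t ^ Suc j * exp (- (Re om * (r/2)) * cosh t))))"
      using om assms by (intro integrable_mult_right integrable_bessel_dominant) simp
  qed auto
  then show ?thesis unfolding cosh_moment_def by simp
qed

lemma tendsto_exp_cosh_at_top:
  fixes w :: complex
  assumes "Re w > 0"
  shows "((\<lambda>t. exp (- w * of_real (cosh t))) \<longlongrightarrow> 0) at_top"
  and "((\<lambda>t. of_real (sinh t) * exp (- w * of_real (cosh t))) \<longlongrightarrow> 0) at_top"
proof -
  obtain C where C: "C \<ge> 0" "\<And>t::real. cosh t ^ 0 * exp (- Re w * cosh t) \<le> C * exp (- t)"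
    using cosh_power_exp_bound[OF assms] by metis
  obtain D where D: "D \<ge> 0" "\<And>t::real. cosh t ^ 1 * exp (- Re w * cosh t) \<le> D * exp (- t)"
    using cosh_power_exp_bound[OF assms] by metis
  have lim: "((\<lambda>t. E * exp (- t)) \<longlongrightarrow> (0::real)) at_top" for E by real_asymp
  show "((\<lambda>t. exp (- w * of_real (cosh t))) \<longlongrightarrow> 0) at_top"
    by (rule Lim_null_comparison[OF _ lim[of C]], rule always_eventually)
       (use C in \<open>simp add: norm_exp_eq_Re\<close>)
  show "((\<lambda>t. of_real (sinh t) * exp (- w * of_real (cosh t))) \<longlongrightarrow> 0) at_top"
  proof (rule Lim_null_comparison[OF _ lim[of D]], rule always_eventually, rule allI)
    fix t
    have "cmod (of_real (sinh t) * exp (- w * of_real (cosh t))) = \<bar>sinh t\<bar> * exp (- Re w * cosh t)"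
      by (simp add: norm_mult norm_exp_eq_Re)
    also have "\<dots> \<le> cosh t * exp (- Re w * cosh t)"
      using sinh_less_cosh_real[of "\<bar>t\<bar>"] by (intro mult_right_mono) auto
    also have "\<dots> \<le> D * exp (- t)" using D(2)[of t] by simp
    finally show "cmod (of_real (sinh t) * exp (- w * of_real (cosh t))) \<le> D * exp (- t)" .
  qed
qed

lemma hyperbolic_of_real:
  "cosh (of_real t :: complex) = of_real (cosh t)" "sinh (of_real t :: complex) = of_real (sinh t)"
  by (simp_all add: cosh_def sinh_def exp_of_real scaleR_conv_of_real flip: of_real_minus)

lemma exp_cosh_has_derivative:
  fixes w :: complex
  shows "((\<lambda>t. exp (- w * of_real (cosh t))) has_vector_derivative
      - w * of_real (sinh t) * exp (- w * of_real (cosh t))) (at t)"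
proof -
  have "((\<lambda>z::complex. exp (- w * cosh z)) has_field_derivative
      - w * sinh (of_real t) * exp (- w * cosh (of_real t))) (at (of_real t))"
    by (auto intro!: derivative_eq_intros)
  from has_vector_derivative_real_field[OF this] show ?thesis
    by (simp add: hyperbolic_of_real)
qed

lemma integrable_bessel_Ici:
  assumes "Re w > 0" "d \<ge> 0"
  shows "set_integrable lborel {d..} (\<lambda>t. of_real (cosh t ^ j) * exp (- w * of_real (cosh t)))"
proof -
  have "set_integrable lborel {0..} (\<lambda>t. of_real (cosh t ^ j) * exp (- w * of_real (cosh t)))"
    using integrable_bessel[OF assms(1), of j] unfolding set_integrable_def bessel_integrand_def .
  then show ?thesis by (rule set_integrable_subset) (use assms in auto)
qed

lemma cosh_moment_eq:
  "cosh_moment j w = (LINT t:{0..}|lborel. of_real (cosh t ^ j) * exp (- w * of_real (cosh t)))"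
  by (simp add: set_lebesgue_integral_def cosh_moment_def bessel_integrand_def)

text \<open>Bessel's equation for \<open>K\<^sub>0\<close>. It expresses that \<open>sinh t e\<^bsup>- w cosh t\<^esup>\<close> vanishes at both ends
  of the half line, so that its derivative has integral \<open>0\<close>.\<close>
lemma cosh_moment_2:
  assumes "Re w > 0"
  shows "w * cosh_moment 2 w = w * cosh_moment 0 w + cosh_moment 1 w"
proof -
  let ?e = "\<lambda>t. exp (- w * of_real (cosh t))"
  have "(LINT t:{0..}|lborel. (of_real (cosh t ^ 1) * ?e t) - w * (of_real (cosh t ^ 2) * ?e t - of_real (cosh t ^ 0) * ?e t))
      = 0 - of_real (sinh 0) * ?e 0"
  proof (rule integral_FTC_Ici)
    show "((\<lambda>t. of_real (sinh t) * ?e t) has_vector_derivative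
        (of_real (cosh t ^ 1) * ?e t) - w * (of_real (cosh t ^ 2) * ?e t - of_real (cosh t ^ 0) * ?e t)) (at t)" for t
    proof -
      have "((\<lambda>z::complex. sinh z * exp (- w * cosh z)) has_field_derivative
         cosh (of_real t) * exp (- w * cosh (of_real t)) + sinh (of_real t) * (- w * sinh (of_real t) * exp (- w * cosh (of_real t)))) (at (of_real t))"
        by (auto intro!: derivative_eq_intros)
      from has_vector_derivative_real_field[OF this]
      have "((\<lambda>t. of_real (sinh t) * ?e t) has_vector_derivative
         of_real (cosh t) * ?e t - w * ((of_real (sinh t))^2 * ?e t)) (at t)"
        by (simp add: hyperbolic_of_real power2_eq_square mult_ac)
      moreover have "(of_real (sinh t))^2 = (of_real (cosh t ^ 2 - 1) :: complex)"
        using cosh_square_eq[of t] by (simp flip: of_real_power)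
      ultimately show ?thesis by (simp add: algebra_simps)
    qed
    show "set_integrable lborel {0..} (\<lambda>t. (of_real (cosh t ^ 1) * ?e t) - w * (of_real (cosh t ^ 2) * ?e t - of_real (cosh t ^ 0) * ?e t))"
      by (intro set_integral_diff set_integrable_mult_right integrable_bessel_Ici assms) auto
    show "((\<lambda>t. of_real (sinh t) * ?e t) \<longlongrightarrow> 0) at_top"
      by (rule tendsto_exp_cosh_at_top[OF assms])
  qed
  moreover have "(LINT t:{0..}|lborel. (of_real (cosh t ^ 1) * ?e t) - w * (of_real (cosh t ^ 2) * ?e t - of_real (cosh t ^ 0) * ?e t))
     = cosh_moment 1 w - w * (cosh_moment 2 w - cosh_moment 0 w)"
    unfolding cosh_moment_eq
    by (subst set_integral_diff set_integral_mult_right;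
        (intro set_integral_diff set_integrable_mult_right integrable_bessel_Ici assms order_refl)?)+
       (rule refl)
  ultimately show ?thesis by (simp add: algebra_simps)
qed

text \<open>The singularity of \<open>K\<^sub>1\<close> at \<open>0\<close> is exactly \<open>1 / w\<close>: replacing \<open>cosh t\<close> by \<open>sinh t\<close> in front
  of the exponential makes the integral elementary, equal to \<open>e\<^bsup>-w\<^esup> / w\<close>, and
  \<open>cosh t - sinh t = e\<^bsup>-t\<^esup>\<close> is integrable.\<close>
lemma norm_mult_cosh_moment_1:
  assumes "Re w > 0"
  shows "cmod (w * cosh_moment 1 w - exp (- w)) \<le> cmod w * exp (- Re w)"
proof -
  let ?e = "\<lambda>t. exp (- w * of_real (cosh t))"
  have sinh_int: "set_integrable lborel {0..} (\<lambda>t. - w * of_real (sinh t) * ?e t)"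
    unfolding set_integrable_def
  proof (rule Bochner_Integration.integrable_bound)
    show "integrable lborel (\<lambda>t. cmod w * cmod (bessel_integrand 1 w t))"
      by (intro integrable_mult_right integrable_norm integrable_bessel assms)
    have "sinh \<in> borel_measurable (borel :: real measure)" "cosh \<in> borel_measurable (borel :: real measure)"
      by (intro borel_measurable_continuous_onI continuous_intros)+
    then show "(\<lambda>t. indicator {0..} t *\<^sub>R (- w * of_real (sinh t) * ?e t)) \<in> borel_measurable lborel"
      by measurable
    show "AE t in lborel. norm (indicator {0..} t *\<^sub>R (- w * of_real (sinh t) * ?e t))
        \<le> norm (cmod w * cmod (bessel_integrand 1 w t))"
    proof (rule AE_I2)
      fix t :: real
      have "cmod w * (sinh t * exp (- (Re w * cosh t))) \<le> cmod w * (cosh t * exp (- (Re w * cosh t)))"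
        by (intro mult_left_mono mult_right_mono less_imp_le[OF sinh_less_cosh_real]) auto
      then show "norm (indicator {0..} t *\<^sub>R (- w * of_real (sinh t) * ?e t))
        \<le> norm (cmod w * cmod (bessel_integrand 1 w t))"
        by (auto simp: norm_mult norm_bessel_integrand norm_exp_eq_Re indicator_def mult.assoc)
    qed
  qed
  have "(LINT t:{0..}|lborel. - w * of_real (sinh t) * ?e t) = 0 - ?e 0"
    by (rule integral_FTC_Ici[OF exp_cosh_has_derivative sinh_int tendsto_exp_cosh_at_top(1)[OF assms]])
  then have "w * cosh_moment 1 w - exp (- w) =
      (LINT t:{0..}|lborel. w * (of_real (cosh t ^ 1) * ?e t)) + (LINT t:{0..}|lborel. - w * of_real (sinh t) * ?e t)"
    unfolding cosh_moment_eq by (subst set_integral_mult_right) auto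
  also have "\<dots> = (LINT t:{0..}|lborel. w * (of_real (cosh t ^ 1) * ?e t) + - w * of_real (sinh t) * ?e t)"
    by (intro set_integral_add(2)[symmetric] sinh_int set_integrable_mult_right integrable_bessel_Ici assms order_refl)
  finally have eq: "w * cosh_moment 1 w - exp (- w) =
    (LINT t|lborel. indicator {0..} t *\<^sub>R (w * (of_real (cosh t ^ 1) * ?e t) + - w * of_real (sinh t) * ?e t))"
    by (simp add: set_lebesgue_integral_def)
  have "cmod (w * cosh_moment 1 w - exp (- w)) \<le> (LINT t|lborel. (cmod w * exp (- Re w)) * (indicator {0..} t *\<^sub>R exp (- t)))"
    unfolding eq
  proof (rule Bochner_Integration.integral_norm_bound_integral)
    show "integrable lborel (\<lambda>t. indicator {0..} t *\<^sub>R (w * (of_real (cosh t ^ 1) * ?e t) + - w * of_real (sinh t) * ?e t))"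
      unfolding set_integrable_def[symmetric]
      by (intro set_integral_add(1) sinh_int set_integrable_mult_right integrable_bessel_Ici assms order_refl)
    show "integrable lborel (\<lambda>t. (cmod w * exp (- Re w)) * (indicator {0..} t *\<^sub>R exp (- t)))"
      by (intro integrable_mult_right integrable_exp_minus_Ici)
    fix t :: real
    have "w * (of_real (cosh t ^ 1) * ?e t) + - w * of_real (sinh t) * ?e t = w * of_real (exp (- t)) * ?e t"
      by (simp add: algebra_simps flip: cosh_minus_sinh)
    moreover have "Re w * cosh t \<ge> Re w * 1" using assms by (intro mult_left_mono cosh_real_ge_1) auto
    ultimately show "cmod (indicator {0..} t *\<^sub>R (w * (of_real (cosh t ^ 1) * ?e t) + - w * of_real (sinh t) * ?e t))
      \<le> cmod w * exp (- Re w) * (indicator {0..} t *\<^sub>R exp (- t))"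
      by (auto simp: norm_mult norm_exp_eq_Re indicator_def mult.assoc mult.commute[of "exp (- Re w)"]
        intro!: mult_left_mono)
  qed
  also have "\<dots> = cmod w * exp (- Re w)"
    unfolding integral_mult_right_zero integral_exp_minus_Ici by simp
  finally show ?thesis .
qed

text \<open>Integration by parts with \<open>e\<^bsup>- w cosh t\<^esup> = - (e\<^bsup>- w cosh t\<^esup>)' / (w sinh t)\<close>, which gains a
  factor \<open>1 / w\<close> wherever \<open>sinh t\<close> is bounded away from \<open>0\<close>.\<close>
lemma bessel_tail_identity:
  fixes w :: complex
  assumes "Re w > 0" "d > 0"
  shows "set_integrable lborel {d..} (\<lambda>t. exp (- w * of_real (cosh t)) * of_real (cosh t / (sinh t)\<^sup>2))"
    and "w * (LINT t:{d..}|lborel. exp (- w * of_real (cosh t)))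
      + (LINT t:{d..}|lborel. exp (- w * of_real (cosh t)) * of_real (cosh t / (sinh t)\<^sup>2))
      = exp (- w * of_real (cosh d)) / of_real (sinh d)"
proof -
  let ?e = "\<lambda>t. exp (- w * of_real (cosh t))"
  have e_int: "set_integrable lborel {d..} ?e"
    using integrable_bessel_Ici[of w d 0] assms by simp
  show S_int: "set_integrable lborel {d..} (\<lambda>t. ?e t * of_real (cosh t / (sinh t)\<^sup>2))"
    unfolding set_integrable_def
  proof (rule Bochner_Integration.integrable_bound)
    show "integrable lborel (\<lambda>t. 1 / (sinh d)\<^sup>2 * cmod (bessel_integrand 1 w t))"
      by (intro integrable_mult_right integrable_norm integrable_bessel assms)
    have "sinh \<in> borel_measurable (borel :: real measure)" "cosh \<in> borel_measurable (borel :: real measure)"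
      by (intro borel_measurable_continuous_onI continuous_intros)+
    then show "(\<lambda>t. indicator {d..} t *\<^sub>R (?e t * of_real (cosh t / (sinh t)\<^sup>2))) \<in> borel_measurable lborel"
      by measurable
    show "AE t in lborel. norm (indicator {d..} t *\<^sub>R (?e t * of_real (cosh t / (sinh t)\<^sup>2)))
      \<le> norm (1 / (sinh d)\<^sup>2 * cmod (bessel_integrand 1 w t))"
    proof (rule AE_I2)
      fix t :: real
      show "norm (indicator {d..} t *\<^sub>R (?e t * of_real (cosh t / (sinh t)\<^sup>2)))
        \<le> norm (1 / (sinh d)\<^sup>2 * cmod (bessel_integrand 1 w t))"
      proof (cases "t \<ge> d")
        case True
        then have "sinh d > 0" "sinh d \<le> sinh t" using assms by auto
        then have "cosh t / (sinh t)\<^sup>2 \<le> cosh t / (sinh d)\<^sup>2"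
          by (intro divide_left_mono power_mono) auto
        then have "exp (- (Re w * cosh t)) * (cosh t / (sinh t)\<^sup>2) \<le> exp (- (Re w * cosh t)) * (cosh t / (sinh d)\<^sup>2)"
          by (intro mult_left_mono) auto
        then show ?thesis using True assms
          by (simp add: norm_mult norm_bessel_integrand norm_exp_eq_Re norm_divide norm_power field_simps)
      qed simp
    qed
  qed
  have "(LINT t:{d..}|lborel. w * ?e t + ?e t * of_real (cosh t / (sinh t)\<^sup>2))
      = 0 - (- (?e d * of_real (1 / sinh d)))"
  proof (rule integral_FTC_Ici)
    show "((\<lambda>t. - (?e t * of_real (1 / sinh t))) has_vector_derivative
        w * ?e t + ?e t * of_real (cosh t / (sinh t)\<^sup>2)) (at t)" if "t \<ge> d" for t
    proof -
      have t: "sinh t \<noteq> 0" using that assms by auto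
      then have "((\<lambda>t. 1 / sinh t) has_real_derivative - (cosh t / (sinh t)\<^sup>2)) (at t)"
        by (auto intro!: derivative_eq_intros simp: power2_eq_square)
      then have "((\<lambda>t. of_real (1 / sinh t) :: complex) has_vector_derivative of_real (- (cosh t / (sinh t)\<^sup>2))) (at t)"
        by (rule has_vector_derivative_of_real)
      from has_vector_derivative_minus[OF has_vector_derivative_mult[OF exp_cosh_has_derivative this]]
      have "((\<lambda>t. - (?e t * of_real (1 / sinh t))) has_vector_derivative
         - (?e t * of_real (- (cosh t / (sinh t)\<^sup>2)) + (- w * of_real (sinh t) * ?e t) * of_real (1 / sinh t))) (at t)" .
      then show ?thesis using t by (simp add: field_simps)
    qed
    show "set_integrable lborel {d..} (\<lambda>t. w * ?e t + ?e t * of_real (cosh t / (sinh t)\<^sup>2))"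
      by (intro set_integral_add(1) S_int set_integrable_mult_right e_int)
    have "((\<lambda>t. 1 / sinh t) \<longlongrightarrow> (0::real)) at_top" by real_asymp
    then have "((\<lambda>t. of_real (1 / sinh t)) \<longlongrightarrow> (of_real 0::complex)) at_top"
      by (rule tendsto_of_real)
    from tendsto_mult[OF tendsto_exp_cosh_at_top(1)[OF assms(1)] this]
    show "((\<lambda>t. - (?e t * of_real (1 / sinh t))) \<longlongrightarrow> 0) at_top"
      using tendsto_minus by fastforce
  qed
  also have "(LINT t:{d..}|lborel. w * ?e t + ?e t * of_real (cosh t / (sinh t)\<^sup>2))
     = w * (LINT t:{d..}|lborel. ?e t) + (LINT t:{d..}|lborel. ?e t * of_real (cosh t / (sinh t)\<^sup>2))"
    by (subst set_integral_add(2), intro set_integrable_mult_right e_int, rule S_int, simp)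
  finally show "w * (LINT t:{d..}|lborel. exp (- w * of_real (cosh t)))
      + (LINT t:{d..}|lborel. exp (- w * of_real (cosh t)) * of_real (cosh t / (sinh t)\<^sup>2))
      = exp (- w * of_real (cosh d)) / of_real (sinh d)" by simp
qed

text \<open>The gain \<open>1 / |w|\<close> has to come from the oscillation, since \<open>Re w\<close> may be arbitrarily small
  compared to \<open>|w|\<close>. The remainder of the integration by parts for \<open>w\<close> is dominated by the one
  for \<open>Re w\<close>, and for a positive parameter both terms of that identity are nonnegative, so each
  is at most the boundary term.\<close>
lemma norm_bessel_tail:
  assumes "Re w > 0" "d > 0"
  shows "cmod (LINT t:{d..}|lborel. exp (- w * of_real (cosh t))) \<le> 2 * exp (- Re w) / (cmod w * sinh d)"
proof -
  define a where "a = Re w"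
  have a: "a > 0" "Re (of_real a :: complex) > 0" using assms by (auto simp: a_def)
  have sd: "sinh d > 0" using assms by simp
  let ?S = "\<lambda>w::complex. (LINT t:{d..}|lborel. exp (- w * of_real (cosh t)) * of_real (cosh t / (sinh t)\<^sup>2))"
  note Sa = bessel_tail_identity[OF a(2) assms(2)] and Sw = bessel_tail_identity[OF assms]
  \<comment> \<open>The two terms of the identity for the parameter Re w.\<close>
  define R where "R = (LINT t:{d..}|lborel. exp (- a * cosh t) * (cosh t / (sinh t)\<^sup>2))"
  define E where "E = (LINT t:{d..}|lborel. exp (- a * cosh t))"
  have R: "?S (of_real a) = of_real R"
    unfolding R_def set_lebesgue_integral_def
    by (subst integral_complex_of_real[symmetric])
       (simp add: scaleR_conv_of_real exp_of_real mult_ac flip: of_real_mult of_real_minus)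
  have E: "(LINT t:{d..}|lborel. exp (- of_real a * of_real (cosh t))) = (of_real E :: complex)"
    unfolding E_def set_lebesgue_integral_def
    by (subst integral_complex_of_real[symmetric])
       (simp add: scaleR_conv_of_real exp_of_real mult_ac flip: of_real_mult of_real_minus)
  have E0: "E \<ge> 0" unfolding E_def set_lebesgue_integral_def by (intro integral_nonneg_AE) auto
  have "of_real (a * E + R) = (of_real (exp (- a * cosh d) / sinh d) :: complex)"
    using Sa(2) unfolding R E by (simp add: exp_of_real mult_ac flip: of_real_mult of_real_minus of_real_divide)
  then have "a * E + R = exp (- a * cosh d) / sinh d" using of_real_eq_iff by blast
  then have "R \<le> exp (- a * cosh d) / sinh d" using mult_nonneg_nonneg[OF less_imp_le[OF a(1)] E0] by linarith
  moreover have expa: "exp (- a * cosh d) \<le> exp (- a)"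
    using a(1) cosh_real_ge_1[of d] by simp
  ultimately have Rle: "R \<le> exp (- a) / sinh d"
    using sd by (meson divide_right_mono less_imp_le order_trans)
  have "cmod (?S w) \<le> R"
    unfolding R_def set_lebesgue_integral_def
  proof (rule Bochner_Integration.integral_norm_bound_integral)
    show "integrable lborel (\<lambda>t. indicator {d..} t *\<^sub>R (exp (- w * of_real (cosh t)) * of_real (cosh t / (sinh t)\<^sup>2)))"
      using Sw(1) by (simp add: set_integrable_def)
    have "integrable lborel (\<lambda>t. cmod (indicator {d..} t *\<^sub>R (exp (- w * of_real (cosh t)) * of_real (cosh t / (sinh t)\<^sup>2))))"
      using Sw(1) unfolding set_integrable_def by (rule integrable_norm)
    then show "integrable lborel (\<lambda>t. indicator {d..} t *\<^sub>R (exp (- a * cosh t) * (cosh t / (sinh t)\<^sup>2)))"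
      by (simp add: norm_mult norm_divide norm_power norm_exp_eq_Re a_def abs_of_pos cosh_real_pos)
  qed (simp add: norm_mult norm_divide norm_power norm_exp_eq_Re a_def)
  then have S: "cmod (?S w) \<le> exp (- a) / sinh d" using Rle by linarith
  have "w * (LINT t:{d..}|lborel. exp (- w * of_real (cosh t))) = exp (- w * of_real (cosh d)) / of_real (sinh d) - ?S w"
    unfolding eq_diff_eq by (rule Sw(2))
  then have "cmod w * cmod (LINT t:{d..}|lborel. exp (- w * of_real (cosh t)))
     \<le> cmod (exp (- w * of_real (cosh d)) / of_real (sinh d)) + cmod (?S w)"
    unfolding norm_mult[symmetric] by (simp only: norm_triangle_ineq4)
  also have "cmod (exp (- w * of_real (cosh d)) / of_real (sinh d)) \<le> exp (- a) / sinh d"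
    using sd expa by (simp add: norm_divide norm_exp_eq_Re a_def divide_right_mono)
  finally have "cmod w * cmod (LINT t:{d..}|lborel. exp (- w * of_real (cosh t))) \<le> 2 * exp (- a) / sinh d"
    using S by simp
  moreover have "cmod w > 0" using assms by auto
  ultimately show ?thesis using sd by (simp add: a_def field_simps)
qed

lemma cosh_moment_0_split:
  assumes "Re w > 0" "d > 0"
  shows "set_integrable lborel {0..<d} (\<lambda>t. exp (- w * of_real (cosh t)))"
    and "cosh_moment 0 w = (LINT t:{0..<d}|lborel. exp (- w * of_real (cosh t))) + (LINT t:{d..}|lborel. exp (- w * of_real (cosh t)))"
proof -
  have i: "set_integrable lborel {0..} (\<lambda>t. exp (- w * of_real (cosh t)))"
    using integrable_bessel_Ici[of w 0 0] assms by simp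
  show 1: "set_integrable lborel {0..<d} (\<lambda>t. exp (- w * of_real (cosh t)))"
    by (rule set_integrable_subset[OF i]) auto
  have 2: "set_integrable lborel {d..} (\<lambda>t. exp (- w * of_real (cosh t)))"
    by (rule set_integrable_subset[OF i]) (use assms in auto)
  have "{0..} = {0..<d} \<union> {d..}" using assms by auto
  then show "cosh_moment 0 w = (LINT t:{0..<d}|lborel. exp (- w * of_real (cosh t))) + (LINT t:{d..}|lborel. exp (- w * of_real (cosh t)))"
    unfolding cosh_moment_eq using set_integral_Un[OF _ 1 2] by (simp add: ivl_disj_int)
qed

lemma sinh_ge_self: "x \<ge> 0 \<Longrightarrow> sinh x \<ge> (x::real)"
proof -
  assume "x \<ge> 0"
  then have "sinh 0 - 0 \<le> sinh x - x"
    by (rule DERIV_nonneg_imp_nondecreasing) (auto intro!: derivative_eq_intros exI cosh_real_ge_1)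
  then show ?thesis by simp
qed

text \<open>Cut the integral at \<open>d = |w|\<^bsup>-1/2\<^esup>\<close>, the width of the stationary point of \<open>cosh\<close> at \<open>0\<close>: the
  trivial bound \<open>d\<close> on the first part and the bound \<open>2 / (|w| d)\<close> on the tail are then of the
  same size. The estimate is uniform up to the imaginary axis.\<close>
lemma norm_cosh_moment_0:
  assumes "Re w > 0"
  shows "cmod (cosh_moment 0 w) \<le> 3 / sqrt (cmod w) * exp (- Re w)"
proof -
  define d where "d = 1 / sqrt (cmod w)"
  have w: "cmod w > 0" using assms by auto
  have d: "d > 0" using w by (simp add: d_def)
  note sp = cosh_moment_0_split[OF assms d]
  have "cmod (LINT t:{0..<d}|lborel. exp (- w * of_real (cosh t))) \<le> (LINT t|lborel. indicator {0..<d} t *\<^sub>R exp (- Re w))"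
    unfolding set_lebesgue_integral_def
  proof (rule Bochner_Integration.integral_norm_bound_integral)
    show "integrable lborel (\<lambda>t. indicator {0..<d} t *\<^sub>R exp (- w * of_real (cosh t)))"
      using sp(1) by (simp add: set_integrable_def)
    fix t :: real
    have "Re w * cosh t \<ge> Re w * 1" using assms by (intro mult_left_mono cosh_real_ge_1) auto
    then show "cmod (indicator {0..<d} t *\<^sub>R exp (- w * of_real (cosh t))) \<le> indicator {0..<d} t *\<^sub>R exp (- Re w)"
      by (auto simp: indicator_def norm_exp_eq_Re)
  qed (use d in \<open>auto simp: integrable_indicator_iff\<close>)
  also have "\<dots> = d * exp (- Re w)" using d by simp
  finally have 1: "cmod (LINT t:{0..<d}|lborel. exp (- w * of_real (cosh t))) \<le> d * exp (- Re w)" .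
  have "sinh d \<ge> d" by (rule sinh_ge_self) (use d in simp)
  then have "2 * exp (- Re w) / (cmod w * sinh d) \<le> 2 * exp (- Re w) / (cmod w * d)"
    using d w by (intro divide_left_mono mult_left_mono) auto
  also have "\<dots> = 2 * d * exp (- Re w)"
    using w by (simp add: d_def field_simps flip: real_sqrt_mult) 
  finally have 2: "cmod (LINT t:{d..}|lborel. exp (- w * of_real (cosh t))) \<le> 2 * d * exp (- Re w)"
    using norm_bessel_tail[OF assms d] by linarith
  have "cmod (cosh_moment 0 w) \<le> d * exp (- Re w) + 2 * d * exp (- Re w)"
    unfolding sp(2) using norm_triangle_mono[OF 1 2] .
  then show ?thesis by (simp add: d_def field_simps)
qed

lemma norm_exp_minus_diff_le:
  assumes "Re z1 \<ge> 0" "Re z2 \<ge> 0"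
  shows "cmod (exp (- z1) - exp (- z2)) \<le> cmod (z1 - z2)"
proof -
  have "cmod (exp (- z1) - exp (- z2)) \<le> 1 * cmod (z1 - z2)"
  proof (rule field_differentiable_bound[where S = "{z. Re z \<ge> 0}" and f' = "\<lambda>z. - exp (- z)"])
    show "((\<lambda>z. exp (- z)) has_field_derivative - exp (- z)) (at z within {z. Re z \<ge> 0})" for z :: complex
      by (auto intro!: derivative_eq_intros)
  qed (use assms in \<open>auto simp: convex_halfspace_Re_ge norm_exp_eq_Re\<close>)
  then show ?thesis by simp
qed

text \<open>Near \<open>0\<close> both terms behave like \<open>- ln |w|\<close> with the same modulus, so the logarithms
  cancel. Cut where \<open>sinh t = 1 / |w|\<close>: before this point the difference of the exponentials is
  at most \<open>2 |w| cosh t\<close>, which integrates to \<open>2\<close>, and each of the two tails is at most \<open>2\<close>.\<close>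
lemma norm_cosh_moment_0_diff:
  assumes "Re w1 > 0" "Re w2 > 0" "cmod w1 = cmod w2"
  shows "cmod (cosh_moment 0 w1 - cosh_moment 0 w2) \<le> 6"
proof -
  define \<rho> where "\<rho> = cmod w1"
  have \<rho>: "\<rho> > 0" using assms by (auto simp: \<rho>_def)
  define d where "d = arsinh (1 / \<rho>)"
  have d: "d > 0" and sd: "sinh d = 1 / \<rho>" using \<rho> by (auto simp: d_def)
  note s1 = cosh_moment_0_split[OF assms(1) d] and s2 = cosh_moment_0_split[OF assms(2) d]
  let ?e = "\<lambda>w t. exp (- w * of_real (cosh t))"
  have cosh_int: "set_integrable lborel {0..d} cosh"
    by (intro borel_integrable_atLeastAtMost' continuous_intros)
  have co: "(LINT t:{0..d}|lborel. cosh t) = sinh d"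
  proof -
    have "(cosh has_integral (sinh d - sinh 0)) {0..d}"
      by (rule fundamental_theorem_of_calculus) (use d in \<open>auto intro!: derivative_eq_intros simp flip: has_real_derivative_iff_has_vector_derivative\<close>)
    then show ?thesis using set_borel_integral_eq_integral(2)[OF cosh_int] by (auto simp: integral_unique)
  qed
  have "cmod (LINT t|lborel. indicator {0..<d} t *\<^sub>R ?e w1 t - indicator {0..<d} t *\<^sub>R ?e w2 t)
     \<le> (LINT t|lborel. (2 * \<rho>) * (indicator {0..d} t *\<^sub>R cosh t))"
  proof (rule Bochner_Integration.integral_norm_bound_integral)
    show "integrable lborel (\<lambda>t. indicator {0..<d} t *\<^sub>R ?e w1 t - indicator {0..<d} t *\<^sub>R ?e w2 t)"
      using s1(1) s2(1) by (auto simp: set_integrable_def)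
    show "integrable lborel (\<lambda>t. (2 * \<rho>) * (indicator {0..d} t *\<^sub>R cosh t))"
      using cosh_int unfolding set_integrable_def by (rule integrable_mult_right)
    fix t :: real
    have "cmod (?e w1 t - ?e w2 t) \<le> cmod (w1 * of_real (cosh t) - w2 * of_real (cosh t))"
      using norm_exp_minus_diff_le[of "w1 * of_real (cosh t)" "w2 * of_real (cosh t)"] assms by simp
    also have "\<dots> = cmod (w1 - w2) * cosh t" by (simp add: norm_mult flip: left_diff_distrib)
    also have "\<dots> \<le> (2 * \<rho>) * cosh t"
      using norm_triangle_ineq4[of w1 w2] assms by (intro mult_right_mono) (auto simp: \<rho>_def)
    finally have *: "cmod (?e w1 t - ?e w2 t) \<le> (2 * \<rho>) * cosh t" .
    show "cmod (indicator {0..<d} t *\<^sub>R ?e w1 t - indicator {0..<d} t *\<^sub>R ?e w2 t) \<le> (2 * \<rho>) * (indicator {0..d} t *\<^sub>R cosh t)"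
      using * \<rho> by (cases "t \<in> {0..<d}") auto
  qed
  also have "\<dots> = 2 * \<rho> * sinh d" using co by (simp add: set_lebesgue_integral_def)
  also have "\<dots> = 2" using sd \<rho> by simp
  finally have A: "cmod ((LINT t:{0..<d}|lborel. ?e w1 t) - (LINT t:{0..<d}|lborel. ?e w2 t)) \<le> 2"
    using s1(1) s2(1) by (simp add: set_lebesgue_integral_def set_integrable_def)
  have B: "cmod (LINT t:{d..}|lborel. ?e w t) \<le> 2" if "Re w > 0" "cmod w = \<rho>" for w
  proof -
    have "cmod (LINT t:{d..}|lborel. ?e w t) \<le> 2 * exp (- Re w) / (cmod w * sinh d)"
      by (rule norm_bessel_tail[OF that(1) d])
    also have "cmod w * sinh d = 1" using that sd \<rho> by simp
    also have "2 * exp (- Re w) / 1 \<le> 2" using that by simp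
    finally show ?thesis .
  qed
  have "cosh_moment 0 w1 - cosh_moment 0 w2 = ((LINT t:{0..<d}|lborel. ?e w1 t) - (LINT t:{0..<d}|lborel. ?e w2 t))
      + ((LINT t:{d..}|lborel. ?e w1 t) - (LINT t:{d..}|lborel. ?e w2 t))"
    by (simp add: s1(2) s2(2))
  moreover have "cmod ((LINT t:{d..}|lborel. ?e w1 t) - (LINT t:{d..}|lborel. ?e w2 t)) \<le> 2 + 2"
    using B[of w1] B[of w2] assms by (intro order_trans[OF norm_triangle_ineq4] add_mono) (auto simp: \<rho>_def)
  ultimately have "cmod (cosh_moment 0 w1 - cosh_moment 0 w2) \<le> 2 + (2 + 2)"
    by (simp only: norm_triangle_mono[OF A])
  then show ?thesis by simp
qed

text \<open>These multiples of the Bessel functions are regular at \<open>0\<close>, with the limits \<open>1\<close> and \<open>2\<close>.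
  The second one is \<open>w\<^sup>2 K\<^sub>2(w)\<close>, by the recurrence \<open>w K\<^sub>2 = w K\<^sub>0 + 2 K\<^sub>1\<close>.\<close>
definition bessel_wK1 :: "complex \<Rightarrow> complex" where
  "bessel_wK1 w = w * cosh_moment 1 w"

definition bessel_w2K2 :: "complex \<Rightarrow> complex" where
  "bessel_w2K2 w = w\<^sup>2 * cosh_moment 0 w + 2 * bessel_wK1 w"

lemma cosh_moment_0_radial_derivative:
  assumes "Re om > 0" "r > 0"
  shows "((\<lambda>r. cosh_moment 0 (om * of_real r)) has_vector_derivative
            - bessel_wK1 (om * of_real r) / of_real r) (at r)"
  using cosh_moment_has_derivative[of om r 0] assms by (simp add: bessel_wK1_def)

lemma bessel_wK1_radial_derivative:
  assumes "Re om > 0" "r > 0"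
  shows "((\<lambda>r. bessel_wK1 (om * of_real r)) has_vector_derivative
            - om\<^sup>2 * of_real r * cosh_moment 0 (om * of_real r)) (at r)"
proof -
  let ?w = "om * of_real r"
  have w: "Re ?w > 0" using assms by simp
  have "((\<lambda>r. om * of_real r) has_vector_derivative om) (at r)"
    by (auto intro!: derivative_eq_intros)
  from has_vector_derivative_mult[OF this cosh_moment_has_derivative[OF w assms(2), of 1]]
  have "((\<lambda>r. bessel_wK1 (om * of_real r)) has_vector_derivative
      om * (- (?w * cosh_moment 2 ?w) + cosh_moment 1 ?w)) (at r)"
    by (simp add: bessel_wK1_def algebra_simps numeral_2_eq_2)
  then show ?thesis
    unfolding cosh_moment_2[OF w] by (simp add: algebra_simps power2_eq_square)
qed

lemma bessel_w2K2_radial_derivative: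
  assumes "Re om > 0" "r > 0"
  shows "((\<lambda>r. bessel_w2K2 (om * of_real r)) has_vector_derivative
            - om\<^sup>2 * of_real r * bessel_wK1 (om * of_real r)) (at r)"
proof -
  let ?w = "om * of_real r"
  have "((\<lambda>r. (om * of_real r)\<^sup>2) has_vector_derivative 2 * om\<^sup>2 * of_real r) (at r)"
    by (auto intro!: derivative_eq_intros simp: power2_eq_square)
  from has_vector_derivative_add[OF has_vector_derivative_mult[OF this cosh_moment_0_radial_derivative[OF assms]]
      has_vector_derivative_mult_right[OF bessel_wK1_radial_derivative[OF assms], of 2]]
  have "((\<lambda>r. bessel_w2K2 (om * of_real r)) has_vector_derivative
      ?w\<^sup>2 * (- bessel_wK1 ?w / of_real r) + 2 * om\<^sup>2 * of_real r * cosh_moment 0 ?w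
      + 2 * (- om\<^sup>2 * of_real r * cosh_moment 0 ?w)) (at r)"
    by (simp add: bessel_w2K2_def)
  then show ?thesis using assms by (simp add: field_simps power2_eq_square)
qed

lemma norm_bessel_wK1_minus_exp:
  assumes "Re w > 0" shows "cmod (bessel_wK1 w - exp (- w)) \<le> cmod w * exp (- Re w)"
  using norm_mult_cosh_moment_1[OF assms] by (simp add: bessel_wK1_def)

lemma norm_bessel_wK1:
  assumes "Re w > 0" shows "cmod (bessel_wK1 w) \<le> (1 + cmod w) * exp (- Re w)"
proof -
  have "cmod (bessel_wK1 w) \<le> cmod (bessel_wK1 w - exp (- w)) + cmod (exp (- w))"
    using norm_triangle_ineq[of "bessel_wK1 w - exp (- w)" "exp (- w)"] by simp
  then show ?thesis using norm_bessel_wK1_minus_exp[OF assms] by (simp add: algebra_simps norm_exp_eq_Re)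
qed

lemma norm_bessel_w2K2:
  assumes "Re w > 0"
  shows "cmod (bessel_w2K2 w) \<le> (3 * (cmod w * sqrt (cmod w)) + 2 * (1 + cmod w)) * exp (- Re w)"
proof -
  have w: "cmod w > 0" using assms by auto
  have "cmod (w\<^sup>2 * cosh_moment 0 w) \<le> (cmod w)\<^sup>2 * (3 / sqrt (cmod w) * exp (- Re w))"
    unfolding norm_mult norm_power by (intro mult_left_mono norm_cosh_moment_0 assms) auto
  also have "\<dots> = 3 * (cmod w * sqrt (cmod w)) * exp (- Re w)"
    using w by (simp add: field_simps power2_eq_square)
  finally have "cmod (w\<^sup>2 * cosh_moment 0 w) \<le> 3 * (cmod w * sqrt (cmod w)) * exp (- Re w)" .
  moreover have "cmod (2 * bessel_wK1 w) \<le> 2 * ((1 + cmod w) * exp (- Re w))"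
    using norm_bessel_wK1[OF assms] by (simp add: norm_mult)
  ultimately show ?thesis
    unfolding bessel_w2K2_def using norm_triangle_ineq[of "w\<^sup>2 * cosh_moment 0 w" "2 * bessel_wK1 w"]
    by (simp add: algebra_simps)
qed

lemma tendsto_of_real_mult_0: "((\<lambda>r. om * of_real r) \<longlongrightarrow> (0::complex)) (at_right 0)"
  by (auto intro!: tendsto_eq_intros)

lemma tendsto_bessel_wK1_0:
  assumes "Re om > 0"
  shows "((\<lambda>r. bessel_wK1 (om * of_real r)) \<longlongrightarrow> 1) (at_right 0)"
proof -
  have 1: "((\<lambda>r. bessel_wK1 (om * of_real r) - exp (- (om * of_real r))) \<longlongrightarrow> 0) (at_right 0)"
  proof (rule Lim_null_comparison)
    show "\<forall>\<^sub>F r in at_right 0. cmod (bessel_wK1 (om * of_real r) - exp (- (om * of_real r))) \<le> cmod om * r"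
      unfolding eventually_at_right_field
    proof (intro exI[of _ 1] conjI allI impI)
      fix r :: real assume r: "0 < r" "r < 1"
      then have w: "Re (om * of_real r) > 0" using assms by simp
      have "cmod (om * of_real r) * exp (- Re (om * of_real r)) \<le> cmod (om * of_real r) * 1"
        using w by (intro mult_left_mono) auto
      then show "cmod (bessel_wK1 (om * of_real r) - exp (- (om * of_real r))) \<le> cmod om * r"
        using norm_bessel_wK1_minus_exp[OF w] r by (simp add: norm_mult)
    qed simp
    show "((\<lambda>r. cmod om * r) \<longlongrightarrow> 0) (at_right 0)" by (auto intro!: tendsto_eq_intros)
  qed
  have "((\<lambda>r. exp (- (om * of_real r))) \<longlongrightarrow> exp (- 0)) (at_right 0)"
    by (intro tendsto_intros tendsto_of_real_mult_0)
  from tendsto_add[OF 1 this] show ?thesis by simp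
qed

lemma tendsto_bessel_w2K2_0:
  assumes "Re om > 0"
  shows "((\<lambda>r. bessel_w2K2 (om * of_real r)) \<longlongrightarrow> 2) (at_right 0)"
proof -
  have "((\<lambda>r. (om * of_real r)\<^sup>2 * cosh_moment 0 (om * of_real r)) \<longlongrightarrow> 0) (at_right 0)"
  proof (rule Lim_null_comparison)
    show "\<forall>\<^sub>F r in at_right 0. cmod ((om * of_real r)\<^sup>2 * cosh_moment 0 (om * of_real r))
        \<le> 3 * (cmod om * r * sqrt (cmod om * r))"
      unfolding eventually_at_right_field
    proof (intro exI[of _ 1] conjI allI impI)
      fix r :: real assume r: "0 < r" "r < 1"
      let ?w = "om * of_real r"
      have w: "Re ?w > 0" using assms r by simp
      have cw: "cmod ?w > 0" using complex_Re_le_cmod[of ?w] w by linarith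
      have "3 / sqrt (cmod ?w) * exp (- Re ?w) \<le> 3 / sqrt (cmod ?w) * 1"
        using w by (intro mult_left_mono) auto
      then have "cmod (?w\<^sup>2 * cosh_moment 0 ?w) \<le> (cmod ?w)\<^sup>2 * (3 / sqrt (cmod ?w))"
        unfolding norm_mult[of "?w\<^sup>2"] norm_power using norm_cosh_moment_0[OF w]
        by (intro mult_left_mono) auto
      also have "\<dots> = 3 * (cmod ?w * sqrt (cmod ?w))"
        using cw by (simp add: field_simps power2_eq_square)
      finally show "cmod (?w\<^sup>2 * cosh_moment 0 ?w) \<le> 3 * (cmod om * r * sqrt (cmod om * r))"
        using r by (simp add: norm_mult)
    qed simp
    show "((\<lambda>r. 3 * (cmod om * r * sqrt (cmod om * r))) \<longlongrightarrow> 0) (at_right 0)"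
      by (auto intro!: tendsto_eq_intros)
  qed
  from tendsto_add[OF this tendsto_mult[OF tendsto_const tendsto_bessel_wK1_0[OF assms], of 2]]
  show ?thesis by (simp add: bessel_w2K2_def)
qed

text \<open>Both functions have the limit \<open>2\<close> at \<open>0\<close> and derivatives of size \<open>|\<omega>|\<^sup>2 r\<close>, so the mean
  value inequality starting from \<open>r = 0\<close> makes their difference quadratically small. This is the
  cancellation of the \<open>1 / r\<^sup>2\<close> singularities in the second derivatives of the difference of two
  Green functions.\<close>
lemma norm_bessel_w2K2_diff_small:
  assumes om: "Re om1 > 0" "Re om2 > 0" "cmod om1 = cmod om2"
    and r: "r > 0" "cmod om1 * r \<le> 1"
  shows "cmod (bessel_w2K2 (om1 * of_real r) - bessel_w2K2 (om2 * of_real r)) \<le> 4 * (cmod om1 * r)\<^sup>2"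
proof -
  let ?Q = "\<lambda>r. bessel_w2K2 (om1 * of_real r) - bessel_w2K2 (om2 * of_real r)"
  let ?B = "4 * (cmod om1)\<^sup>2 * r"
  have d: "cmod (- om\<^sup>2 * of_real s * bessel_wK1 (om * of_real s)) \<le> 2 * (cmod om1)\<^sup>2 * r"
    if "Re om > 0" "cmod om = cmod om1" "0 < s" "s \<le> r" for om s
  proof -
    have w: "Re (om * of_real s) > 0" using that by simp
    have "cmod om1 * s \<le> cmod om1 * r" using that by (intro mult_left_mono) auto
    then have cs: "cmod (om * of_real s) \<le> 1" using that r by (simp add: norm_mult)
    have "cmod (bessel_wK1 (om * of_real s)) \<le> (1 + cmod (om * of_real s)) * exp (- Re (om * of_real s))"
      by (rule norm_bessel_wK1[OF w])
    also have "\<dots> \<le> 2 * 1" using cs w by (intro mult_mono) auto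
    finally have "cmod (- om\<^sup>2 * of_real s * bessel_wK1 (om * of_real s)) \<le> (cmod om1)\<^sup>2 * s * 2"
      using that unfolding norm_mult norm_minus_cancel norm_power by (intro mult_mono) auto
    also have "\<dots> \<le> (cmod om1)\<^sup>2 * r * 2" using that by (intro mult_mono) auto
    finally show ?thesis by simp
  qed
  have step: "cmod (?Q r - ?Q s) \<le> ?B * r" if s: "0 < s" "s < r" for s
  proof -
    have "cmod (?Q r - ?Q s) \<le> ?B * norm (r - s)"
    proof (rule differentiable_bound[of "{s..r}" ?Q "\<lambda>x h. h *\<^sub>R
        (- om1\<^sup>2 * of_real x * bessel_wK1 (om1 * of_real x) - (- om2\<^sup>2 * of_real x * bessel_wK1 (om2 * of_real x)))"])
      fix x assume x: "x \<in> {s..r}"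
      then have x0: "x > 0" using s by simp
      show "(?Q has_derivative (\<lambda>h. h *\<^sub>R
        (- om1\<^sup>2 * of_real x * bessel_wK1 (om1 * of_real x) - (- om2\<^sup>2 * of_real x * bessel_wK1 (om2 * of_real x)))))
          (at x within {s..r})"
        unfolding has_vector_derivative_def[symmetric]
        by (intro has_vector_derivative_at_within[OF has_vector_derivative_diff] bessel_w2K2_radial_derivative om x0)
      show "onorm (\<lambda>h. h *\<^sub>R
        (- om1\<^sup>2 * of_real x * bessel_wK1 (om1 * of_real x) - (- om2\<^sup>2 * of_real x * bessel_wK1 (om2 * of_real x)))) \<le> ?B"
      proof (rule onorm_le)
        fix h :: real
        have "cmod (- om1\<^sup>2 * of_real x * bessel_wK1 (om1 * of_real x) - (- om2\<^sup>2 * of_real x * bessel_wK1 (om2 * of_real x)))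
          \<le> 2 * (cmod om1)\<^sup>2 * r + 2 * (cmod om1)\<^sup>2 * r"
          using x x0 om by (intro order_trans[OF norm_triangle_ineq4] add_mono d) auto
        also have "\<dots> = ?B" by simp
        finally have "\<bar>h\<bar> * cmod (- om1\<^sup>2 * of_real x * bessel_wK1 (om1 * of_real x) - (- om2\<^sup>2 * of_real x * bessel_wK1 (om2 * of_real x)))
          \<le> \<bar>h\<bar> * ?B" by (intro mult_left_mono) auto
        then show "cmod (h *\<^sub>R
        (- om1\<^sup>2 * of_real x * bessel_wK1 (om1 * of_real x) - (- om2\<^sup>2 * of_real x * bessel_wK1 (om2 * of_real x)))) \<le> ?B * norm h"
          unfolding norm_scaleR real_norm_def by (simp only: mult.commute[of "\<bar>h\<bar>"])
      qed
    qed (use s in auto)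
    also have "\<dots> \<le> ?B * r" using s r by (intro mult_left_mono) auto
    finally show ?thesis .
  qed
  have "((\<lambda>s. ?Q r - ?Q s) \<longlongrightarrow> ?Q r - (2 - 2)) (at_right 0)"
    by (intro tendsto_intros tendsto_bessel_w2K2_0 om)
  then have "((\<lambda>s. cmod (?Q r - ?Q s)) \<longlongrightarrow> cmod (?Q r - (2 - 2))) (at_right 0)"
    by (rule tendsto_norm)
  then have "cmod (?Q r - (2 - 2)) \<le> ?B * r"
  proof (rule tendsto_upperbound)
    show "\<forall>\<^sub>F s in at_right 0. cmod (?Q r - ?Q s) \<le> ?B * r"
      unfolding eventually_at_right_field using step r by blast
  qed simp
  then show ?thesis by (simp add: power2_eq_square mult_ac)
qed

text \<open>The common majorant of the kernels at distance \<open>r\<close>. The bound \<open>1\<close> and the power \<open>r\<^bsup>-1/2\<^esup>\<close>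
  determine the constants of the theorem; the exponential only ensures integrability for nonreal
  spectral parameters.\<close>
definition decay :: "real \<Rightarrow> real \<Rightarrow> real \<Rightarrow> real" where
  "decay \<rho>0 a r = min 1 (1 / sqrt (\<rho>0 * r) * exp (- a * r))"

lemma exp_minus_le_of_le:
  assumes "a \<le> Re om" "r \<ge> 0" shows "exp (- Re (om * of_real r)) \<le> exp (- a * r)"
  using mult_right_mono[OF assms] by simp

lemma decay_small:
  assumes "\<rho>0 > 0" "r > 0" "\<rho>0 * r \<le> 1" "0 \<le> a" "a \<le> \<rho>0"
  shows "decay \<rho>0 a r \<ge> 1 / 3"
proof -
  have "1 \<le> 1 / sqrt (\<rho>0 * r)" using assms by simp
  moreover have "exp (-1) \<le> exp (- a * r)"
    using mult_right_mono[OF assms(5), of r] assms(2,3) by (simp, linarith)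
  moreover have "exp (-1) \<ge> (1/3::real)"
    using exp_le by (simp add: exp_minus field_simps)
  ultimately have "1 * (1/3) \<le> 1 / sqrt (\<rho>0 * r) * exp (- a * r)"
    using assms by (intro mult_mono) linarith+
  then show ?thesis by (simp add: decay_def)
qed

lemma norm_cosh_moment_0_diff_le_decay:
  assumes om: "Re om1 > 0" "Re om2 > 0" "cmod om1 = \<rho>0" "cmod om2 = \<rho>0"
    and a: "0 \<le> a" "a \<le> Re om1" "a \<le> Re om2" and r: "r > 0"
  shows "cmod (cosh_moment 0 (om1 * of_real r) - cosh_moment 0 (om2 * of_real r)) \<le> 6 * decay \<rho>0 a r"
proof -
  have \<rho>0: "\<rho>0 > 0" using om by auto
  have "cmod (cosh_moment 0 (om * of_real r)) \<le> 3 * (1 / sqrt (\<rho>0 * r) * exp (- a * r))"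
    if "Re om > 0" "cmod om = \<rho>0" "a \<le> Re om" for om
  proof -
    have "cmod (cosh_moment 0 (om * of_real r)) \<le> 3 / sqrt (cmod (om * of_real r)) * exp (- Re (om * of_real r))"
      using that r by (intro norm_cosh_moment_0) simp
    also have "\<dots> \<le> 3 / sqrt (cmod (om * of_real r)) * exp (- a * r)"
      using that r by (intro mult_left_mono exp_minus_le_of_le) auto
    finally show ?thesis using that r by (simp add: norm_mult)
  qed
  then have "cmod (cosh_moment 0 (om1 * of_real r) - cosh_moment 0 (om2 * of_real r))
     \<le> 3 * (1 / sqrt (\<rho>0 * r) * exp (- a * r)) + 3 * (1 / sqrt (\<rho>0 * r) * exp (- a * r))"
    using om a by (intro order_trans[OF norm_triangle_ineq4] add_mono) auto
  moreover have "cmod (cosh_moment 0 (om1 * of_real r) - cosh_moment 0 (om2 * of_real r)) \<le> 6"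
    using om r by (intro norm_cosh_moment_0_diff) (auto simp: norm_mult)
  ultimately show ?thesis by (simp add: decay_def)
qed

text \<open>For small \<open>r\<close> the quadratic bound suffices because the majorant is then bounded below, and
  for large \<open>r\<close> each of the two terms separately is of size \<open>(\<rho>\<^sub>0 r)\<^bsup>3/2\<^esup> = (\<rho>\<^sub>0 r)\<^sup>2 (\<rho>\<^sub>0 r)\<^bsup>-1/2\<^esup>\<close>.\<close>
lemma norm_bessel_w2K2_diff_le_decay:
  assumes om: "Re om1 > 0" "Re om2 > 0" "cmod om1 = \<rho>0" "cmod om2 = \<rho>0"
    and a: "0 \<le> a" "a \<le> Re om1" "a \<le> Re om2" and r: "r > 0"
  shows "cmod (bessel_w2K2 (om1 * of_real r) - bessel_w2K2 (om2 * of_real r)) \<le> 14 * (\<rho>0 * r)\<^sup>2 * decay \<rho>0 a r"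
proof (cases "\<rho>0 * r \<le> 1")
  case True
  have \<rho>0: "\<rho>0 > 0" using om by auto
  have "Re om1 \<le> \<rho>0" using complex_Re_le_cmod[of om1] om by simp
  then have "decay \<rho>0 a r \<ge> 1/3" using a r True \<rho>0 by (intro decay_small) auto
  then have "14 * (\<rho>0 * r)\<^sup>2 * (1/3) \<le> 14 * (\<rho>0 * r)\<^sup>2 * decay \<rho>0 a r"
    by (intro mult_left_mono) auto
  moreover have "cmod (bessel_w2K2 (om1 * of_real r) - bessel_w2K2 (om2 * of_real r)) \<le> 4 * (\<rho>0 * r)\<^sup>2"
    using norm_bessel_w2K2_diff_small[OF om(1,2) _ r] om True by simp
  moreover have "4 * (\<rho>0 * r)\<^sup>2 \<le> 14 * (\<rho>0 * r)\<^sup>2 * (1/3)" by simp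
  ultimately show ?thesis by linarith
next
  case False
  define \<rho> where "\<rho> = \<rho>0 * r"
  have \<rho>: "\<rho> > 1" using False by (simp add: \<rho>_def)
  then have sr: "sqrt \<rho> \<ge> 1" by simp
  have dec: "decay \<rho>0 a r = 1 / sqrt \<rho> * exp (- a * r)"
  proof -
    have "1 / sqrt \<rho> * exp (- a * r) \<le> 1 * 1"
      using sr a r \<rho> by (intro mult_mono) auto
    then show ?thesis by (simp add: decay_def \<rho>_def)
  qed
  have "cmod (bessel_w2K2 (om * of_real r)) \<le> 7 * (\<rho> * sqrt \<rho>) * exp (- a * r)"
    if "Re om > 0" "cmod om = \<rho>0" "a \<le> Re om" for om
  proof -
    have cm: "cmod (om * of_real r) = \<rho>" using that r by (simp add: norm_mult \<rho>_def)
    have "cmod (bessel_w2K2 (om * of_real r)) \<le> (3 * (\<rho> * sqrt \<rho>) + 2 * (1 + \<rho>)) * exp (- Re (om * of_real r))"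
      using norm_bessel_w2K2[of "om * of_real r"] that r cm by simp
    also have "\<dots> \<le> (7 * (\<rho> * sqrt \<rho>)) * exp (- a * r)"
    proof (intro mult_mono exp_minus_le_of_le that)
      have "\<rho> * 1 \<le> \<rho> * sqrt \<rho>" using sr \<rho> by (intro mult_left_mono) auto
      then show "3 * (\<rho> * sqrt \<rho>) + 2 * (1 + \<rho>) \<le> 7 * (\<rho> * sqrt \<rho>)" 
        using \<rho> unfolding mult_1_right ring_distribs by linarith
    qed (use r \<rho> in auto)
    finally show ?thesis .
  qed
  then have "cmod (bessel_w2K2 (om1 * of_real r) - bessel_w2K2 (om2 * of_real r))
      \<le> 7 * (\<rho> * sqrt \<rho>) * exp (- a * r) + 7 * (\<rho> * sqrt \<rho>) * exp (- a * r)"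
    using om a by (intro order_trans[OF norm_triangle_ineq4] add_mono) auto
  also have "\<dots> = 14 * \<rho>\<^sup>2 * decay \<rho>0 a r"
    using \<rho> unfolding dec by (simp add: field_simps power2_eq_square)
  finally show ?thesis by (simp add: \<rho>_def)
qed

section \<open>Integration by parts in the plane\<close>

lemma UNIV_2_eq: "i \<noteq> j \<Longrightarrow> (UNIV :: 2 set) = {i, j}"
  using exhaust_2 by (metis (full_types) UNIV_eq_I insertCI)

text \<open>The plane as a product of lines, the coordinate \<open>i\<close> of differentiation being the inner
  one.\<close>
definition plane_pt :: "2 \<Rightarrow> 2 \<Rightarrow> real \<times> real \<Rightarrow> real ^ 2" where
  "plane_pt j i = (\<lambda>(s, t). s *\<^sub>R axis j 1 + t *\<^sub>R axis i 1)"

lemma plane_pt_measurable [measurable]: "plane_pt j i \<in> borel_measurable borel"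
  unfolding plane_pt_def split_beta by (intro borel_measurable_continuous_onI continuous_intros)

lemma plane_pt_nth [simp]:
  assumes "i \<noteq> j"
  shows "plane_pt j i (s, t) $ i = t" "plane_pt j i (s, t) $ j = s"
  using assms by (auto simp: plane_pt_def axis_def)

lemma distr_plane_pt:
  assumes "i \<noteq> j"
  shows "distr (lborel \<Otimes>\<^sub>M lborel) borel (plane_pt j i) = lborel"
proof (rule lborel_eqI[symmetric])
  fix l u :: "real ^ 2" assume le: "\<And>b. b \<in> Basis \<Longrightarrow> l \<bullet> b \<le> u \<bullet> b"
  have lu: "l $ k \<le> u $ k" for k
    using le[of "axis k 1"] by (auto simp: Basis_vec_def inner_axis)
  have "plane_pt j i -` box l u = {l $ j<..<u $ j} \<times> {l $ i<..<u $ i}"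
  proof -
    have all2: "(\<forall>k. P k) \<longleftrightarrow> P i \<and> P j" for P :: "2 \<Rightarrow> bool"
      using UNIV_2_eq[OF assms] by (metis UNIV_I insertE singletonD)
    show ?thesis using assms by (auto simp: mem_box_cart all2)
  qed
  then have "emeasure (distr (lborel \<Otimes>\<^sub>M lborel) borel (plane_pt j i)) (box l u)
      = emeasure (lborel \<Otimes>\<^sub>M lborel) ({l $ j<..<u $ j} \<times> {l $ i<..<u $ i})"
    by (subst emeasure_distr) (auto simp: lborel_prod)
  also have "\<dots> = ennreal (u $ j - l $ j) * ennreal (u $ i - l $ i)"
    by (subst lborel.emeasure_pair_measure_Times) (auto simp: lu)
  also have "\<dots> = (\<Prod>k\<in>UNIV. ennreal (u $ k - l $ k))"
    unfolding UNIV_2_eq[OF assms] using assms by (simp add: mult.commute)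
  also have "\<dots> = ennreal (\<Prod>k\<in>UNIV. (u $ k - l $ k))"
    by (rule prod_ennreal) (use lu in auto)
  also have "(\<Prod>k\<in>UNIV. (u $ k - l $ k)) = (\<Prod>b\<in>Basis. (u - l) \<bullet> b)"
  proof -
    have B: "(Basis :: (real ^ 2) set) = (\<lambda>k. axis k 1) ` UNIV" by (auto simp: Basis_vec_def)
    have inj: "inj (\<lambda>k::2. axis k (1::real))" by (auto simp: inj_on_def axis_eq_axis)
    show ?thesis unfolding B by (subst prod.reindex[OF inj]) (simp add: inner_axis comp_def)
  qed
  finally show "emeasure (distr (lborel \<Otimes>\<^sub>M lborel) borel (plane_pt j i)) (box l u)
      = ennreal (\<Prod>b\<in>Basis. (u - l) \<bullet> b)" .
qed simp

lemma integrable_plane_pt: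
  fixes h :: "real ^ 2 \<Rightarrow> 'b::{banach, second_countable_topology}"
  assumes "i \<noteq> j" "integrable lborel h"
  shows "integrable (lborel \<Otimes>\<^sub>M lborel) (\<lambda>z. h (plane_pt j i z))"
proof -
  have [measurable]: "h \<in> borel_measurable borel" using assms(2) by (auto dest: borel_measurable_integrable)
  have "integrable (distr (lborel \<Otimes>\<^sub>M lborel) borel (plane_pt j i)) h"
    unfolding distr_plane_pt[OF assms(1)] by (rule assms)
  then show ?thesis by (subst (asm) integrable_distr_eq) (auto simp: lborel_prod)
qed

text \<open>By Fubini's theorem it suffices to integrate along the lines in direction \<open>i\<close>, and only
  one of these lines meets the origin. A singularity there therefore causes no boundary term,
  provided that the partial derivative taken off the origin is integrable.\<close>
lemma integral_partial_derivative_eq_0: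
  fixes h h' :: "real ^ 2 \<Rightarrow> complex"
  assumes der: "\<And>x j. j \<noteq> i \<Longrightarrow> x $ j \<noteq> 0 \<Longrightarrow> ((\<lambda>s. h (x + s *\<^sub>R axis i 1)) has_vector_derivative h' x) (at 0)"
    and h: "integrable lborel h" and h': "integrable lborel h'"
  shows "(LINT x|lborel. h' x) = 0"
proof -
  obtain j :: 2 where ij: "i \<noteq> j" by (metis (full_types) one_neq_zero)
  have [measurable]: "h' \<in> borel_measurable borel" using h' by (auto dest: borel_measurable_integrable)
  have "(LINT x|lborel. h' x) = (LINT z|(lborel \<Otimes>\<^sub>M lborel). h' (plane_pt j i z))"
    by (subst distr_plane_pt[OF ij, symmetric], subst integral_distr) (auto simp: lborel_prod)
  also have "\<dots> = (LINT s|lborel. LINT t|lborel. h' (plane_pt j i (s, t)))"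
    by (rule lborel_pair.integral_fst'[symmetric]) (rule integrable_plane_pt[OF ij h'])
  also have "\<dots> = 0"
  proof (rule integral_eq_zero_AE)
    have "AE s in lborel. s \<noteq> (0::real)" by (rule AE_lborel_singleton)
    with lborel_pair.AE_integrable_fst'[OF integrable_plane_pt[OF ij h]]
      lborel_pair.AE_integrable_fst'[OF integrable_plane_pt[OF ij h']]
    show "AE s in lborel. (LINT t|lborel. h' (plane_pt j i (s, t))) = 0"
    proof eventually_elim
      case (elim s)
      show ?case
      proof (rule integral_derivative_eq_0[where G = "\<lambda>t. h (plane_pt j i (s, t))"])
        fix t
        have "((\<lambda>u. h (plane_pt j i (s, t) + u *\<^sub>R axis i 1)) has_vector_derivative h' (plane_pt j i (s, t))) (at 0)"
          by (rule der[of j]) (use ij elim in auto)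
        moreover have "plane_pt j i (s, t) + u *\<^sub>R axis i 1 = plane_pt j i (s, t + u)" for u
          by (simp add: plane_pt_def scaleR_add_left)
        ultimately have "((\<lambda>u. h (plane_pt j i (s, t + u))) has_vector_derivative h' (plane_pt j i (s, t))) (at 0)"
          by simp
        then show "((\<lambda>t. h (plane_pt j i (s, t))) has_vector_derivative h' (plane_pt j i (s, t))) (at t)"
          using has_vector_derivative_shift[of "\<lambda>t. h (plane_pt j i (s, t))" _ 0 t]
          by (simp add: has_vector_derivative_def has_derivative_at)
      qed (use elim in auto)
    qed
  qed
  finally show ?thesis .
qed

lemma integrable_mult_bounded:
  fixes f G :: "real ^ 2 \<Rightarrow> complex"
  assumes "integrable lborel f" "G \<in> borel_measurable borel" "\<And>x. cmod (G x) \<le> B"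
  shows "integrable lborel (\<lambda>x. f x * G x)"
proof (rule Bochner_Integration.integrable_bound)
  show "integrable lborel (\<lambda>x. B * cmod (f x))" using assms(1) by auto
  show "AE x in lborel. norm (f x * G x) \<le> norm (B * cmod (f x))"
  proof (rule AE_I2)
    fix x
    have "cmod (f x) * cmod (G x) \<le> cmod (f x) * B" by (intro mult_left_mono assms) auto
    then show "norm (f x * G x) \<le> norm (B * cmod (f x))"
      unfolding norm_mult real_norm_def mult.commute[of B] by (rule order_trans) simp
  qed
qed (use assms in \<open>auto dest: borel_measurable_integrable\<close>)

lemma integral_by_parts_partial:
  fixes a a' F F' :: "real ^ 2 \<Rightarrow> complex"
  assumes a: "integrable lborel a" "integrable lborel a'"
    and da: "\<And>x j. j \<noteq> i \<Longrightarrow> x $ j \<noteq> 0 \<Longrightarrow> ((\<lambda>s. a (x + s *\<^sub>R axis i 1)) has_vector_derivative a' x) (at 0)"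
    and F: "F \<in> borel_measurable borel" "F' \<in> borel_measurable borel"
      "\<And>x. cmod (F x) \<le> B" "\<And>x. cmod (F' x) \<le> B"
    and dF: "\<And>x. ((\<lambda>s. F (x + s *\<^sub>R axis i 1)) has_vector_derivative F' x) (at 0)"
  shows "(LINT x|lborel. a x * F' x) = - (LINT x|lborel. a' x * F x)"
proof -
  have "(LINT x|lborel. a x * F' x + a' x * F x) = 0"
  proof (rule integral_partial_derivative_eq_0[where i = i and h = "\<lambda>x. a x * F x"])
    fix x :: "real ^ 2" and j assume "j \<noteq> i" "x $ j \<noteq> 0"
    from has_vector_derivative_mult[OF da[OF this] dF[of x]]
    show "((\<lambda>s. a (x + s *\<^sub>R axis i 1) * F (x + s *\<^sub>R axis i 1)) has_vector_derivative
        a x * F' x + a' x * F x) (at 0)" by simp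
  qed (intro Bochner_Integration.integrable_add integrable_mult_bounded[OF a(1) F(1,3)]
    integrable_mult_bounded[OF a(1) F(2,4)] integrable_mult_bounded[OF a(2) F(1,3)])+
  then show ?thesis
    using integrable_mult_bounded[OF a(1) F(2,4)] integrable_mult_bounded[OF a(2) F(1,3)]
    by (simp add: eq_neg_iff_add_eq_0)
qed

section \<open>Integrable functions on the plane\<close>

lemma AE_nth_nonzero: "AE x in lborel. (x :: real ^ 2) $ i \<noteq> 0"
proof -
  have "negligible {x :: real ^ 2. x \<bullet> axis i 1 = 0}"
    by (intro negligible_standard_hyperplane) (auto simp: Basis_vec_def)
  then have "{x :: real ^ 2. x $ i = 0} \<in> null_sets lebesgue"
    by (simp add: inner_axis negligible_iff_null_sets)
  then have "AE x in lebesgue. (x :: real ^ 2) $ i \<noteq> 0"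
    by (intro AE_I'[of "{x. x $ i = 0}"]) auto
  then show ?thesis by (simp add: AE_completion_iff)
qed

lemma vec_nth_borel [measurable]: "(\<lambda>x::real ^ 2. x $ i) \<in> borel_measurable borel"
  by (intro borel_measurable_continuous_onI continuous_intros)

text \<open>Polar coordinates are avoided: radial functions are dominated by products of functions of
  one variable.\<close>
lemma integrable_tensor:
  fixes f g :: "real \<Rightarrow> real"
  assumes "integrable lborel f" "integrable lborel g"
  shows "integrable lborel (\<lambda>x::real ^ 2. f (x $ 1) * g (x $ 2))"
proof -
  have [measurable]: "f \<in> borel_measurable borel" "g \<in> borel_measurable borel"
    using assms by (auto dest: borel_measurable_integrable)
  have ij: "(2::2) \<noteq> 1" by simp
  have "integrable (distr (lborel \<Otimes>\<^sub>M lborel) borel (plane_pt 1 2)) (\<lambda>x::real ^ 2. f (x $ 1) * g (x $ 2))"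
  proof (subst integrable_distr_eq)
    show "integrable (lborel \<Otimes>\<^sub>M lborel) (\<lambda>z. f (plane_pt 1 2 z $ 1) * g (plane_pt 1 2 z $ 2))"
    proof (rule lborel_pair.Fubini_integrable)
      have "integrable lborel (\<lambda>s. norm (f s) * (LINT t|lborel. norm (g t)))"
        using assms by (intro integrable_mult_left integrable_norm)
      then show "integrable lborel (\<lambda>s. LINT t|lborel. norm (f (plane_pt 1 2 (s, t) $ 1) * g (plane_pt 1 2 (s, t) $ 2)))"
        unfolding plane_pt_nth[OF ij] norm_mult by simp
      have "(\<lambda>z. f (plane_pt 1 2 z $ 1) * g (plane_pt 1 2 z $ 2)) = (\<lambda>z. f (fst z) * g (snd z))"
        using ij by (auto simp: fun_eq_iff)
      then show "(\<lambda>z. f (plane_pt 1 2 z $ 1) * g (plane_pt 1 2 z $ 2)) \<in> borel_measurable (lborel \<Otimes>\<^sub>M lborel)"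
        by simp
      show "AE s in lborel. integrable lborel (\<lambda>t. f (plane_pt 1 2 (s, t) $ 1) * g (plane_pt 1 2 (s, t) $ 2))"
        unfolding plane_pt_nth[OF ij] by (intro AE_I2 integrable_mult_right assms)
    qed
  qed (auto simp: lborel_prod)
  then show ?thesis unfolding distr_plane_pt[OF ij] .
qed

lemma integrable_even:
  fixes f :: "real \<Rightarrow> real"
  assumes int: "integrable lborel (\<lambda>s. indicator {0..} s *\<^sub>R f s)" and even: "\<And>s. f (- s) = f s"
  shows "integrable lborel f"
proof -
  have "integrable lborel (\<lambda>s. indicator {0..} s *\<^sub>R f s + indicator {0..} (- s) *\<^sub>R f (- s))"
    using lborel_integrable_real_affine[OF int, of "-1" 0]
    by (intro Bochner_Integration.integrable_add int) simp
  then have "integrable lborel (\<lambda>s. if s = 0 then f 0 + f 0 else f s)"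
    by (rule Bochner_Integration.integrable_cong[THEN iffD1, rotated -1]) (auto simp: even indicator_def)
  then show ?thesis
  proof (rule integrable_cong_AE_imp)
    have "(\<lambda>s. if s = 0 then f 0 else (if s = 0 then f 0 + f 0 else f s)) \<in> borel_measurable borel"
      using \<open>integrable lborel (\<lambda>s. if s = 0 then f 0 + f 0 else f s)\<close>[THEN borel_measurable_integrable]
      by measurable
    moreover have "(\<lambda>s. if s = 0 then f 0 else (if s = 0 then f 0 + f 0 else f s)) = f" by auto
    ultimately show "f \<in> borel_measurable lborel" by simp
    show "AE s in lborel. (if s = 0 then f 0 + f 0 else f s) = f s"
      using AE_lborel_singleton[of 0] by eventually_elim auto
  qed
qed

lemma integrable_powr_pieces:
  shows "integrable lborel (\<lambda>s::real. indicator {0..1} s *\<^sub>R s powr (-1/2))"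
    and "\<sigma> > 1 \<Longrightarrow> integrable lborel (\<lambda>s::real. indicator {1..} s *\<^sub>R s powr (-\<sigma>))"
proof -
  have "(\<lambda>s::real. s powr (-1/2)) absolutely_integrable_on {0..1}"
    by (intro nonnegative_absolutely_integrable_1 integrable_on_powr_from_0) auto
  then show "integrable lborel (\<lambda>s::real. indicator {0..1} s *\<^sub>R s powr (-1/2))"
    unfolding set_integrable_def by (subst (asm) integrable_completion) auto
  assume "\<sigma> > 1"
  then have "(\<lambda>s::real. s powr (-\<sigma>)) absolutely_integrable_on {1..}"
    using has_integral_powr_to_inf[of "-\<sigma>" 1]
    by (intro nonnegative_absolutely_integrable_1) (auto simp: integrable_on_def)
  then show "integrable lborel (\<lambda>s::real. indicator {1..} s *\<^sub>R s powr (-\<sigma>))"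
    unfolding set_integrable_def by (subst (asm) integrable_completion) auto
qed

lemma integrable_1d_singular: "integrable lborel (\<lambda>s::real. \<bar>s\<bar> powr (-1/2) / (1 + \<bar>s\<bar>))"
proof (rule integrable_even)
  show "integrable lborel (\<lambda>s::real. indicator {0..} s *\<^sub>R (\<bar>s\<bar> powr (-1/2) / (1 + \<bar>s\<bar>)))"
  proof (rule Bochner_Integration.integrable_bound)
    show "integrable lborel (\<lambda>s::real. indicator {0..1} s *\<^sub>R s powr (-1/2) + indicator {1..} s *\<^sub>R s powr (-(3/2)))"
      by (intro Bochner_Integration.integrable_add integrable_powr_pieces) auto
    show "AE s::real in lborel. norm (indicator {0..} s *\<^sub>R (\<bar>s\<bar> powr (-1/2) / (1 + \<bar>s\<bar>)))
        \<le> norm (indicator {0..1} s *\<^sub>R s powr (-1/2) + indicator {1..} s *\<^sub>R s powr (-(3/2)))"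
    proof (rule AE_I2)
      fix s :: real
      consider "s < 0" | "0 \<le> s" "s \<le> 1" | "s > 1" by linarith
      then show "norm (indicator {0..} s *\<^sub>R (\<bar>s\<bar> powr (-1/2) / (1 + \<bar>s\<bar>)))
        \<le> norm (indicator {0..1} s *\<^sub>R s powr (-1/2) + indicator {1..} s *\<^sub>R s powr (-(3/2)))"
      proof cases
        case 2
        have "s powr (-1/2) / (1 + s) \<le> s powr (-1/2) / 1"
          using 2 by (intro divide_left_mono) auto
        also have "\<dots> \<le> s powr (-1/2) + indicator {1..} s *\<^sub>R s powr (-(3/2))" by simp
        finally show ?thesis using 2 by (simp add: indicator_def)
      next
        case 3
        have "s powr (-1/2) / (1 + s) \<le> s powr (-1/2) / s"
          using 3 by (intro divide_left_mono) auto
        also have "\<dots> = s powr (-1/2) * s powr (-1)" using 3 by (subst powr_neg_one) auto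
        also have "\<dots> = s powr (-(3/2))" unfolding powr_add[symmetric] by simp
        finally show ?thesis using 3 by simp
      next
        case 1
        then show ?thesis by (simp add: indicator_def)
      qed
    qed
  qed measurable
qed simp

lemma integrable_1d_powr:
  assumes "\<sigma> > 1" shows "integrable lborel (\<lambda>s::real. (1 + \<bar>s\<bar>) powr (-\<sigma>))"
proof (rule integrable_even)
  show "integrable lborel (\<lambda>s::real. indicator {0..} s *\<^sub>R ((1 + \<bar>s\<bar>) powr (-\<sigma>)))"
  proof (rule Bochner_Integration.integrable_bound)
    show "integrable lborel (\<lambda>s::real. indicator {0..1} s + indicator {1..} s *\<^sub>R s powr (-\<sigma>))"
      using assms by (intro Bochner_Integration.integrable_add integrable_powr_pieces)
        (auto simp: integrable_indicator_iff)
    show "AE s in lborel. norm (indicator {0..} s *\<^sub>R ((1 + \<bar>s\<bar>) powr (-\<sigma>)))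
        \<le> norm (indicator {0..1} s + indicator {1..} s *\<^sub>R s powr (-\<sigma>))"
    proof (rule AE_I2)
      fix s :: real
      consider "s < 0" | "0 \<le> s" "s \<le> 1" | "s > 1" by linarith
      then show "norm (indicator {0..} s *\<^sub>R ((1 + \<bar>s\<bar>) powr (-\<sigma>)))
        \<le> norm (indicator {0..1} s + indicator {1..} s *\<^sub>R s powr (-\<sigma>))"
      proof cases
        case 2
        then have "(1 + s) powr (-\<sigma>) \<le> 1"
          using assms powr_mono[of "-\<sigma>" 0 "1 + s"] by simp
        moreover have "indicator {1..} s *\<^sub>R s powr (-\<sigma>) \<ge> 0" by simp
        ultimately have "(1 + s) powr (-\<sigma>) \<le> 1 + indicator {1..} s *\<^sub>R s powr (-\<sigma>)"
          by linarith
        then show ?thesis using 2 by simp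
      next
        case 3
        then have "(1 + s) powr (-\<sigma>) \<le> s powr (-\<sigma>)"
          using assms by (intro powr_mono2') auto
        then show ?thesis using 3 by simp
      next
        case 1
        then show ?thesis by (simp add: indicator_def)
      qed
    qed
  qed measurable
qed simp

lemma abs_nth_le_norm: "\<bar>(x :: real ^ 2) $ i\<bar> \<le> norm x"
  using component_le_norm_cart[of x i] by simp

lemma integrable_plane_powr:
  assumes "\<sigma> > 2" shows "integrable lborel (\<lambda>x::real ^ 2. (1 + norm x) powr (-\<sigma>))"
proof (rule Bochner_Integration.integrable_bound)
  show "integrable lborel (\<lambda>x::real ^ 2. (1 + \<bar>x $ 1\<bar>) powr (-(\<sigma>/2)) * (1 + \<bar>x $ 2\<bar>) powr (-(\<sigma>/2)))"
    using assms by (intro integrable_tensor integrable_1d_powr) auto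
  show "AE x in lborel. norm ((1 + norm (x::real ^ 2)) powr (-\<sigma>))
      \<le> norm ((1 + \<bar>x $ 1\<bar>) powr (-(\<sigma>/2)) * (1 + \<bar>x $ 2\<bar>) powr (-(\<sigma>/2)))"
  proof (rule AE_I2)
    fix x :: "real ^ 2"
    have "(1 + norm x) powr (-\<sigma>) = (1 + norm x) powr (-(\<sigma>/2)) * (1 + norm x) powr (-(\<sigma>/2))"
      unfolding powr_add[symmetric] by simp
    also have "\<dots> \<le> (1 + \<bar>x $ 1\<bar>) powr (-(\<sigma>/2)) * (1 + \<bar>x $ 2\<bar>) powr (-(\<sigma>/2))"
      using assms abs_nth_le_norm[of x] by (intro mult_mono powr_mono2') auto
    finally show "norm ((1 + norm (x::real ^ 2)) powr (-\<sigma>))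
      \<le> norm ((1 + \<bar>x $ 1\<bar>) powr (-(\<sigma>/2)) * (1 + \<bar>x $ 2\<bar>) powr (-(\<sigma>/2)))" by simp
  qed
qed auto

text \<open>Since \<open>1 / r \<le> |x\<^sub>1|\<^bsup>-1/2\<^esup> |x\<^sub>2|\<^bsup>-1/2\<^esup>\<close>, the singularity is dominated by a product of integrable
  singularities, and the exponential beats the factors \<open>(1 + |x\<^sub>i|)\<^bsup>-1\<^esup>\<close> needed at infinity.\<close>
lemma integrable_plane_exp:
  assumes "a > 0" shows "integrable lborel (\<lambda>x::real ^ 2. (1 + 1 / norm x) * exp (- a * norm x))"
proof -
  have "((\<lambda>r::real. (1 + r) ^ 3 * exp (- a * r)) \<longlongrightarrow> 0) at_top"
    using assms by real_asymp
  then have "\<forall>\<^sub>F r in at_top. (1 + r) ^ 3 * exp (- a * r) < 1"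
    by (rule order_tendstoD) simp
  then obtain X where X: "\<And>r. r \<ge> X \<Longrightarrow> (1 + r) ^ 3 * exp (- a * r) < 1"
    by (auto simp: eventually_at_top_linorder)
  define C where "C = max 1 ((1 + \<bar>X\<bar>) ^ 3)"
  have C: "(1 + r) ^ 3 * exp (- a * r) \<le> C" if "r \<ge> 0" for r
  proof (cases "r \<ge> X")
    case True then show ?thesis using X[of r] unfolding C_def by linarith
  next
    case False
    have "(1 + r) ^ 3 * exp (- a * r) \<le> (1 + \<bar>X\<bar>) ^ 3 * 1"
      using False that assms by (intro mult_mono power_mono) auto
    then show ?thesis by (simp add: C_def)
  qed
  let ?b = "\<lambda>s::real. \<bar>s\<bar> powr (-1/2) / (1 + \<bar>s\<bar>)"
  show ?thesis
  proof (rule Bochner_Integration.integrable_bound)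
    show "integrable lborel (\<lambda>x::real ^ 2. C * (?b (x $ 1) * ?b (x $ 2)))"
      by (intro integrable_mult_right integrable_tensor integrable_1d_singular)
    show "AE x in lborel. norm ((1 + 1 / norm x) * exp (- a * norm x)) \<le> norm (C * (?b ((x::real ^ 2) $ 1) * ?b (x $ 2)))"
      using AE_nth_nonzero[of 1] AE_nth_nonzero[of 2]
    proof eventually_elim
      case (elim x)
      define r where "r = norm x"
      have r: "r > 0" using elim by (auto simp: r_def)
      have "(1 + 1 / r) * exp (- a * r) = ((1 + r) ^ 3 * exp (- a * r)) * (1 / (r * (1 + r)^2))"
      proof -
        have "y ^ 3 * (1 / (r * y\<^sup>2)) = y / r" if "y > 0" for y
          using that by (simp add: power2_eq_square power3_eq_cube)
        from this[of "1 + r"] have eq: "1 + 1 / r = (1 + r) ^ 3 * (1 / (r * (1 + r)\<^sup>2))"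
          using r by (simp add: add_divide_distrib)
        show ?thesis unfolding eq by (simp only: mult_ac)
      qed
      also have "\<dots> \<le> C * (1 / (r * (1 + r)^2))"
        using r by (intro mult_right_mono C) auto
      also have "1 / (r * (1 + r)^2) = (r powr (-1/2) / (1 + r)) * (r powr (-1/2) / (1 + r))"
      proof -
        have "r powr (-1/2) * r powr (-1/2) = 1 / r"
          unfolding powr_add[symmetric] using powr_neg_one[OF r] by simp
        then show ?thesis by (simp add: power2_eq_square)
      qed
      also have "C * \<dots> \<le> C * (?b (x $ 1) * ?b (x $ 2))"
      proof (intro mult_left_mono mult_mono frac_le powr_mono2')
        show "\<bar>x $ 1\<bar> \<le> r" "\<bar>x $ 2\<bar> \<le> r" using abs_nth_le_norm[of x] by (auto simp: r_def)
        then show "1 + \<bar>x $ 1\<bar> \<le> 1 + r" "1 + \<bar>x $ 2\<bar> \<le> 1 + r" by auto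
      qed (use elim r in \<open>auto simp: C_def\<close>)
      finally have "(1 + 1 / r) * exp (- a * r) \<le> C * (?b (x $ 1) * ?b (x $ 2))" .
      moreover have "(1 + 1 / r) * exp (- a * r) \<ge> 0" using r by auto
      ultimately show ?case unfolding r_def real_norm_def by linarith
    qed
  qed measurable
qed

lemma integrable_plane_square: "integrable lborel (\<lambda>x::real ^ 2. 2 / (1 + (norm x)\<^sup>2)\<^sup>2)"
proof (rule Bochner_Integration.integrable_bound)
  show "integrable lborel (\<lambda>x::real ^ 2. 8 * (1 + norm x) powr (-4))"
    by (intro integrable_mult_right integrable_plane_powr) auto
  show "AE x in lborel. norm (2 / (1 + (norm (x::real ^ 2))\<^sup>2)\<^sup>2) \<le> norm (8 * (1 + norm x) powr (-4))"
  proof (rule AE_I2)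
    fix x :: "real ^ 2"
    define r where "r = norm x"
    have r: "r \<ge> 0" by (simp add: r_def)
    have "(1 + r)\<^sup>2 \<le> 2 * (1 + r\<^sup>2)" using sum_squares_ge_zero[of "r - 1" 0] by (simp add: power2_eq_square algebra_simps)
    then have "((1 + r)\<^sup>2)\<^sup>2 \<le> (2 * (1 + r\<^sup>2))\<^sup>2" by (intro power_mono) auto
    then have "(1 + r) ^ 4 \<le> 4 * (1 + r\<^sup>2)\<^sup>2"
      unfolding power_mult_distrib power_mult[symmetric] by simp
    moreover have "(1 + r\<^sup>2)\<^sup>2 > 0" using r by (intro zero_less_power add_pos_nonneg) auto
    moreover have "(1 + r) powr (-4) = 1 / (1 + r) ^ 4"
      using r powr_realpow[of "1 + r" 4] by (simp add: powr_minus divide_inverse)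
    ultimately have "8 / (4 * (1 + r\<^sup>2)\<^sup>2) \<le> 8 * (1 + r) powr (-4)"
      using r by (simp only: times_divide_eq_right mult_1_right, intro divide_left_mono mult_pos_pos) auto
    then have "2 / (1 + r\<^sup>2)\<^sup>2 \<le> 8 * (1 + r) powr (-4)" by simp
    then show "norm (2 / (1 + (norm (x::real ^ 2))\<^sup>2)\<^sup>2) \<le> norm (8 * (1 + norm x) powr (-4))"
      by (simp add: r_def)
  qed
qed measurable

section \<open>Scaling, translation and reflection\<close>

lemma lborel_scale:
  assumes "c > 0"
  shows "lborel = density (distr lborel borel (\<lambda>x::real ^ 2. c *\<^sub>R x)) (\<lambda>_. ennreal (c\<^sup>2))"
  using lborel_affine[of c "0 :: real ^ 2"] assms by (simp add: ennreal_power)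

lemma integral_scale_plane:
  fixes h :: "real ^ 2 \<Rightarrow> 'b::{banach, second_countable_topology}"
  assumes "c > 0" and [measurable]: "h \<in> borel_measurable borel"
  shows "(LINT x|lborel. h x) = c\<^sup>2 *\<^sub>R (LINT x|lborel. h (c *\<^sub>R x))"
  by (subst lborel_scale[OF assms(1)]) (simp add: integral_density integral_distr)

lemma lborel_translate: "distr lborel borel (\<lambda>x::real ^ 2. t + x) = lborel"
  using lborel_distr_plus[of t] .

lemma lborel_reflect: "distr lborel borel (\<lambda>x::real ^ 2. t - x) = lborel"
proof -
  have "lborel = density (distr lborel borel (\<lambda>x::real ^ 2. t + (-1) *\<^sub>R x)) (\<lambda>_. ennreal (\<bar>-1\<bar> ^ DIM(real ^ 2)))"
    by (rule lborel_affine) simp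
  then show ?thesis by (simp add: density_1)
qed

section \<open>Norms of the majorant\<close>

definition decay_mass2 :: real where
  "decay_mass2 = (LINT x|lborel. 1 / norm (x::real ^ 2) * exp (- 2 * norm x))"

definition decay_mass :: "real \<Rightarrow> real" where
  "decay_mass s = (LINT x|lborel. (2 / (1 + norm (x::real ^ 2))) powr (s / 2))"

lemma decay_nonneg: "decay \<rho> a r \<ge> 0" if "\<rho> \<ge> 0" "r \<ge> 0"
  using that by (simp add: decay_def)

lemma decay_borel [measurable]: "decay \<rho> a \<in> borel_measurable borel"
  unfolding decay_def by measurable

text \<open>The square is at most \<open>e\<^bsup>- 2 a r\<^esup> / (\<rho> r)\<close>, and scaling by \<open>a\<close> produces the factor \<open>1 / a\<close>.
  When the spectral parameter approaches the real axis, \<open>\<rho> a\<close> is comparable to its imaginary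
  part.\<close>
lemma integral_decay_square_le:
  assumes "\<rho> > 0" "a > 0"
  shows "integrable lborel (\<lambda>x::real ^ 2. (decay \<rho> a (norm x))\<^sup>2)"
    and "(LINT x|lborel. (decay \<rho> a (norm (x::real ^ 2)))\<^sup>2) \<le> decay_mass2 / (\<rho> * a)"
proof -
  let ?h = "\<lambda>x::real ^ 2. 1 / (\<rho> * norm x) * exp (- (2 * a) * norm x)"
  have h: "integrable lborel ?h"
  proof (rule Bochner_Integration.integrable_bound)
    show "integrable lborel (\<lambda>x::real ^ 2. 1 / \<rho> * ((1 + 1 / norm x) * exp (- (2 * a) * norm x)))"
      using assms by (intro integrable_mult_right integrable_plane_exp) auto
    show "AE x in lborel. norm (?h x) \<le> norm (1 / \<rho> * ((1 + 1 / norm x) * exp (- (2 * a) * norm x)))"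
    proof (rule AE_I2)
      fix x :: "real ^ 2"
      have "1 / \<rho> * (1 / norm x * exp (- (2 * a) * norm x)) \<le> 1 / \<rho> * ((1 + 1 / norm x) * exp (- (2 * a) * norm x))"
        using assms by (intro mult_left_mono mult_right_mono) auto
      moreover have "0 \<le> 1 / \<rho> * (1 / norm x * exp (- (2 * a) * norm x))" using assms by simp
      ultimately show "norm (?h x) \<le> norm (1 / \<rho> * ((1 + 1 / norm x) * exp (- (2 * a) * norm x)))"
        using assms by (simp add: abs_mult)
    qed
  qed measurable
  have le: "(decay \<rho> a (norm x))\<^sup>2 \<le> ?h x" for x :: "real ^ 2"
  proof -
    have "(decay \<rho> a (norm x))\<^sup>2 \<le> (1 / sqrt (\<rho> * norm x) * exp (- a * norm x))\<^sup>2"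
      using assms by (intro power_mono decay_nonneg) (auto simp: decay_def)
    also have "\<dots> = 1 / (\<rho> * norm x) * (exp (- a * norm x) * exp (- a * norm x))"
      using assms by (simp add: power_mult_distrib power_divide power2_eq_square)
    also have "\<dots> = ?h x" by (simp flip: exp_add)
    finally show ?thesis .
  qed
  show i: "integrable lborel (\<lambda>x::real ^ 2. (decay \<rho> a (norm x))\<^sup>2)"
  proof (rule Bochner_Integration.integrable_bound[OF h])
    show "AE x in lborel. norm ((decay \<rho> a (norm (x::real ^ 2)))\<^sup>2) \<le> norm (?h x)"
      unfolding real_norm_def abs_power2 by (intro AE_I2 order_trans[OF le abs_ge_self])
  qed measurable
  have "(LINT x|lborel. (decay \<rho> a (norm (x::real ^ 2)))\<^sup>2) \<le> (LINT x|lborel. ?h x)"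
    by (intro integral_mono i h le)
  also have "\<dots> = (1 / a)\<^sup>2 *\<^sub>R (LINT x|lborel. ?h ((1 / a) *\<^sub>R x))"
    using assms by (intro integral_scale_plane) (auto, measurable)
  also have "(\<lambda>x. ?h ((1 / a) *\<^sub>R x)) = (\<lambda>x. (a / \<rho>) * (1 / norm x * exp (- 2 * norm x)))"
    using assms by (auto simp: fun_eq_iff)
  also have "(1 / a)\<^sup>2 *\<^sub>R (LINT x|lborel. (a / \<rho>) * (1 / norm (x::real ^ 2) * exp (- 2 * norm x))) = decay_mass2 / (\<rho> * a)"
    unfolding integral_mult_right_zero decay_mass2_def[symmetric] using assms by (simp add: power2_eq_square)
  finally show "(LINT x|lborel. (decay \<rho> a (norm (x::real ^ 2)))\<^sup>2) \<le> decay_mass2 / (\<rho> * a)" .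
qed

lemma decay_mass_integrable:
  assumes "s > 4" shows "integrable lborel (\<lambda>x::real ^ 2. (2 / (1 + norm x)) powr (s / 2))"
proof -
  have "integrable lborel (\<lambda>x::real ^ 2. 2 powr (s / 2) * (1 + norm x) powr (- (s / 2)))"
    using assms by (intro integrable_mult_right integrable_plane_powr) auto
  moreover have "(2 / (1 + norm x)) powr (s / 2) = 2 powr (s / 2) * (1 + norm x) powr (- (s / 2))" for x :: "real ^ 2"
    by (subst powr_minus_divide, subst powr_divide) auto
  ultimately show ?thesis by (simp only:)
qed

text \<open>The majorant is at most \<open>(2 / (1 + \<rho> r))\<^bsup>1/2\<^esup>\<close>. Its \<open>s\<close>-th power is integrable on the plane
  because \<open>s / 2 > 2\<close>, and scaling by \<open>\<rho>\<close> produces the factor \<open>\<rho>\<^bsup>-2\<^esup>\<close>. The bound does not depend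
  on the exponential rate \<open>a\<close>, hence survives the limit to the spectrum.\<close>
lemma integral_decay_powr_le:
  assumes "\<rho> > 0" "a \<ge> 0" "s > 4"
  shows "integrable lborel (\<lambda>x::real ^ 2. decay \<rho> a (norm x) powr s)"
    and "(LINT x|lborel. decay \<rho> a (norm (x::real ^ 2)) powr s) \<le> decay_mass s / \<rho>\<^sup>2"
proof -
  let ?b = "\<lambda>x::real ^ 2. (2 / (1 + norm x)) powr (s / 2)"
  let ?h = "\<lambda>x::real ^ 2. ?b (\<rho> *\<^sub>R x)"
  have h: "integrable lborel ?h"
  proof -
    have "integrable (density (distr lborel borel (\<lambda>x::real ^ 2. \<rho> *\<^sub>R x)) (\<lambda>_. ennreal (\<rho>\<^sup>2))) ?b"
      unfolding lborel_scale[OF assms(1), symmetric] by (rule decay_mass_integrable[OF assms(3)])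
    then show ?thesis using assms(1) by (simp add: integrable_density integrable_distr_eq)
  qed
  have le: "decay \<rho> a (norm x) powr s \<le> ?h x" for x :: "real ^ 2"
  proof -
    define t where "t = \<rho> * norm x"
    have t: "t \<ge> 0" using assms by (simp add: t_def)
    have ex: "exp (- a * norm x) \<le> 1" using assms by simp
    have "decay \<rho> a (norm x) \<le> (2 / (1 + t)) powr (1 / 2)"
    proof (cases "t \<le> 1")
      case True
      have "1 powr (1/2) \<le> (2 / (1 + t)) powr (1 / 2)"
        using True t by (intro powr_mono2) auto
      then show ?thesis by (simp add: decay_def)
    next
      case False
      have "decay \<rho> a (norm x) \<le> 1 / sqrt t * 1"
        unfolding decay_def t_def[symmetric] using t by (intro min.coboundedI2 mult_left_mono ex) auto
      also have "\<dots> = (1 / t) powr (1 / 2)" using False by (simp add: powr_half_sqrt real_sqrt_divide)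
      also have "\<dots> \<le> (2 / (1 + t)) powr (1 / 2)"
        using False by (intro powr_mono2) (auto simp: field_simps)
      finally show ?thesis .
    qed
    then have "decay \<rho> a (norm x) powr s \<le> ((2 / (1 + t)) powr (1 / 2)) powr s"
      using assms by (intro powr_mono2 decay_nonneg) auto
    also have "\<dots> = ?h x" using assms by (simp add: powr_powr t_def)
    finally show ?thesis .
  qed
  show i: "integrable lborel (\<lambda>x::real ^ 2. decay \<rho> a (norm x) powr s)"
  proof (rule Bochner_Integration.integrable_bound[OF h])
    show "AE x in lborel. norm (decay \<rho> a (norm (x::real ^ 2)) powr s) \<le> norm (?h x)"
      unfolding real_norm_def abs_of_nonneg[OF powr_ge_zero] by (intro AE_I2 le)
  qed measurable
  have "(LINT x|lborel. decay \<rho> a (norm (x::real ^ 2)) powr s) \<le> (LINT x|lborel. ?h x)"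
    by (intro integral_mono i h le)
  moreover have "decay_mass s = \<rho>\<^sup>2 *\<^sub>R (LINT x|lborel. ?h x)"
    unfolding decay_mass_def by (rule integral_scale_plane[OF assms(1)]) measurable
  ultimately show "(LINT x|lborel. decay \<rho> a (norm (x::real ^ 2)) powr s) \<le> decay_mass s / \<rho>\<^sup>2"
    using assms by (simp add: pos_le_divide_eq mult.commute)
qed

lemma decay_mass_nonneg: "decay_mass s \<ge> 0"
  unfolding decay_mass_def by (intro integral_nonneg_AE AE_I2) auto

section \<open>Smooth bump functions\<close>

text \<open>Differentiating \<open>P(1/t) e\<^bsup>-1/t\<^esup>\<close> gives \<open>Q(1/t) e\<^bsup>-1/t\<^esup>\<close> with \<open>Q(x) = x\<^sup>2 (P(x) - P'(x))\<close>, so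
  this recursion yields the derivatives of the flat function \<open>e\<^bsup>-1/t\<^esup>\<close>.\<close>
fun flat_poly :: "nat \<Rightarrow> real poly" where
  "flat_poly 0 = 1"
| "flat_poly (Suc n) = [:0, 0, 1:] * (flat_poly n - pderiv (flat_poly n))"

definition flat :: "nat \<Rightarrow> real \<Rightarrow> real" where
  "flat n t = (if t > 0 then poly (flat_poly n) (1 / t) * exp (- (1 / t)) else 0)"

lemma poly_times_exp_tendsto_0: "((\<lambda>s::real. poly p s * exp (- s)) \<longlongrightarrow> 0) at_top"
proof -
  have "((\<lambda>s::real. s ^ k * (poly p s * exp (- s))) \<longlongrightarrow> 0) at_top" for k
  proof (induction p arbitrary: k)
    case (pCons a p)
    have "((\<lambda>s::real. a * (s ^ k / exp s) + s ^ Suc k * (poly p s * exp (- s))) \<longlongrightarrow> a * 0 + 0) at_top"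
      by (intro tendsto_intros tendsto_power_div_exp_0 pCons.IH)
    then show ?case by (simp add: exp_minus field_simps)
  qed simp
  from this[of 0] show ?thesis by simp
qed

lemma flat_has_derivative: "(flat n has_real_derivative flat (Suc n) t) (at t)"
proof -
  consider "t > 0" | "t < 0" | "t = 0" by linarith
  then show ?thesis
  proof cases
    case 1
    have "((\<lambda>t. poly (flat_poly n) (1 / t) * exp (- (1 / t))) has_real_derivative flat (Suc n) t) (at t)"
      using 1 by (auto intro!: derivative_eq_intros DERIV_chain'[OF _ poly_DERIV, THEN DERIV_cong]
          simp: flat_def field_simps power2_eq_square)
    then show ?thesis
    proof (rule has_field_derivative_transform_within_open)
      show "open ({0<..} :: real set)" "t \<in> {0<..}" using 1 by auto
    qed (auto simp: flat_def)
  next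
    case 2
    have "((\<lambda>t. 0) has_real_derivative flat (Suc n) t) (at t)"
      using 2 by (simp add: flat_def)
    then show ?thesis
    proof (rule has_field_derivative_transform_within_open)
      show "open ({..<0} :: real set)" "t \<in> {..<0}" using 2 by auto
    qed (auto simp: flat_def)
  next
    case 3
    have "((\<lambda>h. flat n h / h) \<longlongrightarrow> 0) (at 0)"
    proof (rule filterlim_split_at)
      show "((\<lambda>h. flat n h / h) \<longlongrightarrow> 0) (at_left 0)"
        by (rule tendsto_eventually) (auto simp: eventually_at_left_field flat_def intro!: exI[of _ "-1"])
      have "((\<lambda>s. poly (pCons 0 (flat_poly n)) s * exp (- s)) \<longlongrightarrow> 0) at_top"
        by (rule poly_times_exp_tendsto_0)
      from filterlim_compose[OF this filterlim_inverse_at_top_right]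
      have "((\<lambda>h. poly (pCons 0 (flat_poly n)) (inverse h) * exp (- inverse h)) \<longlongrightarrow> 0) (at_right 0)" .
      then show "((\<lambda>h. flat n h / h) \<longlongrightarrow> 0) (at_right 0)"
        by (rule Lim_transform_eventually)
           (auto simp: eventually_at_right_field flat_def field_simps intro!: exI[of _ 1])
    qed
    then show ?thesis using 3 by (simp add: DERIV_def flat_def)
  qed
qed

text \<open>Closed under derivatives by rule induction, and large enough to contain approximations of
  the indicator of any interval.\<close>
inductive_set smooth_functions :: "(real \<Rightarrow> real) set" where
  flat: "(\<lambda>t. flat n (c * t + d)) \<in> smooth_functions"
| add: "f \<in> smooth_functions \<Longrightarrow> g \<in> smooth_functions \<Longrightarrow> (\<lambda>t. f t + g t) \<in> smooth_functions"
| mult: "f \<in> smooth_functions \<Longrightarrow> g \<in> smooth_functions \<Longrightarrow> (\<lambda>t. f t * g t) \<in> smooth_functions"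
| cmult: "f \<in> smooth_functions \<Longrightarrow> (\<lambda>t. c * f t) \<in> smooth_functions"

lemma smooth_functions_derivative:
  assumes "f \<in> smooth_functions"
  shows "\<exists>f'\<in>smooth_functions. \<forall>t. (f has_real_derivative f' t) (at t)"
  using assms
proof induction
  case (flat n c d)
  have "((\<lambda>t. flat n (c * t + d)) has_real_derivative c * flat (Suc n) (c * t + d)) (at t)" for t
    by (auto intro!: derivative_eq_intros DERIV_chain'[OF _ flat_has_derivative, THEN DERIV_cong])
  moreover have "(\<lambda>t. c * flat (Suc n) (c * t + d)) \<in> smooth_functions"
    by (intro smooth_functions.intros)
  ultimately show ?case by (intro bexI[of _ "\<lambda>t. c * flat (Suc n) (c * t + d)"] allI) auto
next
  case (add f g)
  then obtain f' g' where fg: "f' \<in> smooth_functions" "g' \<in> smooth_functions"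
    "\<And>t. (f has_real_derivative f' t) (at t)" "\<And>t. (g has_real_derivative g' t) (at t)" by blast
  then have "((\<lambda>t. f t + g t) has_real_derivative f' t + g' t) (at t)" for t
    by (intro DERIV_add) auto
  moreover have "(\<lambda>t. f' t + g' t) \<in> smooth_functions" using fg by (intro smooth_functions.add)
  ultimately show ?case by (intro bexI[of _ "\<lambda>t. f' t + g' t"] allI) auto
next
  case (mult f g)
  then obtain f' g' where fg: "f' \<in> smooth_functions" "g' \<in> smooth_functions"
    "\<And>t. (f has_real_derivative f' t) (at t)" "\<And>t. (g has_real_derivative g' t) (at t)" by blast
  then have "((\<lambda>t. f t * g t) has_real_derivative f' t * g t + g' t * f t) (at t)" for t
    by (intro DERIV_mult) auto
  moreover have "(\<lambda>t. f' t * g t + g' t * f t) \<in> smooth_functions"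
    using fg mult.hyps by (intro smooth_functions.add smooth_functions.mult)
  ultimately show ?case by (intro bexI[of _ "\<lambda>t. f' t * g t + g' t * f t"] allI) auto
next
  case (cmult f c)
  then obtain f' where f: "f' \<in> smooth_functions" "\<And>t. (f has_real_derivative f' t) (at t)" by blast
  then have "((\<lambda>t. c * f t) has_real_derivative c * f' t) (at t)" for t
    by (intro DERIV_cmult) auto
  moreover have "(\<lambda>t. c * f' t) \<in> smooth_functions" using f by (intro smooth_functions.cmult)
  ultimately show ?case by (intro bexI[of _ "\<lambda>t. c * f' t"] allI) auto
qed

lemma smooth_functions_translate:
  "f \<in> smooth_functions \<Longrightarrow> (\<lambda>t. f (t - s)) \<in> smooth_functions"
proof (induction rule: smooth_functions.induct)
  case (flat n c d)
  have "(\<lambda>t. flat n (c * t + (d - c * s))) \<in> smooth_functions" by (rule smooth_functions.flat)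
  then show ?case by (simp add: algebra_simps)
qed (auto intro: smooth_functions.intros)

definition bumps :: "(real \<Rightarrow> real) set" where
  "bumps = {f \<in> smooth_functions. \<exists>R. \<forall>t. \<bar>t\<bar> > R \<longrightarrow> f t = 0}"

lemma bumps_deriv:
  assumes "f \<in> bumps"
  shows "(f has_real_derivative deriv f t) (at t)" "deriv f \<in> bumps"
proof -
  obtain f' where f': "f' \<in> smooth_functions" "\<And>t. (f has_real_derivative f' t) (at t)"
    using assms smooth_functions_derivative[of f] by (auto simp: bumps_def)
  then have eq: "deriv f = f'" by (auto intro: DERIV_imp_deriv)
  show "(f has_real_derivative deriv f t) (at t)" using f' eq by simp
  obtain R where R: "\<And>t. \<bar>t\<bar> > R \<Longrightarrow> f t = 0" using assms by (auto simp: bumps_def)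
  have "f' t = 0" if "\<bar>t\<bar> > R" for t
  proof -
    have "((\<lambda>t. 0) has_real_derivative f' t) (at t)"
    proof (rule has_field_derivative_transform_within_open[OF f'(2)])
      show "open {t. \<bar>t\<bar> > R}" by (intro open_Collect_less continuous_intros)
    qed (use that R in auto)
    then show ?thesis using DERIV_unique DERIV_const by blast
  qed
  then show "deriv f \<in> bumps" using f'(1) eq by (auto simp: bumps_def)
qed

lemma bumps_translate:
  assumes "f \<in> bumps" shows "(\<lambda>t. f (t - s)) \<in> bumps"
proof -
  obtain R where R: "\<And>t. \<bar>t\<bar> > R \<Longrightarrow> f t = 0" using assms by (auto simp: bumps_def)
  have "\<forall>t. \<bar>t\<bar> > R + \<bar>s\<bar> \<longrightarrow> f (t - s) = 0" by (auto intro!: R)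
  then show ?thesis using assms smooth_functions_translate by (auto simp: bumps_def)
qed

lemma deriv_translate:
  assumes "f \<in> bumps" shows "deriv (\<lambda>t. f (t - s)) = (\<lambda>t. deriv f (t - s))"
proof
  fix t
  have "((\<lambda>t. f (t - s)) has_real_derivative deriv f (t - s) * 1) (at t)"
    by (rule DERIV_chain'[OF _ bumps_deriv(1)[OF assms]]) (auto intro!: derivative_eq_intros)
  then show "deriv (\<lambda>t. f (t - s)) t = deriv f (t - s)" by (auto intro: DERIV_imp_deriv)
qed

lemma bumps_continuous:
  assumes "f \<in> bumps" shows "continuous_on UNIV f"
  using bumps_deriv(1)[OF assms] by (meson DERIV_continuous_on has_field_derivative_at_within)

lemma bumps_bounded:
  assumes "f \<in> bumps" obtains B R where "B \<ge> 0" "R \<ge> 0" "\<And>t. \<bar>f t\<bar> \<le> B" "\<And>t. \<bar>t\<bar> > R \<Longrightarrow> f t = 0"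
proof -
  obtain R where R: "\<And>t. \<bar>t\<bar> > R \<Longrightarrow> f t = 0" using assms by (auto simp: bumps_def)
  have "bounded (f ` {- \<bar>R\<bar>..\<bar>R\<bar>})"
    by (intro compact_imp_bounded compact_continuous_image continuous_on_subset[OF bumps_continuous[OF assms]]) auto
  then obtain B where B: "\<And>t. t \<in> {- \<bar>R\<bar>..\<bar>R\<bar>} \<Longrightarrow> \<bar>f t\<bar> \<le> B"
    unfolding bounded_iff by fastforce
  show ?thesis
  proof (rule that[of "\<bar>B\<bar>" "\<bar>R\<bar>"])
    fix t
    show "\<bar>f t\<bar> \<le> \<bar>B\<bar>"
    proof (cases "\<bar>t\<bar> > \<bar>R\<bar>")
      case False
      then have "t \<in> {- \<bar>R\<bar>..\<bar>R\<bar>}" unfolding atLeastAtMost_iff by linarith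
      then show ?thesis using B[of t] by linarith
    qed (use R[of t] in auto)
  qed (auto intro: R)
qed

lemma bumps_measurable: "f \<in> bumps \<Longrightarrow> f \<in> borel_measurable borel"
  by (intro borel_measurable_continuous_onI bumps_continuous)

text \<open>The products \<open>e\<^bsup>-1/(n(t-a))\<^esup> e\<^bsup>-1/(n(b-t))\<^esup>\<close>, extended by \<open>0\<close>, increase to \<open>1\<close> on the
  interval.\<close>
lemma bump_approximation:
  obtains f :: "nat \<Rightarrow> real \<Rightarrow> real" where "\<And>n. f n \<in> bumps" "\<And>n t. 0 \<le> f n t \<and> f n t \<le> 1"
    "\<And>n t. t \<notin> {a<..<b} \<Longrightarrow> f n t = 0" "\<And>t. (\<lambda>n. f n t) \<longlonglongrightarrow> indicator {a<..<b} t"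
proof -
  define f where "f = (\<lambda>n t. flat 0 (real (Suc n) * t + (- real (Suc n) * a)) * flat 0 ((- real (Suc n)) * t + real (Suc n) * b))"
  have feq: "f n t = (if a < t \<and> t < b then exp (- (1 / (real (Suc n) * (t - a)))) * exp (- (1 / (real (Suc n) * (b - t)))) else 0)" for n t
  proof -
    have 1: "real (Suc n) * t + (- real (Suc n) * a) = real (Suc n) * (t - a)"
      "(- real (Suc n)) * t + real (Suc n) * b = real (Suc n) * (b - t)" by (auto simp: algebra_simps)
    have "real (Suc n) * (t - a) > 0 \<longleftrightarrow> a < t" "real (Suc n) * (b - t) > 0 \<longleftrightarrow> t < b"
      by (auto simp: zero_less_mult_iff)
    then show ?thesis unfolding f_def flat_def 1 by simp
  qed
  show ?thesis
  proof
    fix n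
    have "f n \<in> smooth_functions" unfolding f_def by (intro smooth_functions.intros)
    moreover have "\<forall>t. \<bar>t\<bar> > max \<bar>a\<bar> \<bar>b\<bar> \<longrightarrow> f n t = 0" by (auto simp: feq)
    ultimately show "f n \<in> bumps" unfolding bumps_def by blast
  next
    fix n t
    show "0 \<le> f n t \<and> f n t \<le> 1" by (auto simp: feq intro!: mult_le_one)
    show "t \<notin> {a<..<b} \<Longrightarrow> f n t = 0" by (auto simp: feq)
  next
    fix t
    show "(\<lambda>n. f n t) \<longlonglongrightarrow> indicator {a<..<b} t"
    proof (cases "a < t \<and> t < b")
      case True
      have lim: "(\<lambda>n. exp (- (1 / (real (Suc n) * c)))) \<longlonglongrightarrow> 1" if "c > 0" for c
        using that by real_asymp
      have "(\<lambda>n. exp (- (1 / (real (Suc n) * (t - a)))) * exp (- (1 / (real (Suc n) * (b - t))))) \<longlonglongrightarrow> 1 * 1"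
        by (intro tendsto_mult lim) (use True in auto)
      then show ?thesis using True by (simp add: feq)
    next
      case False
      then show ?thesis by (auto simp: feq indicator_def)
    qed
  qed
qed

section \<open>Tensor products as test functions\<close>

text \<open>Test functions of this form suffice for everything below. Their partial derivatives are
  again tensor products, so that mixed derivatives commute by inspection.\<close>
definition tensor :: "(real \<Rightarrow> real) \<Rightarrow> (real \<Rightarrow> real) \<Rightarrow> real ^ 2 \<Rightarrow> complex" where
  "tensor f g x = of_real (f (x $ 1) * g (x $ 2))"

lemma tensor_has_derivative:
  assumes "f \<in> bumps" "g \<in> bumps"
  shows "(tensor f g has_derivative
    (\<lambda>h. of_real (h $ 1 * (deriv f (x $ 1) * g (x $ 2)) + h $ 2 * (f (x $ 1) * deriv g (x $ 2))))) (at x)"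
proof -
  have nth: "((\<lambda>x::real ^ 2. u (x $ i)) has_derivative (\<lambda>h. h $ i * deriv u (x $ i))) (at x)"
    if "u \<in> bumps" for u and i :: 2
  proof -
    have "((\<lambda>x::real ^ 2. x $ i) has_derivative (\<lambda>h. h $ i)) (at x)"
      by (rule bounded_linear_imp_has_derivative[OF bounded_linear_vec_nth])
    moreover have "(u has_derivative (\<lambda>h. h * deriv u (x $ i))) (at (x $ i))"
      using bumps_deriv(1)[OF that, of "x $ i"] unfolding has_field_derivative_def
      by (rule has_derivative_eq_rhs) (simp add: fun_eq_iff)
    ultimately show ?thesis by (rule has_derivative_compose)
  qed
  note 1 = nth[OF assms(1), of 1] and 2 = nth[OF assms(2), of 2]
  have "((\<lambda>x::real ^ 2. of_real (f (x $ 1) * g (x $ 2)) :: complex) has_derivative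
    (\<lambda>h. of_real (f (x $ 1) * (h $ 2 * deriv g (x $ 2)) + h $ 1 * deriv f (x $ 1) * g (x $ 2)))) (at x)"
    by (intro has_derivative_of_real has_derivative_mult 1 2)
  then show ?thesis unfolding tensor_def by (simp add: algebra_simps)
qed

lemma pderiv_dir_tensor:
  assumes "f \<in> bumps" "g \<in> bumps"
  shows "pderiv_dir 1 (tensor f g) = tensor (deriv f) g" "pderiv_dir 2 (tensor f g) = tensor f (deriv g)"
  unfolding pderiv_dir_def
  by (simp_all add: fun_eq_iff frechet_derivative_at[OF tensor_has_derivative[OF assms], symmetric] tensor_def axis_def)

lemma tensor_differentiable:
  assumes "f \<in> bumps" "g \<in> bumps" shows "tensor f g differentiable_on UNIV"
  using tensor_has_derivative[OF assms] by (auto simp: differentiable_on_def differentiable_def)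

lemma pderivs_tensor:
  assumes "f \<in> bumps" "g \<in> bumps"
  shows "\<exists>f'\<in>bumps. \<exists>g'\<in>bumps. pderivs is (tensor f g) = tensor f' g'"
  using assms
proof (induction "is")
  case (Cons i "is")
  then obtain f' g' where fg: "f' \<in> bumps" "g' \<in> bumps" "pderivs is (tensor f g) = tensor f' g'" by blast
  then have "pderivs (i # is) (tensor f g) = pderiv_dir i (tensor f' g')" by (simp add: pderivs_def)
  moreover have "i = 1 \<or> i = 2" using exhaust_2 by blast
  ultimately show ?case using pderiv_dir_tensor[OF fg(1,2)] bumps_deriv(2) fg by metis
qed (auto simp: pderivs_def)

lemma tensor_test_function:
  assumes "f \<in> bumps" "g \<in> bumps" shows "tensor f g \<in> test_functions"
proof -
  have "pderivs is (tensor f g) differentiable_on UNIV" for "is"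
    using pderivs_tensor[OF assms, of "is"] tensor_differentiable by auto
  moreover obtain B1 R1 where 1: "\<And>t. \<bar>t\<bar> > R1 \<Longrightarrow> f t = 0" using bumps_bounded[OF assms(1)] by metis
  obtain B2 R2 where 2: "\<And>t. \<bar>t\<bar> > R2 \<Longrightarrow> g t = 0" using bumps_bounded[OF assms(2)] by metis
  have "tensor f g x = 0" if "x \<notin> cball 0 (\<bar>R1\<bar> + \<bar>R2\<bar>)" for x
  proof -
    have "norm x > \<bar>R1\<bar> + \<bar>R2\<bar>" using that by simp
    moreover have "norm x \<le> \<bar>x $ 1\<bar> + \<bar>x $ 2\<bar>"
      using norm_le_l1_cart[of x] by (simp add: sum_2)
    ultimately have "\<bar>x $ 1\<bar> > R1 \<or> \<bar>x $ 2\<bar> > R2" by linarith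
    then show ?thesis using 1 2 by (auto simp: tensor_def)
  qed
  then have "\<exists>K. compact K \<and> (\<forall>x. x \<notin> K \<longrightarrow> tensor f g x = 0)" using compact_cball by blast
  ultimately show ?thesis by (auto simp: test_functions_def)
qed

lemma tensor_translate: "tensor f g (x - y) = tensor (\<lambda>t. f (t - y $ 1)) (\<lambda>t. g (t - y $ 2)) x"
  by (simp add: tensor_def)

lemma tensor_bounded:
  assumes "f \<in> bumps" "g \<in> bumps"
  obtains B R where "B \<ge> 0" "R \<ge> 0" "\<And>x. cmod (tensor f g x) \<le> B * indicator (cball 0 R) x"
proof -
  obtain B1 R1 where 1: "B1 \<ge> 0" "R1 \<ge> 0" "\<And>t. \<bar>f t\<bar> \<le> B1" "\<And>t. \<bar>t\<bar> > R1 \<Longrightarrow> f t = 0" using bumps_bounded[OF assms(1)] by metis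
  obtain B2 R2 where 2: "B2 \<ge> 0" "R2 \<ge> 0" "\<And>t. \<bar>g t\<bar> \<le> B2" "\<And>t. \<bar>t\<bar> > R2 \<Longrightarrow> g t = 0" using bumps_bounded[OF assms(2)] by metis
  show ?thesis
  proof (rule that[of "B1 * B2" "R1 + R2"])
    fix x
    show "cmod (tensor f g x) \<le> B1 * B2 * indicator (cball 0 (R1 + R2)) x"
    proof (cases "x \<in> cball 0 (R1 + R2)")
      case True
      have "\<bar>f (x $ 1)\<bar> * \<bar>g (x $ 2)\<bar> \<le> B1 * B2" using 1 2 by (intro mult_mono) auto
      then show ?thesis using True by (simp add: tensor_def norm_mult)
    next
      case False
      then have "norm x > R1 + R2" by simp
      moreover have "norm x \<le> \<bar>x $ 1\<bar> + \<bar>x $ 2\<bar>"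
        using norm_le_l1_cart[of x] by (simp add: sum_2)
      ultimately have "\<bar>x $ 1\<bar> > R1 \<or> \<bar>x $ 2\<bar> > R2" by linarith
      then show ?thesis using 1 2 False by (auto simp: tensor_def)
    qed
  qed (use 1 2 in auto)
qed

lemma tensor_measurable: "f \<in> bumps \<Longrightarrow> g \<in> bumps \<Longrightarrow> tensor f g \<in> borel_measurable borel"
  using bumps_measurable[of f, measurable] bumps_measurable[of g, measurable]
  unfolding tensor_def by measurable

section \<open>The fundamental lemma of the calculus of variations\<close>

definition locally_integrable :: "(real ^ 2 \<Rightarrow> complex) \<Rightarrow> bool" where
  "locally_integrable h \<longleftrightarrow> (\<forall>R. integrable lborel (\<lambda>x. indicator (cball 0 R) x *\<^sub>R h x))"

lemma locally_integrable_measurable: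
  assumes "locally_integrable h" shows "h \<in> borel_measurable borel"
proof (rule borel_measurable_LIMSEQ_metric)
  show "(\<lambda>x. indicator (cball 0 (real n)) x *\<^sub>R h x) \<in> borel_measurable borel" for n
    using assms by (auto simp: locally_integrable_def dest!: spec borel_measurable_integrable)
  show "(\<lambda>n. indicator (cball 0 (real n)) x *\<^sub>R h x) \<longlonglongrightarrow> h x" for x
  proof (rule tendsto_eventually)
    show "\<forall>\<^sub>F n in sequentially. indicator (cball 0 (real n)) x *\<^sub>R h x = h x"
      using eventually_ge_at_top[of "nat \<lceil>norm x\<rceil>"]
      by eventually_elim (auto simp: indicator_def; linarith)
  qed
qed

lemma box_eq_Times: "(x::real ^ 2) \<in> box a b \<longleftrightarrow> x $ 1 \<in> {a $ 1<..<b $ 1} \<and> x $ 2 \<in> {a $ 2<..<b $ 2}"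
  by (auto simp: mem_box_cart forall_2)

text \<open>Tensor products of approximations to the indicators of the two sides converge boundedly to
  the indicator of the box.\<close>
lemma integral_box_eq_0:
  assumes h: "locally_integrable h"
    and zero: "\<And>f g. f \<in> bumps \<Longrightarrow> g \<in> bumps \<Longrightarrow> (LINT x|lborel. h x * tensor f g x) = 0"
  shows "(LINT x|lborel. indicator (box a b) x *\<^sub>R h x) = 0"
proof -
  obtain f where f: "\<And>n. f n \<in> bumps" "\<And>n t. 0 \<le> f n t \<and> f n t \<le> 1"
    "\<And>n t. t \<notin> {a $ 1<..<b $ 1} \<Longrightarrow> f n t = 0" "\<And>t. (\<lambda>n. f n t) \<longlonglongrightarrow> indicator {a $ 1<..<b $ 1} t"
    using bump_approximation by metis
  obtain g where g: "\<And>n. g n \<in> bumps" "\<And>n t. 0 \<le> g n t \<and> g n t \<le> 1"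
    "\<And>n t. t \<notin> {a $ 2<..<b $ 2} \<Longrightarrow> g n t = 0" "\<And>t. (\<lambda>n. g n t) \<longlonglongrightarrow> indicator {a $ 2<..<b $ 2} t"
    using bump_approximation by metis
  obtain R where R: "box a b \<subseteq> cball 0 R"
    using bounded_box[of a b] bounded_subset_ballD[of "box a b" 0] ball_subset_cball by (metis order_trans)
  have hm [measurable]: "h \<in> borel_measurable borel" by (rule locally_integrable_measurable[OF h])
  have ind: "indicator (box a b) x = (indicator {a $ 1<..<b $ 1} (x $ 1) * indicator {a $ 2<..<b $ 2} (x $ 2) :: real)" for x
    using box_eq_Times[of x a b] by (auto simp: indicator_def)
  have "(\<lambda>n. LINT x|lborel. h x * tensor (f n) (g n) x) \<longlonglongrightarrow> (LINT x|lborel. indicator (box a b) x *\<^sub>R h x)"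
  proof (rule integral_dominated_convergence[where w = "\<lambda>x. cmod (indicator (cball 0 R) x *\<^sub>R h x)"])
    show "(\<lambda>x. h x * tensor (f n) (g n) x) \<in> borel_measurable lborel" for n
      using tensor_measurable[OF f(1) g(1), measurable] by measurable
    show "integrable lborel (\<lambda>x. cmod (indicator (cball 0 R) x *\<^sub>R h x))"
      using h unfolding locally_integrable_def by (intro integrable_norm) blast
    show "AE x in lborel. (\<lambda>n. h x * tensor (f n) (g n) x) \<longlonglongrightarrow> indicator (box a b) x *\<^sub>R h x"
    proof (rule AE_I2)
      fix x
      have "(\<lambda>n. h x * of_real (f n (x $ 1) * g n (x $ 2))) \<longlonglongrightarrow> h x * of_real (indicator (box a b) x)"
        unfolding ind by (intro tendsto_intros f g)
      then show "(\<lambda>n. h x * tensor (f n) (g n) x) \<longlonglongrightarrow> indicator (box a b) x *\<^sub>R h x"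
        by (simp add: tensor_def scaleR_conv_of_real mult.commute)
    qed
    show "AE x in lborel. norm (h x * tensor (f n) (g n) x) \<le> cmod (indicator (cball 0 R) x *\<^sub>R h x)" for n
    proof (rule AE_I2)
      fix x
      show "norm (h x * tensor (f n) (g n) x) \<le> cmod (indicator (cball 0 R) x *\<^sub>R h x)"
      proof (cases "x \<in> box a b")
        case True
        have "\<bar>f n (x $ 1) * g n (x $ 2)\<bar> \<le> 1"
          using f(2)[of n "x $ 1"] g(2)[of n "x $ 2"] by (simp add: abs_mult mult_le_one)
        then have "cmod (h x) * \<bar>f n (x $ 1) * g n (x $ 2)\<bar> \<le> cmod (h x) * 1"
          by (intro mult_left_mono) auto
        moreover have "x \<in> cball 0 R" using True R by auto
        ultimately show ?thesis by (simp add: tensor_def norm_mult abs_mult)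
      next
        case False
        then have "f n (x $ 1) = 0 \<or> g n (x $ 2) = 0" using box_eq_Times[of x a b] f(3) g(3) by blast
        then show ?thesis by (auto simp: tensor_def)
      qed
    qed
  qed measurable
  moreover have "(LINT x|lborel. h x * tensor (f n) (g n) x) = 0" for n by (rule zero[OF f(1) g(1)])
  ultimately show ?thesis by (simp add: LIMSEQ_const_iff)
qed

text \<open>Boxes form an intersection stable generator of the Borel sets, so the integral vanishes
  over every Borel set. The total integral is needed for complements.\<close>
lemma AE_eq_0_of_box_integrals:
  fixes h :: "real ^ 2 \<Rightarrow> complex"
  assumes h: "integrable lborel h" and tot: "(LINT x|lborel. h x) = 0"
    and box: "\<And>a b. (LINT x|lborel. indicator (box a b) x *\<^sub>R h x) = 0"
  shows "AE x in lborel. h x = 0"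
proof (rule sigma_finite_measure.density_zero[OF sigma_finite_lborel h])
  fix A :: "(real ^ 2) set" assume "A \<in> sets lborel"
  have gen: "sets lborel = sigma_sets UNIV (range (\<lambda>(a, b). box a b :: (real ^ 2) set))"
    unfolding sets_lborel borel_eq_box by (rule sets_measure_of) auto
  have "Int_stable (range (\<lambda>(a, b). box a b :: (real ^ 2) set))"
    by (auto simp: Int_stable_def box_Int_box)
  moreover have "range (\<lambda>(a, b). box a b :: (real ^ 2) set) \<subseteq> Pow UNIV" by auto
  moreover have "A \<in> sigma_sets UNIV (range (\<lambda>(a, b). box a b :: (real ^ 2) set))"
    using \<open>A \<in> sets lborel\<close> gen by simp
  ultimately show "set_lebesgue_integral lborel A h = 0"
  proof (induction rule: sigma_sets_induct_disjoint)
    case (basic A)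
    then show ?case using box by (auto simp: set_lebesgue_integral_def)
  next
    case empty then show ?case by (simp add: set_lebesgue_integral_def)
  next
    case (compl A)
    then have A: "A \<in> sets lborel" unfolding gen by simp
    have "(\<lambda>x. indicator (UNIV - A) x *\<^sub>R h x) = (\<lambda>x. h x - indicator A x *\<^sub>R h x)"
      by (auto simp: indicator_def fun_eq_iff)
    then show ?case
      using compl tot integrable_mult_indicator[OF A h] h by (simp add: set_lebesgue_integral_def)
  next
    case (union A)
    then have A: "A i \<in> sets lborel" for i unfolding gen by blast
    have "(LINT x:(\<Union>i. A i)|lborel. h x) = (\<Sum>i. (LINT x:(A i)|lborel. h x))"
    proof (rule lebesgue_integral_countable_add)
      show "set_integrable lborel (\<Union>i. A i) h"
        unfolding set_integrable_def using A by (intro integrable_mult_indicator h) auto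
      show "i \<noteq> j \<Longrightarrow> A i \<inter> A j = {}" for i j using union(1) by (auto simp: disjoint_family_on_def)
    qed (rule A)
    then show ?case using union by simp
  qed
qed

lemma fundamental_lemma:
  assumes h: "locally_integrable h"
    and zero: "\<And>f g. f \<in> bumps \<Longrightarrow> g \<in> bumps \<Longrightarrow> (LINT x|lborel. h x * tensor f g x) = 0"
  shows "AE x in lborel. h x = 0"
proof -
  note box = integral_box_eq_0[OF h zero]
  define Q :: "nat \<Rightarrow> (real ^ 2) set" where "Q = (\<lambda>n. box (\<chi> i. - real n) (\<chi> i. real n))"
  have "AE x in lborel. indicator (Q n) x *\<^sub>R h x = 0" for n
  proof (rule AE_eq_0_of_box_integrals)
    obtain R where R: "Q n \<subseteq> cball 0 R"
      unfolding Q_def using bounded_box bounded_subset_ballD ball_subset_cball by (metis order_trans)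
    have "integrable lborel (\<lambda>x. indicator (Q n) x *\<^sub>R (indicator (cball 0 R) x *\<^sub>R h x))"
      by (rule integrable_mult_indicator) (use h in \<open>auto simp: Q_def locally_integrable_def\<close>)
    moreover have "indicator (Q n) x *\<^sub>R (indicator (cball 0 R) x *\<^sub>R h x) = indicator (Q n) x *\<^sub>R h x" for x
      using R by (auto simp: indicator_def)
    ultimately show "integrable lborel (\<lambda>x. indicator (Q n) x *\<^sub>R h x)" by (simp only:)
    show "(LINT x|lborel. indicator (Q n) x *\<^sub>R h x) = 0" unfolding Q_def by (rule box) auto
    fix a b :: "real ^ 2"
    obtain c d :: "real ^ 2" where cd: "box a b \<inter> Q n = box c d"
      unfolding Q_def box_Int_box by blast
    have "indicator (box a b) x *\<^sub>R (indicator (Q n) x *\<^sub>R h x) = indicator (box c d) x *\<^sub>R h x" for x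
      unfolding cd[symmetric] by (auto simp: indicator_def)
    then show "(LINT x|lborel. indicator (box a b) x *\<^sub>R (indicator (Q n) x *\<^sub>R h x)) = 0"
      by (simp only: box)
  qed
  then have "AE x in lborel. \<forall>n. indicator (Q n) x *\<^sub>R h x = 0"
    unfolding AE_all_countable by blast
  then show ?thesis
  proof eventually_elim
    case (elim x)
    obtain n :: nat where n: "norm x < real n" using reals_Archimedean2 by blast
    have "\<bar>x $ i\<bar> < real n" for i using component_le_norm_cart[of x i] n by linarith
    then have "x \<in> Q n" by (auto simp: Q_def mem_box_cart abs_less_iff minus_less_iff)
    then show ?case using elim by (metis indicator_simps(1) scaleR_one)
  qed
qed

section \<open>The Green function of the Helmholtz operator\<close>

lemma norm_has_partial:
  fixes x :: "real ^ 2"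
  assumes "x \<noteq> 0"
  shows "((\<lambda>s. norm (x + s *\<^sub>R axis i 1)) has_real_derivative x $ i / norm x) (at 0)"
proof -
  have eq: "norm (x + s *\<^sub>R axis i 1) = sqrt ((norm x)\<^sup>2 + 2 * s * x $ i + s\<^sup>2)" for s
  proof -
    have "(norm (x + s *\<^sub>R axis i 1))\<^sup>2 = (norm x)\<^sup>2 + 2 * s * x $ i + s\<^sup>2"
      unfolding power2_norm_eq_inner
      by (simp add: inner_add_left inner_add_right inner_axis inner_axis' axis_nth power2_eq_square algebra_simps)
    then show ?thesis by (metis norm_ge_zero real_sqrt_unique)
  qed
  have "((\<lambda>s. sqrt ((norm x)\<^sup>2 + 2 * s * x $ i + s\<^sup>2)) has_real_derivative
      (2 * x $ i) * (inverse (sqrt ((norm x)\<^sup>2)) / 2)) (at 0)"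
    using assms by (auto intro!: derivative_eq_intros)
  then show ?thesis unfolding eq using assms by (simp add: field_simps)
qed

lemma radial_has_partial:
  fixes x :: "real ^ 2" and g :: "real \<Rightarrow> complex"
  assumes "x \<noteq> 0" "(g has_vector_derivative g') (at (norm x))"
  shows "((\<lambda>s. g (norm (x + s *\<^sub>R axis i 1))) has_vector_derivative of_real (x $ i / norm x) * g') (at 0)"
proof -
  have "((\<lambda>s. norm (x + s *\<^sub>R axis i 1)) has_vector_derivative x $ i / norm x) (at 0)"
    using norm_has_partial[OF assms(1)] by (simp add: has_real_derivative_iff_has_vector_derivative)
  from vector_diff_chain_at[OF this, of g g'] assms(2) show ?thesis
    by (simp add: comp_def scaleR_conv_of_real)
qed

lemma nth_radial_has_partial:
  fixes x :: "real ^ 2" and g :: "real \<Rightarrow> complex"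
  assumes "x \<noteq> 0" "(g has_vector_derivative g') (at (norm x))"
  shows "((\<lambda>s. of_real ((x + s *\<^sub>R axis j 1) $ i) * g (norm (x + s *\<^sub>R axis j 1))) has_vector_derivative
      (if i = j then g (norm x) else 0) + of_real (x $ i * x $ j / norm x) * g') (at 0)"
proof -
  have "((\<lambda>s. of_real ((x + s *\<^sub>R axis j 1) $ i) :: complex) has_vector_derivative of_real (if i = j then 1 else 0)) (at 0)"
    by (rule has_vector_derivative_of_real) (auto simp: axis_def intro!: derivative_eq_intros)
  from has_vector_derivative_mult[OF this radial_has_partial[OF assms, of j]]
  show ?thesis by (auto simp: algebra_simps)
qed

lemma cosh_moment_measurable [measurable]: "cosh_moment j \<in> borel_measurable borel"
proof -
  have "(\<lambda>(w, t). bessel_integrand j w t) \<in> borel_measurable (borel \<Otimes>\<^sub>M lborel)"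
  proof -
    have [measurable]: "cosh \<in> borel_measurable (borel :: real measure)"
      by (intro borel_measurable_continuous_onI continuous_intros)
    show ?thesis unfolding bessel_integrand_def split_beta by measurable
  qed
  then show ?thesis unfolding cosh_moment_def by (rule lborel.borel_measurable_lebesgue_integral)
qed

lemma bessel_wK1_measurable [measurable]: "bessel_wK1 \<in> borel_measurable borel"
  unfolding bessel_wK1_def by measurable

lemma bessel_w2K2_measurable [measurable]: "bessel_w2K2 \<in> borel_measurable borel"
  unfolding bessel_w2K2_def by measurable

lemma of_real_nth_measurable [measurable]:
  "(\<lambda>x::real ^ 2. complex_of_real (x $ i)) \<in> borel_measurable borel"
  by (intro borel_measurable_continuous_onI continuous_intros)

lemma integrable_of_exp_bound:
  fixes f :: "real ^ 2 \<Rightarrow> complex"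
  assumes "f \<in> borel_measurable borel" "a > 0"
    and "\<And>x. x \<noteq> 0 \<Longrightarrow> cmod (f x) \<le> C * ((1 + 1 / norm x) * exp (- a * norm x))"
  shows "integrable lborel f"
proof (rule Bochner_Integration.integrable_bound)
  show "integrable lborel (\<lambda>x::real ^ 2. C * ((1 + 1 / norm x) * exp (- a * norm x)))"
    by (intro integrable_mult_right integrable_plane_exp assms)
  show "AE x in lborel. norm (f x) \<le> norm (C * ((1 + 1 / norm x) * exp (- a * norm x)))"
    using AE_lborel_singleton[of 0]
  proof eventually_elim
    case (elim x)
    then show ?case using assms(3)[of x] by (metis abs_ge_self order_trans real_norm_def)
  qed
qed (use assms in auto)

lemma inverse_sqrt_le: "r > 0 \<Longrightarrow> 1 / sqrt r \<le> 1 + 1 / (r::real)"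
proof -
  assume r: "r > 0"
  have "2 * (1 / sqrt r) * 1 \<le> (1 / sqrt r)\<^sup>2 + 1\<^sup>2" by (rule sum_squares_bound)
  moreover have "(1 / sqrt r)\<^sup>2 = 1 / r" using r by (simp add: power_divide)
  moreover have "1 / sqrt r > 0" using r by simp
  ultimately show ?thesis by (simp only: power_one mult_1_right)
qed

text \<open>The value is \<open>2 \<pi>\<close>, the total mass of the source of \<open>K\<^sub>0\<close>; the constants below need only
  its positivity.\<close>
definition kernel_mass :: real where
  "kernel_mass = (LINT x|lborel. 2 / (1 + (norm (x::real ^ 2))\<^sup>2)\<^sup>2)"

lemma kernel_mass_pos: "kernel_mass > 0"
proof -
  have pos: "2 / (1 + (norm (x::real ^ 2))\<^sup>2)\<^sup>2 > 0" for x
    by (intro divide_pos_pos zero_less_power add_pos_nonneg) auto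
  have "kernel_mass \<ge> 0" unfolding kernel_mass_def by (intro integral_nonneg_AE AE_I2 less_imp_le[OF pos])
  moreover have "kernel_mass \<noteq> 0"
  proof
    assume "kernel_mass = 0"
    then have "AE x in lborel. 2 / (1 + (norm (x::real ^ 2))\<^sup>2)\<^sup>2 = 0"
      unfolding kernel_mass_def
      by (subst (asm) integral_nonneg_eq_0_iff_AE[OF integrable_plane_square]) (auto intro!: AE_I2 less_imp_le[OF pos])
    then have "AE x in (lborel :: (real ^ 2) measure). x \<notin> UNIV"
    proof eventually_elim
      case (elim x)
      then show ?case using pos[of x] by linarith
    qed
    then have "(UNIV :: (real ^ 2) set) \<in> null_sets lborel"
      by (subst AE_iff_null_sets) auto
    then show False by (auto simp: null_sets_def emeasure_lborel_UNIV)
  qed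
  ultimately show ?thesis by linarith
qed

text \<open>The radial function \<open>K\<^sub>0(\<omega> |x|)\<close>, a Green function of \<open>\<omega>\<^sup>2 - \<Delta>\<close> up to normalisation.
  Its gradient is \<open>- x / |x|\<^sup>2\<close> times the flux \<open>\<omega> |x| K\<^sub>1(\<omega> |x|)\<close>, which tends to \<open>1\<close> at the
  origin.\<close>
locale bessel_kernel =
  fixes om :: complex
  assumes Re_om: "Re om > 0"
begin

lemma om_nonzero: "cmod om > 0"
  using Re_om complex_Re_le_cmod[of om] by linarith

lemma Re_om_r: "r > 0 \<Longrightarrow> Re (om * of_real r) > 0"
  using Re_om by simp

definition green where "green (x::real ^ 2) = cosh_moment 0 (om * of_real (norm x))"
definition flux where "flux (x::real ^ 2) = bessel_wK1 (om * of_real (norm x))"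
definition grad where "grad i (x::real ^ 2) = of_real (x $ i) * (- flux x / of_real ((norm x)\<^sup>2))"

lemma measurable_green [measurable]:
  "green \<in> borel_measurable borel" "flux \<in> borel_measurable borel" "grad i \<in> borel_measurable borel"
  unfolding green_def flux_def grad_def by measurable

lemma norm_green_le:
  assumes "x \<noteq> 0"
  shows "cmod (green x) \<le> 3 / sqrt (cmod om) * ((1 + 1 / norm x) * exp (- Re om * norm x))"
proof -
  have r: "norm x > 0" using assms by simp
  have "cmod (green x) \<le> 3 / sqrt (cmod (om * of_real (norm x))) * exp (- Re (om * of_real (norm x)))"
    unfolding green_def by (intro norm_cosh_moment_0 Re_om_r r)
  also have "\<dots> = 3 / sqrt (cmod om) * (1 / sqrt (norm x) * exp (- Re om * norm x))"
    by (simp add: norm_mult real_sqrt_mult)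
  also have "\<dots> \<le> 3 / sqrt (cmod om) * ((1 + 1 / norm x) * exp (- Re om * norm x))"
    by (intro mult_left_mono mult_right_mono inverse_sqrt_le r) auto
  finally show ?thesis .
qed

lemma norm_flux_le:
  assumes "x \<noteq> 0" shows "cmod (flux x) \<le> (1 + cmod om * norm x) * exp (- Re om * norm x)"
  using norm_bessel_wK1[OF Re_om_r, of "norm x"] assms by (simp add: flux_def norm_mult)

lemma norm_flux_bounded: 
  assumes "x \<noteq> 0" shows "cmod (flux x) \<le> 1 + cmod om / Re om"
proof -
  let ?r = "norm x"
  have "Re om * ?r \<le> exp (Re om * ?r)" using exp_ge_add_one_self[of "Re om * ?r"] by linarith
  then have "Re om * ?r * exp (- Re om * ?r) \<le> exp (Re om * ?r) * exp (- Re om * ?r)"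
    by (intro mult_right_mono) auto
  also have "\<dots> = 1" by (simp flip: exp_add)
  finally have 1: "?r * exp (- Re om * ?r) \<le> 1 / Re om" using Re_om by (simp add: field_simps)
  have 2: "exp (- Re om * ?r) \<le> 1" using Re_om by simp
  have "(1 + cmod om * ?r) * exp (- Re om * ?r) = exp (- Re om * ?r) + cmod om * (?r * exp (- Re om * ?r))"
    by (simp add: algebra_simps)
  also have "\<dots> \<le> 1 + cmod om * (1 / Re om)" by (intro add_mono mult_left_mono 1 2) auto
  finally show ?thesis using norm_flux_le[OF assms] by simp
qed

lemma norm_flux_over_r:
  assumes "x \<noteq> 0"
  shows "cmod (flux x) / norm x \<le> (1 + cmod om) * ((1 + 1 / norm x) * exp (- Re om * norm x))"
proof -
  let ?r = "norm x"
  have r: "?r > 0" using assms by simp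
  have "cmod (flux x) / ?r \<le> ((1 + cmod om * ?r) * exp (- Re om * ?r)) / ?r"
    by (intro divide_right_mono norm_flux_le assms) auto
  also have "\<dots> = (1 / ?r + cmod om) * exp (- Re om * ?r)"
  proof -
    have "((1 + y * r) * E) / r = (1 / r + y) * E" if "r > 0" for y r E :: real
      using that by (simp add: field_simps)
    from this[OF r] show ?thesis .
  qed
  also have "\<dots> \<le> ((1 + cmod om) * (1 + 1 / ?r)) * exp (- Re om * ?r)"
  proof (intro mult_right_mono)
    have "(1 + cmod om) * (1 + 1 / ?r) = (1 / ?r + cmod om) + (1 + cmod om * (1 / ?r))"
      by (simp add: algebra_simps add_divide_distrib)
    moreover have "1 + cmod om * (1 / ?r) \<ge> 0" by simp
    ultimately show "1 / ?r + cmod om \<le> (1 + cmod om) * (1 + 1 / ?r)" by linarith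
  qed auto
  finally show ?thesis by (simp only: mult.assoc)
qed

lemma norm_grad_le:
  assumes "x \<noteq> 0"
  shows "cmod (grad i x) \<le> cmod (flux x) / norm x"
proof -
  have r: "norm x > 0" using assms by simp
  have "cmod (grad i x) = \<bar>x $ i\<bar> * (cmod (flux x) / (norm x)\<^sup>2)"
    by (simp add: grad_def norm_mult norm_divide norm_power)
  also have "\<dots> \<le> norm x * (cmod (flux x) / (norm x)\<^sup>2)"
    by (intro mult_right_mono abs_nth_le_norm) auto
  finally show ?thesis using r by (simp add: power2_eq_square)
qed

lemma integrable_green: "integrable lborel green"
  by (rule integrable_of_exp_bound[OF _ Re_om norm_green_le]) auto

lemma integrable_grad: "integrable lborel (grad i)"
  by (rule integrable_of_exp_bound[OF _ Re_om order_trans[OF norm_grad_le norm_flux_over_r]]) auto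

lemma green_has_partial:
  assumes "x \<noteq> 0" shows "((\<lambda>s. green (x + s *\<^sub>R axis i 1)) has_vector_derivative grad i x) (at 0)"
proof -
  have r: "norm x > 0" using assms by simp
  have "((\<lambda>s. green (x + s *\<^sub>R axis i 1)) has_vector_derivative
      of_real (x $ i / norm x) * (- bessel_wK1 (om * of_real (norm x)) / of_real (norm x))) (at 0)"
    unfolding green_def by (rule radial_has_partial[OF assms cosh_moment_0_radial_derivative[OF Re_om r]])
  then show ?thesis by (simp add: grad_def flux_def power2_eq_square)
qed

text \<open>The second derivatives of the Green function are not integrable at the origin. Multiplying
  the gradient by \<open>|x|\<^sup>2 / (|x|\<^sup>2 + e\<^sup>2)\<close> makes its derivatives integrable; the second definition
  is the diagonal of the resulting Hessian.\<close>
definition cut_grad where "cut_grad e i (x::real ^ 2) = of_real (x $ i) * (- flux x / of_real ((norm x)\<^sup>2 + e\<^sup>2))"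
definition cut_hess where "cut_hess e i (x::real ^ 2) = - flux x / of_real ((norm x)\<^sup>2 + e\<^sup>2)
   + of_real (x $ i * x $ i) * (om\<^sup>2 * green x / of_real ((norm x)\<^sup>2 + e\<^sup>2) + 2 * flux x / of_real (((norm x)\<^sup>2 + e\<^sup>2)\<^sup>2))"

lemma measurable_cut [measurable]: "cut_grad e i \<in> borel_measurable borel" "cut_hess e i \<in> borel_measurable borel"
  unfolding cut_grad_def cut_hess_def by measurable

lemma norm_cut_grad_le: "cmod (cut_grad e i x) \<le> cmod (grad i x)"
proof (cases "x = 0")
  case False
  then show ?thesis
    unfolding cut_grad_def grad_def norm_mult norm_divide norm_of_real
    by (intro mult_left_mono divide_left_mono mult_pos_pos) (auto intro: add_pos_nonneg)
qed (simp add: cut_grad_def)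

lemma cut_grad_has_partial:
  assumes "x \<noteq> 0" shows "((\<lambda>s. cut_grad e i (x + s *\<^sub>R axis i 1)) has_vector_derivative cut_hess e i x) (at 0)"
proof -
  let ?r = "norm x"
  have r: "?r > 0" using assms by simp
  then have re: "?r\<^sup>2 + e\<^sup>2 > 0" by (intro add_pos_nonneg) auto
  have D: "((\<lambda>r. 1 / (r\<^sup>2 + e\<^sup>2)) has_real_derivative - (2 * ?r) / (?r\<^sup>2 + e\<^sup>2)\<^sup>2) (at ?r)"
    using re by (auto intro!: derivative_eq_intros simp: power2_eq_square)
  have "((\<lambda>r. of_real (1 / (r\<^sup>2 + e\<^sup>2)) :: complex) has_vector_derivative of_real (- (2 * ?r) / (?r\<^sup>2 + e\<^sup>2)\<^sup>2)) (at ?r)"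
    by (rule has_vector_derivative_of_real[OF D])
  from has_vector_derivative_mult[OF has_vector_derivative_minus[OF bessel_wK1_radial_derivative[OF Re_om r]] this]
  have "((\<lambda>r. - bessel_wK1 (om * of_real r) * of_real (1 / (r\<^sup>2 + e\<^sup>2))) has_vector_derivative
     - flux x * of_real (- (2 * ?r) / (?r\<^sup>2 + e\<^sup>2)\<^sup>2) + om\<^sup>2 * of_real ?r * green x * of_real (1 / (?r\<^sup>2 + e\<^sup>2))) (at ?r)"
    by (simp add: flux_def green_def)
  from nth_radial_has_partial[OF assms this, of i i]
  have D: "((\<lambda>s. cut_grad e i (x + s *\<^sub>R axis i 1)) has_vector_derivative - flux x * of_real (1 / (?r\<^sup>2 + e\<^sup>2)) +
      of_real (x $ i * x $ i / ?r) * (- flux x * of_real (- (2 * ?r) / (?r\<^sup>2 + e\<^sup>2)\<^sup>2) + om\<^sup>2 * of_real ?r * green x * of_real (1 / (?r\<^sup>2 + e\<^sup>2)))) (at 0)"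
    by (simp add: cut_grad_def flux_def)
  define E where "E = ?r\<^sup>2 + e\<^sup>2"
  define Y where "Y = om\<^sup>2 * green x / of_real E + 2 * flux x / of_real (E\<^sup>2)"
  have "- flux x * of_real (- (2 * ?r) / E\<^sup>2) + om\<^sup>2 * of_real ?r * green x * of_real (1 / E) = of_real ?r * Y"
    by (simp add: Y_def algebra_simps)
  moreover have "of_real (x $ i * x $ i / ?r) * (of_real ?r * Y) = of_real (x $ i * x $ i) * Y"
    using r by simp
  ultimately have "- flux x * of_real (1 / E) +
      of_real (x $ i * x $ i / ?r) * (- flux x * of_real (- (2 * ?r) / E\<^sup>2) + om\<^sup>2 * of_real ?r * green x * of_real (1 / E)) =
     - flux x / of_real E + of_real (x $ i * x $ i) * Y"
    by simp
  with D show ?thesis unfolding cut_hess_def E_def Y_def by simp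
qed

lemma norm_cut_hess_le:
  assumes "x \<noteq> 0" "e > 0"
  shows "cmod (cut_hess e i x) \<le> (3 * (1 + cmod om) / e + (cmod om)\<^sup>2 * (3 / sqrt (cmod om))) * ((1 + 1 / norm x) * exp (- Re om * norm x))"
proof -
  let ?r = "norm x"
  let ?M = "(1 + 1 / ?r) * exp (- Re om * ?r)"
  define E where "E = ?r\<^sup>2 + e\<^sup>2"
  have r: "?r > 0" using assms by simp
  have E: "E > 0" unfolding E_def using assms by (intro add_pos_pos) auto
  have xi: "\<bar>x $ i * x $ i\<bar> \<le> E"
  proof -
    have "\<bar>x $ i\<bar> * \<bar>x $ i\<bar> \<le> ?r * ?r" by (intro mult_mono abs_nth_le_norm) auto
    then show ?thesis by (simp add: E_def abs_mult power2_eq_square add_increasing2)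
  qed
  have rE: "?r * e \<le> E"
  proof -
    have "?r * e \<ge> 0" using r assms by (intro mult_nonneg_nonneg) auto
    moreover have "2 * (?r * e) \<le> E" using sum_squares_bound[of ?r e] unfolding E_def mult.assoc .
    ultimately show ?thesis by linarith
  qed
  have qE: "cmod (flux x) / E \<le> (1 + cmod om) / e * ?M"
  proof -
    have "cmod (flux x) / E \<le> cmod (flux x) / (?r * e)"
      using r assms E by (intro divide_left_mono rE mult_pos_pos) auto
    also have "\<dots> = (cmod (flux x) / ?r) / e" by simp
    also have "\<dots> \<le> ((1 + cmod om) * ?M) / e"
      using assms by (intro divide_right_mono norm_flux_over_r) auto
    finally show ?thesis by simp
  qed
  have "cmod (cut_hess e i x) \<le> cmod (flux x) / E + \<bar>x $ i * x $ i\<bar> * ((cmod om)\<^sup>2 * cmod (green x) / E + 2 * cmod (flux x) / E\<^sup>2)"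
  proof -
    have "cmod (cut_hess e i x) \<le> cmod (- flux x / of_real E) + cmod (of_real (x $ i * x $ i) * (om\<^sup>2 * green x / of_real E + 2 * flux x / of_real (E\<^sup>2)))"
      unfolding cut_hess_def E_def by (rule norm_triangle_ineq)
    also have "cmod (- flux x / of_real E) = cmod (flux x) / E" using E by (simp add: norm_divide)
    also have "cmod (of_real (x $ i * x $ i) * (om\<^sup>2 * green x / of_real E + 2 * flux x / of_real (E\<^sup>2)))
       \<le> \<bar>x $ i * x $ i\<bar> * (cmod (om\<^sup>2 * green x / of_real E) + cmod (2 * flux x / of_real (E\<^sup>2)))"
      unfolding norm_mult norm_of_real by (intro mult_left_mono norm_triangle_ineq) auto
    finally show ?thesis using E by (simp add: norm_divide norm_mult norm_power)
  qed
  also have "\<dots> \<le> cmod (flux x) / E + E * ((cmod om)\<^sup>2 * cmod (green x) / E + 2 * cmod (flux x) / E\<^sup>2)"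
    using E by (intro add_left_mono mult_right_mono xi) auto
  also have "\<dots> = 3 * (cmod (flux x) / E) + (cmod om)\<^sup>2 * cmod (green x)"
    using E by (simp add: field_simps power2_eq_square)
  also have "\<dots> \<le> 3 * ((1 + cmod om) / e * ?M) + (cmod om)\<^sup>2 * (3 / sqrt (cmod om) * ?M)"
    by (intro add_mono mult_left_mono qE norm_green_le assms) auto
  also have "\<dots> = (3 * (1 + cmod om) / e + (cmod om)\<^sup>2 * (3 / sqrt (cmod om))) * ?M"
  proof -
    have "3 * (p / e * M) + w * (z * M) = (3 * p / e + w * z) * M" for p e M w z :: real
      by (simp add: distrib_right)
    then show ?thesis .
  qed
  finally show ?thesis .
qed

lemma integrable_cut_grad: "integrable lborel (cut_grad e i)"
  by (rule Bochner_Integration.integrable_bound[OF integrable_grad[of i]]) (auto simp: norm_cut_grad_le)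

lemma integrable_cut_hess: "e > 0 \<Longrightarrow> integrable lborel (cut_hess e i)"
  by (rule integrable_of_exp_bound[OF _ Re_om norm_cut_hess_le]) auto

text \<open>Away from the origin Bessel's equation turns the divergence of the gradient into \<open>\<omega>\<^sup>2 K\<^sub>0\<close>.
  What the cutoff adds is the flux times \<open>2 e\<^sup>2 / (|x|\<^sup>2 + e\<^sup>2)\<^sup>2\<close>, an approximate delta function.\<close>
lemma cut_hess_trace:
  assumes "x \<noteq> 0"
  shows "cut_hess e 1 x + cut_hess e 2 x = om\<^sup>2 * (of_real ((norm x)\<^sup>2 / ((norm x)\<^sup>2 + e\<^sup>2)) * green x)
      - of_real (2 * e\<^sup>2 / ((norm x)\<^sup>2 + e\<^sup>2)\<^sup>2) * flux x"
proof -
  define E where "E = (norm x)\<^sup>2 + e\<^sup>2"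
  have E: "E > 0" unfolding E_def using assms by (intro add_pos_nonneg) auto
  have s: "x $ 1 * x $ 1 + x $ 2 * x $ 2 = (norm x)\<^sup>2"
    by (simp add: norm_eq_sqrt_inner inner_vec_def sum_2)
  define Y where "Y = om\<^sup>2 * green x / of_real E + 2 * flux x / (of_real E)\<^sup>2"
  have "cut_hess e 1 x + cut_hess e 2 x = - 2 * flux x / of_real E + of_real (x $ 1 * x $ 1 + x $ 2 * x $ 2) * Y"
  proof -
    have cut_hess_eq: "cut_hess e i x = - flux x / of_real E + of_real (x $ i * x $ i) * Y" for i
      by (simp add: cut_hess_def E_def Y_def)
    show ?thesis unfolding cut_hess_eq of_real_add by (simp add: algebra_simps)
  qed
  also have "\<dots> = - 2 * flux x / of_real E + (of_real E - of_real (e\<^sup>2)) * Y"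
    unfolding s by (simp add: E_def)
  also have "\<dots> = om\<^sup>2 * ((of_real E - of_real (e\<^sup>2)) / of_real E * green x) - 2 * of_real (e\<^sup>2) / (of_real E)\<^sup>2 * flux x"
  proof -
    have "- 2 * y / E + (E - d) * (w * z / E + 2 * y / E\<^sup>2) = w * ((E - d) / E * z) - 2 * d / E\<^sup>2 * y"
      if "E \<noteq> 0" for E d w y z :: complex
      using that by (simp add: field_simps power2_eq_square)
    then show ?thesis using E by (simp add: Y_def)
  qed
  finally show ?thesis by (simp add: E_def)
qed

text \<open>Under \<open>x = e y\<close> the weight becomes \<open>2 / (1 + |y|\<^sup>2)\<^sup>2\<close> while the flux and \<open>F\<close> tend to their
  values \<open>1\<close> and \<open>F 0\<close> at the origin.\<close>
lemma tendsto_cutoff_term: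
  assumes F: "F \<in> borel_measurable borel" "\<And>x. cmod (F x) \<le> B" "isCont F 0"
    and e: "\<And>n. e n > (0::real)" "e \<longlonglongrightarrow> 0"
  shows "(\<lambda>n. LINT x|lborel. of_real (2 * (e n)\<^sup>2 / ((norm x)\<^sup>2 + (e n)\<^sup>2)\<^sup>2) * flux x * F x)
    \<longlonglongrightarrow> of_real (LINT x|lborel. 2 / (1 + (norm (x::real ^ 2))\<^sup>2)\<^sup>2) * F 0"
proof -
  note [measurable] = F(1)
  let ?w = "\<lambda>x::real ^ 2. 2 / (1 + (norm x)\<^sup>2)\<^sup>2"
  have scaled: "(LINT x|lborel. of_real (2 * (e n)\<^sup>2 / ((norm x)\<^sup>2 + (e n)\<^sup>2)\<^sup>2) * flux x * F x)
     = (LINT x|lborel. of_real (?w x) * (flux (e n *\<^sub>R x) * F (e n *\<^sub>R x)))" for n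
  proof -
    have "(LINT x|lborel. of_real (2 * (e n)\<^sup>2 / ((norm x)\<^sup>2 + (e n)\<^sup>2)\<^sup>2) * flux x * F x)
      = (e n)\<^sup>2 *\<^sub>R (LINT x|lborel. of_real (2 * (e n)\<^sup>2 / ((norm (e n *\<^sub>R x))\<^sup>2 + (e n)\<^sup>2)\<^sup>2) * flux (e n *\<^sub>R x) * F (e n *\<^sub>R x))"
      by (rule integral_scale_plane[OF e(1)]) measurable
    also have "\<dots> = (LINT x|lborel. (e n)\<^sup>2 *\<^sub>R (of_real (2 * (e n)\<^sup>2 / ((norm (e n *\<^sub>R x))\<^sup>2 + (e n)\<^sup>2)\<^sup>2) * flux (e n *\<^sub>R x) * F (e n *\<^sub>R x)))"
      by simp
    also have "(\<lambda>x. (e n)\<^sup>2 *\<^sub>R (of_real (2 * (e n)\<^sup>2 / ((norm (e n *\<^sub>R x))\<^sup>2 + (e n)\<^sup>2)\<^sup>2) * flux (e n *\<^sub>R x) * F (e n *\<^sub>R x)))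
       = (\<lambda>x. of_real (?w x) * (flux (e n *\<^sub>R x) * F (e n *\<^sub>R x)))"
    proof
      fix x :: "real ^ 2"
      have "(norm (e n *\<^sub>R x))\<^sup>2 + (e n)\<^sup>2 = (e n)\<^sup>2 * (1 + (norm x)\<^sup>2)"
        by (simp add: power_mult_distrib algebra_simps)
      then have "(e n)\<^sup>2 * (2 * (e n)\<^sup>2 / ((norm (e n *\<^sub>R x))\<^sup>2 + (e n)\<^sup>2)\<^sup>2) = ?w x"
        using e(1)[of n] by (simp add: power_mult_distrib power2_eq_square)
      then show "(e n)\<^sup>2 *\<^sub>R (of_real (2 * (e n)\<^sup>2 / ((norm (e n *\<^sub>R x))\<^sup>2 + (e n)\<^sup>2)\<^sup>2) * flux (e n *\<^sub>R x) * F (e n *\<^sub>R x))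
       = of_real (?w x) * (flux (e n *\<^sub>R x) * F (e n *\<^sub>R x))"
        unfolding scaleR_conv_of_real by (metis (no_types, lifting) mult.assoc of_real_mult)
    qed
    finally show ?thesis .
  qed
  define M where "M = (1 + cmod om / Re om) * B"
  have "(\<lambda>n. LINT x|lborel. of_real (?w x) * (flux (e n *\<^sub>R x) * F (e n *\<^sub>R x)))
     \<longlonglongrightarrow> (LINT x|lborel. of_real (?w x) * (1 * F 0))"
  proof (rule integral_dominated_convergence[where w = "\<lambda>x. M * ?w x"])
    show "integrable lborel (\<lambda>x::real ^ 2. M * ?w x)"
      by (intro integrable_mult_right integrable_plane_square)
    show "AE x in lborel. (\<lambda>n. of_real (?w x) * (flux (e n *\<^sub>R x) * F (e n *\<^sub>R x))) \<longlonglongrightarrow> of_real (?w x) * (1 * F 0)"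
      using AE_lborel_singleton[of "0 :: real ^ 2"]
    proof eventually_elim
      case (elim x)
      then have nx: "norm x > 0" by simp
      have "(\<lambda>n. e n * norm x) \<longlonglongrightarrow> 0" using e(2) by (auto intro!: tendsto_eq_intros)
      then have "filterlim (\<lambda>n. e n * norm x) (at_right 0) sequentially"
        using e(1) nx less_imp_neq[OF e(1)] by (auto simp: filterlim_at)
      from filterlim_compose[OF tendsto_bessel_wK1_0[OF Re_om] this]
      have ql: "(\<lambda>n. flux (e n *\<^sub>R x)) \<longlonglongrightarrow> 1"
        using e(1) by (simp add: flux_def abs_of_pos)
      have "(\<lambda>n. e n *\<^sub>R x) \<longlonglongrightarrow> 0" using e(2) by (auto intro!: tendsto_eq_intros)
      then have "(\<lambda>n. F (e n *\<^sub>R x)) \<longlonglongrightarrow> F 0"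
        by (rule isCont_tendsto_compose[OF F(3)])
      with ql show ?case by (intro tendsto_intros)
    qed
    show "AE x in lborel. norm (of_real (?w x) * (flux (e n *\<^sub>R x) * F (e n *\<^sub>R x))) \<le> M * ?w x" for n
      using AE_lborel_singleton[of "0 :: real ^ 2"]
    proof eventually_elim
      case (elim x)
      have "B \<ge> 0" using F(2)[of 0] norm_ge_zero order_trans by blast
      then have "cmod (flux (e n *\<^sub>R x)) * cmod (F (e n *\<^sub>R x)) \<le> M"
        unfolding M_def using e(1)[of n] elim by (intro mult_mono norm_flux_bounded F) (auto intro: order_trans[OF norm_ge_zero norm_flux_bounded[OF elim]])
      then have "?w x * (cmod (flux (e n *\<^sub>R x)) * cmod (F (e n *\<^sub>R x))) \<le> ?w x * M"
        by (intro mult_left_mono) auto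
      then show ?case by (simp add: norm_mult norm_divide norm_power mult.commute del: of_real_divide of_real_power)
    qed
  qed measurable
  moreover have "(LINT x|lborel. of_real (?w x) * (1 * F 0)) = of_real (LINT x|lborel. ?w x) * F 0"
    unfolding integral_mult_left_zero integral_complex_of_real by simp
  ultimately show ?thesis unfolding scaled by (simp only:)
qed

text \<open>The identity \<open>(\<omega>\<^sup>2 - \<Delta>) K\<^sub>0(\<omega> |x|) = c \<delta>\<^sub>0\<close>. The first integration by parts needs no
  cutoff, since the gradient is integrable; the second is performed with the cut off gradient,
  and the limit of its divergence produces the point mass. The function \<open>F\<close> is bounded with
  bounded derivatives, as are the correlations of square integrable functions with bumps.\<close>
theorem bessel_fundamental_solution:
  fixes F :: "real ^ 2 \<Rightarrow> complex" and G H :: "2 \<Rightarrow> real ^ 2 \<Rightarrow> complex"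
  assumes meas: "F \<in> borel_measurable borel" "\<And>i. G i \<in> borel_measurable borel" "\<And>i. H i \<in> borel_measurable borel"
    and bnd: "\<And>x. cmod (F x) \<le> B" "\<And>i x. cmod (G i x) \<le> B" "\<And>i x. cmod (H i x) \<le> B"
    and dF: "\<And>i x. ((\<lambda>s. F (x + s *\<^sub>R axis i 1)) has_vector_derivative G i x) (at 0)"
    and dG: "\<And>i x. ((\<lambda>s. G i (x + s *\<^sub>R axis i 1)) has_vector_derivative H i x) (at 0)"
    and cont: "isCont F 0"
  shows "(LINT x|lborel. green x * (om\<^sup>2 * F x - (H 1 x + H 2 x)))
     = of_real kernel_mass * F 0"
proof -
  note [measurable] = meas
  let ?K = "of_real kernel_mass :: complex"
  define e where "e = (\<lambda>n. 1 / real (Suc n))"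
  have e: "e n > 0" for n by (simp add: e_def)
  have e0: "e \<longlonglongrightarrow> 0" unfolding e_def by real_asymp
  have nz: "x \<noteq> 0" if "x $ j \<noteq> 0" for x :: "real ^ 2" and j using that by auto
  have step1: "(LINT x|lborel. green x * H i x) = - (LINT x|lborel. grad i x * G i x)" for i
    by (rule integral_by_parts_partial[where i = i and B = B])
       (use meas bnd dG nz green_has_partial integrable_green integrable_grad in auto)
  have step2: "(LINT x|lborel. cut_grad (e n) i x * G i x) = - (LINT x|lborel. cut_hess (e n) i x * F x)" for i n
    by (rule integral_by_parts_partial[where i = i and B = B])
       (use meas bnd dF nz cut_grad_has_partial integrable_cut_grad integrable_cut_hess[OF e] in auto)
  have lim1: "(\<lambda>n. LINT x|lborel. cut_grad (e n) i x * G i x) \<longlonglongrightarrow> (LINT x|lborel. grad i x * G i x)" for i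
  proof (rule integral_dominated_convergence[where w = "\<lambda>x. cmod (grad i x * G i x)"])
    show "integrable lborel (\<lambda>x. cmod (grad i x * G i x))"
      by (intro integrable_norm integrable_mult_bounded[OF integrable_grad meas(2) bnd(2)])
    show "AE x in lborel. (\<lambda>n. cut_grad (e n) i x * G i x) \<longlonglongrightarrow> grad i x * G i x"
      using AE_lborel_singleton[of 0]
    proof eventually_elim
      case (elim x)
      have "(\<lambda>n. (norm x)\<^sup>2 + (e n)\<^sup>2) \<longlonglongrightarrow> (norm x)\<^sup>2 + 0\<^sup>2" by (intro tendsto_intros e0)
      then have "(\<lambda>n. of_real (x $ i) * (- flux x / of_real ((norm x)\<^sup>2 + (e n)\<^sup>2)))
         \<longlonglongrightarrow> of_real (x $ i) * (- flux x / of_real ((norm x)\<^sup>2 + 0\<^sup>2))"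
        using elim by (intro tendsto_intros e0) auto
      from tendsto_mult[OF this tendsto_const[of "G i x"]] show ?case by (simp add: grad_def cut_grad_def)
    qed
    show "AE x in lborel. norm (cut_grad (e n) i x * G i x) \<le> cmod (grad i x * G i x)" for n
      unfolding norm_mult by (intro AE_I2 mult_right_mono norm_cut_grad_le) auto
  qed measurable
  have cut_le: "cmod (of_real ((norm x)\<^sup>2 / ((norm x)\<^sup>2 + (e n)\<^sup>2)) * green x * F x) \<le> cmod (green x * F x)" for n x
  proof -
    have "(norm x)\<^sup>2 / ((norm x)\<^sup>2 + (e n)\<^sup>2) \<le> 1" by (intro divide_le_eq_1_pos[THEN iffD2] add_nonneg_pos) (use e[of n] in auto)
    then have "\<bar>(norm x)\<^sup>2 / ((norm x)\<^sup>2 + (e n)\<^sup>2)\<bar> * cmod (green x * F x) \<le> 1 * cmod (green x * F x)"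
      by (intro mult_right_mono) auto
    then show ?thesis unfolding mult.assoc norm_mult[of "of_real _"] norm_of_real by simp
  qed
  have lim2: "(\<lambda>n. LINT x|lborel. of_real ((norm x)\<^sup>2 / ((norm x)\<^sup>2 + (e n)\<^sup>2)) * green x * F x) \<longlonglongrightarrow> (LINT x|lborel. green x * F x)"
  proof (rule integral_dominated_convergence[where w = "\<lambda>x. cmod (green x * F x)"])
    show "integrable lborel (\<lambda>x. cmod (green x * F x))"
      by (intro integrable_norm integrable_mult_bounded[OF integrable_green meas(1) bnd(1)])
    show "AE x in lborel. (\<lambda>n. of_real ((norm x)\<^sup>2 / ((norm x)\<^sup>2 + (e n)\<^sup>2)) * green x * F x) \<longlonglongrightarrow> green x * F x"
      using AE_lborel_singleton[of 0]
    proof eventually_elim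
      case (elim x)
      have "(\<lambda>n. (norm x)\<^sup>2 / ((norm x)\<^sup>2 + (e n)\<^sup>2)) \<longlonglongrightarrow> (norm x)\<^sup>2 / ((norm x)\<^sup>2 + 0\<^sup>2)"
        using elim by (intro tendsto_intros e0) auto
      then have "(\<lambda>n. (norm x)\<^sup>2 / ((norm x)\<^sup>2 + (e n)\<^sup>2)) \<longlonglongrightarrow> 1" using elim by simp
      then have "(\<lambda>n. of_real ((norm x)\<^sup>2 / ((norm x)\<^sup>2 + (e n)\<^sup>2)) * green x * F x) \<longlonglongrightarrow> of_real 1 * green x * F x"
        by (intro tendsto_intros)
      then show ?case by simp
    qed
    show "AE x in lborel. norm (of_real ((norm x)\<^sup>2 / ((norm x)\<^sup>2 + (e n)\<^sup>2)) * green x * F x) \<le> cmod (green x * F x)" for n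
      by (intro AE_I2 cut_le)
  qed measurable
  let ?X = "\<lambda>n. LINT x|lborel. of_real ((norm x)\<^sup>2 / ((norm x)\<^sup>2 + (e n)\<^sup>2)) * green x * F x"
  let ?Y = "\<lambda>n. LINT x|lborel. of_real (2 * (e n)\<^sup>2 / ((norm x)\<^sup>2 + (e n)\<^sup>2)\<^sup>2) * flux x * F x"
  have sum_c: "(LINT x|lborel. cut_grad (e n) 1 x * G 1 x) + (LINT x|lborel. cut_grad (e n) 2 x * G 2 x) = - om\<^sup>2 * ?X n + ?Y n" for n
  proof -
    have ic: "integrable lborel (\<lambda>x. cut_hess (e n) i x * F x)" for i
      by (rule integrable_mult_bounded[OF integrable_cut_hess[OF e] meas(1) bnd(1)])
    have iX: "integrable lborel (\<lambda>x. of_real ((norm x)\<^sup>2 / ((norm x)\<^sup>2 + (e n)\<^sup>2)) * green x * F x)"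
    proof (rule Bochner_Integration.integrable_bound[OF integrable_mult_bounded[OF integrable_green meas(1) bnd(1)]])
      show "AE x in lborel. norm (of_real ((norm x)\<^sup>2 / ((norm x)\<^sup>2 + (e n)\<^sup>2)) * green x * F x) \<le> norm (green x * F x)"
        by (intro AE_I2 cut_le)
    qed measurable
    have AEeq: "AE x in lborel. cut_hess (e n) 1 x * F x + cut_hess (e n) 2 x * F x
        = om\<^sup>2 * (of_real ((norm x)\<^sup>2 / ((norm x)\<^sup>2 + (e n)\<^sup>2)) * green x * F x) - of_real (2 * (e n)\<^sup>2 / ((norm x)\<^sup>2 + (e n)\<^sup>2)\<^sup>2) * flux x * F x"
      using AE_lborel_singleton[of 0]
    proof eventually_elim
      case (elim x)
      show ?case using arg_cong[OF cut_hess_trace[OF elim, of "e n"], of "\<lambda>z. z * F x"] by (simp only: ring_distribs mult.assoc left_diff_distrib)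
    qed
    have iY: "integrable lborel (\<lambda>x. of_real (2 * (e n)\<^sup>2 / ((norm x)\<^sup>2 + (e n)\<^sup>2)\<^sup>2) * flux x * F x)"
    proof (rule integrable_cong_AE_imp)
      show "integrable lborel (\<lambda>x. om\<^sup>2 * (of_real ((norm x)\<^sup>2 / ((norm x)\<^sup>2 + (e n)\<^sup>2)) * green x * F x) - (cut_hess (e n) 1 x * F x + cut_hess (e n) 2 x * F x))"
        by (intro Bochner_Integration.integrable_diff Bochner_Integration.integrable_add integrable_mult_right iX ic)
      show "AE x in lborel. om\<^sup>2 * (of_real ((norm x)\<^sup>2 / ((norm x)\<^sup>2 + (e n)\<^sup>2)) * green x * F x) - (cut_hess (e n) 1 x * F x + cut_hess (e n) 2 x * F x)
         = of_real (2 * (e n)\<^sup>2 / ((norm x)\<^sup>2 + (e n)\<^sup>2)\<^sup>2) * flux x * F x"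
        using AEeq by eventually_elim (simp only: diff_diff_eq2 add_diff_cancel_left')
    qed measurable
    have "(LINT x|lborel. cut_hess (e n) 1 x * F x) + (LINT x|lborel. cut_hess (e n) 2 x * F x) = (LINT x|lborel. cut_hess (e n) 1 x * F x + cut_hess (e n) 2 x * F x)"
      by (rule Bochner_Integration.integral_add[symmetric]) (rule ic)+
    also have "\<dots> = (LINT x|lborel. om\<^sup>2 * (of_real ((norm x)\<^sup>2 / ((norm x)\<^sup>2 + (e n)\<^sup>2)) * green x * F x) - of_real (2 * (e n)\<^sup>2 / ((norm x)\<^sup>2 + (e n)\<^sup>2)\<^sup>2) * flux x * F x)"
      by (rule integral_cong_AE[OF _ _ AEeq]) measurable
    also have "\<dots> = om\<^sup>2 * ?X n - ?Y n"
      by (subst Bochner_Integration.integral_diff[OF integrable_mult_right[OF iX] iY], subst integral_mult_right_zero, rule refl)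
    finally have "(LINT x|lborel. cut_hess (e n) 1 x * F x) + (LINT x|lborel. cut_hess (e n) 2 x * F x) = om\<^sup>2 * ?X n - ?Y n" .
    then show ?thesis unfolding step2 by (simp add: algebra_simps)
  qed
  have "(\<lambda>n. (LINT x|lborel. cut_grad (e n) 1 x * G 1 x) + (LINT x|lborel. cut_grad (e n) 2 x * G 2 x))
     \<longlonglongrightarrow> - om\<^sup>2 * (LINT x|lborel. green x * F x) + ?K * F 0"
    unfolding sum_c by (intro tendsto_intros lim2 tendsto_cutoff_term[folded kernel_mass_def, OF meas(1) bnd(1) cont e e0])
  moreover have "(\<lambda>n. (LINT x|lborel. cut_grad (e n) 1 x * G 1 x) + (LINT x|lborel. cut_grad (e n) 2 x * G 2 x))
     \<longlonglongrightarrow> (LINT x|lborel. grad 1 x * G 1 x) + (LINT x|lborel. grad 2 x * G 2 x)"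
    by (intro tendsto_intros lim1)
  ultimately have bG: "(LINT x|lborel. grad 1 x * G 1 x) + (LINT x|lborel. grad 2 x * G 2 x) = - om\<^sup>2 * (LINT x|lborel. green x * F x) + ?K * F 0"
    by (rule LIMSEQ_unique[rotated])
  have iaF: "integrable lborel (\<lambda>x. green x * F x)" by (rule integrable_mult_bounded[OF integrable_green meas(1) bnd(1)])
  have iaH: "integrable lborel (\<lambda>x. green x * H i x)" for i by (rule integrable_mult_bounded[OF integrable_green meas(3) bnd(3)])
  have "(\<lambda>x. green x * (om\<^sup>2 * F x - (H 1 x + H 2 x))) = (\<lambda>x. om\<^sup>2 * (green x * F x) - (green x * H 1 x + green x * H 2 x))"
    by (simp add: fun_eq_iff algebra_simps)
  then have "(LINT x|lborel. green x * (om\<^sup>2 * F x - (H 1 x + H 2 x)))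
     = om\<^sup>2 * (LINT x|lborel. green x * F x) - ((LINT x|lborel. green x * H 1 x) + (LINT x|lborel. green x * H 2 x))"
    using iaF iaH by (simp add: Bochner_Integration.integral_add Bochner_Integration.integral_diff)
  also have "\<dots> = om\<^sup>2 * (LINT x|lborel. green x * F x) + ((LINT x|lborel. grad 1 x * G 1 x) + (LINT x|lborel. grad 2 x * G 2 x))"
    unfolding step1 by simp
  also have "\<dots> = ?K * F 0" unfolding bG by simp
  finally show ?thesis .
qed

end

section \<open>The difference of two Green functions\<close>

text \<open>Two parameters of the same modulus \<open>\<rho>\<^sub>0\<close>, with a common lower bound \<open>\<alpha>\<close> on their real
  parts. Equal moduli are what makes the singularities of the two Green functions cancel.\<close>
locale bessel_pair =
  fixes om1 om2 :: complex and \<rho>0 \<alpha> :: real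
  assumes Re_om: "Re om1 > 0" "Re om2 > 0" and norm_om: "cmod om1 = \<rho>0" "cmod om2 = \<rho>0"
    and alpha: "\<alpha> > 0" "\<alpha> \<le> Re om1" "\<alpha> \<le> Re om2"
begin

sublocale k1: bessel_kernel om1 by unfold_locales (rule Re_om)
sublocale k2: bessel_kernel om2 by unfold_locales (rule Re_om)

lemma \<rho>0_pos: "\<rho>0 > 0" using k1.om_nonzero norm_om by simp

definition green_diff where "green_diff x = k1.green x - k2.green x"
definition grad_diff where "grad_diff i x = k1.grad i x - k2.grad i x"
text \<open>With \<open>Q = \<omega>\<^sub>1\<^sup>2 K\<^sub>2(\<omega>\<^sub>1 r) - \<omega>\<^sub>2\<^sup>2 K\<^sub>2(\<omega>\<^sub>2 r)\<close> the Hessian of a difference of Green functions is a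
  multiple of the identity plus \<open>Q x\<^sub>i x\<^sub>j / |x|\<^sup>2\<close>.\<close>
definition radial_hess where
  "radial_hess (x::real ^ 2) = (bessel_w2K2 (om1 * of_real (norm x)) - bessel_w2K2 (om2 * of_real (norm x))) / of_real ((norm x)\<^sup>2)"
definition hess_diff where "hess_diff i j (x::real ^ 2) = (if i = j then - (k1.flux x - k2.flux x) / of_real ((norm x)\<^sup>2) else 0)
    + of_real (x $ i * x $ j / (norm x)\<^sup>2) * radial_hess x"

lemma measurable_pair [measurable]: "green_diff \<in> borel_measurable borel" "grad_diff i \<in> borel_measurable borel"
  "radial_hess \<in> borel_measurable borel" "hess_diff i j \<in> borel_measurable borel"
proof -
  show "green_diff \<in> borel_measurable borel" "grad_diff i \<in> borel_measurable borel" unfolding green_diff_def grad_diff_def by measurable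
  show [measurable]: "radial_hess \<in> borel_measurable borel" unfolding radial_hess_def by measurable
  show "hess_diff i j \<in> borel_measurable borel" unfolding hess_diff_def by (cases "i = j") (simp_all, measurable)
qed

lemma norm_green_diff_le: "x \<noteq> 0 \<Longrightarrow> cmod (green_diff x) \<le> 6 * decay \<rho>0 \<alpha> (norm x)"
  unfolding green_diff_def k1.green_def k2.green_def using Re_om norm_om alpha
  by (intro norm_cosh_moment_0_diff_le_decay) auto

lemma norm_radial_hess_le: assumes "x \<noteq> 0" shows "cmod (radial_hess x) \<le> 14 * \<rho>0\<^sup>2 * decay \<rho>0 \<alpha> (norm x)"
proof -
  have r: "norm x > 0" using assms by simp
  have "cmod (bessel_w2K2 (om1 * of_real (norm x)) - bessel_w2K2 (om2 * of_real (norm x))) \<le> 14 * (\<rho>0 * norm x)\<^sup>2 * decay \<rho>0 \<alpha> (norm x)"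
    using Re_om norm_om alpha r by (intro norm_bessel_w2K2_diff_le_decay) auto
  also have "\<dots> = (14 * \<rho>0\<^sup>2 * decay \<rho>0 \<alpha> (norm x)) * (norm x)\<^sup>2" by (simp add: power_mult_distrib)
  finally show ?thesis unfolding radial_hess_def norm_divide using r by (simp add: norm_power pos_divide_le_eq)
qed

lemma decay_le_exp:
  assumes "r > 0" shows "decay \<rho>0 \<alpha> r \<le> 1 / sqrt \<rho>0 * ((1 + 1 / r) * exp (- \<alpha> * r))"
proof -
  have "decay \<rho>0 \<alpha> r \<le> 1 / sqrt \<rho>0 * (1 / sqrt r * exp (- \<alpha> * r))"
    by (simp add: decay_def real_sqrt_mult)
  also have "\<dots> \<le> 1 / sqrt \<rho>0 * ((1 + 1 / r) * exp (- \<alpha> * r))"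
    using \<rho>0_pos by (intro mult_left_mono mult_right_mono inverse_sqrt_le assms) auto
  finally show ?thesis .
qed

lemma integrable_green_diff: "integrable lborel green_diff"
  unfolding green_diff_def by (intro Bochner_Integration.integrable_diff k1.integrable_green k2.integrable_green)

lemma integrable_grad_diff: "integrable lborel (grad_diff i)"
  unfolding grad_diff_def by (intro Bochner_Integration.integrable_diff k1.integrable_grad k2.integrable_grad)

lemma integrable_radial_hess: "integrable lborel radial_hess"
proof (rule integrable_of_exp_bound[OF _ alpha(1)])
  fix x :: "real ^ 2" assume x: "x \<noteq> 0"
  have "cmod (radial_hess x) \<le> 14 * \<rho>0\<^sup>2 * decay \<rho>0 \<alpha> (norm x)" by (rule norm_radial_hess_le[OF x])
  also have "\<dots> \<le> 14 * \<rho>0\<^sup>2 * (1 / sqrt \<rho>0 * ((1 + 1 / norm x) * exp (- \<alpha> * norm x)))"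
    using x by (intro mult_left_mono decay_le_exp) auto
  finally show "cmod (radial_hess x) \<le> (14 * \<rho>0\<^sup>2 * (1 / sqrt \<rho>0)) * ((1 + 1 / norm x) * exp (- \<alpha> * norm x))"
    by (simp only: mult.assoc)
qed auto

text \<open>The flux over \<open>r\<^sup>2\<close> is not integrable for a single Green function. For the difference it
  is, by the relation \<open>2 w K\<^sub>1 = w\<^sup>2 K\<^sub>2 - w\<^sup>2 K\<^sub>0\<close>, so no cutoff is needed in this part.\<close>
lemma flux_diff_eq:
  assumes "x \<noteq> 0"
  shows "(k1.flux x - k2.flux x) / of_real ((norm x)\<^sup>2) = (radial_hess x - (om1\<^sup>2 * k1.green x - om2\<^sup>2 * k2.green x)) / 2"
  using assms
  by (simp add: radial_hess_def bessel_w2K2_def k1.flux_def k2.flux_def k1.green_def k2.green_def field_simps power_mult_distrib)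

lemma integrable_hess_diff: "integrable lborel (hess_diff i j)"
proof -
  have 1: "integrable lborel (\<lambda>x. (if i = j then - ((radial_hess x - (om1\<^sup>2 * k1.green x - om2\<^sup>2 * k2.green x)) / 2) else 0))"
  proof (cases "i = j")
    case True
    have "integrable lborel (\<lambda>x. - ((radial_hess x - (om1\<^sup>2 * k1.green x - om2\<^sup>2 * k2.green x)) / 2))"
      by (intro Bochner_Integration.integrable_minus integrable_divide Bochner_Integration.integrable_diff
          integrable_mult_right integrable_radial_hess k1.integrable_green k2.integrable_green)
    then show ?thesis using True by (simp only: simp_thms if_True)
  qed simp
  have 2: "integrable lborel (\<lambda>x. of_real (x $ i * x $ j / (norm x)\<^sup>2) * radial_hess x)"
  proof (rule Bochner_Integration.integrable_bound[OF integrable_radial_hess])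
    show "AE x in lborel. norm (of_real (x $ i * x $ j / (norm x)\<^sup>2) * radial_hess x) \<le> norm (radial_hess x)"
    proof (rule AE_I2)
      fix x :: "real ^ 2"
      have "\<bar>x $ i\<bar> * \<bar>x $ j\<bar> \<le> norm x * norm x" by (intro mult_mono abs_nth_le_norm) auto
      then have "\<bar>x $ i * x $ j / (norm x)\<^sup>2\<bar> \<le> 1"
        by (cases "x = 0") (auto simp: abs_mult power2_eq_square)
      then have "\<bar>x $ i * x $ j / (norm x)\<^sup>2\<bar> * cmod (radial_hess x) \<le> 1 * cmod (radial_hess x)" by (intro mult_right_mono) auto
      then show "norm (of_real (x $ i * x $ j / (norm x)\<^sup>2) * radial_hess x) \<le> norm (radial_hess x)"
        unfolding norm_mult norm_of_real by simp
    qed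
  qed measurable
  show ?thesis
  proof (rule integrable_cong_AE_imp[OF Bochner_Integration.integrable_add[OF 1 2]])
    show "AE x in lborel. (if i = j then - ((radial_hess x - (om1\<^sup>2 * k1.green x - om2\<^sup>2 * k2.green x)) / 2) else 0)
        + of_real (x $ i * x $ j / (norm x)\<^sup>2) * radial_hess x = hess_diff i j x"
      using AE_lborel_singleton[of "0 :: real ^ 2"]
    proof eventually_elim
      case (elim x)
      show ?case unfolding hess_diff_def minus_divide_left[symmetric] flux_diff_eq[OF elim] by (rule refl)
    qed
  qed measurable
qed

lemma green_diff_has_partial:
  "x \<noteq> 0 \<Longrightarrow> ((\<lambda>s. green_diff (x + s *\<^sub>R axis i 1)) has_vector_derivative grad_diff i x) (at 0)"
  unfolding green_diff_def grad_diff_def by (intro has_vector_derivative_diff k1.green_has_partial k2.green_has_partial)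

lemma grad_diff_has_partial:
  assumes "x \<noteq> 0"
  shows "((\<lambda>s. grad_diff i (x + s *\<^sub>R axis j 1)) has_vector_derivative hess_diff i j x) (at 0)"
proof -
  let ?r = "norm x"
  have r: "?r > 0" using assms by simp
  have D: "((\<lambda>r. 1 / r\<^sup>2) has_real_derivative - 2 / ?r ^ 3) (at ?r)"
    using r by (auto intro!: derivative_eq_intros simp: power2_eq_square power3_eq_cube)
  have "((\<lambda>r. of_real (1 / r\<^sup>2) :: complex) has_vector_derivative of_real (- 2 / ?r ^ 3)) (at ?r)"
    by (rule has_vector_derivative_of_real[OF D])
  from has_vector_derivative_mult[OF has_vector_derivative_minus[OF has_vector_derivative_diff[OF
      bessel_wK1_radial_derivative[OF Re_om(1) r] bessel_wK1_radial_derivative[OF Re_om(2) r]]] this]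
  have "((\<lambda>r. - (bessel_wK1 (om1 * of_real r) - bessel_wK1 (om2 * of_real r)) * of_real (1 / r\<^sup>2)) has_vector_derivative
     - (k1.flux x - k2.flux x) * of_real (- 2 / ?r ^ 3) +
     - (- om1\<^sup>2 * of_real ?r * k1.green x - (- om2\<^sup>2 * of_real ?r * k2.green x)) * of_real (1 / ?r\<^sup>2)) (at ?r)"
    unfolding k1.flux_def k2.flux_def k1.green_def k2.green_def .
  also have "- (k1.flux x - k2.flux x) * of_real (- 2 / ?r ^ 3) +
     - (- om1\<^sup>2 * of_real ?r * k1.green x - (- om2\<^sup>2 * of_real ?r * k2.green x)) * of_real (1 / ?r\<^sup>2) = radial_hess x / of_real ?r"
    using r by (simp add: radial_hess_def bessel_w2K2_def k1.flux_def k2.flux_def k1.green_def k2.green_def field_simps power_mult_distrib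
        power2_eq_square power3_eq_cube)
  finally have "((\<lambda>r. - (bessel_wK1 (om1 * of_real r) - bessel_wK1 (om2 * of_real r)) * of_real (1 / r\<^sup>2)) has_vector_derivative
     radial_hess x / of_real ?r) (at ?r)" .
  from nth_radial_has_partial[OF assms this, of j i]
  have D: "((\<lambda>s. of_real ((x + s *\<^sub>R axis j 1) $ i) * (- (bessel_wK1 (om1 * of_real (norm (x + s *\<^sub>R axis j 1)))
      - bessel_wK1 (om2 * of_real (norm (x + s *\<^sub>R axis j 1)))) * of_real (1 / (norm (x + s *\<^sub>R axis j 1))\<^sup>2)))
    has_vector_derivative (if i = j then - (k1.flux x - k2.flux x) * of_real (1 / ?r\<^sup>2) else 0) + of_real (x $ i * x $ j / ?r) * (radial_hess x / of_real ?r)) (at 0)"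
    unfolding k1.flux_def k2.flux_def .
  have grad_diff: "grad_diff i y = of_real (y $ i) * (- (bessel_wK1 (om1 * of_real (norm y)) - bessel_wK1 (om2 * of_real (norm y))) * of_real (1 / (norm y)\<^sup>2))" for y
    by (simp add: grad_diff_def k1.grad_def k2.grad_def k1.flux_def k2.flux_def algebra_simps diff_divide_distrib)
  have "(if i = j then - (k1.flux x - k2.flux x) * of_real (1 / ?r\<^sup>2) else 0) + of_real (x $ i * x $ j / ?r) * (radial_hess x / of_real ?r) = hess_diff i j x"
    by (auto simp: hess_diff_def power2_eq_square)
  with D show ?thesis unfolding grad_diff by simp
qed

text \<open>The symbol \<open>\<partial>\<^sub>1\<partial>\<^sub>1 - \<partial>\<^sub>2\<partial>\<^sub>2 + 2 \<sigma> \<partial>\<^sub>1\<partial>\<^sub>2\<close> is \<open>(\<partial>\<^sub>1 + \<sigma> \<partial>\<^sub>2)\<^sup>2\<close>. It annihilates multiples of the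
  identity in the Hessian, and only the well behaved radial part survives.\<close>
theorem traceless_kernel:
  fixes F :: "real ^ 2 \<Rightarrow> complex" and G :: "2 \<Rightarrow> real ^ 2 \<Rightarrow> complex" and H :: "2 \<Rightarrow> 2 \<Rightarrow> real ^ 2 \<Rightarrow> complex"
  assumes meas: "F \<in> borel_measurable borel" "\<And>i. G i \<in> borel_measurable borel" "\<And>i j. H i j \<in> borel_measurable borel"
    and bnd: "\<And>x. cmod (F x) \<le> B" "\<And>i x. cmod (G i x) \<le> B" "\<And>i j x. cmod (H i j x) \<le> B"
    and dF: "\<And>i x. ((\<lambda>s. F (x + s *\<^sub>R axis i 1)) has_vector_derivative G i x) (at 0)"
    and dG: "\<And>i j x. ((\<lambda>s. G j (x + s *\<^sub>R axis i 1)) has_vector_derivative H i j x) (at 0)"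
    and \<sigma>: "\<sigma>\<^sup>2 = -1"
  shows "(LINT x|lborel. green_diff x * (H 1 1 x - H 2 2 x + 2 * \<sigma> * H 1 2 x))
     = (LINT x|lborel. (of_real (x $ 1) + \<sigma> * of_real (x $ 2))\<^sup>2 / of_real ((norm x)\<^sup>2) * radial_hess x * F x)"
proof -
  note [measurable] = meas
  have nz: "x \<noteq> 0" if "x $ j \<noteq> 0" for x :: "real ^ 2" and j using that by auto
  have parts: "(LINT x|lborel. green_diff x * H i j x) = (LINT x|lborel. hess_diff i j x * F x)" for i j
  proof -
    have "(LINT x|lborel. green_diff x * H i j x) = - (LINT x|lborel. grad_diff i x * G j x)"
      by (rule integral_by_parts_partial[where i = i and B = B])
         (use meas bnd dG nz green_diff_has_partial integrable_green_diff integrable_grad_diff in auto)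
    also have "(LINT x|lborel. grad_diff i x * G j x) = - (LINT x|lborel. hess_diff i j x * F x)"
      by (rule integral_by_parts_partial[where i = j and B = B])
         (use meas bnd dF nz grad_diff_has_partial integrable_grad_diff integrable_hess_diff in auto)
    finally show ?thesis by simp
  qed
  have ifH: "integrable lborel (\<lambda>x. green_diff x * H i j x)" for i j
    by (rule integrable_mult_bounded[OF integrable_green_diff meas(3) bnd(3)])
  have ifF: "integrable lborel (\<lambda>x. hess_diff i j x * F x)" for i j
    by (rule integrable_mult_bounded[OF integrable_hess_diff meas(1) bnd(1)])
  have "(\<lambda>x. green_diff x * (H 1 1 x - H 2 2 x + 2 * \<sigma> * H 1 2 x)) = (\<lambda>x. green_diff x * H 1 1 x - green_diff x * H 2 2 x + 2 * \<sigma> * (green_diff x * H 1 2 x))"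
    by (simp add: fun_eq_iff algebra_simps)
  then have "(LINT x|lborel. green_diff x * (H 1 1 x - H 2 2 x + 2 * \<sigma> * H 1 2 x)) =
     (LINT x|lborel. hess_diff 1 1 x * F x) - (LINT x|lborel. hess_diff 2 2 x * F x) + 2 * \<sigma> * (LINT x|lborel. hess_diff 1 2 x * F x)"
    using ifH by (simp add: parts)
  also have "\<dots> = (LINT x|lborel. hess_diff 1 1 x * F x - hess_diff 2 2 x * F x + 2 * \<sigma> * (hess_diff 1 2 x * F x))"
    using ifF by simp
  also have "\<dots> = (LINT x|lborel. (of_real (x $ 1) + \<sigma> * of_real (x $ 2))\<^sup>2 / of_real ((norm x)\<^sup>2) * radial_hess x * F x)"
  proof (rule Bochner_Integration.integral_cong[OF refl])
    fix x :: "real ^ 2"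
    have "hess_diff 1 1 x - hess_diff 2 2 x + 2 * \<sigma> * hess_diff 1 2 x
      = (of_real (x $ 1 * x $ 1 / (norm x)\<^sup>2) - of_real (x $ 2 * x $ 2 / (norm x)\<^sup>2) + 2 * \<sigma> * of_real (x $ 1 * x $ 2 / (norm x)\<^sup>2)) * radial_hess x"
      by (simp add: hess_diff_def algebra_simps)
    also have "of_real (x $ 1 * x $ 1 / (norm x)\<^sup>2) - of_real (x $ 2 * x $ 2 / (norm x)\<^sup>2) + 2 * \<sigma> * of_real (x $ 1 * x $ 2 / (norm x)\<^sup>2)
      = (of_real (x $ 1 * x $ 1) - of_real (x $ 2 * x $ 2) + 2 * \<sigma> * of_real (x $ 1 * x $ 2)) / of_real ((norm x)\<^sup>2)"
      by (simp add: add_divide_distrib diff_divide_distrib)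
    also have "of_real (x $ 1 * x $ 1) - of_real (x $ 2 * x $ 2) + 2 * \<sigma> * of_real (x $ 1 * x $ 2)
      = (of_real (x $ 1) + \<sigma> * of_real (x $ 2))\<^sup>2"
      using \<sigma> by (simp add: power2_sum power_mult_distrib) (simp add: power2_eq_square)
    finally have "hess_diff 1 1 x - hess_diff 2 2 x + 2 * \<sigma> * hess_diff 1 2 x = (of_real (x $ 1) + \<sigma> * of_real (x $ 2))\<^sup>2 / of_real ((norm x)\<^sup>2) * radial_hess x" .
    from arg_cong[OF this, of "\<lambda>z. z * F x"]
    show "hess_diff 1 1 x * F x - hess_diff 2 2 x * F x + 2 * \<sigma> * (hess_diff 1 2 x * F x)
       = (of_real (x $ 1) + \<sigma> * of_real (x $ 2))\<^sup>2 / of_real ((norm x)\<^sup>2) * radial_hess x * F x"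
      by (simp add: algebra_simps)
  qed
  finally show ?thesis .
qed

lemma norm_traceless_symbol:
  assumes "\<sigma> = \<i> \<or> \<sigma> = - \<i>" and "x \<noteq> (0 :: real ^ 2)"
  shows "cmod ((of_real (x $ 1) + \<sigma> * of_real (x $ 2))\<^sup>2 / of_real ((norm x)\<^sup>2)) = 1"
proof -
  have "(cmod (of_real (x $ 1) + \<sigma> * of_real (x $ 2)))\<^sup>2 = (x $ 1)\<^sup>2 + (x $ 2)\<^sup>2"
    using assms(1) by (auto simp: cmod_power2)
  also have "\<dots> = (norm x)\<^sup>2" by (simp add: norm_eq_sqrt_inner inner_vec_def sum_2 power2_eq_square)
  finally show ?thesis using assms(2) by (simp add: norm_divide norm_power)
qed

end

section \<open>Correlation with a test function\<close>

text \<open>To solve a weak equation for a merely square integrable \<open>u\<close> one tests it with all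
  translates of a bump: the resulting function of the translation is smooth and bounded, and a
  Green function can be integrated against it.\<close>
definition corr :: "(real ^ 2 \<Rightarrow> complex) \<Rightarrow> (real \<Rightarrow> real) \<Rightarrow> (real \<Rightarrow> real) \<Rightarrow> real ^ 2 \<Rightarrow> complex" where
  "corr u f g y = (LINT z|lborel. u z * tensor f g (z - y))"

definition borel_L2 :: "(real ^ 2 \<Rightarrow> complex) set" where
  "borel_L2 = {u \<in> borel_measurable borel. integrable lborel (\<lambda>x. (cmod (u x))\<^sup>2)}"

lemma borel_L2_measurable: "u \<in> borel_L2 \<Longrightarrow> u \<in> borel_measurable borel"
  by (simp add: borel_L2_def)

lemma borel_L2_local:
  assumes "u \<in> borel_L2" and A: "bounded A" "A \<in> sets borel"
  shows "integrable lborel (\<lambda>z. indicator A z * cmod (u z))"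
proof (rule Bochner_Integration.integrable_bound)
  have "emeasure lborel A < \<infinity>"
    using A(1) by (rule emeasure_bounded_finite)
  then have "integrable lborel (indicator A :: real ^ 2 \<Rightarrow> real)"
    using A by (intro integrable_real_indicator) auto
  then show "integrable lborel (\<lambda>z. indicator A z + (cmod (u z))\<^sup>2)"
    using assms by (intro Bochner_Integration.integrable_add) (auto simp: borel_L2_def)
  show "AE z in lborel. norm (indicator A z * cmod (u z)) \<le> norm (indicator A z + (cmod (u z))\<^sup>2)"
  proof (rule AE_I2)
    fix z
    have "2 * cmod (u z) * 1 \<le> (cmod (u z))\<^sup>2 + 1\<^sup>2" by (rule sum_squares_bound)
    then have "cmod (u z) \<le> 1 + (cmod (u z))\<^sup>2" using norm_ge_zero[of "u z"] by (simp only: power_one)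
    then show "norm (indicator A z * cmod (u z)) \<le> norm (indicator A z + (cmod (u z))\<^sup>2)"
      by (auto simp: indicator_def)
  qed
  show "(\<lambda>z. indicator A z * cmod (u z)) \<in> borel_measurable lborel"
    using borel_L2_measurable[OF assms(1), measurable] A(2) by measurable
qed

lemma tensor_translated_bound:
  assumes "f \<in> bumps" "g \<in> bumps"
  obtains B R where "B \<ge> 0" "R \<ge> 0" "\<And>y z. norm y \<le> S \<Longrightarrow> cmod (tensor f g (z - y)) \<le> B * indicator (cball 0 R) z"
proof -
  obtain B R where BR: "B \<ge> 0" "R \<ge> 0" "\<And>x. cmod (tensor f g x) \<le> B * indicator (cball 0 R) x"
    using tensor_bounded[OF assms] by metis
  show ?thesis
  proof (rule that[of B "R + \<bar>S\<bar>"])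
    fix y z :: "real ^ 2" assume "norm y \<le> S"
    then have "indicator (cball 0 R) (z - y) \<le> (indicator (cball 0 (R + \<bar>S\<bar>)) z :: real)"
      using norm_triangle_ineq2[of z y] by (auto simp: indicator_def)
    then have "B * indicator (cball 0 R) (z - y) \<le> B * indicator (cball 0 (R + \<bar>S\<bar>)) z"
      using BR by (intro mult_left_mono) auto
    then show "cmod (tensor f g (z - y)) \<le> B * indicator (cball 0 (R + \<bar>S\<bar>)) z"
      using BR(3)[of "z - y"] by linarith
  qed (use BR in auto)
qed

lemma tensor_translate_measurable:
  assumes "f \<in> bumps" "g \<in> bumps" shows "(\<lambda>z. tensor f g (z - y)) \<in> borel_measurable borel"
  using tensor_measurable[OF assms, measurable] by measurable

lemma integrable_corr:
  assumes u: "u \<in> borel_L2" and fg: "f \<in> bumps" "g \<in> bumps"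
  shows "integrable lborel (\<lambda>z. u z * tensor f g (z - y))"
proof -
  obtain B R where BR: "B \<ge> 0" "\<And>z. cmod (tensor f g (z - y)) \<le> B * indicator (cball 0 R) z"
    using tensor_translated_bound[OF fg, of "norm y"] by (metis order_refl)
  show ?thesis
  proof (rule Bochner_Integration.integrable_bound)
    show "integrable lborel (\<lambda>z. B * (indicator (cball 0 R) z * cmod (u z)))"
      by (intro integrable_mult_right borel_L2_local u) auto
    show "AE z in lborel. norm (u z * tensor f g (z - y)) \<le> norm (B * (indicator (cball 0 R) z * cmod (u z)))"
    proof (rule AE_I2)
      fix z
      have "cmod (u z) * cmod (tensor f g (z - y)) \<le> cmod (u z) * (B * indicator (cball 0 R) z)"
        by (intro mult_left_mono BR) auto
      then show "norm (u z * tensor f g (z - y)) \<le> norm (B * (indicator (cball 0 R) z * cmod (u z)))"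
        using BR(1) by (simp add: norm_mult mult_ac)
    qed
  qed (use borel_L2_measurable[OF u, measurable] tensor_translate_measurable[OF fg, measurable] in measurable)
qed

lemma corr_measurable:
  assumes u: "u \<in> borel_L2" and fg: "f \<in> bumps" "g \<in> bumps"
  shows "corr u f g \<in> borel_measurable borel"
proof -
  note [measurable] = borel_L2_measurable[OF u] tensor_measurable[OF fg]
  have "(\<lambda>(y, z). u z * tensor f g (z - y)) \<in> borel_measurable (borel \<Otimes>\<^sub>M lborel)"
    unfolding split_beta by measurable
  then show ?thesis unfolding corr_def by (rule lborel.borel_measurable_lebesgue_integral)
qed

lemma tensor_L2:
  assumes "f \<in> bumps" "g \<in> bumps" shows "tensor f g \<in> borel_L2"
proof -
  obtain B R where BR: "B \<ge> 0" "R \<ge> 0" "\<And>x. cmod (tensor f g x) \<le> B * indicator (cball 0 R) x"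
    using tensor_bounded[OF assms] by metis
  have "integrable lborel (\<lambda>x. (cmod (tensor f g x))\<^sup>2)"
  proof (rule Bochner_Integration.integrable_bound)
    show "integrable lborel (\<lambda>x. B\<^sup>2 * indicator (cball (0::real ^ 2) R) x)"
      using emeasure_bounded_finite[of "cball (0::real ^ 2) R"]
      by (intro integrable_mult_right integrable_real_indicator) auto
    show "AE x in lborel. norm ((cmod (tensor f g x))\<^sup>2) \<le> norm (B\<^sup>2 * indicator (cball (0::real ^ 2) R) x)"
    proof (rule AE_I2)
      fix x
      have "(cmod (tensor f g x))\<^sup>2 \<le> (B * indicator (cball 0 R) x)\<^sup>2"
        by (intro power_mono BR) auto
      then show "norm ((cmod (tensor f g x))\<^sup>2) \<le> norm (B\<^sup>2 * indicator (cball (0::real ^ 2) R) x)"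
        by (auto simp: indicator_def)
    qed
  qed (use tensor_measurable[OF assms, measurable] in measurable)
  then show ?thesis using tensor_measurable[OF assms] by (simp add: borel_L2_def)
qed

lemma integral_translate:
  fixes h :: "real ^ 2 \<Rightarrow> 'b::{banach, second_countable_topology}"
  assumes [measurable]: "h \<in> borel_measurable borel"
  shows "(LINT x|lborel. h (x - y)) = (LINT x|lborel. h x)"
    "integrable lborel (\<lambda>x. h (x - y)) \<longleftrightarrow> integrable lborel h"
proof -
  have "(LINT x|lborel. h x) = (LINT x|distr lborel borel (\<lambda>x. - y + x). h x)" by (simp only: lborel_translate)
  also have "\<dots> = (LINT x|lborel. h (x - y))" by (subst integral_distr) auto
  finally show "(LINT x|lborel. h (x - y)) = (LINT x|lborel. h x)" by simp
  have "integrable lborel h \<longleftrightarrow> integrable (distr lborel borel (\<lambda>x. - y + x)) h" by (simp only: lborel_translate)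
  also have "\<dots> \<longleftrightarrow> integrable lborel (\<lambda>x. h (x - y))" by (subst integrable_distr_eq) auto
  finally show "integrable lborel (\<lambda>x. h (x - y)) \<longleftrightarrow> integrable lborel h" by simp
qed

text \<open>A bound that is uniform in the translation, from \<open>a b \<le> a\<^sup>2 + b\<^sup>2\<close>.\<close>
lemma norm_corr_le_integral:
  assumes u: "u \<in> borel_L2" and fg: "f \<in> bumps" "g \<in> bumps"
  shows "(LINT z|lborel. cmod (u z) * cmod (tensor f g (z - y)))
     \<le> (LINT z|lborel. (cmod (u z))\<^sup>2) + (LINT z|lborel. (cmod (tensor f g z))\<^sup>2)"
proof -
  note [measurable] = tensor_measurable[OF fg]
  have iu: "integrable lborel (\<lambda>z. (cmod (u z))\<^sup>2)" using u by (simp add: borel_L2_def)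
  have it: "integrable lborel (\<lambda>z. (cmod (tensor f g (z - y)))\<^sup>2)"
    using tensor_L2[OF fg] by (subst integral_translate(2)[of "\<lambda>z. (cmod (tensor f g z))\<^sup>2"]) (auto simp: borel_L2_def)
  have "(LINT z|lborel. cmod (u z) * cmod (tensor f g (z - y))) \<le> (LINT z|lborel. (cmod (u z))\<^sup>2 + (cmod (tensor f g (z - y)))\<^sup>2)"
  proof (rule integral_mono)
    show "integrable lborel (\<lambda>z. cmod (u z) * cmod (tensor f g (z - y)))"
      using integrable_norm[OF integrable_corr[OF u fg]] by (simp add: norm_mult)
    show "integrable lborel (\<lambda>z. (cmod (u z))\<^sup>2 + (cmod (tensor f g (z - y)))\<^sup>2)"
      by (intro Bochner_Integration.integrable_add iu it)
    fix z
    have "2 * cmod (u z) * cmod (tensor f g (z - y)) \<le> (cmod (u z))\<^sup>2 + (cmod (tensor f g (z - y)))\<^sup>2"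
      by (rule sum_squares_bound)
    moreover have "0 \<le> cmod (u z) * cmod (tensor f g (z - y))" by simp
    ultimately show "cmod (u z) * cmod (tensor f g (z - y)) \<le> (cmod (u z))\<^sup>2 + (cmod (tensor f g (z - y)))\<^sup>2"
      unfolding mult.assoc by linarith
  qed
  also have "\<dots> = (LINT z|lborel. (cmod (u z))\<^sup>2) + (LINT z|lborel. (cmod (tensor f g (z - y)))\<^sup>2)"
    by (rule Bochner_Integration.integral_add[OF iu it])
  also have "(LINT z|lborel. (cmod (tensor f g (z - y)))\<^sup>2) = (LINT z|lborel. (cmod (tensor f g z))\<^sup>2)"
    by (rule integral_translate(1)[of "\<lambda>z. (cmod (tensor f g z))\<^sup>2"]) measurable
  finally show ?thesis .
qed

lemma corr_bounded:
  assumes u: "u \<in> borel_L2" and fg: "f \<in> bumps" "g \<in> bumps"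
  obtains B where "\<And>y. cmod (corr u f g y) \<le> B"
proof (rule that)
  fix y
  have "cmod (corr u f g y) \<le> (LINT z|lborel. cmod (u z * tensor f g (z - y)))"
    unfolding corr_def by (rule integral_norm_bound)
  then show "cmod (corr u f g y) \<le> (LINT z|lborel. (cmod (u z))\<^sup>2) + (LINT z|lborel. (cmod (tensor f g z))\<^sup>2)"
    using norm_corr_le_integral[OF u fg, of y] by (simp add: norm_mult)
qed

lemma tensor_has_partial:
  assumes "f \<in> bumps" "g \<in> bumps"
  shows "((\<lambda>s. tensor f g (x + s *\<^sub>R axis i 1)) has_vector_derivative pderiv_dir i (tensor f g) x) (at 0)"
proof -
  have g: "((\<lambda>s. x + s *\<^sub>R axis i 1) has_derivative (\<lambda>s. s *\<^sub>R axis i 1)) (at 0)"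
    by (auto intro!: derivative_eq_intros)
  have "(tensor f g has_derivative frechet_derivative (tensor f g) (at (x + 0 *\<^sub>R axis i 1))) (at (x + 0 *\<^sub>R axis i 1))"
    using tensor_has_derivative[OF assms, of x] by (simp add: frechet_derivative_at[symmetric])
  from has_derivative_compose[OF g this]
  have "((\<lambda>s. tensor f g (x + s *\<^sub>R axis i 1)) has_derivative (\<lambda>s. frechet_derivative (tensor f g) (at x) (s *\<^sub>R axis i 1))) (at 0)"
    by simp
  moreover have "linear (frechet_derivative (tensor f g) (at x))"
    using has_derivative_linear[OF tensor_has_derivative[OF assms, of x]]
    unfolding frechet_derivative_at[OF tensor_has_derivative[OF assms, of x]] .
  ultimately show ?thesis
    by (simp add: has_vector_derivative_def pderiv_dir_def linear_cmul)
qed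

text \<open>The translation enters with a minus sign, whence the sign of the derivative; it cancels in
  the second order operators used below.\<close>
lemma corr_has_partial:
  assumes u: "u \<in> borel_L2" and fg: "f \<in> bumps" "g \<in> bumps"
    and fg': "f' \<in> bumps" "g' \<in> bumps" "pderiv_dir i (tensor f g) = tensor f' g'"
  shows "((\<lambda>s. corr u f g (y + s *\<^sub>R axis i 1)) has_vector_derivative - corr u f' g' y) (at 0)"
proof -
  obtain B R where BR: "B \<ge> 0" "\<And>y' z. norm y' \<le> norm y + 1 \<Longrightarrow> cmod (tensor f' g' (z - y')) \<le> B * indicator (cball 0 R) z"
    using tensor_translated_bound[OF fg'(1,2), of "norm y + 1"] by metis
  note [measurable] = borel_L2_measurable[OF u] tensor_measurable[OF fg'(1,2)]
  have "((\<lambda>s. LINT z|lborel. u z * tensor f g (z - (y + s *\<^sub>R axis i 1))) has_vector_derivative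
      (LINT z|lborel. - (u z * tensor f' g' (z - (y + 0 *\<^sub>R axis i 1))))) (at 0)"
  proof (rule has_vector_derivative_integral[where d = 1 and B = "\<lambda>z. B * (indicator (cball 0 R) z * cmod (u z))"])
    show "integrable lborel (\<lambda>z. u z * tensor f g (z - (y + s *\<^sub>R axis i 1)))" for s
      by (rule integrable_corr[OF u fg])
    show "((\<lambda>s. u z * tensor f g (z - (y + s *\<^sub>R axis i 1))) has_vector_derivative - (u z * tensor f' g' (z - (y + s *\<^sub>R axis i 1)))) (at s)" for s z
    proof -
      let ?x = "z - (y + s *\<^sub>R axis i 1)"
      have "((\<lambda>t. - t + s) has_vector_derivative - 1) (at s)" by (auto intro!: derivative_eq_intros)
      moreover have "((\<lambda>r. tensor f g (?x + r *\<^sub>R axis i 1)) has_vector_derivative tensor f' g' ?x) (at (- s + s))"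
        using tensor_has_partial[OF fg, of ?x i] fg'(3) by simp
      ultimately have "((\<lambda>r. tensor f g (?x + r *\<^sub>R axis i 1)) \<circ> (\<lambda>t. - t + s) has_vector_derivative (- 1) *\<^sub>R tensor f' g' ?x) (at s)"
        by (rule vector_diff_chain_at)
      moreover have "(\<lambda>r. tensor f g (?x + r *\<^sub>R axis i 1)) \<circ> (\<lambda>t. - t + s) = (\<lambda>t. tensor f g (z - (y + t *\<^sub>R axis i 1)))"
        by (auto simp: fun_eq_iff algebra_simps)
      ultimately have "((\<lambda>t. tensor f g (z - (y + t *\<^sub>R axis i 1))) has_vector_derivative (- 1) *\<^sub>R tensor f' g' ?x) (at s)"
        by (simp only:)
      from has_vector_derivative_mult_right[OF this, of "u z"] show ?thesis by simp
    qed
    show "cmod (- (u z * tensor f' g' (z - (y + s *\<^sub>R axis i 1)))) \<le> B * (indicator (cball 0 R) z * cmod (u z))" if "\<bar>s - 0\<bar> < 1" for s z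
    proof -
      have "norm (y + s *\<^sub>R axis i 1) \<le> norm y + 1"
        using norm_triangle_ineq[of y "s *\<^sub>R axis i 1"] that
        by simp
      then have "cmod (u z) * cmod (tensor f' g' (z - (y + s *\<^sub>R axis i 1))) \<le> cmod (u z) * (B * indicator (cball 0 R) z)"
        by (intro mult_left_mono BR) auto
      then show ?thesis by (simp add: norm_mult mult_ac)
    qed
    show "integrable lborel (\<lambda>z. B * (indicator (cball 0 R) z * cmod (u z)))"
      by (intro integrable_mult_right borel_L2_local u) auto
  qed auto
  then show ?thesis by (simp add: corr_def)
qed

lemma corr_isCont:
  assumes u: "u \<in> borel_L2" and fg: "f \<in> bumps" "g \<in> bumps"
  shows "isCont (corr u f g) 0"
  unfolding continuous_at_sequentially comp_def
proof (intro allI impI)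
  fix Y :: "nat \<Rightarrow> real ^ 2" assume Y: "Y \<longlonglongrightarrow> 0"
  note [measurable] = borel_L2_measurable[OF u] tensor_measurable[OF fg]
  have "bounded (range Y)" using Y by (rule convergent_imp_bounded)
  then obtain S where S: "\<And>n. norm (Y n) \<le> S" by (auto simp: bounded_iff)
  obtain B R where BR: "B \<ge> 0" "\<And>y' z. norm y' \<le> S \<Longrightarrow> cmod (tensor f g (z - y')) \<le> B * indicator (cball 0 R) z"
    using tensor_translated_bound[OF fg, of S] by metis
  show "(\<lambda>n. corr u f g (Y n)) \<longlonglongrightarrow> corr u f g 0"
    unfolding corr_def
  proof (rule integral_dominated_convergence[where w = "\<lambda>z. B * (indicator (cball 0 R) z * cmod (u z))"])
    show "integrable lborel (\<lambda>z. B * (indicator (cball 0 R) z * cmod (u z)))"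
      by (intro integrable_mult_right borel_L2_local u) auto
    show "AE z in lborel. (\<lambda>n. u z * tensor f g (z - Y n)) \<longlonglongrightarrow> u z * tensor f g (z - 0)"
    proof (rule AE_I2)
      fix z
      have "isCont (tensor f g) (z - 0)"
        using tensor_has_derivative[OF fg] has_derivative_continuous by blast
      moreover have "(\<lambda>n. z - Y n) \<longlonglongrightarrow> z - 0" by (intro tendsto_intros Y)
      ultimately have "(\<lambda>n. tensor f g (z - Y n)) \<longlonglongrightarrow> tensor f g (z - 0)" by (rule isCont_tendsto_compose)
      then show "(\<lambda>n. u z * tensor f g (z - Y n)) \<longlonglongrightarrow> u z * tensor f g (z - 0)" by (intro tendsto_intros)
    qed
    show "AE z in lborel. norm (u z * tensor f g (z - Y n)) \<le> B * (indicator (cball 0 R) z * cmod (u z))" for n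
    proof (rule AE_I2)
      fix z
      have "cmod (u z) * cmod (tensor f g (z - Y n)) \<le> cmod (u z) * (B * indicator (cball 0 R) z)"
        by (intro mult_left_mono BR S) auto
      then show "norm (u z * tensor f g (z - Y n)) \<le> B * (indicator (cball 0 R) z * cmod (u z))"
        by (simp add: norm_mult mult_ac)
    qed
  qed measurable
qed

text \<open>The substitution \<open>x = z - y\<close> between two applications of Fubini's theorem moves the kernel
  from the test function onto \<open>u\<close>.\<close>
lemma corr_kernel_Fubini:
  assumes K: "integrable lborel K" and u: "u \<in> borel_L2" and fg: "f \<in> bumps" "g \<in> bumps"
  shows "integrable lborel (\<lambda>x. tensor f g x * (LINT z|lborel. K (z - x) * u z))"
    and "(LINT y|lborel. K y * corr u f g y) = (LINT x|lborel. (LINT z|lborel. K (z - x) * u z) * tensor f g x)"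
proof -
  note [measurable] = borel_L2_measurable[OF u] tensor_measurable[OF fg] borel_measurable_integrable[OF K, simplified]
  define M where "M = (LINT z|lborel. (cmod (u z))\<^sup>2) + (LINT z|lborel. (cmod (tensor f g z))\<^sup>2)"
  have meas: "(\<lambda>p. K (fst p) * (u (snd p) * tensor f g (snd p - fst p))) \<in> borel_measurable (lborel \<Otimes>\<^sub>M lborel)"
    by measurable
  have int1: "integrable (lborel \<Otimes>\<^sub>M lborel) (\<lambda>p. K (fst p) * (u (snd p) * tensor f g (snd p - fst p)))"
  proof (rule lborel_pair.Fubini_integrable[OF meas])
    show "integrable lborel (\<lambda>y. LINT z|lborel. norm (K (fst (y, z)) * (u (snd (y, z)) * tensor f g (snd (y, z) - fst (y, z)))))"
    proof (rule Bochner_Integration.integrable_bound)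
      show "integrable lborel (\<lambda>y. M * cmod (K y))" using K by auto
      show "AE y in lborel. norm (LINT z|lborel. norm (K (fst (y, z)) * (u (snd (y, z)) * tensor f g (snd (y, z) - fst (y, z))))) \<le> norm (M * cmod (K y))"
      proof (rule AE_I2)
        fix y
        have "(LINT z|lborel. norm (K (fst (y, z)) * (u (snd (y, z)) * tensor f g (snd (y, z) - fst (y, z)))))
           = cmod (K y) * (LINT z|lborel. cmod (u z) * cmod (tensor f g (z - y)))"
          by (simp add: norm_mult)
        also have "\<dots> \<le> cmod (K y) * M"
          unfolding M_def by (intro mult_left_mono norm_corr_le_integral u fg) auto
        finally have "(LINT z|lborel. norm (K (fst (y, z)) * (u (snd (y, z)) * tensor f g (snd (y, z) - fst (y, z))))) \<le> M * cmod (K y)"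
          by (simp only: mult.commute)
        moreover have "(LINT z|lborel. norm (K (fst (y, z)) * (u (snd (y, z)) * tensor f g (snd (y, z) - fst (y, z))))) \<ge> 0"
          by (intro integral_nonneg_AE AE_I2) auto
        ultimately show "norm (LINT z|lborel. norm (K (fst (y, z)) * (u (snd (y, z)) * tensor f g (snd (y, z) - fst (y, z))))) \<le> norm (M * cmod (K y))"
          unfolding real_norm_def by linarith
      qed
      have "(\<lambda>(y, z). norm (K y * (u z * tensor f g (z - y)))) \<in> borel_measurable (lborel \<Otimes>\<^sub>M lborel)"
        by measurable
      then show "(\<lambda>y. LINT z|lborel. norm (K (fst (y, z)) * (u (snd (y, z)) * tensor f g (snd (y, z) - fst (y, z))))) \<in> borel_measurable lborel"
        by (simp only: fst_conv snd_conv) (rule lborel.borel_measurable_lebesgue_integral)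
    qed
    show "AE y in lborel. integrable lborel (\<lambda>z. K (fst (y, z)) * (u (snd (y, z)) * tensor f g (snd (y, z) - fst (y, z))))"
      by (simp only: fst_conv snd_conv) (intro AE_I2 integrable_mult_right integrable_corr u fg)
  qed
  \<comment> \<open>Substitute \<open>y = z - x\<close> in the inner integral.\<close>
  have meas2: "(\<lambda>p. K (fst p - snd p) * (u (fst p) * tensor f g (snd p))) \<in> borel_measurable (lborel \<Otimes>\<^sub>M lborel)"
    by measurable
  have swap: "integrable (lborel \<Otimes>\<^sub>M lborel) (\<lambda>p. K (snd p) * (u (fst p) * tensor f g (fst p - snd p)))"
    using lborel_pair.integrable_product_swap[OF int1] by (simp add: case_prod_unfold)
  have sub: "(LINT y|lborel. h (z - y)) = (LINT y|lborel. h y)" "integrable lborel (\<lambda>y. h (z - y)) \<longleftrightarrow> integrable lborel h"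
    if [measurable]: "h \<in> borel_measurable borel" for h :: "real ^ 2 \<Rightarrow> 'c::{banach, second_countable_topology}" and z
  proof -
    have "(LINT x|lborel. h x) = (LINT x|distr lborel borel (\<lambda>x. z - x). h x)" by (simp add: lborel_reflect)
    also have "\<dots> = (LINT x|lborel. h (z - x))" by (subst integral_distr) auto
    finally show "(LINT y|lborel. h (z - y)) = (LINT y|lborel. h y)" by simp
    have "integrable lborel h \<longleftrightarrow> integrable (distr lborel borel (\<lambda>x. z - x)) h" by (simp add: lborel_reflect)
    also have "\<dots> \<longleftrightarrow> integrable lborel (\<lambda>x. h (z - x))" by (subst integrable_distr_eq) auto
    finally show "integrable lborel (\<lambda>x. h (z - x)) \<longleftrightarrow> integrable lborel h" by simp
  qed
  have int2: "integrable (lborel \<Otimes>\<^sub>M lborel) (\<lambda>p. K (fst p - snd p) * (u (fst p) * tensor f g (snd p)))"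
  proof (rule lborel_pair.Fubini_integrable[OF meas2])
    have eq: "(LINT x|lborel. norm (K (z - x) * (u z * tensor f g x))) = (LINT y|lborel. norm (K y * (u z * tensor f g (z - y))))" for z
      using sub(1)[of "\<lambda>y. norm (K y * (u z * tensor f g (z - y)))" z] by simp
    have "integrable lborel (\<lambda>z. LINT y|lborel. norm (K (snd (z, y)) * (u (fst (z, y)) * tensor f g (fst (z, y) - snd (z, y)))))"
      using lborel_pair.integrable_fst'[OF integrable_norm[OF swap]] .
    then show "integrable lborel (\<lambda>z. LINT x|lborel. norm (K (fst (z, x) - snd (z, x)) * (u (fst (z, x)) * tensor f g (snd (z, x)))))"
      by (simp only: fst_conv snd_conv eq)
    have "AE z in lborel. integrable lborel (\<lambda>y. K y * (u z * tensor f g (z - y)))"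
      using lborel_pair.AE_integrable_fst'[OF swap] by simp
    then show "AE z in lborel. integrable lborel (\<lambda>x. K (fst (z, x) - snd (z, x)) * (u (fst (z, x)) * tensor f g (snd (z, x))))"
    proof eventually_elim
      case (elim z)
      show ?case using sub(2)[of "\<lambda>y. K y * (u z * tensor f g (z - y))" z] elim by simp
    qed
  qed
  have inner: "(LINT z|lborel. K (z - x) * (u z * tensor f g x)) = (LINT z|lborel. K (z - x) * u z) * tensor f g x" for x
    unfolding mult.assoc[symmetric] by (rule integral_mult_left_zero)
  have "(LINT y|lborel. K y * corr u f g y) = (LINT y|lborel. LINT z|lborel. K y * (u z * tensor f g (z - y)))"
    by (simp add: corr_def)
  also have "\<dots> = (LINT z|lborel. LINT y|lborel. K y * (u z * tensor f g (z - y)))"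
    using lborel_pair.Fubini_integral[of "\<lambda>y z. K y * (u z * tensor f g (z - y))"] int1 by (simp add: case_prod_unfold)
  also have "\<dots> = (LINT z|lborel. LINT x|lborel. K (z - x) * (u z * tensor f g x))"
    using sub(1)[of "\<lambda>y. K y * (u z * tensor f g (z - y))" z for z] by simp
  also have "\<dots> = (LINT x|lborel. LINT z|lborel. K (z - x) * (u z * tensor f g x))"
    using lborel_pair.Fubini_integral[of "\<lambda>z x. K (z - x) * (u z * tensor f g x)"] int2 by (simp add: case_prod_unfold)
  also have "\<dots> = (LINT x|lborel. (LINT z|lborel. K (z - x) * u z) * tensor f g x)"
    unfolding inner by (rule refl)
  finally show "(LINT y|lborel. K y * corr u f g y) = (LINT x|lborel. (LINT z|lborel. K (z - x) * u z) * tensor f g x)" .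
  have "integrable lborel (\<lambda>x. LINT z|lborel. K (z - x) * (u z * tensor f g x))"
    using lborel_pair.integrable_snd[of "\<lambda>z x. K (z - x) * (u z * tensor f g x)"] int2 by (simp add: case_prod_unfold)
  then show "integrable lborel (\<lambda>x. tensor f g x * (LINT z|lborel. K (z - x) * u z))"
    unfolding inner by (simp only: mult.commute)
qed

text \<open>The kernel enters as \<open>K (z - x)\<close>, a reflected convolution; the kernels in use are even.\<close>
definition convol :: "(real ^ 2 \<Rightarrow> complex) \<Rightarrow> (real ^ 2 \<Rightarrow> complex) \<Rightarrow> real ^ 2 \<Rightarrow> complex" where
  "convol K u x = (LINT z|lborel. K (z - x) * u z)"

lemma convol_integrable:
  assumes K: "K \<in> borel_measurable borel" "integrable lborel (\<lambda>x. (cmod (K x))\<^sup>2)" and u: "u \<in> borel_L2"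
  shows "integrable lborel (\<lambda>z. K (z - x) * u z)"
    and "(LINT z|lborel. cmod (K (z - x)) * cmod (u z)) \<le> (LINT z|lborel. (cmod (K z))\<^sup>2) + (LINT z|lborel. (cmod (u z))\<^sup>2)"
proof -
  note [measurable] = borel_L2_measurable[OF u] K(1)
  have iK: "integrable lborel (\<lambda>z. (cmod (K (z - x)))\<^sup>2)"
    using K(2) by (subst integral_translate(2)[of "\<lambda>z. (cmod (K z))\<^sup>2"]) auto
  have iu: "integrable lborel (\<lambda>z. (cmod (u z))\<^sup>2)" using u by (simp add: borel_L2_def)
  have le: "cmod (K (z - x)) * cmod (u z) \<le> (cmod (K (z - x)))\<^sup>2 + (cmod (u z))\<^sup>2" for z
  proof -
    have "2 * cmod (K (z - x)) * cmod (u z) \<le> (cmod (K (z - x)))\<^sup>2 + (cmod (u z))\<^sup>2"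
      by (rule sum_squares_bound)
    moreover have "0 \<le> cmod (K (z - x)) * cmod (u z)" by simp
    ultimately show ?thesis unfolding mult.assoc by linarith
  qed
  show int: "integrable lborel (\<lambda>z. K (z - x) * u z)"
  proof (rule Bochner_Integration.integrable_bound[OF Bochner_Integration.integrable_add[OF iK iu]])
    show "AE z in lborel. norm (K (z - x) * u z) \<le> norm ((cmod (K (z - x)))\<^sup>2 + (cmod (u z))\<^sup>2)"
      using le by (intro AE_I2) (simp add: norm_mult)
  qed measurable
  have "(LINT z|lborel. cmod (K (z - x)) * cmod (u z)) \<le> (LINT z|lborel. (cmod (K (z - x)))\<^sup>2 + (cmod (u z))\<^sup>2)"
    using integrable_norm[OF int] le
    by (intro integral_mono Bochner_Integration.integrable_add iK iu) (simp_all add: norm_mult)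
  also have "\<dots> = (LINT z|lborel. (cmod (K (z - x)))\<^sup>2) + (LINT z|lborel. (cmod (u z))\<^sup>2)"
    by (rule Bochner_Integration.integral_add[OF iK iu])
  also have "(LINT z|lborel. (cmod (K (z - x)))\<^sup>2) = (LINT z|lborel. (cmod (K z))\<^sup>2)"
    by (rule integral_translate(1)[of "\<lambda>z. (cmod (K z))\<^sup>2"]) measurable
  finally show "(LINT z|lborel. cmod (K (z - x)) * cmod (u z)) \<le> (LINT z|lborel. (cmod (K z))\<^sup>2) + (LINT z|lborel. (cmod (u z))\<^sup>2)" .
qed

lemma convol_locally_integrable:
  assumes K: "K \<in> borel_measurable borel" "integrable lborel (\<lambda>x. (cmod (K x))\<^sup>2)" and u: "u \<in> borel_L2"
  shows "locally_integrable (convol K u)"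
  unfolding locally_integrable_def
proof
  fix R
  note [measurable] = borel_L2_measurable[OF u] K(1)
  define M where "M = (LINT z|lborel. (cmod (K z))\<^sup>2) + (LINT z|lborel. (cmod (u z))\<^sup>2)"
  have "(\<lambda>(x, z). K (z - x) * u z) \<in> borel_measurable (borel \<Otimes>\<^sub>M lborel)"
    unfolding split_beta by measurable
  then have cm: "convol K u \<in> borel_measurable borel"
    unfolding convol_def by (rule lborel.borel_measurable_lebesgue_integral)
  have M: "cmod (convol K u x) \<le> M" for x
  proof -
    have "cmod (convol K u x) \<le> (LINT z|lborel. cmod (K (z - x) * u z))"
      unfolding convol_def by (rule integral_norm_bound)
    then show ?thesis using convol_integrable(2)[OF K u, of x] by (simp add: norm_mult M_def)
  qed
  show "integrable lborel (\<lambda>x. indicator (cball 0 R) x *\<^sub>R convol K u x)"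
  proof (rule Bochner_Integration.integrable_bound)
    show "integrable lborel (\<lambda>x. M * indicator (cball (0::real ^ 2) R) x)"
      using emeasure_bounded_finite[of "cball (0::real ^ 2) R"]
      by (intro integrable_mult_right integrable_real_indicator) auto
    show "AE x in lborel. norm (indicator (cball 0 R) x *\<^sub>R convol K u x) \<le> norm (M * indicator (cball (0::real ^ 2) R) x)"
    proof (rule AE_I2)
      fix x
      have "cmod (convol K u x) \<le> \<bar>M\<bar>" using M[of x] by linarith
      then show "norm (indicator (cball 0 R) x *\<^sub>R convol K u x) \<le> norm (M * indicator (cball (0::real ^ 2) R) x)"
        by (auto simp: indicator_def)
    qed
    show "(\<lambda>x. indicator (cball 0 R) x *\<^sub>R convol K u x) \<in> borel_measurable lborel"
      using cm by (intro borel_measurable_scaleR borel_measurable_indicator) auto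
  qed
qed

lemma borel_L2_locally_integrable:
  assumes u: "u \<in> borel_L2" shows "locally_integrable u"
  unfolding locally_integrable_def
proof
  fix R
  show "integrable lborel (\<lambda>x. indicator (cball 0 R) x *\<^sub>R u x)"
  proof (rule Bochner_Integration.integrable_bound)
    show "integrable lborel (\<lambda>z. indicator (cball 0 R) z * cmod (u z))"
      by (intro borel_L2_local u) auto
  qed (use borel_L2_measurable[OF u, measurable] in \<open>auto simp: indicator_def\<close>)
qed

lemma locally_integrable_lincomb:
  assumes "locally_integrable f" "locally_integrable g"
  shows "locally_integrable (\<lambda>x. c * f x - d * g x)"
  unfolding locally_integrable_def
proof
  fix R
  have "integrable lborel (\<lambda>x. c * (indicator (cball 0 R) x *\<^sub>R f x) - d * (indicator (cball 0 R) x *\<^sub>R g x))"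
    using assms unfolding locally_integrable_def
    by (intro Bochner_Integration.integrable_diff integrable_mult_right) blast+
  moreover have "(\<lambda>x. c * (indicator (cball 0 R) x *\<^sub>R f x) - d * (indicator (cball 0 R) x *\<^sub>R g x))
    = (\<lambda>x. indicator (cball 0 R) x *\<^sub>R (c * f x - d * g x))"
    by (auto simp: fun_eq_iff indicator_def)
  ultimately show "integrable lborel (\<lambda>x. indicator (cball 0 R) x *\<^sub>R (c * f x - d * g x))" by (simp only:)
qed

lemma deriv_bump: "f \<in> bumps \<Longrightarrow> deriv f \<in> bumps"
  by (rule bumps_deriv(2))

lemma corr_derivatives:
  assumes u: "u \<in> borel_L2" and fg: "f \<in> bumps" "g \<in> bumps"
  shows "((\<lambda>s. corr u f g (y + s *\<^sub>R axis 1 1)) has_vector_derivative - corr u (deriv f) g y) (at 0)"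
    and "((\<lambda>s. corr u f g (y + s *\<^sub>R axis 2 1)) has_vector_derivative - corr u f (deriv g) y) (at 0)"
  by (intro corr_has_partial u fg deriv_bump pderiv_dir_tensor)+

lemma corr_derivative_family:
  assumes u: "u \<in> borel_L2" and fg: "f \<in> bumps" "g \<in> bumps"
  defines "G \<equiv> (\<lambda>i y. - (if i = (1::2) then corr u (deriv f) g y else corr u f (deriv g) y))"
  shows "((\<lambda>s. corr u f g (y + s *\<^sub>R axis i 1)) has_vector_derivative G i y) (at 0)"
proof -
  have "i = 1 \<or> i = 2" using exhaust_2 by blast
  then show ?thesis using corr_derivatives[OF u fg, of y] by (auto simp: G_def)
qed

lemma corr_bounds:
  assumes u: "u \<in> borel_L2" and fg: "f \<in> bumps" "g \<in> bumps"
  obtains B where "\<And>y. cmod (corr u f g y) \<le> B" "\<And>y. cmod (corr u (deriv f) g y) \<le> B"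
    "\<And>y. cmod (corr u f (deriv g) y) \<le> B" "\<And>y. cmod (corr u (deriv (deriv f)) g y) \<le> B"
    "\<And>y. cmod (corr u (deriv f) (deriv g) y) \<le> B" "\<And>y. cmod (corr u f (deriv (deriv g)) y) \<le> B"
proof -
  have "\<exists>B. \<forall>y. cmod (corr u f' g' y) \<le> B" if "f' \<in> bumps" "g' \<in> bumps" for f' g'
    using corr_bounded[OF u that] by metis
  note b = this
  obtain B1 where 1: "\<forall>y. cmod (corr u f g y) \<le> B1"
    using b[OF fg(1) fg(2)] by (elim exE)
  obtain B2 where 2: "\<forall>y. cmod (corr u (deriv f) g y) \<le> B2"
    using b[OF deriv_bump[OF fg(1)] fg(2)] by (elim exE)
  obtain B3 where 3: "\<forall>y. cmod (corr u f (deriv g) y) \<le> B3"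
    using b[OF fg(1) deriv_bump[OF fg(2)]] by (elim exE)
  obtain B4 where 4: "\<forall>y. cmod (corr u (deriv (deriv f)) g y) \<le> B4"
    using b[OF deriv_bump[OF deriv_bump[OF fg(1)]] fg(2)] by (elim exE)
  obtain B5 where 5: "\<forall>y. cmod (corr u (deriv f) (deriv g) y) \<le> B5"
    using b[OF deriv_bump[OF fg(1)] deriv_bump[OF fg(2)]] by (elim exE)
  obtain B6 where 6: "\<forall>y. cmod (corr u f (deriv (deriv g)) y) \<le> B6"
    using b[OF fg(1) deriv_bump[OF deriv_bump[OF fg(2)]]] by (elim exE)
  show ?thesis
  proof (rule that[of "max B1 (max B2 (max B3 (max B4 (max B5 B6))))"])
  qed (use 1 2 3 4 5 6 in \<open>simp_all add: le_max_iff_disj\<close>)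
qed

lemma (in bessel_kernel) corr_fundamental_solution:
  assumes u: "u \<in> borel_L2" and fg: "f \<in> bumps" "g \<in> bumps"
  shows "(LINT x|lborel. green x * (om\<^sup>2 * corr u f g x - (corr u (deriv (deriv f)) g x + corr u f (deriv (deriv g)) x)))
     = of_real kernel_mass * corr u f g 0"
proof -
  obtain B where B: "\<And>y. cmod (corr u f g y) \<le> B" "\<And>y. cmod (corr u (deriv f) g y) \<le> B"
    "\<And>y. cmod (corr u f (deriv g) y) \<le> B" "\<And>y. cmod (corr u (deriv (deriv f)) g y) \<le> B"
    "\<And>y. cmod (corr u (deriv f) (deriv g) y) \<le> B" "\<And>y. cmod (corr u f (deriv (deriv g)) y) \<le> B"
    using corr_bounds[OF u fg] by metis
  define G where "G = (\<lambda>i y. - (if i = (1::2) then corr u (deriv f) g y else corr u f (deriv g) y))"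
  define H where "H = (\<lambda>i y. (if i = (1::2) then corr u (deriv (deriv f)) g y else corr u f (deriv (deriv g)) y))"
  have "(LINT x|lborel. green x * (om\<^sup>2 * corr u f g x - (H 1 x + H 2 x))) = of_real kernel_mass * corr u f g 0"
  proof (rule bessel_fundamental_solution[where B = B and G = G])
    show "corr u f g \<in> borel_measurable borel" by (rule corr_measurable[OF u fg])
    show "G i \<in> borel_measurable borel" for i
      unfolding G_def using corr_measurable[OF u deriv_bump[OF fg(1)] fg(2)] corr_measurable[OF u fg(1) deriv_bump[OF fg(2)]]
      by (cases "i = 1") auto
    show "H i \<in> borel_measurable borel" for i
      unfolding H_def using corr_measurable[OF u deriv_bump[OF deriv_bump[OF fg(1)]] fg(2)] corr_measurable[OF u fg(1) deriv_bump[OF deriv_bump[OF fg(2)]]]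
      by (cases "i = 1") auto
    show "cmod (corr u f g x) \<le> B" for x by (rule B)
    show "cmod (G i x) \<le> B" for i x unfolding G_def using B(2,3) by (cases "i = 1") auto
    show "cmod (H i x) \<le> B" for i x unfolding H_def using B(4,6) by (cases "i = 1") auto
    show "((\<lambda>s. corr u f g (x + s *\<^sub>R axis i 1)) has_vector_derivative G i x) (at 0)" for i x
      unfolding G_def by (rule corr_derivative_family[OF u fg])
    show "((\<lambda>s. G i (x + s *\<^sub>R axis i 1)) has_vector_derivative H i x) (at 0)" for i x
    proof -
      have "i = 1 \<or> i = 2" using exhaust_2 by blast
      then show ?thesis
        using has_vector_derivative_minus[OF corr_derivatives(1)[OF u deriv_bump[OF fg(1)] fg(2)], of x]
          has_vector_derivative_minus[OF corr_derivatives(2)[OF u fg(1) deriv_bump[OF fg(2)]], of x]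
        by (auto simp: G_def H_def)
    qed
    show "isCont (corr u f g) 0" by (rule corr_isCont[OF u fg])
  qed
  then show ?thesis by (simp add: H_def)
qed

lemma (in bessel_pair) corr_traceless:
  assumes u: "u \<in> borel_L2" and fg: "a \<in> bumps" "b \<in> bumps" and \<sigma>: "\<sigma>\<^sup>2 = -1"
  shows "(LINT x|lborel. green_diff x * (corr u (deriv (deriv a)) b x - corr u a (deriv (deriv b)) x + 2 * \<sigma> * corr u (deriv a) (deriv b) x))
     = (LINT x|lborel. (of_real (x $ 1) + \<sigma> * of_real (x $ 2))\<^sup>2 / of_real ((norm x)\<^sup>2) * radial_hess x * corr u a b x)"
proof -
  obtain B where B: "\<And>y. cmod (corr u a b y) \<le> B" "\<And>y. cmod (corr u (deriv a) b y) \<le> B"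
    "\<And>y. cmod (corr u a (deriv b) y) \<le> B" "\<And>y. cmod (corr u (deriv (deriv a)) b y) \<le> B"
    "\<And>y. cmod (corr u (deriv a) (deriv b) y) \<le> B" "\<And>y. cmod (corr u a (deriv (deriv b)) y) \<le> B"
    using corr_bounds[OF u fg] by metis
  define G where "G = (\<lambda>i y. - (if i = (1::2) then corr u (deriv a) b y else corr u a (deriv b) y))"
  define H where "H = (\<lambda>i j y. (if i = (1::2) \<and> j = (1::2) then corr u (deriv (deriv a)) b y
     else if i = 1 \<or> j = 1 then corr u (deriv a) (deriv b) y else corr u a (deriv (deriv b)) y))"
  note m = corr_measurable[OF u]
  have "(LINT x|lborel. green_diff x * (H 1 1 x - H 2 2 x + 2 * \<sigma> * H 1 2 x))
     = (LINT x|lborel. (of_real (x $ 1) + \<sigma> * of_real (x $ 2))\<^sup>2 / of_real ((norm x)\<^sup>2) * radial_hess x * corr u a b x)"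
  proof (rule traceless_kernel[where B = B and G = G])
    show "corr u a b \<in> borel_measurable borel" by (rule m[OF fg])
    show "G i \<in> borel_measurable borel" for i
      unfolding G_def using m[OF deriv_bump[OF fg(1)] fg(2)] m[OF fg(1) deriv_bump[OF fg(2)]]
      by (cases "i = 1") auto
    show "H i j \<in> borel_measurable borel" for i j
      unfolding H_def using m[OF deriv_bump[OF deriv_bump[OF fg(1)]] fg(2)] m[OF fg(1) deriv_bump[OF deriv_bump[OF fg(2)]]]
        m[OF deriv_bump[OF fg(1)] deriv_bump[OF fg(2)]]
      by (cases "i = 1"; cases "j = 1") auto
    show "cmod (corr u a b x) \<le> B" for x by (rule B)
    show "cmod (G i x) \<le> B" for i x unfolding G_def using B(2,3) by (cases "i = 1") auto
    show "cmod (H i j x) \<le> B" for i j x unfolding H_def using B(4,5,6) by (cases "i = 1"; cases "j = 1") auto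
    show "((\<lambda>s. corr u a b (x + s *\<^sub>R axis i 1)) has_vector_derivative G i x) (at 0)" for i x
      unfolding G_def by (rule corr_derivative_family[OF u fg])
    show "((\<lambda>s. G j (x + s *\<^sub>R axis i 1)) has_vector_derivative H i j x) (at 0)" for i j x
    proof -
      have i: "i = 1 \<or> i = 2" and j: "j = 1 \<or> j = 2" using exhaust_2 by blast+
      show ?thesis
        using i j has_vector_derivative_minus[OF corr_derivatives(1)[OF u deriv_bump[OF fg(1)] fg(2)], of x]
          has_vector_derivative_minus[OF corr_derivatives(2)[OF u deriv_bump[OF fg(1)] fg(2)], of x]
          has_vector_derivative_minus[OF corr_derivatives(1)[OF u fg(1) deriv_bump[OF fg(2)]], of x]
          has_vector_derivative_minus[OF corr_derivatives(2)[OF u fg(1) deriv_bump[OF fg(2)]], of x]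
        by (auto simp: G_def H_def)
    qed
  qed (rule \<sigma>)
  then show ?thesis by (simp add: H_def)
qed

lemma corr_translate:
  "corr u a b y = (LINT z|lborel. u z * tensor (\<lambda>t. a (t - y $ 1)) (\<lambda>t. b (t - y $ 2)) z)"
  unfolding corr_def tensor_translate by (rule refl)

lemma corr_0: "corr u a b 0 = (LINT z|lborel. u z * tensor a b z)"
  by (simp add: corr_def)

section \<open>The inverse of the square of the Laplacian minus \<open>\<mu>\<^sup>2\<close>\<close>

context bessel_pair
begin

text \<open>The angular factor has modulus \<open>1\<close>; it is the square of the unimodular function
  \<open>(x\<^sub>1 + \<sigma> x\<^sub>2) / |x|\<close>, as in the kernel of the Beurling transform.\<close>
definition beurling where
  "beurling \<sigma> (x::real ^ 2) = (of_real (x $ 1) + \<sigma> * of_real (x $ 2))\<^sup>2 / of_real ((norm x)\<^sup>2) * radial_hess x"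

lemma beurling_measurable [measurable]: "beurling \<sigma> \<in> borel_measurable borel"
  unfolding beurling_def by measurable

lemma norm_beurling_le:
  assumes "\<sigma> = \<i> \<or> \<sigma> = - \<i>" "x \<noteq> 0"
  shows "cmod (beurling \<sigma> x) \<le> 14 * \<rho>0\<^sup>2 * decay \<rho>0 \<alpha> (norm x)"
  unfolding beurling_def norm_mult norm_traceless_symbol[OF assms] using norm_radial_hess_le[OF assms(2)] by simp

lemma decay_bounds:
  assumes "r > 0" shows "0 \<le> decay \<rho>0 \<alpha> r" "decay \<rho>0 \<alpha> r \<le> 1"
  using assms \<rho>0_pos by (auto simp: decay_def)

lemma integrable_decay_square: "integrable lborel (\<lambda>x::real ^ 2. (decay \<rho>0 \<alpha> (norm x))\<^sup>2)"
  by (rule integral_decay_square_le(1)[OF \<rho>0_pos alpha(1)])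

lemma square_integrable_of_decay:
  fixes h :: "real ^ 2 \<Rightarrow> complex"
  assumes "h \<in> borel_measurable borel" "\<And>x. x \<noteq> 0 \<Longrightarrow> cmod (h x) \<le> C * decay \<rho>0 \<alpha> (norm x)"
  shows "integrable lborel (\<lambda>x. (cmod (h x))\<^sup>2)"
proof (rule Bochner_Integration.integrable_bound)
  show "integrable lborel (\<lambda>x::real ^ 2. C\<^sup>2 * (decay \<rho>0 \<alpha> (norm x))\<^sup>2)"
    by (intro integrable_mult_right integrable_decay_square)
  show "AE x in lborel. norm ((cmod (h x))\<^sup>2) \<le> norm (C\<^sup>2 * (decay \<rho>0 \<alpha> (norm x))\<^sup>2)"
    using AE_lborel_singleton[of "0 :: real ^ 2"]
  proof eventually_elim
    case (elim x)
    have "(cmod (h x))\<^sup>2 \<le> (C * decay \<rho>0 \<alpha> (norm x))\<^sup>2"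
      using assms(2)[OF elim] by (intro power_mono) auto
    then show ?case by (simp add: power_mult_distrib)
  qed
qed (use assms(1) in measurable)

lemma integrable_beurling: "\<sigma> = \<i> \<or> \<sigma> = - \<i> \<Longrightarrow> integrable lborel (beurling \<sigma>)"
proof (rule Bochner_Integration.integrable_bound[OF integrable_radial_hess])
  assume \<sigma>: "\<sigma> = \<i> \<or> \<sigma> = - \<i>"
  show "AE x in lborel. norm (beurling \<sigma> x) \<le> norm (radial_hess x)"
    using AE_lborel_singleton[of "0 :: real ^ 2"]
  proof eventually_elim
    case (elim x)
    show ?case unfolding beurling_def norm_mult norm_traceless_symbol[OF \<sigma> elim] by simp
  qed
qed measurable

text \<open>Let \<open>W\<close> be the correlation of the left side of the equation. Since
  \<open>\<Delta>\<^sup>2 - \<mu>\<^sup>2 = (- \<mu> - \<Delta>) (\<mu> - \<Delta>)\<close>, integrating \<open>W\<close> against the first Green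
  function leaves \<open>c (\<mu> - \<Delta>)\<close> of the correlation at the origin, and against the second
  one \<open>c (- \<mu> - \<Delta>)\<close> of it. The difference is \<open>2 \<mu> c\<close> times its value, without
  derivatives. On the right side the second order operator is moved onto the difference of Green
  functions and Fubini's theorem turns the pairing into convolutions; the fundamental lemma
  removes the test function.\<close>
theorem representation:
  fixes \<mu> \<gamma> \<sigma> :: complex
  assumes om: "om1\<^sup>2 = - \<mu>" "om2\<^sup>2 = \<mu>" and \<sigma>: "\<sigma> = \<i> \<or> \<sigma> = - \<i>"
    and u: "u \<in> borel_L2" and g1: "g1 \<in> borel_L2" and g2: "g2 \<in> borel_L2"
    and weak: "\<And>a b. a \<in> bumps \<Longrightarrow> b \<in> bumps \<Longrightarrow>
      (LINT z|lborel. u z * tensor (deriv (deriv (deriv (deriv a)))) b z)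
      + 2 * (LINT z|lborel. u z * tensor (deriv (deriv a)) (deriv (deriv b)) z)
      + (LINT z|lborel. u z * tensor a (deriv (deriv (deriv (deriv b)))) z)
      - \<mu>\<^sup>2 * (LINT z|lborel. u z * tensor a b z)
      = \<gamma> * (LINT z|lborel. g1 z * tensor a b z)
        + ((LINT z|lborel. g2 z * tensor (deriv (deriv a)) b z) - (LINT z|lborel. g2 z * tensor a (deriv (deriv b)) z)
          + 2 * \<sigma> * (LINT z|lborel. g2 z * tensor (deriv a) (deriv b) z))"
  shows "AE x in lborel. 2 * \<mu> * of_real kernel_mass * u x = \<gamma> * convol green_diff g1 x + convol (beurling \<sigma>) g2 x"
proof -
  have \<sigma>2: "\<sigma>\<^sup>2 = -1" using \<sigma> by auto
  let ?c = "of_real kernel_mass :: complex"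
  have sqf: "integrable lborel (\<lambda>x. (cmod (green_diff x))\<^sup>2)"
    by (rule square_integrable_of_decay[OF _ norm_green_diff_le]) auto
  have sqS: "integrable lborel (\<lambda>x. (cmod (beurling \<sigma> x))\<^sup>2)"
    by (rule square_integrable_of_decay[OF _ norm_beurling_le[OF \<sigma>]]) auto
  have intS: "integrable lborel (beurling \<sigma>)" by (rule integrable_beurling[OF \<sigma>])
  have key: "2 * \<mu> * ?c * (LINT z|lborel. u z * tensor a b z)
      = (LINT x|lborel. (\<gamma> * convol green_diff g1 x + convol (beurling \<sigma>) g2 x) * tensor a b x)"
    if a: "a \<in> bumps" and b: "b \<in> bumps" for a b
  proof -
    define a1 where "a1 = deriv a"
    define a2 where "a2 = deriv a1"
    define a4 where "a4 = deriv (deriv a2)"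
    define b1 where "b1 = deriv b"
    define b2 where "b2 = deriv b1"
    define b4 where "b4 = deriv (deriv b2)"
    have ab [simp]: "a \<in> bumps" "a1 \<in> bumps" "a2 \<in> bumps" "a4 \<in> bumps" "b \<in> bumps" "b1 \<in> bumps" "b2 \<in> bumps" "b4 \<in> bumps"
      using a b by (auto simp: a1_def a2_def a4_def b1_def b2_def b4_def intro!: deriv_bump)
    define W where "W = (\<lambda>y. corr u a4 b y + 2 * corr u a2 b2 y + corr u a b4 y - \<mu>\<^sup>2 * corr u a b y)"
    \<comment> \<open>The translates of the bumps are again bumps, so the weak equation holds for the
      correlations at every point.\<close>
    have Weq: "W y = \<gamma> * corr g1 a b y + (corr g2 a2 b y - corr g2 a b2 y + 2 * \<sigma> * corr g2 a1 b1 y)" for y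
    proof -
      define A where "A = (\<lambda>t. a (t - y $ 1))"
      define B where "B = (\<lambda>t. b (t - y $ 2))"
      have AB: "A \<in> bumps" "B \<in> bumps" unfolding A_def B_def by (intro bumps_translate ab)+
      have dA: "deriv A = (\<lambda>t. a1 (t - y $ 1))" "deriv (deriv A) = (\<lambda>t. a2 (t - y $ 1))"
        "deriv (deriv (deriv (deriv A))) = (\<lambda>t. a4 (t - y $ 1))"
        unfolding A_def a1_def a2_def a4_def by (simp_all add: deriv_translate a deriv_bump)
      have dB: "deriv B = (\<lambda>t. b1 (t - y $ 2))" "deriv (deriv B) = (\<lambda>t. b2 (t - y $ 2))"
        "deriv (deriv (deriv (deriv B))) = (\<lambda>t. b4 (t - y $ 2))"
        unfolding B_def b1_def b2_def b4_def by (simp_all add: deriv_translate b deriv_bump)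
      show ?thesis
        using weak[OF AB] unfolding dA(3) dB(3) unfolding dA(2) dB(2) unfolding dA(1) dB(1) unfolding A_def B_def corr_translate[symmetric] W_def .
    qed
    have bint: "integrable lborel (\<lambda>x. K x * corr v a' b' x)"
      if t: "integrable lborel K" "v \<in> borel_L2" "a' \<in> bumps" "b' \<in> bumps" for K v a' b'
    proof -
      obtain B where "\<And>y. cmod (corr v a' b' y) \<le> B" using corr_bounded[OF t(2-4)] by metis
      then show ?thesis by (intro integrable_mult_bounded t corr_measurable)
    qed
    have fund: "(LINT x|lborel. k1.green x * (- \<mu> * corr u a' b' x - (corr u (deriv (deriv a')) b' x + corr u a' (deriv (deriv b')) x))) = ?c * corr u a' b' 0"
      "(LINT x|lborel. k2.green x * (\<mu> * corr u a' b' x - (corr u (deriv (deriv a')) b' x + corr u a' (deriv (deriv b')) x))) = ?c * corr u a' b' 0"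
      "integrable lborel (\<lambda>x. k1.green x * (- \<mu> * corr u a' b' x - (corr u (deriv (deriv a')) b' x + corr u a' (deriv (deriv b')) x)))"
      "integrable lborel (\<lambda>x. k2.green x * (\<mu> * corr u a' b' x - (corr u (deriv (deriv a')) b' x + corr u a' (deriv (deriv b')) x)))"
      if "a' \<in> bumps" "b' \<in> bumps" for a' b'
    proof -
      show "(LINT x|lborel. k1.green x * (- \<mu> * corr u a' b' x - (corr u (deriv (deriv a')) b' x + corr u a' (deriv (deriv b')) x))) = ?c * corr u a' b' 0"
        using k1.corr_fundamental_solution[OF u that] unfolding om .
      show "(LINT x|lborel. k2.green x * (\<mu> * corr u a' b' x - (corr u (deriv (deriv a')) b' x + corr u a' (deriv (deriv b')) x))) = ?c * corr u a' b' 0"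
        using k2.corr_fundamental_solution[OF u that] unfolding om .
      have "integrable lborel (\<lambda>x. K x * (m * corr u a' b' x - (corr u (deriv (deriv a')) b' x + corr u a' (deriv (deriv b')) x)))"
        if K: "integrable lborel K" for K m
      proof -
        have "(\<lambda>x. K x * (m * corr u a' b' x - (corr u (deriv (deriv a')) b' x + corr u a' (deriv (deriv b')) x)))
          = (\<lambda>x. m * (K x * corr u a' b' x) - (K x * corr u (deriv (deriv a')) b' x + K x * corr u a' (deriv (deriv b')) x))"
          by (simp add: fun_eq_iff algebra_simps)
        then show ?thesis
          by (simp only:) (intro Bochner_Integration.integrable_diff Bochner_Integration.integrable_add
            integrable_mult_right bint[OF K u] deriv_bump \<open>a' \<in> bumps\<close> \<open>b' \<in> bumps\<close>)
      qed
      then show "integrable lborel (\<lambda>x. k1.green x * (- \<mu> * corr u a' b' x - (corr u (deriv (deriv a')) b' x + corr u a' (deriv (deriv b')) x)))"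
        "integrable lborel (\<lambda>x. k2.green x * (\<mu> * corr u a' b' x - (corr u (deriv (deriv a')) b' x + corr u a' (deriv (deriv b')) x)))"
        using k1.integrable_green k2.integrable_green by blast+
    qed
    have d2: "deriv a1 = a2" "deriv b1 = b2" "deriv (deriv a2) = a4" "deriv (deriv b2) = b4" "deriv a = a1" "deriv b = b1"
      by (simp_all add: a1_def a2_def a4_def b1_def b2_def b4_def)
    note f00 = fund[OF ab(1) ab(5), unfolded d2] and f20 = fund[OF ab(3) ab(5), unfolded d2] and f02 = fund[OF ab(1) ab(7), unfolded d2]
    \<comment> \<open>The factorisation of the fourth order operator, written out for the correlations.\<close>
    have W1: "k1.green x * W x = \<mu> * (k1.green x * (- \<mu> * corr u a b x - (corr u a2 b x + corr u a b2 x)))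
        - k1.green x * (- \<mu> * corr u a2 b x - (corr u a4 b x + corr u a2 b2 x))
        - k1.green x * (- \<mu> * corr u a b2 x - (corr u a2 b2 x + corr u a b4 x))" for x
      by (simp add: W_def algebra_simps power2_eq_square)
    have W2: "k2.green x * W x = - \<mu> * (k2.green x * (\<mu> * corr u a b x - (corr u a2 b x + corr u a b2 x)))
        - k2.green x * (\<mu> * corr u a2 b x - (corr u a4 b x + corr u a2 b2 x))
        - k2.green x * (\<mu> * corr u a b2 x - (corr u a2 b2 x + corr u a b4 x))" for x
      by (simp add: W_def algebra_simps power2_eq_square)
    have iW1: "integrable lborel (\<lambda>x. k1.green x * W x)" unfolding W1
      by (intro Bochner_Integration.integrable_diff integrable_mult_right f00 f20 f02)
    have iW2: "integrable lborel (\<lambda>x. k2.green x * W x)" unfolding W2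
      by (intro Bochner_Integration.integrable_diff integrable_mult_right f00 f20 f02)
    have L1: "(LINT x|lborel. k1.green x * W x) = \<mu> * (?c * corr u a b 0) - ?c * corr u a2 b 0 - ?c * corr u a b2 0"
      unfolding W1
      by (subst Bochner_Integration.integral_diff, intro Bochner_Integration.integrable_diff integrable_mult_right f00 f20 f02, rule f02,
          subst Bochner_Integration.integral_diff, intro integrable_mult_right f00, rule f20, subst integral_mult_right_zero)
         (simp only: f00 f20 f02)
    have L2: "(LINT x|lborel. k2.green x * W x) = - \<mu> * (?c * corr u a b 0) - ?c * corr u a2 b 0 - ?c * corr u a b2 0"
      unfolding W2
      by (subst Bochner_Integration.integral_diff, intro Bochner_Integration.integrable_diff integrable_mult_right f00 f20 f02, rule f02,
          subst Bochner_Integration.integral_diff, intro integrable_mult_right f00, rule f20, subst integral_mult_right_zero)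
         (simp only: f00 f20 f02)
    have "(\<lambda>x. green_diff x * W x) = (\<lambda>x. k1.green x * W x - k2.green x * W x)" by (simp add: green_diff_def fun_eq_iff algebra_simps)
    then have "(LINT x|lborel. green_diff x * W x) = (LINT x|lborel. k1.green x * W x) - (LINT x|lborel. k2.green x * W x)"
      using iW1 iW2 by simp
    also have "\<dots> = 2 * \<mu> * ?c * corr u a b 0" unfolding L1 L2 by (simp add: algebra_simps)
    finally have lhs: "(LINT x|lborel. green_diff x * W x) = 2 * \<mu> * ?c * corr u a b 0" .
    have iH: "integrable lborel (\<lambda>x. green_diff x * (corr g2 a2 b x - corr g2 a b2 x + 2 * \<sigma> * corr g2 a1 b1 x))"
    proof -
      have "(\<lambda>x. green_diff x * (corr g2 a2 b x - corr g2 a b2 x + 2 * \<sigma> * corr g2 a1 b1 x))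
        = (\<lambda>x. green_diff x * corr g2 a2 b x - green_diff x * corr g2 a b2 x + 2 * \<sigma> * (green_diff x * corr g2 a1 b1 x))"
        by (simp add: fun_eq_iff algebra_simps)
      then show ?thesis
        by (simp only:) (intro Bochner_Integration.integrable_diff Bochner_Integration.integrable_add
          integrable_mult_right bint[OF integrable_green_diff g2] ab)
    qed
    have "(\<lambda>x. green_diff x * W x) = (\<lambda>x. \<gamma> * (green_diff x * corr g1 a b x) + green_diff x * (corr g2 a2 b x - corr g2 a b2 x + 2 * \<sigma> * corr g2 a1 b1 x))"
      unfolding Weq by (simp add: fun_eq_iff algebra_simps)
    then have "(LINT x|lborel. green_diff x * W x) = \<gamma> * (LINT x|lborel. green_diff x * corr g1 a b x)
        + (LINT x|lborel. green_diff x * (corr g2 a2 b x - corr g2 a b2 x + 2 * \<sigma> * corr g2 a1 b1 x))"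
      using bint[OF integrable_green_diff g1 ab(1) ab(5)] iH by simp
    also have "(LINT x|lborel. green_diff x * (corr g2 a2 b x - corr g2 a b2 x + 2 * \<sigma> * corr g2 a1 b1 x)) = (LINT x|lborel. beurling \<sigma> x * corr g2 a b x)"
      using corr_traceless[OF g2 a b \<sigma>2] unfolding d2 beurling_def .
    also have "(LINT x|lborel. beurling \<sigma> x * corr g2 a b x) = (LINT x|lborel. convol (beurling \<sigma>) g2 x * tensor a b x)"
      unfolding convol_def by (rule corr_kernel_Fubini(2)[OF intS g2 a b])
    also have "(LINT x|lborel. green_diff x * corr g1 a b x) = (LINT x|lborel. convol green_diff g1 x * tensor a b x)"
      unfolding convol_def by (rule corr_kernel_Fubini(2)[OF integrable_green_diff g1 a b])
    also have "\<gamma> * (LINT x|lborel. convol green_diff g1 x * tensor a b x) + (LINT x|lborel. convol (beurling \<sigma>) g2 x * tensor a b x)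
      = (LINT x|lborel. \<gamma> * (convol green_diff g1 x * tensor a b x) + convol (beurling \<sigma>) g2 x * tensor a b x)"
    proof -
      have "integrable lborel (\<lambda>x. convol green_diff g1 x * tensor a b x)" "integrable lborel (\<lambda>x. convol (beurling \<sigma>) g2 x * tensor a b x)"
        using corr_kernel_Fubini(1)[OF integrable_green_diff g1 a b] corr_kernel_Fubini(1)[OF intS g2 a b]
        by (simp_all only: convol_def mult.commute)
      then show ?thesis by simp
    qed
    also have "(\<lambda>x. \<gamma> * (convol green_diff g1 x * tensor a b x) + convol (beurling \<sigma>) g2 x * tensor a b x)
       = (\<lambda>x. (\<gamma> * convol green_diff g1 x + convol (beurling \<sigma>) g2 x) * tensor a b x)"
      by (simp add: fun_eq_iff algebra_simps)
    finally show ?thesis using lhs by (simp add: corr_0)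
  qed
  define h where "h = (\<lambda>x. 2 * \<mu> * ?c * u x - 1 * (\<gamma> * convol green_diff g1 x - (-1) * convol (beurling \<sigma>) g2 x))"
  have "locally_integrable h"
    unfolding h_def
    by (intro locally_integrable_lincomb borel_L2_locally_integrable u convol_locally_integrable g1 g2 sqf sqS) auto
  then have "AE x in lborel. h x = 0"
  proof (rule fundamental_lemma)
    fix a b assume ab: "a \<in> bumps" "b \<in> bumps"
    have 1: "integrable lborel (\<lambda>x. u x * tensor a b x)"
      using integrable_corr[OF u ab, of 0] by simp
    have "integrable lborel (\<lambda>x. convol green_diff g1 x * tensor a b x)" "integrable lborel (\<lambda>x. convol (beurling \<sigma>) g2 x * tensor a b x)"
      using corr_kernel_Fubini(1)[OF integrable_green_diff g1 ab] corr_kernel_Fubini(1)[OF intS g2 ab]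
      by (simp_all only: convol_def mult.commute)
    then have 2: "integrable lborel (\<lambda>x. (\<gamma> * convol green_diff g1 x + convol (beurling \<sigma>) g2 x) * tensor a b x)"
      by (simp add: distrib_right mult.assoc)
    have "(\<lambda>x. h x * tensor a b x) = (\<lambda>x. 2 * \<mu> * ?c * (u x * tensor a b x) - (\<gamma> * convol green_diff g1 x + convol (beurling \<sigma>) g2 x) * tensor a b x)"
      by (simp add: h_def fun_eq_iff algebra_simps)
    then show "(LINT x|lborel. h x * tensor a b x) = 0"
      using 1 2 key[OF ab] by simp
  qed
  then show ?thesis by eventually_elim (simp add: h_def)
qed

lemma decay_times_L2_integrable:
  assumes u: "u \<in> borel_L2"
  shows "integrable lborel (\<lambda>z. decay \<rho>0 \<alpha> (norm (z - x)) * cmod (u z))"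
proof -
  have "integrable lborel (\<lambda>z. of_real (decay \<rho>0 \<alpha> (norm (z - x))) * u z)"
    by (rule convol_integrable(1)[of "\<lambda>x. of_real (decay \<rho>0 \<alpha> (norm x))"])
       (use integrable_decay_square u in auto)
  from integrable_norm[OF this] show ?thesis
  proof (rule integrable_cong_AE_imp)
    show "AE z in lborel. cmod (of_real (decay \<rho>0 \<alpha> (norm (z - x))) * u z) = decay \<rho>0 \<alpha> (norm (z - x)) * cmod (u z)"
      using AE_lborel_singleton[of x]
    proof eventually_elim
      case (elim z)
      then have "norm (z - x) > 0" by simp
      then show ?case using decay_bounds(1)[of "norm (z - x)"] by (simp add: norm_mult)
    qed
  qed (use borel_L2_measurable[OF u, measurable] in measurable)
qed

lemma norm_convol_le:
  assumes K: "K \<in> borel_measurable borel" "\<And>x. x \<noteq> 0 \<Longrightarrow> cmod (K x) \<le> C * decay \<rho>0 \<alpha> (norm x)" and u: "u \<in> borel_L2"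
  shows "cmod (convol K u x) \<le> C * (LINT z|lborel. decay \<rho>0 \<alpha> (norm (z - x)) * cmod (u z))"
proof -
  have int: "integrable lborel (\<lambda>z. K (z - x) * u z)"
    by (rule convol_integrable(1)[OF K(1) square_integrable_of_decay[OF K] u])
  have "cmod (convol K u x) \<le> (LINT z|lborel. cmod (K (z - x) * u z))"
    unfolding convol_def by (rule integral_norm_bound)
  also have "\<dots> \<le> (LINT z|lborel. C * (decay \<rho>0 \<alpha> (norm (z - x)) * cmod (u z)))"
  proof (rule integral_mono_AE)
    show "AE z in lborel. cmod (K (z - x) * u z) \<le> C * (decay \<rho>0 \<alpha> (norm (z - x)) * cmod (u z))"
      using AE_lborel_singleton[of x]
    proof eventually_elim
      case (elim z)
      then have "cmod (K (z - x)) * cmod (u z) \<le> C * decay \<rho>0 \<alpha> (norm (z - x)) * cmod (u z)"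
        by (intro mult_right_mono K(2)) auto
      then show ?case by (simp add: norm_mult mult.assoc)
    qed
  qed (intro integrable_norm int integrable_mult_right decay_times_L2_integrable u)+
  finally show ?thesis by simp
qed

text \<open>The two kernels are at most \<open>6\<close> and \<open>14 \<rho>\<^sub>0\<^sup>2 = 14 |\<mu>|\<close> times the majorant; dividing by
  \<open>2 |\<mu>| c\<close> gives the factor \<open>7 / c\<close>.\<close>
theorem pointwise_bound:
  fixes \<mu> \<gamma> \<sigma> :: complex
  assumes om: "om1\<^sup>2 = - \<mu>" "om2\<^sup>2 = \<mu>" and \<sigma>: "\<sigma> = \<i> \<or> \<sigma> = - \<i>"
    and u: "u \<in> borel_L2" and g1: "g1 \<in> borel_L2" and g2: "g2 \<in> borel_L2"
    and weak: "\<And>a b. a \<in> bumps \<Longrightarrow> b \<in> bumps \<Longrightarrow>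
      (LINT z|lborel. u z * tensor (deriv (deriv (deriv (deriv a)))) b z)
      + 2 * (LINT z|lborel. u z * tensor (deriv (deriv a)) (deriv (deriv b)) z)
      + (LINT z|lborel. u z * tensor a (deriv (deriv (deriv (deriv b)))) z)
      - \<mu>\<^sup>2 * (LINT z|lborel. u z * tensor a b z)
      = \<gamma> * (LINT z|lborel. g1 z * tensor a b z)
        + ((LINT z|lborel. g2 z * tensor (deriv (deriv a)) b z) - (LINT z|lborel. g2 z * tensor a (deriv (deriv b)) z)
          + 2 * \<sigma> * (LINT z|lborel. g2 z * tensor (deriv a) (deriv b) z))"
  shows "AE x in lborel. cmod (u x) \<le> 7 / kernel_mass * (cmod \<gamma> / cmod \<mu> + 1)
     * (LINT z|lborel. decay \<rho>0 \<alpha> (norm (z - x)) * (cmod (g1 z) + cmod (g2 z)))"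
proof -
  have "AE x in lborel. 2 * \<mu> * of_real kernel_mass * u x = \<gamma> * convol green_diff g1 x + convol (beurling \<sigma>) g2 x"
    by (rule representation[OF om \<sigma> u g1 g2 weak])
  then show ?thesis
  proof eventually_elim
    case (elim x)
    let ?D = "\<lambda>g. LINT z|lborel. decay \<rho>0 \<alpha> (norm (z - x)) * cmod (g z)"
    have \<mu>: "cmod \<mu> = \<rho>0\<^sup>2" using om(2) norm_om(2) by (metis norm_power)
    then have \<mu>0: "cmod \<mu> > 0" using \<rho>0_pos by simp
    have D0: "?D g \<ge> 0" for g
    proof (rule integral_nonneg_AE)
      show "AE z in lborel. 0 \<le> decay \<rho>0 \<alpha> (norm (z - x)) * cmod (g z)"
        using AE_lborel_singleton[of x] by eventually_elim (auto intro!: mult_nonneg_nonneg decay_bounds(1))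
    qed
    have "2 * cmod \<mu> * kernel_mass * cmod (u x) = cmod (2 * \<mu> * of_real kernel_mass * u x)"
      using kernel_mass_pos by (simp add: norm_mult)
    also have "\<dots> \<le> cmod (\<gamma> * convol green_diff g1 x) + cmod (convol (beurling \<sigma>) g2 x)"
      unfolding elim by (rule norm_triangle_ineq)
    also have "\<dots> \<le> cmod \<gamma> * (6 * ?D g1) + 14 * \<rho>0\<^sup>2 * ?D g2"
      unfolding norm_mult using norm_green_diff_le norm_beurling_le[OF \<sigma>]
      by (intro add_mono mult_left_mono norm_convol_le g1 g2) auto
    also have "\<dots> \<le> cmod \<gamma> * (14 * ?D g1) + (cmod \<gamma> * (14 * ?D g2) + 14 * cmod \<mu> * ?D g1) + 14 * \<rho>0\<^sup>2 * ?D g2"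
    proof -
      have "cmod \<gamma> * (6 * ?D g1) \<le> cmod \<gamma> * (14 * ?D g1)" using D0[of g1] by (intro mult_left_mono) auto
      moreover have "0 \<le> cmod \<gamma> * (14 * ?D g2) + 14 * cmod \<mu> * ?D g1"
        using D0[of g1] D0[of g2] by (intro add_nonneg_nonneg mult_nonneg_nonneg) auto
      ultimately show ?thesis by linarith
    qed
    also have "\<dots> = 14 * (cmod \<gamma> + cmod \<mu>) * (?D g1 + ?D g2)" unfolding \<mu> by (simp add: algebra_simps)
    finally have 1: "2 * cmod \<mu> * kernel_mass * cmod (u x) \<le> 14 * (cmod \<gamma> + cmod \<mu>) * (?D g1 + ?D g2)" .
    have sum: "(LINT z|lborel. decay \<rho>0 \<alpha> (norm (z - x)) * (cmod (g1 z) + cmod (g2 z))) = ?D g1 + ?D g2"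
      using decay_times_L2_integrable[OF g1] decay_times_L2_integrable[OF g2] by (simp add: distrib_left)
    have gen: "U \<le> 7 / c * (G / m + 1) * X" if "2 * m * c * U \<le> 14 * (G + m) * X" "m > 0" "c > 0" for U c G m X :: real
    proof -
      have "U \<le> (14 * (G + m) * X) / (2 * m * c)" using that by (simp add: pos_le_divide_eq mult_ac)
      also have "\<dots> = 7 / c * (G / m + 1) * X" using that by (simp add: field_simps)
      finally show ?thesis .
    qed
    show ?case unfolding sum by (rule gen[OF 1 \<mu>0 kernel_mass_pos])
  qed
qed

end

section \<open>Weak derivatives and the two scalar equations\<close>

lemma L2_complexD:
  assumes "f \<in> (L2 :: (real ^ 2 \<Rightarrow> complex) set)"
  shows "f \<in> borel_measurable lebesgue" "integrable lebesgue (\<lambda>x. (cmod (f x))\<^sup>2)"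
  using assms by (auto simp: L2_def)

lemma L2_borel_representative:
  assumes "f \<in> (L2 :: (real ^ 2 \<Rightarrow> complex) set)"
  obtains u where "u \<in> borel_L2" "AE x in lebesgue. f x = u x"
proof -
  have fm: "f \<in> borel_measurable lebesgue" using L2_complexD[OF assms] by simp
  have "(\<lambda>x. Re (f x)) \<in> borel_measurable lebesgue" using fm by measurable
  then obtain r where r: "r \<in> borel_measurable lborel" "AE x in lborel. Re (f x) = r x"
    using completion_ex_borel_measurable_real by blast
  have "(\<lambda>x. Im (f x)) \<in> borel_measurable lebesgue" using fm by measurable
  then obtain s where s: "s \<in> borel_measurable lborel" "AE x in lborel. Im (f x) = s x"
    using completion_ex_borel_measurable_real by blast
  define u where "u = (\<lambda>x. of_real (r x) + \<i> * of_real (s x) :: complex)"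
  have "AE x in lborel. f x = u x"
    using r(2) s(2) by eventually_elim (simp add: u_def complex_eq_iff)
  then have ae: "AE x in lebesgue. f x = u x" by (rule AE_completion)
  have um [measurable]: "u \<in> borel_measurable borel" using r(1) s(1) unfolding u_def by simp
  have "integrable lebesgue (\<lambda>x. (cmod (u x))\<^sup>2)"
  proof (rule integrable_cong_AE_imp[OF L2_complexD(2)[OF assms]])
    show "(\<lambda>x. (cmod (u x))\<^sup>2) \<in> borel_measurable lebesgue"
      by (rule measurable_completion) measurable
    show "AE x in lebesgue. (cmod (f x))\<^sup>2 = (cmod (u x))\<^sup>2"
      using ae by eventually_elim simp
  qed
  then have "integrable lborel (\<lambda>x. (cmod (u x))\<^sup>2)"
    by (subst (asm) integrable_completion) measurable
  then have "u \<in> borel_L2" using um by (simp add: borel_L2_def)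
  then show ?thesis using ae by (rule that)
qed

lemma integral_lebesgue_borel_representative:
  assumes "AE x in lebesgue. f x = u x" "f \<in> borel_measurable lebesgue" "u \<in> borel_measurable borel" "\<phi> \<in> borel_measurable borel"
  shows "(LINT x|lebesgue. f x * \<phi> x) = (LINT x|lborel. u x * (\<phi> x :: complex))"
proof -
  note [measurable] = assms(2-4)
  have "(LINT x|lebesgue. f x * \<phi> x) = (LINT x|lebesgue. u x * \<phi> x)"
  proof (rule integral_cong_AE)
    have [measurable]: "\<phi> \<in> borel_measurable lebesgue" "u \<in> borel_measurable lebesgue"
      using assms(3,4) by (auto intro: measurable_completion)
    show "(\<lambda>x. f x * \<phi> x) \<in> borel_measurable lebesgue" "(\<lambda>x. u x * \<phi> x) \<in> borel_measurable lebesgue"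
      by measurable
    show "AE x in lebesgue. f x * \<phi> x = u x * \<phi> x" using assms(1) by eventually_elim simp
  qed
  also have "\<dots> = (LINT x|lborel. u x * \<phi> x)" by (rule integral_completion) measurable
  finally show ?thesis .
qed

lemma L2_lincomb:
  assumes "f \<in> (L2 :: (real ^ 2 \<Rightarrow> complex) set)" "g \<in> L2"
  shows "(\<lambda>x. c * f x + d * g x) \<in> L2"
proof -
  note [measurable] = L2_complexD(1)[OF assms(1)] L2_complexD(1)[OF assms(2)]
  have m: "(\<lambda>x. c * f x + d * g x) \<in> borel_measurable lebesgue" by measurable
  have "integrable lebesgue (\<lambda>x. (cmod (c * f x + d * g x))\<^sup>2)"
  proof (rule Bochner_Integration.integrable_bound)
    show "integrable lebesgue (\<lambda>x. 2 * (cmod c)\<^sup>2 * (cmod (f x))\<^sup>2 + 2 * (cmod d)\<^sup>2 * (cmod (g x))\<^sup>2)"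
      using L2_complexD(2)[OF assms(1)] L2_complexD(2)[OF assms(2)]
      by (intro Bochner_Integration.integrable_add integrable_mult_right)
    show "AE x in lebesgue. norm ((cmod (c * f x + d * g x))\<^sup>2) \<le> norm (2 * (cmod c)\<^sup>2 * (cmod (f x))\<^sup>2 + 2 * (cmod d)\<^sup>2 * (cmod (g x))\<^sup>2)"
    proof (rule AE_I2)
      fix x
      have "(cmod (c * f x + d * g x))\<^sup>2 \<le> (cmod (c * f x) + cmod (d * g x))\<^sup>2"
        by (intro power_mono norm_triangle_ineq) auto
      also have "\<dots> \<le> 2 * (cmod (c * f x))\<^sup>2 + 2 * (cmod (d * g x))\<^sup>2"
        using sum_squares_bound[of "cmod (c * f x)" "cmod (d * g x)"] by (simp add: power2_sum)
      finally show "norm ((cmod (c * f x + d * g x))\<^sup>2) \<le> norm (2 * (cmod c)\<^sup>2 * (cmod (f x))\<^sup>2 + 2 * (cmod d)\<^sup>2 * (cmod (g x))\<^sup>2)"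
        by (simp add: norm_mult power_mult_distrib mult.assoc)
    qed
  qed measurable
  then show ?thesis using m by (simp add: L2_def)
qed

lemma test_function_differentiable:
  "\<phi> \<in> test_functions \<Longrightarrow> pderivs is \<phi> differentiable_on UNIV"
  by (simp add: test_functions_def)

lemma test_function_continuous:
  assumes "\<phi> \<in> test_functions" shows "continuous_on UNIV \<phi>"
  using test_function_differentiable[OF assms, of "[]"]
  by (simp add: pderivs_def differentiable_imp_continuous_on)

lemma pderiv_dir_test_function:
  assumes "\<phi> \<in> test_functions" shows "pderiv_dir i \<phi> \<in> test_functions"
proof -
  have 1: "pderivs is (pderiv_dir i \<phi>) = pderivs (is @ [i]) \<phi>" for "is"
    by (simp add: pderivs_def)
  obtain K where K: "compact K" "\<And>x. x \<notin> K \<Longrightarrow> \<phi> x = 0"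
    using assms by (auto simp: test_functions_def)
  have "pderiv_dir i \<phi> x = 0" if x: "x \<notin> K" for x
  proof -
    have "(\<phi> has_derivative (\<lambda>_. 0)) (at x)"
    proof (rule has_derivative_transform_within_open)
      show "((\<lambda>_. 0) has_derivative (\<lambda>_. 0)) (at x)" by simp
      show "open (- K)" using K(1) compact_imp_closed by blast
    qed (use x K in auto)
    then have "frechet_derivative \<phi> (at x) = (\<lambda>_. 0)" by (simp add: frechet_derivative_at[symmetric])
    then show ?thesis by (simp add: pderiv_dir_def)
  qed
  moreover have "pderivs is (pderiv_dir i \<phi>) differentiable_on UNIV" for "is"
    unfolding 1 by (rule test_function_differentiable[OF assms])
  ultimately show ?thesis
    using K(1) by (auto simp: test_functions_def)
qed

lemma test_function_L2:
  assumes "\<phi> \<in> test_functions"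
  shows "\<phi> \<in> borel_measurable borel" "integrable lborel (\<lambda>x. (cmod (\<phi> x))\<^sup>2)"
proof -
  show m [measurable]: "\<phi> \<in> borel_measurable borel"
    by (intro borel_measurable_continuous_onI test_function_continuous assms)
  obtain K where K: "compact K" "\<And>x. x \<notin> K \<Longrightarrow> \<phi> x = 0"
    using assms by (auto simp: test_functions_def)
  have "bounded (\<phi> ` K)"
    using continuous_on_subset[OF test_function_continuous[OF assms]] K(1)
    by (intro compact_imp_bounded compact_continuous_image) auto
  then obtain B where B: "\<And>x. x \<in> K \<Longrightarrow> cmod (\<phi> x) \<le> B" by (auto simp: bounded_iff)
  show "integrable lborel (\<lambda>x. (cmod (\<phi> x))\<^sup>2)"
  proof (rule Bochner_Integration.integrable_bound)
    show "integrable lborel (\<lambda>x. B\<^sup>2 * indicator K x)"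
      using emeasure_bounded_finite[OF compact_imp_bounded[OF K(1)]] compact_imp_closed[OF K(1)]
      by (intro integrable_mult_right integrable_real_indicator) auto
    show "AE x in lborel. norm ((cmod (\<phi> x))\<^sup>2) \<le> norm (B\<^sup>2 * indicator K x)"
    proof (rule AE_I2)
      fix x
      show "norm ((cmod (\<phi> x))\<^sup>2) \<le> norm (B\<^sup>2 * indicator K x)"
        using B[of x] K(2)[of x] by (cases "x \<in> K") (auto intro: power_mono)
    qed
  qed measurable
qed

lemma integrable_L2_test_function:
  assumes f: "f \<in> L2" and \<phi>: "\<phi> \<in> test_functions"
  shows "integrable lebesgue (\<lambda>x. f x * \<phi> x)"
proof (rule Bochner_Integration.integrable_bound)
  have m: "\<phi> \<in> borel_measurable lebesgue"
    using test_function_L2(1)[OF \<phi>] by (simp add: measurable_completion)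
  have "integrable lebesgue (\<lambda>x. (cmod (\<phi> x))\<^sup>2)"
    using test_function_L2[OF \<phi>] by (subst integrable_completion) auto
  then show "integrable lebesgue (\<lambda>x. (cmod (f x))\<^sup>2 + (cmod (\<phi> x))\<^sup>2)"
    using L2_complexD(2)[OF f] by (intro Bochner_Integration.integrable_add)
  show "AE x in lebesgue. norm (f x * \<phi> x) \<le> norm ((cmod (f x))\<^sup>2 + (cmod (\<phi> x))\<^sup>2)"
  proof (rule AE_I2)
    fix x
    have "2 * cmod (f x) * cmod (\<phi> x) \<le> (cmod (f x))\<^sup>2 + (cmod (\<phi> x))\<^sup>2" by (rule sum_squares_bound)
    moreover have "0 \<le> cmod (f x) * cmod (\<phi> x)" by simp
    ultimately have "cmod (f x) * cmod (\<phi> x) \<le> (cmod (f x))\<^sup>2 + (cmod (\<phi> x))\<^sup>2"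
      unfolding mult.assoc by linarith
    then show "norm (f x * \<phi> x) \<le> norm ((cmod (f x))\<^sup>2 + (cmod (\<phi> x))\<^sup>2)"
      by (simp add: norm_mult)
  qed
  show "(\<lambda>x. f x * \<phi> x) \<in> borel_measurable lebesgue"
    using L2_complexD(1)[OF f] m by measurable
qed

lemma has_weak_deriv_1:
  assumes "has_weak_deriv [i] f g" "\<phi> \<in> test_functions"
  shows "(LINT x|lebesgue. f x * pderiv_dir i \<phi> x) = - (LINT x|lebesgue. g x * \<phi> x)"
  using assms by (simp add: has_weak_deriv_def pderivs_def)

lemma weak_pd_properties:
  assumes "\<exists>g\<in>L2. has_weak_deriv [i] f g"
  shows "weak_pd i f \<in> L2" "has_weak_deriv [i] f (weak_pd i f)"
  using someI_ex[of "\<lambda>g. g \<in> L2 \<and> has_weak_deriv [i] f g"] assms unfolding weak_pd_def by blast+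

lemma weak_derivative_lincomb:
  assumes "has_weak_deriv [i] f f'" "has_weak_deriv [i] g g'" "f \<in> L2" "g \<in> L2" "f' \<in> L2" "g' \<in> L2"
  shows "has_weak_deriv [i] (\<lambda>x. c * f x + d * g x) (\<lambda>x. c * f' x + d * g' x)"
  unfolding has_weak_deriv_def
proof
  fix \<phi> :: "real ^ 2 \<Rightarrow> complex" assume \<phi>: "\<phi> \<in> test_functions"
  have lin: "(LINT x|lebesgue. (c * f x + d * g x) * \<psi> x) = c * (LINT x|lebesgue. f x * \<psi> x) + d * (LINT x|lebesgue. g x * \<psi> x)"
    if "f \<in> L2" "g \<in> L2" "\<psi> \<in> test_functions" for f g :: "real ^ 2 \<Rightarrow> complex" and \<psi>
  proof -
    have "(\<lambda>x. (c * f x + d * g x) * \<psi> x) = (\<lambda>x. c * (f x * \<psi> x) + d * (g x * \<psi> x))"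
      by (simp add: fun_eq_iff algebra_simps)
    then show ?thesis
      using integrable_L2_test_function[OF that(1,3)] integrable_L2_test_function[OF that(2,3)] by simp
  qed
  show "(LINT x|lebesgue. (c * f x + d * g x) * pderivs [i] \<phi> x) =
      (- 1) ^ length [i] * (LINT x|lebesgue. (c * f' x + d * g' x) * \<phi> x)"
    using lin[OF assms(3,4) pderiv_dir_test_function[OF \<phi>, of i]] lin[OF assms(5,6) \<phi>]
      has_weak_deriv_1[OF assms(1) \<phi>] has_weak_deriv_1[OF assms(2) \<phi>]
    by (simp add: pderivs_def algebra_simps)
qed

text \<open>Both Wirtinger derivatives at once, so that each argument is carried out for one
  operator.\<close>
definition d_sigma :: "complex \<Rightarrow> (real ^ 2 \<Rightarrow> complex) \<Rightarrow> real ^ 2 \<Rightarrow> complex" where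
  "d_sigma \<sigma> f = (\<lambda>x. 1 / 2 * weak_pd 1 f x + \<sigma> / 2 * weak_pd 2 f x)"

lemma d_zbar_eq: "d_zbar = d_sigma (- \<i>)"
  by (simp add: fun_eq_iff d_zbar_def d_sigma_def field_simps)

lemma d_z_eq: "d_z = d_sigma \<i>"
  by (simp add: fun_eq_iff d_z_def d_sigma_def field_simps)

lemma d_sigma_integral:
  assumes "\<And>i. \<exists>g\<in>L2. has_weak_deriv [i] f g" "\<phi> \<in> test_functions"
  shows "d_sigma \<sigma> f \<in> L2"
    and "2 * (LINT x|lebesgue. d_sigma \<sigma> f x * \<phi> x)
      = - ((LINT x|lebesgue. f x * pderiv_dir 1 \<phi> x) + \<sigma> * (LINT x|lebesgue. f x * pderiv_dir 2 \<phi> x))"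
proof -
  note w = weak_pd_properties[OF assms(1)]
  show "d_sigma \<sigma> f \<in> L2" unfolding d_sigma_def by (intro L2_lincomb w)
  have "(\<lambda>x. d_sigma \<sigma> f x * \<phi> x) = (\<lambda>x. 1/2 * (weak_pd 1 f x * \<phi> x) + \<sigma>/2 * (weak_pd 2 f x * \<phi> x))"
    by (simp add: d_sigma_def fun_eq_iff algebra_simps)
  then show "2 * (LINT x|lebesgue. d_sigma \<sigma> f x * \<phi> x)
      = - ((LINT x|lebesgue. f x * pderiv_dir 1 \<phi> x) + \<sigma> * (LINT x|lebesgue. f x * pderiv_dir 2 \<phi> x))"
    using integrable_L2_test_function[OF w(1)[of 1] assms(2)] integrable_L2_test_function[OF w(1)[of 2] assms(2)]
      has_weak_deriv_1[OF w(2)[of 1] assms(2)] has_weak_deriv_1[OF w(2)[of 2] assms(2)]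
    by (simp add: algebra_simps)
qed

text \<open>The second order weak derivatives of \<open>f\<close> are also weak derivatives of whichever
  representative of a first derivative has been chosen, because testing determines both.\<close>
lemma H2_scalar_second_derivative:
  assumes f: "f \<in> H2_scalar"
  shows "\<exists>g\<in>L2. has_weak_deriv [i] f g" and "\<exists>g\<in>L2. has_weak_deriv [i] (weak_pd j f) g"
proof -
  have ex: "\<exists>g\<in>L2. has_weak_deriv is f g" if "length is \<le> 2" for "is"
    using f that by (auto simp: H2_scalar_def)
  show 1: "\<exists>g\<in>L2. has_weak_deriv [i] f g" for i using ex[of "[i]"] by simp
  obtain g where g: "g \<in> L2" "has_weak_deriv [j, i] f g" using ex[of "[j, i]"] by auto
  have "has_weak_deriv [i] (weak_pd j f) g"
    unfolding has_weak_deriv_def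
  proof
    fix \<phi> :: "real ^ 2 \<Rightarrow> complex" assume \<phi>: "\<phi> \<in> test_functions"
    have "(LINT x|lebesgue. f x * pderiv_dir j (pderiv_dir i \<phi>) x) = (LINT x|lebesgue. g x * \<phi> x)"
      using g(2) \<phi> by (simp add: has_weak_deriv_def pderivs_def)
    moreover have "B = - C" if "A = - B" "A = C" for A B C :: complex using that by simp
    ultimately have "(LINT x|lebesgue. weak_pd j f x * pderiv_dir i \<phi> x) = - (LINT x|lebesgue. g x * \<phi> x)"
      using has_weak_deriv_1[OF weak_pd_properties(2)[OF 1] pderiv_dir_test_function[OF \<phi>], of j i] by blast
    then show "(LINT x|lebesgue. weak_pd j f x * pderivs [i] \<phi> x) = (- 1) ^ length [i] * (LINT x|lebesgue. g x * \<phi> x)"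
      by (simp add: pderivs_def)
  qed
  then show "\<exists>g\<in>L2. has_weak_deriv [i] (weak_pd j f) g" using g(1) by blast
qed

lemma d_sigma_twice:
  assumes f: "f \<in> H2_scalar" and ab: "a \<in> bumps" "b \<in> bumps"
  shows "d_sigma \<sigma> (d_sigma \<sigma> f) \<in> L2"
    and "4 * (LINT x|lebesgue. d_sigma \<sigma> (d_sigma \<sigma> f) x * tensor a b x)
      = (LINT x|lebesgue. f x * tensor (deriv (deriv a)) b x) + 2 * \<sigma> * (LINT x|lebesgue. f x * tensor (deriv a) (deriv b) x)
        + \<sigma>\<^sup>2 * (LINT x|lebesgue. f x * tensor a (deriv (deriv b)) x)"
proof -
  have h: "\<exists>g\<in>L2. has_weak_deriv [i] (d_sigma \<sigma> f) g" for i
  proof -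
    obtain g1 where g1: "g1 \<in> L2" "has_weak_deriv [i] (weak_pd 1 f) g1" using H2_scalar_second_derivative(2)[OF f] by blast
    obtain g2 where g2: "g2 \<in> L2" "has_weak_deriv [i] (weak_pd 2 f) g2" using H2_scalar_second_derivative(2)[OF f] by blast
    have "weak_pd j f \<in> L2" for j by (rule weak_pd_properties(1)[OF H2_scalar_second_derivative(1)[OF f]])
    then have "has_weak_deriv [i] (d_sigma \<sigma> f) (\<lambda>x. 1/2 * g1 x + \<sigma>/2 * g2 x)"
      unfolding d_sigma_def by (intro weak_derivative_lincomb g1 g2)
    moreover have "(\<lambda>x. 1/2 * g1 x + \<sigma>/2 * g2 x) \<in> L2" by (intro L2_lincomb g1 g2)
    ultimately show ?thesis by blast
  qed
  have f1: "\<exists>g\<in>L2. has_weak_deriv [i] f g" for i by (rule H2_scalar_second_derivative(1)[OF f])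
  note d = deriv_bump[OF ab(1)] deriv_bump[OF ab(2)]
  note t = tensor_test_function
  show "d_sigma \<sigma> (d_sigma \<sigma> f) \<in> L2" by (rule d_sigma_integral(1)[OF h t[OF ab]])
  have "2 * (LINT x|lebesgue. d_sigma \<sigma> (d_sigma \<sigma> f) x * tensor a b x)
     = - ((LINT x|lebesgue. d_sigma \<sigma> f x * tensor (deriv a) b x) + \<sigma> * (LINT x|lebesgue. d_sigma \<sigma> f x * tensor a (deriv b) x))"
    using d_sigma_integral(2)[OF h t[OF ab]] by (simp add: pderiv_dir_tensor ab)
  moreover have "2 * (LINT x|lebesgue. d_sigma \<sigma> f x * tensor (deriv a) b x)
     = - ((LINT x|lebesgue. f x * tensor (deriv (deriv a)) b x) + \<sigma> * (LINT x|lebesgue. f x * tensor (deriv a) (deriv b) x))"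
    using d_sigma_integral(2)[OF f1 t[OF d(1) ab(2)]] by (simp add: pderiv_dir_tensor ab d)
  moreover have "2 * (LINT x|lebesgue. d_sigma \<sigma> f x * tensor a (deriv b) x)
     = - ((LINT x|lebesgue. f x * tensor (deriv a) (deriv b) x) + \<sigma> * (LINT x|lebesgue. f x * tensor a (deriv (deriv b)) x))"
    using d_sigma_integral(2)[OF f1 t[OF ab(1) d(2)]] by (simp add: pderiv_dir_tensor ab d)
  moreover have "4 * X = A + 2 * \<sigma> * B + \<sigma>\<^sup>2 * D"
    if "2 * X = - (Y + \<sigma> * Z)" "2 * Y = - (A + \<sigma> * B)" "2 * Z = - (B + \<sigma> * D)" for X Y Z A B D :: complex
  proof -
    have "4 * X = 2 * (2 * X)" by simp
    also have "\<dots> = - (2 * Y + \<sigma> * (2 * Z))" unfolding that(1) by (simp add: algebra_simps)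
    finally have "4 * X = - (2 * Y + \<sigma> * (2 * Z))" .
    then show ?thesis unfolding that(2,3) by (simp add: algebra_simps power2_eq_square)
  qed
  ultimately show "4 * (LINT x|lebesgue. d_sigma \<sigma> (d_sigma \<sigma> f) x * tensor a b x)
      = (LINT x|lebesgue. f x * tensor (deriv (deriv a)) b x) + 2 * \<sigma> * (LINT x|lebesgue. f x * tensor (deriv a) (deriv b) x)
        + \<sigma>\<^sup>2 * (LINT x|lebesgue. f x * tensor a (deriv (deriv b)) x)"
    by blast
qed

text \<open>One row of the equation, tested with a tensor product and written in terms of Borel
  measurable representatives, with the operator moved onto the test function.\<close>
lemma weak_scalar_equation:
  assumes v: "v \<in> H2_scalar" and w: "w \<in> L2" and g: "g \<in> L2" and \<sigma>: "\<sigma>\<^sup>2 = -1"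
    and eq: "AE x in lebesgue. c * w x + 4 * d_sigma \<sigma> (d_sigma \<sigma> v) x = g x"
    and vb: "v' \<in> borel_L2" "AE x in lebesgue. v x = v' x"
    and wb: "w' \<in> borel_L2" "AE x in lebesgue. w x = w' x"
    and gb: "g' \<in> borel_L2" "AE x in lebesgue. g x = g' x"
    and ab: "a \<in> bumps" "b \<in> bumps"
  shows "c * (LINT x|lborel. w' x * tensor a b x) + ((LINT x|lborel. v' x * tensor (deriv (deriv a)) b x)
      - (LINT x|lborel. v' x * tensor a (deriv (deriv b)) x) + 2 * \<sigma> * (LINT x|lborel. v' x * tensor (deriv a) (deriv b) x))
     = (LINT x|lborel. g' x * tensor a b x)"
proof -
  note d = deriv_bump[OF ab(1)] deriv_bump[OF ab(2)]
  have vL: "v \<in> L2" using v by (simp add: H2_scalar_def)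
  have rep: "(LINT x|lborel. u' x * tensor p q x) = (LINT x|lebesgue. u x * tensor p q x)"
    if "u' \<in> borel_L2" "AE x in lebesgue. u x = u' x" "u \<in> L2" "p \<in> bumps" "q \<in> bumps" for u u' p q
    using integral_lebesgue_borel_representative[OF that(2) L2_complexD(1)[OF that(3)] borel_L2_measurable[OF that(1)] tensor_measurable[OF that(4,5)]] by simp
  have dd: "d_sigma \<sigma> (d_sigma \<sigma> v) \<in> L2" by (rule d_sigma_twice(1)[OF v ab])
  have i1: "integrable lebesgue (\<lambda>x. w x * tensor a b x)" and i2: "integrable lebesgue (\<lambda>x. d_sigma \<sigma> (d_sigma \<sigma> v) x * tensor a b x)"
    by (intro integrable_L2_test_function w dd tensor_test_function ab)+
  have "(LINT x|lebesgue. g x * tensor a b x) = (LINT x|lebesgue. c * (w x * tensor a b x) + 4 * (d_sigma \<sigma> (d_sigma \<sigma> v) x * tensor a b x))"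
  proof (rule integral_cong_AE)
    show "(\<lambda>x. g x * tensor a b x) \<in> borel_measurable lebesgue"
      by (rule borel_measurable_integrable[OF integrable_L2_test_function[OF g tensor_test_function[OF ab]]])
    show "(\<lambda>x. c * (w x * tensor a b x) + 4 * (d_sigma \<sigma> (d_sigma \<sigma> v) x * tensor a b x)) \<in> borel_measurable lebesgue"
      using i1 i2 by (intro borel_measurable_integrable Bochner_Integration.integrable_add integrable_mult_right)
    show "AE x in lebesgue. g x * tensor a b x = c * (w x * tensor a b x) + 4 * (d_sigma \<sigma> (d_sigma \<sigma> v) x * tensor a b x)"
      using eq
    proof eventually_elim
      case (elim x)
      show ?case unfolding elim[symmetric] by (simp add: algebra_simps)
    qed
  qed
  also have "\<dots> = c * (LINT x|lebesgue. w x * tensor a b x) + 4 * (LINT x|lebesgue. d_sigma \<sigma> (d_sigma \<sigma> v) x * tensor a b x)"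
    using i1 i2 by simp
  also have "4 * (LINT x|lebesgue. d_sigma \<sigma> (d_sigma \<sigma> v) x * tensor a b x)
      = (LINT x|lebesgue. v x * tensor (deriv (deriv a)) b x) + 2 * \<sigma> * (LINT x|lebesgue. v x * tensor (deriv a) (deriv b) x)
        + \<sigma>\<^sup>2 * (LINT x|lebesgue. v x * tensor a (deriv (deriv b)) x)"
    by (rule d_sigma_twice(2)[OF v ab])
  finally show ?thesis
    unfolding \<sigma> rep[OF gb g ab] rep[OF wb w ab] rep[OF vb vL deriv_bump[OF d(1)] ab(2)] rep[OF vb vL ab(1) deriv_bump[OF d(2)]] rep[OF vb vL d]
    by (simp add: algebra_simps)
qed

section \<open>The resolvent of the free operator\<close>

text \<open>The principal root satisfies \<open>2 (Re \<surd>\<mu>)\<^sup>2 = |\<mu>| + Re \<mu>\<close>, and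
  \<open>(Im \<mu>)\<^sup>2 = (|\<mu>| - Re \<mu>) (|\<mu>| + Re \<mu>)\<close>.\<close>
lemma Re_csqrt_lower:
  assumes "Im \<mu> \<noteq> 0"
  shows "\<bar>Im \<mu>\<bar> / (2 * sqrt (cmod \<mu>)) \<le> Re (csqrt \<mu>)"
proof -
  have \<mu>: "cmod \<mu> > 0" using assms by auto
  have "(Im \<mu>)\<^sup>2 = (cmod \<mu> - Re \<mu>) * (cmod \<mu> + Re \<mu>)"
    by (simp add: cmod_power2 algebra_simps flip: power2_eq_square)
  also have "\<dots> \<le> (2 * cmod \<mu>) * (cmod \<mu> + Re \<mu>)"
    using abs_Re_le_cmod[of \<mu>] by (intro mult_right_mono) linarith+
  finally have "(\<bar>Im \<mu>\<bar> / (2 * sqrt (cmod \<mu>)))\<^sup>2 \<le> (cmod \<mu> + Re \<mu>) / 2"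
    using \<mu> by (simp add: power_divide power_mult_distrib field_simps)
  then have "\<bar>Im \<mu>\<bar> / (2 * sqrt (cmod \<mu>)) \<le> sqrt ((cmod \<mu> + Re \<mu>) / 2)"
    by (rule real_le_rsqrt)
  then show ?thesis by simp
qed

lemma bessel_pair_csqrt:
  assumes "Im \<mu> \<noteq> 0"
  shows "bessel_pair (csqrt (- \<mu>)) (csqrt \<mu>) (sqrt (cmod \<mu>)) (\<bar>Im \<mu>\<bar> / (2 * sqrt (cmod \<mu>)))"
proof
  have \<mu>: "cmod \<mu> > 0" using assms by auto
  then have pos: "\<bar>Im \<mu>\<bar> / (2 * sqrt (cmod \<mu>)) > 0" using assms by simp
  show "\<bar>Im \<mu>\<bar> / (2 * sqrt (cmod \<mu>)) > 0" by (rule pos)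
  show "\<bar>Im \<mu>\<bar> / (2 * sqrt (cmod \<mu>)) \<le> Re (csqrt (- \<mu>))" using Re_csqrt_lower[of "- \<mu>"] assms by simp
  then show "0 < Re (csqrt (- \<mu>))" using pos by linarith
  show "\<bar>Im \<mu>\<bar> / (2 * sqrt (cmod \<mu>)) \<le> Re (csqrt \<mu>)" using Re_csqrt_lower[of "\<mu>"] assms by simp
  then show "0 < Re (csqrt \<mu>)" using pos by linarith
  show "cmod (csqrt (- \<mu>)) = sqrt (cmod \<mu>)" "cmod (csqrt \<mu>) = sqrt (cmod \<mu>)"
    by (metis norm_power power2_csqrt real_sqrt_unique norm_ge_zero norm_minus_cancel)+
qed

definition resolvent_decay :: "complex \<Rightarrow> real \<Rightarrow> real" where
  "resolvent_decay \<mu> = decay (sqrt (cmod \<mu>)) (\<bar>Im \<mu>\<bar> / (2 * sqrt (cmod \<mu>)))"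

text \<open>Eliminate one component: multiply its row by a constant and apply the second order
  operator in that row to the other row, which is legitimate because the rows hold for all test
  functions. The two operators compose to \<open>\<Delta>\<^sup>2\<close>, and the zeroth order terms to
  \<open>m\<^sup>2 - \<kappa>\<^sup>2 = - \<mu>\<^sup>2\<close>.\<close>
theorem resolvent_pointwise_bound:
  fixes \<kappa> \<mu> :: complex and m :: real
  assumes u: "u \<in> H2" and g: "\<And>i. (\<lambda>x. g x $ i) \<in> L2"
    and eq: "AE x in lebesgue. D_free m u x - \<kappa> *s u x = g x"
    and \<mu>: "\<mu>\<^sup>2 = \<kappa>\<^sup>2 - (of_real m)\<^sup>2" "Im \<mu> \<noteq> 0"
    and ub: "\<And>i. u' i \<in> borel_L2" "\<And>i. AE x in lebesgue. u x $ i = u' i x"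
    and gb: "\<And>i. g' i \<in> borel_L2" "\<And>i. AE x in lebesgue. g x $ i = g' i x"
  shows "AE x in lborel. cmod (u' 1 x) \<le> 7 / kernel_mass * (cmod (\<kappa> + of_real m) / cmod \<mu> + 1)
     * (LINT z|lborel. resolvent_decay \<mu> (norm (z - x)) * (cmod (g' 1 z) + cmod (g' 2 z)))"
    and "AE x in lborel. cmod (u' 2 x) \<le> 7 / kernel_mass * (cmod (\<kappa> - of_real m) / cmod \<mu> + 1)
     * (LINT z|lborel. resolvent_decay \<mu> (norm (z - x)) * (cmod (g' 1 z) + cmod (g' 2 z)))"
proof -
  interpret bessel_pair "csqrt (- \<mu>)" "csqrt \<mu>" "sqrt (cmod \<mu>)" "\<bar>Im \<mu>\<bar> / (2 * sqrt (cmod \<mu>))"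
    by (rule bessel_pair_csqrt[OF \<mu>(2)])
  have uH: "(\<lambda>x. u x $ i) \<in> H2_scalar" for i using u by (simp add: H2_def)
  have uL: "(\<lambda>x. u x $ i) \<in> L2" for i using uH[of i] by (simp add: H2_scalar_def)
  have eq1: "AE x in lebesgue. (of_real m - \<kappa>) * u x $ 1 + 4 * d_sigma (- \<i>) (d_sigma (- \<i>) (\<lambda>x. u x $ 2)) x = g x $ 1"
    using eq
  proof eventually_elim
    case (elim x)
    from arg_cong[OF elim, of "\<lambda>v. v $ 1"] show ?case
      by (simp add: D_free_def d_zbar_eq algebra_simps)
  qed
  have eq2: "AE x in lebesgue. (- of_real m - \<kappa>) * u x $ 2 + 4 * d_sigma \<i> (d_sigma \<i> (\<lambda>x. u x $ 1)) x = g x $ 2"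
    using eq
  proof eventually_elim
    case (elim x)
    from arg_cong[OF elim, of "\<lambda>v. v $ 2"] show ?case
      by (simp add: D_free_def d_z_eq algebra_simps)
  qed
  let ?U = "\<lambda>i a b. LINT x|lborel. u' i x * tensor a b x"
  let ?G = "\<lambda>i a b. LINT x|lborel. g' i x * tensor a b x"
  have E1: "(of_real m - \<kappa>) * ?U 1 a b + (?U 2 (deriv (deriv a)) b - ?U 2 a (deriv (deriv b)) + 2 * (- \<i>) * ?U 2 (deriv a) (deriv b)) = ?G 1 a b"
    if "a \<in> bumps" "b \<in> bumps" for a b
    by (rule weak_scalar_equation[OF uH uL g _ eq1 ub ub gb that]) simp
  have E2: "(- of_real m - \<kappa>) * ?U 2 a b + (?U 1 (deriv (deriv a)) b - ?U 1 a (deriv (deriv b)) + 2 * \<i> * ?U 1 (deriv a) (deriv b)) = ?G 2 a b"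
    if "a \<in> bumps" "b \<in> bumps" for a b
    by (rule weak_scalar_equation[OF uH uL g _ eq2 ub ub gb that]) simp
  have com: "csqrt (- \<mu>) ^ 2 = - \<mu>" "csqrt \<mu> ^ 2 = \<mu>" by simp_all
  show "AE x in lborel. cmod (u' 1 x) \<le> 7 / kernel_mass * (cmod (\<kappa> + of_real m) / cmod \<mu> + 1)
     * (LINT z|lborel. resolvent_decay \<mu> (norm (z - x)) * (cmod (g' 1 z) + cmod (g' 2 z)))"
    unfolding resolvent_decay_def
  proof (rule pointwise_bound[OF com, where \<sigma> = "- \<i>"])
    fix a b assume ab: "a \<in> bumps" "b \<in> bumps"
    note d = deriv_bump[OF ab(1)] deriv_bump[OF ab(2)]
    show "?U 1 (deriv (deriv (deriv (deriv a)))) b + 2 * ?U 1 (deriv (deriv a)) (deriv (deriv b)) + ?U 1 a (deriv (deriv (deriv (deriv b)))) - \<mu>\<^sup>2 * ?U 1 a b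
       = (\<kappa> + of_real m) * ?G 1 a b + (?G 2 (deriv (deriv a)) b - ?G 2 a (deriv (deriv b)) + 2 * (- \<i>) * ?G 2 (deriv a) (deriv b))"
      unfolding E1[OF ab, symmetric] E2[OF deriv_bump[OF d(1)] ab(2), symmetric] E2[OF ab(1) deriv_bump[OF d(2)], symmetric]
        E2[OF d, symmetric] \<mu>(1)
      by (simp add: algebra_simps power2_eq_square)
  qed (use ub gb in auto)
  show "AE x in lborel. cmod (u' 2 x) \<le> 7 / kernel_mass * (cmod (\<kappa> - of_real m) / cmod \<mu> + 1)
     * (LINT z|lborel. resolvent_decay \<mu> (norm (z - x)) * (cmod (g' 1 z) + cmod (g' 2 z)))"
    unfolding resolvent_decay_def add.commute[of "cmod (g' 1 _)"]
  proof (rule pointwise_bound[OF com, where \<sigma> = "\<i>"])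
    fix a b assume ab: "a \<in> bumps" "b \<in> bumps"
    note d = deriv_bump[OF ab(1)] deriv_bump[OF ab(2)]
    show "?U 2 (deriv (deriv (deriv (deriv a)))) b + 2 * ?U 2 (deriv (deriv a)) (deriv (deriv b)) + ?U 2 a (deriv (deriv (deriv (deriv b)))) - \<mu>\<^sup>2 * ?U 2 a b
       = (\<kappa> - of_real m) * ?G 2 a b + (?G 1 (deriv (deriv a)) b - ?G 1 a (deriv (deriv b)) + 2 * \<i> * ?G 1 (deriv a) (deriv b))"
      unfolding E2[OF ab, symmetric] E1[OF deriv_bump[OF d(1)] ab(2), symmetric] E1[OF ab(1) deriv_bump[OF d(2)], symmetric]
        E1[OF d, symmetric] \<mu>(1)
      by (simp add: algebra_simps power2_eq_square)
  qed (use ub gb in auto)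
qed

text \<open>Comparing real and imaginary parts, \<open>|Im \<mu>| < |Im \<kappa>|\<close> would force \<open>|Re \<mu>| < |Re \<kappa>|\<close>,
  whereas \<open>Re \<mu> Im \<mu> = Re \<kappa> Im \<kappa>\<close>. So moving the spectral parameter off the real axis moves \<open>\<mu>\<close>
  off it at least as far.\<close>
lemma abs_Im_ge_of_square_diff:
  fixes \<mu> \<kappa> :: complex and m :: real
  assumes "\<mu>\<^sup>2 = \<kappa>\<^sup>2 - (of_real m)\<^sup>2"
  shows "\<bar>Im \<kappa>\<bar> \<le> \<bar>Im \<mu>\<bar>"
proof (rule ccontr)
  assume neg: "\<not> \<bar>Im \<kappa>\<bar> \<le> \<bar>Im \<mu>\<bar>"
  have re: "(Re \<mu>)\<^sup>2 - (Im \<mu>)\<^sup>2 = (Re \<kappa>)\<^sup>2 - (Im \<kappa>)\<^sup>2 - m\<^sup>2"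
    using arg_cong[OF assms, of Re] by (simp add: power2_eq_square)
  have im: "Re \<mu> * Im \<mu> = Re \<kappa> * Im \<kappa>"
    using arg_cong[OF assms, of Im] by (simp add: power2_eq_square mult.commute)
  have lt: "(Im \<mu>)\<^sup>2 < (Im \<kappa>)\<^sup>2" 
    using neg power_strict_mono[of "\<bar>Im \<mu>\<bar>" "\<bar>Im \<kappa>\<bar>" 2] by (simp add: not_le)
  have "(Re \<mu>)\<^sup>2 < (Re \<kappa>)\<^sup>2" using re lt zero_le_power2[of m] by linarith
  then have "(Re \<mu>)\<^sup>2 * (Im \<mu>)\<^sup>2 < (Re \<kappa>)\<^sup>2 * (Im \<kappa>)\<^sup>2"
    using lt by (intro mult_strict_mono') auto
  then show False using im by (simp flip: power_mult_distrib)
qed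

section \<open>The eigenvalue inequality\<close>

lemma translate_decay:
  fixes h :: "real \<Rightarrow> real" 
  assumes [measurable]: "h \<in> borel_measurable borel"
  shows "(LINT z|lborel. h (norm (z - (x::real ^ 2)))) = (LINT z|lborel. h (norm (z::real ^ 2)))"
    and "integrable lborel (\<lambda>z::real ^ 2. h (norm z)) \<Longrightarrow> integrable lborel (\<lambda>z::real ^ 2. h (norm (z - x)))"
proof -
  have m: "(\<lambda>z::real ^ 2. h (norm z)) \<in> borel_measurable borel" by measurable
  show "(LINT z|lborel. h (norm (z - (x::real ^ 2)))) = (LINT z|lborel. h (norm (z::real ^ 2)))"
    by (rule integral_translate(1)[OF m])
  show "integrable lborel (\<lambda>z::real ^ 2. h (norm z)) \<Longrightarrow> integrable lborel (\<lambda>z::real ^ 2. h (norm (z - x)))"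
    using integral_translate(2)[OF m, of x] by simp
qed

text \<open>Here \<open>w\<close> stands for the size of the eigenfunction and \<open>v\<close> for that of the potential. The
  term with \<open>\<delta>\<close> is controlled by the \<open>L\<^sup>2\<close> norms, the weight \<open>\<delta>\<^bsup>1/2\<^esup>\<close> being chosen so that both
  contributions are \<open>O(\<delta>\<^bsup>1/2\<^esup>)\<close>. The term with \<open>v\<close> is controlled by the supremum \<open>M\<close> of \<open>w\<close> and
  Young's inequality; the free parameter \<open>\<tau>\<close> is optimised only at the very end, when Young's
  inequality becomes Hoelder's.\<close>
lemma decay_integral_bound:
  fixes w v G :: "real ^ 2 \<Rightarrow> real"
  assumes \<rho>: "\<rho> > 0" and a: "a > 0" and p: "1 < p" "p < 4/3" and s: "s = p / (p - 1)"
    and \<delta>: "\<delta> > 0" "\<delta> / 2 \<le> \<rho> * a" and \<tau>: "\<tau> > 0" and M: "M \<ge> 0"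
    and w: "AE z in lborel. 0 \<le> w z \<and> w z \<le> M" "integrable lborel (\<lambda>z. (w z)\<^sup>2)"
    and v: "\<And>z. v z \<ge> 0" "integrable lborel (\<lambda>z. v z powr p)"
    and G: "AE z in lborel. 0 \<le> G z \<and> G z \<le> 2 * (\<delta> * w z + v z * w z)"
  shows "(LINT z|lborel. decay \<rho> a (norm (z - x)) * G z)
    \<le> sqrt \<delta> * (2 * decay_mass2 + (LINT z|lborel. (w z)\<^sup>2))
      + 2 * M * (\<tau> powr s * decay_mass s / (\<rho>\<^sup>2 * s) + \<tau> powr (- p) * (LINT z|lborel. v z powr p) / p)"
proof -
  let ?d = "\<lambda>z. decay \<rho> a (norm (z - x))"
  have s4: "s > 4" using p unfolding s by (simp add: field_simps)
  have ps: "1 / s + 1 / p = 1" using p unfolding s by (simp add: field_simps)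
  define B where "B = (\<lambda>z. \<delta> * sqrt \<delta> * (?d z)\<^sup>2 + sqrt \<delta> * (w z)\<^sup>2
     + 2 * M * (\<tau> powr s / s * ?d z powr s + \<tau> powr (- p) / p * v z powr p))"
  have d0: "?d z \<ge> 0" for z using \<rho> by (intro decay_nonneg) auto
  have i1: "integrable lborel (\<lambda>z. (?d z)\<^sup>2)"
    by (rule translate_decay(2)[of "\<lambda>r. (decay \<rho> a r)\<^sup>2"]) (use integral_decay_square_le(1)[OF \<rho> a] in auto)
  have i2: "integrable lborel (\<lambda>z. ?d z powr s)"
    by (rule translate_decay(2)[of "\<lambda>r. decay \<rho> a r powr s"]) (use integral_decay_powr_le(1)[OF \<rho> less_imp_le[OF a] s4] in auto)
  have iB: "integrable lborel B"
    unfolding B_def by (intro Bochner_Integration.integrable_add integrable_mult_right i1 i2 w v)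
  have le: "AE z in lborel. 0 \<le> ?d z * G z \<and> ?d z * G z \<le> B z"
    using w(1) G
  proof eventually_elim
    case (elim z)
    have w0: "w z \<ge> 0" using elim by simp
    have "?d z * G z \<le> ?d z * (2 * (\<delta> * w z + v z * w z))"
      using elim d0 by (intro mult_left_mono) auto
    also have "\<dots> = 2 * (\<delta> * (?d z * w z)) + 2 * (w z * (?d z * v z))" by (simp add: algebra_simps)
    also have "2 * (\<delta> * (?d z * w z)) \<le> \<delta> * sqrt \<delta> * (?d z)\<^sup>2 + sqrt \<delta> * (w z)\<^sup>2"
    proof -
      have "2 * (sqrt \<delta> * ?d z) * w z \<le> (sqrt \<delta> * ?d z)\<^sup>2 + (w z)\<^sup>2" by (rule sum_squares_bound)
      then have "sqrt \<delta> * (2 * (sqrt \<delta> * ?d z) * w z) \<le> sqrt \<delta> * ((sqrt \<delta> * ?d z)\<^sup>2 + (w z)\<^sup>2)"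
        using \<delta> by (intro mult_left_mono) auto
      moreover have "sqrt \<delta> * (2 * (sqrt \<delta> * ?d z) * w z) = 2 * (\<delta> * (?d z * w z))"
      proof -
        have "sqrt \<delta> * (2 * (sqrt \<delta> * D) * W) = 2 * ((sqrt \<delta> * sqrt \<delta>) * (D * W))" for D W by (simp only: mult_ac)
        then show ?thesis using \<delta> by simp
      qed
      moreover have "sqrt \<delta> * ((sqrt \<delta> * ?d z)\<^sup>2 + (w z)\<^sup>2) = \<delta> * sqrt \<delta> * (?d z)\<^sup>2 + sqrt \<delta> * (w z)\<^sup>2"
        using \<delta> by (simp add: power_mult_distrib distrib_left mult_ac)
      ultimately show ?thesis by simp
    qed
    also have "2 * (w z * (?d z * v z)) \<le> 2 * (M * (\<tau> powr s / s * ?d z powr s + \<tau> powr (- p) / p * v z powr p))"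
    proof -
      have "(\<tau> * ?d z) * (v z / \<tau>) \<le> (\<tau> * ?d z) powr s / s + (v z / \<tau>) powr p / p"
        using s4 p ps d0[of z] v(1)[of z] \<tau> by (intro Youngs_inequality) auto
      moreover have "(\<tau> * ?d z) * (v z / \<tau>) = ?d z * v z" using \<tau> by simp
      moreover have "(\<tau> * ?d z) powr s / s = \<tau> powr s / s * ?d z powr s" using \<tau> d0[of z] by (simp add: powr_mult)
      moreover have "(v z / \<tau>) powr p / p = \<tau> powr (- p) / p * v z powr p"
        using \<tau> v(1)[of z] by (subst powr_minus_divide, subst powr_divide) auto
      ultimately have Y: "?d z * v z \<le> \<tau> powr s / s * ?d z powr s + \<tau> powr (- p) / p * v z powr p" by simp
      have "w z * (?d z * v z) \<le> M * (\<tau> powr s / s * ?d z powr s + \<tau> powr (- p) / p * v z powr p)"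
        using elim d0[of z] v(1)[of z] M by (intro mult_mono Y) auto
      then show ?thesis by simp
    qed
    finally show ?case using elim d0[of z] by (simp add: B_def)
  qed
  have "(LINT z|lborel. ?d z * G z) \<le> (LINT z|lborel. B z)"
  proof (rule integral_mono_AE')
    show "integrable lborel B" by (rule iB)
    show "AE z in lborel. ?d z * G z \<le> B z" using le by eventually_elim simp
    show "AE z in lborel. 0 \<le> B z" using le by eventually_elim linarith
  qed
  also have "(LINT z|lborel. B z) = \<delta> * sqrt \<delta> * (LINT z|lborel. (?d z)\<^sup>2) + sqrt \<delta> * (LINT z|lborel. (w z)\<^sup>2)
     + 2 * M * (\<tau> powr s / s * (LINT z|lborel. ?d z powr s) + \<tau> powr (- p) / p * (LINT z|lborel. v z powr p))"
    unfolding B_def using i1 i2 w(2) v(2) by simp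
  also have "\<dots> \<le> \<delta> * sqrt \<delta> * (2 * decay_mass2 / \<delta>) + sqrt \<delta> * (LINT z|lborel. (w z)\<^sup>2)
     + 2 * M * (\<tau> powr s / s * (decay_mass s / \<rho>\<^sup>2) + \<tau> powr (- p) / p * (LINT z|lborel. v z powr p))"
  proof (intro add_mono mult_left_mono order_refl)
    have m0: "decay_mass2 \<ge> 0" unfolding decay_mass2_def by (intro integral_nonneg_AE AE_I2) auto
    have "(LINT z|lborel. (?d z)\<^sup>2) = (LINT z|lborel. (decay \<rho> a (norm (z::real ^ 2)))\<^sup>2)"
      by (rule translate_decay(1)[of "\<lambda>r. (decay \<rho> a r)\<^sup>2"]) measurable
    also have "\<dots> \<le> decay_mass2 / (\<rho> * a)" by (rule integral_decay_square_le(2)[OF \<rho> a])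
    also have "\<dots> \<le> decay_mass2 / (\<delta> / 2)" using \<delta> \<rho> a m0 by (intro divide_left_mono mult_pos_pos) auto
    finally show "(LINT z|lborel. (?d z)\<^sup>2) \<le> 2 * decay_mass2 / \<delta>" by (simp add: mult.commute)
    have "(LINT z|lborel. ?d z powr s) = (LINT z|lborel. decay \<rho> a (norm (z::real ^ 2)) powr s)"
      by (rule translate_decay(1)[of "\<lambda>r. decay \<rho> a r powr s"]) measurable
    also have "\<dots> \<le> decay_mass s / \<rho>\<^sup>2" by (rule integral_decay_powr_le(2)[OF \<rho> less_imp_le[OF a] s4])
    finally show "(LINT z|lborel. ?d z powr s) \<le> decay_mass s / \<rho>\<^sup>2" .
  qed (use \<delta> M s4 p in auto)
  also have "\<dots> = sqrt \<delta> * (2 * decay_mass2 + (LINT z|lborel. (w z)\<^sup>2))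
      + 2 * M * (\<tau> powr s * decay_mass s / (\<rho>\<^sup>2 * s) + \<tau> powr (- p) * (LINT z|lborel. v z powr p) / p)"
    using \<delta> by (simp add: distrib_left)
  finally show ?thesis .
qed

lemma AE_eq_0_of_contraction:
  fixes w :: "'a \<Rightarrow> real"
  assumes contr: "\<And>M. M \<ge> 0 \<Longrightarrow> AE x in N. w x \<le> M \<Longrightarrow> AE x in N. w x \<le> \<theta> * M"
    and \<theta>: "0 \<le> \<theta>" "\<theta> < 1" and M: "M0 \<ge> 0" "AE x in N. w x \<le> M0"
  shows "AE x in N. w x \<le> 0"
proof -
  have "AE x in N. w x \<le> \<theta> ^ n * M0" for n
  proof (induction n)
    case (Suc n)
    from contr[OF _ this] show ?case using \<theta> M by (simp add: mult.assoc)
  qed (use M in simp)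
  then have "AE x in N. \<forall>n. w x \<le> \<theta> ^ n * M0" unfolding AE_all_countable by blast
  then show ?thesis
  proof eventually_elim
    case (elim x)
    have "(\<lambda>n. \<theta> ^ n * M0) \<longlonglongrightarrow> 0 * M0"
      using \<theta> by (intro tendsto_intros LIMSEQ_realpow_zero)
    then show ?case using elim by (intro LIMSEQ_le_const[of _ "0"]) auto
  qed
qed

lemma cmod_csqrt: "cmod (csqrt z) = sqrt (cmod z)"
proof -
  have "(cmod (csqrt z))\<^sup>2 = cmod z" by (simp flip: norm_power)
  then show ?thesis by (simp add: real_sqrt_unique)
qed

lemma norm_entry_le_mat_norm: "cmod (A $ i $ j) \<le> mat_norm A"
proof -
  have "(cmod (A $ i $ j))\<^sup>2 \<le> (\<Sum>j\<in>UNIV. (cmod (A $ i $ j))\<^sup>2)"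
    by (rule member_le_sum) auto
  also have "\<dots> \<le> (\<Sum>i\<in>UNIV. \<Sum>j\<in>UNIV. (cmod (A $ i $ j))\<^sup>2)"
    by (rule member_le_sum[of i UNIV "\<lambda>i. \<Sum>j\<in>UNIV. (cmod (A $ i $ j))\<^sup>2"]) (auto intro: sum_nonneg)
  finally show ?thesis unfolding mat_norm_def by (rule real_le_rsqrt)
qed

lemma mat_norm_nonneg: "mat_norm A \<ge> 0"
  using norm_ge_zero norm_entry_le_mat_norm by (rule order_trans)

lemma norm_mat_vec_nth_le: "cmod ((A *v x) $ i) \<le> mat_norm A * (cmod (x $ 1) + cmod (x $ 2))"
proof -
  have "cmod ((A *v x) $ i) = cmod (A $ i $ 1 * x $ 1 + A $ i $ 2 * x $ 2)"
    by (simp add: matrix_vector_mult_def sum_2)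
  also have "\<dots> \<le> cmod (A $ i $ 1) * cmod (x $ 1) + cmod (A $ i $ 2) * cmod (x $ 2)"
    by (rule order_trans[OF norm_triangle_ineq]) (simp add: norm_mult)
  also have "\<dots> \<le> mat_norm A * cmod (x $ 1) + mat_norm A * cmod (x $ 2)"
    by (intro add_mono mult_right_mono norm_entry_le_mat_norm) auto
  finally show ?thesis by (simp add: distrib_left)
qed

lemma mat_norm_measurable [measurable]: "mat_norm \<in> borel_measurable borel"
  unfolding mat_norm_def by (intro borel_measurable_continuous_onI continuous_intros)

lemma L2_vec_nth:
  assumes "g \<in> (L2 :: (real ^ 2 \<Rightarrow> complex ^ 2) set)"
  shows "(\<lambda>x. g x $ i) \<in> L2"
proof -
  have g: "g \<in> borel_measurable lebesgue" "integrable lebesgue (\<lambda>x. (norm (g x))\<^sup>2)"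
    using assms by (auto simp: L2_def)
  have "(\<lambda>v::complex ^ 2. v $ i) \<in> borel_measurable borel"
    by (intro borel_measurable_continuous_onI continuous_intros)
  then have m: "(\<lambda>x. g x $ i) \<in> borel_measurable lebesgue"
    using measurable_compose[OF g(1)] by blast
  have "integrable lebesgue (\<lambda>x. (cmod (g x $ i))\<^sup>2)"
  proof (rule Bochner_Integration.integrable_bound[OF g(2)])
    show "AE x in lebesgue. norm ((cmod (g x $ i))\<^sup>2) \<le> norm ((norm (g x))\<^sup>2)"
      unfolding real_norm_def abs_power2 by (intro AE_I2 power_mono Finite_Cartesian_Product.norm_nth_le) auto
  qed (use m in measurable)
  then show ?thesis using m by (simp add: L2_def)
qed

lemma AE_lborel_of_lebesgue: "AE x in lebesgue. P x \<Longrightarrow> AE x in lborel. P x"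
  by (simp add: AE_completion_iff)

lemma potential_borel_representative:
  fixes V :: "real ^ 2 \<Rightarrow> complex ^ 2 ^ 2"
  assumes V: "V \<in> borel_measurable lebesgue"
  obtains v :: "real ^ 2 \<Rightarrow> real" where "\<And>x. v x \<ge> 0" "v \<in> borel_measurable borel" "AE x in lborel. mat_norm (V x) = v x"
    "potential_integral p V = (\<integral>\<^sup>+x. ennreal (v x powr p) \<partial>lborel)"
proof -
  have "(\<lambda>x. mat_norm (V x)) \<in> borel_measurable lebesgue"
    by (rule measurable_compose[OF V mat_norm_measurable])
  then obtain v0 where v0: "v0 \<in> borel_measurable lborel" "AE x in lborel. mat_norm (V x) = v0 x"
    using completion_ex_borel_measurable_real by blast
  define v where "v = (\<lambda>x. \<bar>v0 x\<bar>)"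
  have vm [measurable]: "v \<in> borel_measurable borel" using v0(1) by (simp add: v_def)
  have ae: "AE x in lborel. mat_norm (V x) = v x"
    using v0(2)
  proof eventually_elim
    case (elim x)
    then show ?case using mat_norm_nonneg[of "V x"] by (simp add: v_def)
  qed
  have "potential_integral p V = (\<integral>\<^sup>+x. ennreal (v x powr p) \<partial>lebesgue)"
    unfolding potential_integral_def
  proof (rule nn_integral_cong_AE)
    show "AE x in lebesgue. ennreal (mat_norm (V x) powr p) = ennreal (v x powr p)"
      using AE_completion[OF ae] by eventually_elim simp
  qed
  also have "\<dots> = (\<integral>\<^sup>+x. ennreal (v x powr p) \<partial>lborel)"
    by (rule nn_integral_completion)
  finally show ?thesis using that[of v] vm ae by (simp add: v_def)
qed

text \<open>For nonreal \<open>\<nu>\<close> the kernel is square integrable, which bounds the integral independently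
  of \<open>x\<close>. This is where the boundedness of eigenfunctions comes from.\<close>
lemma resolvent_decay_L2_bound:
  assumes \<nu>: "Im \<nu> \<noteq> 0" and g: "g \<in> borel_L2"
  shows "integrable lborel (\<lambda>z. resolvent_decay \<nu> (norm (z - x)) * cmod (g z))"
    and "(LINT z|lborel. resolvent_decay \<nu> (norm (z - x)) * cmod (g z))
      \<le> (LINT z|lborel. (resolvent_decay \<nu> (norm (z::real ^ 2)))\<^sup>2) + (LINT z|lborel. (cmod (g z))\<^sup>2)"
proof -
  have pos: "sqrt (cmod \<nu>) > 0" "\<bar>Im \<nu>\<bar> / (2 * sqrt (cmod \<nu>)) > 0"
    using \<nu> by (auto intro!: divide_pos_pos mult_pos_pos)
  let ?K = "\<lambda>x::real ^ 2. complex_of_real (resolvent_decay \<nu> (norm x))"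
  have n: "cmod (?K x) = resolvent_decay \<nu> (norm x)" for x
    using decay_nonneg[of "sqrt (cmod \<nu>)" "norm x"] by (simp add: resolvent_decay_def)
  have K: "?K \<in> borel_measurable borel" unfolding resolvent_decay_def by measurable
  have K2: "integrable lborel (\<lambda>x. (cmod (?K x))\<^sup>2)"
    unfolding n unfolding resolvent_decay_def by (rule integral_decay_square_le(1)[OF pos])
  show "integrable lborel (\<lambda>z. resolvent_decay \<nu> (norm (z - x)) * cmod (g z))"
    using integrable_norm[OF convol_integrable(1)[OF K K2 g, of x]] unfolding norm_mult n .
  show "(LINT z|lborel. resolvent_decay \<nu> (norm (z - x)) * cmod (g z))
      \<le> (LINT z|lborel. (resolvent_decay \<nu> (norm (z::real ^ 2)))\<^sup>2) + (LINT z|lborel. (cmod (g z))\<^sup>2)"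
    using convol_integrable(2)[OF K K2 g, of x] unfolding n .
qed

text \<open>An eigenfunction for \<open>k\<close> satisfies \<open>(D\<^sub>m - \<kappa>) u = (k - \<kappa>) u - V u\<close> for every \<open>\<kappa>\<close>. The right
  side is square integrable, so the pointwise bound for the free resolvent applies to it. The
  function \<open>G\<close> is the size of the right side, and \<open>X\<close> makes the bound on \<open>u\<close> uniform.\<close>
lemma shifted_bound:
  fixes m :: real and k \<kappa> \<nu> :: complex and V :: "real ^ 2 \<Rightarrow> complex ^ 2 ^ 2"
  assumes V: "potential V" and u: "u \<in> H2" and eq: "AE x in lebesgue. D_pert m V u x = k *s u x"
    and \<nu>: "\<nu>\<^sup>2 = \<kappa>\<^sup>2 - (of_real m)\<^sup>2" "Im \<nu> \<noteq> 0"
    and ub: "\<And>i. u' i \<in> borel_L2" "\<And>i. AE x in lebesgue. u x $ i = u' i x"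
    and v: "AE x in lborel. mat_norm (V x) = v x"
  defines "w \<equiv> \<lambda>x. cmod (u' 1 x) + cmod (u' 2 x)"
  shows "\<exists>G X. (AE z in lborel. 0 \<le> G z \<and> G z \<le> 2 * (cmod (k - \<kappa>) * w z + v z * w z)) \<and>
    (\<forall>x. (LINT z|lborel. resolvent_decay \<nu> (norm (z - x)) * G z) \<le> X) \<and>
    (AE x in lborel. w x \<le> 7 / kernel_mass * (cmod (\<kappa> + of_real m) / cmod \<nu> + cmod (\<kappa> - of_real m) / cmod \<nu> + 2)
       * (LINT z|lborel. resolvent_decay \<nu> (norm (z - x)) * G z))"
proof -
  define g where "g = (\<lambda>x. (k - \<kappa>) *s u x - V x *v u x)"
  have uL: "(\<lambda>x. u x $ i) \<in> L2" for i using u by (simp add: H2_def H2_scalar_def)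
  have VuL: "(\<lambda>x. (V x *v u x) $ i) \<in> L2" for i
    using V u by (intro L2_vec_nth) (auto simp: potential_def)
  have gL: "(\<lambda>x. g x $ i) \<in> L2" for i
    using L2_lincomb[OF uL[of i] VuL[of i], of "k - \<kappa>" "-1"]
    by (simp add: g_def algebra_simps)
  obtain ga where ga: "ga \<in> borel_L2" "AE x in lebesgue. g x $ 1 = ga x" using L2_borel_representative[OF gL] by metis
  obtain gb where gb: "gb \<in> borel_L2" "AE x in lebesgue. g x $ 2 = gb x" using L2_borel_representative[OF gL] by metis
  define g' where "g' = (\<lambda>i::2. if i = 1 then ga else gb)"
  have g'1: "g' i \<in> borel_L2" for i using ga gb by (simp add: g'_def)
  have g'2: "AE x in lebesgue. g x $ i = g' i x" for i
  proof -
    have "i = 1 \<or> i = 2" using exhaust_2 by blast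
    then show ?thesis using ga gb by (auto simp: g'_def)
  qed
  have eqg: "AE x in lebesgue. D_free m u x - \<kappa> *s u x = g x"
    using eq
  proof eventually_elim
    case (elim x)
    then have "D_free m u x = k *s u x - V x *v u x" by (simp add: D_pert_def eq_diff_eq)
    then show ?case by (simp add: g_def vector_sub_rdistrib)
  qed
  note rb = resolvent_pointwise_bound[OF u gL eqg \<nu> ub g'1 g'2]
  let ?Y = "\<lambda>x. LINT z|lborel. resolvent_decay \<nu> (norm (z - x)) * (cmod (g' 1 z) + cmod (g' 2 z))"
  have gi: "AE z in lborel. cmod (g' i z) \<le> cmod (k - \<kappa>) * w z + v z * w z" for i
    using AE_lborel_of_lebesgue[OF g'2[of i]] v AE_lborel_of_lebesgue[OF ub(2)[of 1]] AE_lborel_of_lebesgue[OF ub(2)[of 2]]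
  proof eventually_elim
    case (elim z)
    have "cmod (g' i z) = cmod ((k - \<kappa>) * u z $ i - (V z *v u z) $ i)" using elim(1) by (simp add: g_def algebra_simps)
    also have "\<dots> \<le> cmod (k - \<kappa>) * cmod (u z $ i) + mat_norm (V z) * (cmod (u z $ 1) + cmod (u z $ 2))"
      by (rule order_trans[OF norm_triangle_ineq4]) (intro add_mono norm_mat_vec_nth_le, simp add: norm_mult)
    also have "cmod (k - \<kappa>) * cmod (u z $ i) \<le> cmod (k - \<kappa>) * w z"
    proof (intro mult_left_mono)
      have "i = 1 \<or> i = 2" using exhaust_2 by blast
      then show "cmod (u z $ i) \<le> w z" using elim by (auto simp: w_def)
    qed auto
    also have "mat_norm (V z) * (cmod (u z $ 1) + cmod (u z $ 2)) = v z * w z" using elim by (simp add: w_def)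
    finally show ?case by simp
  qed
  show ?thesis
  proof (intro exI[of _ "\<lambda>z. cmod (g' 1 z) + cmod (g' 2 z)"]
      exI[of _ "2 * (LINT z|lborel. (resolvent_decay \<nu> (norm (z::real ^ 2)))\<^sup>2) + (LINT z|lborel. (cmod (g' 1 z))\<^sup>2) + (LINT z|lborel. (cmod (g' 2 z))\<^sup>2)"] conjI allI)
    show "AE z in lborel. 0 \<le> cmod (g' 1 z) + cmod (g' 2 z) \<and> cmod (g' 1 z) + cmod (g' 2 z) \<le> 2 * (cmod (k - \<kappa>) * w z + v z * w z)"
      using gi[of 1] gi[of 2]
    proof eventually_elim
      case (elim z)
      have "a + b \<le> 2 * c" if "a \<le> c" "b \<le> c" for a b c :: real using that by simp
      from this[OF elim] show ?case by (intro conjI add_nonneg_nonneg norm_ge_zero)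
    qed
    show "?Y x \<le> 2 * (LINT z|lborel. (resolvent_decay \<nu> (norm (z::real ^ 2)))\<^sup>2) + (LINT z|lborel. (cmod (g' 1 z))\<^sup>2) + (LINT z|lborel. (cmod (g' 2 z))\<^sup>2)" for x
    proof -
      note b1 = resolvent_decay_L2_bound[OF \<nu>(2) g'1[of 1], of x] and b2 = resolvent_decay_L2_bound[OF \<nu>(2) g'1[of 2], of x]
      have "?Y x = (LINT z|lborel. resolvent_decay \<nu> (norm (z - x)) * cmod (g' 1 z)) + (LINT z|lborel. resolvent_decay \<nu> (norm (z - x)) * cmod (g' 2 z))"
        using b1(1) b2(1) by (simp add: distrib_left)
      then show ?thesis using b1(2) b2(2) by linarith
    qed
    show "AE x in lborel. w x \<le> 7 / kernel_mass * (cmod (\<kappa> + of_real m) / cmod \<nu> + cmod (\<kappa> - of_real m) / cmod \<nu> + 2) * ?Y x"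
      using rb
    proof eventually_elim
      case (elim x)
      have gen: "C * (P + 1) * Y + C * (Q + 1) * Y = C * (P + Q + 2) * Y" for C P Q Y :: real
        by (simp add: algebra_simps)
      show ?case unfolding w_def gen[symmetric] by (intro add_mono elim)
    qed
  qed
qed

text \<open>If the right side \<open>\<theta>\<close> were less than \<open>1\<close>, an essential bound \<open>M\<close> for the eigenfunction
  would improve to \<open>\<theta> M\<close>; iterating from the first finite bound, the eigenfunction would
  vanish.\<close>
lemma eigenvalue_inequality:
  fixes p m I \<tau> s :: real and k \<mu> :: complex and V :: "real ^ 2 \<Rightarrow> complex ^ 2 ^ 2"
  assumes p: "1 < p" "p < 4/3" and s: "s = p / (p - 1)" and \<tau>: "\<tau> > 0"
    and V: "potential V" and u: "u \<in> H2" and nz: "\<not> (AE x in lebesgue. u x = 0)"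
    and eq: "AE x in lebesgue. D_pert m V u x = k *s u x"
    and \<mu>: "\<mu>\<^sup>2 = k\<^sup>2 - (of_real m)\<^sup>2" "\<mu> \<noteq> 0"
    and I: "potential_integral p V = ennreal I" "I \<ge> 0"
  shows "1 \<le> 4 * (7 / kernel_mass) * (cmod (k + of_real m) / cmod \<mu> + cmod (k - of_real m) / cmod \<mu> + 1)
     * (\<tau> powr s * decay_mass s / (cmod \<mu> * s) + \<tau> powr (- p) * I / p)"
proof -
  have uL: "(\<lambda>x. u x $ i) \<in> L2" for i using u by (simp add: H2_def H2_scalar_def)
  obtain ua where ua: "ua \<in> borel_L2" "AE x in lebesgue. u x $ 1 = ua x" using L2_borel_representative[OF uL] by metis
  obtain uc where uc: "uc \<in> borel_L2" "AE x in lebesgue. u x $ 2 = uc x" using L2_borel_representative[OF uL] by metis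
  define u' where "u' = (\<lambda>i::2. if i = 1 then ua else uc)"
  have u'1: "u' i \<in> borel_L2" for i using ua uc by (simp add: u'_def)
  have u'2: "AE x in lebesgue. u x $ i = u' i x" for i
  proof -
    have "i = 1 \<or> i = 2" using exhaust_2 by blast
    then show ?thesis using ua uc by (auto simp: u'_def)
  qed
  define w where "w = (\<lambda>x. cmod (u' 1 x) + cmod (u' 2 x))"
  have w0: "w x \<ge> 0" for x by (simp add: w_def)
  note [measurable] = borel_L2_measurable[OF u'1]
  have w2: "integrable lborel (\<lambda>z. (w z)\<^sup>2)"
  proof (rule Bochner_Integration.integrable_bound)
    show "integrable lborel (\<lambda>z. 2 * (cmod (u' 1 z))\<^sup>2 + 2 * (cmod (u' 2 z))\<^sup>2)"
      using u'1 by (intro Bochner_Integration.integrable_add integrable_mult_right) (auto simp: borel_L2_def)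
    show "AE z in lborel. norm ((w z)\<^sup>2) \<le> norm (2 * (cmod (u' 1 z))\<^sup>2 + 2 * (cmod (u' 2 z))\<^sup>2)"
    proof (rule AE_I2)
      fix z
      have "(w z)\<^sup>2 \<le> 2 * (cmod (u' 1 z))\<^sup>2 + 2 * (cmod (u' 2 z))\<^sup>2"
        using sum_squares_bound[of "cmod (u' 1 z)" "cmod (u' 2 z)"] by (simp add: w_def power2_sum)
      then show "norm ((w z)\<^sup>2) \<le> norm (2 * (cmod (u' 1 z))\<^sup>2 + 2 * (cmod (u' 2 z))\<^sup>2)" by simp
    qed
  qed (unfold w_def, measurable)
  obtain v where v: "\<And>x. v x \<ge> 0" "v \<in> borel_measurable borel" "AE x in lborel. mat_norm (V x) = v x"
    "potential_integral p V = (\<integral>\<^sup>+x. ennreal (v x powr p) \<partial>lborel)"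
    using potential_borel_representative[of V p] V by (auto simp: potential_def)
  note [measurable] = v(2)
  have vp: "integrable lborel (\<lambda>z. v z powr p)"
    by (rule integrableI_nn_integral_finite[of _ _ I]) (use v(4) I in \<open>auto intro!: AE_I2\<close>)
  have vI: "(LINT z|lborel. v z powr p) = I"
  proof -
    have "ennreal (LINT z|lborel. v z powr p) = ennreal I"
      using nn_integral_eq_integral[OF vp] v(4) I by simp
    then show ?thesis using I by (simp add: integral_nonneg_AE)
  qed
  define \<delta> where "\<delta> = (\<lambda>n. 1 / real (Suc n))"
  have \<delta>0: "\<delta> n > 0" for n by (simp add: \<delta>_def)
  have \<delta>lim: "\<delta> \<longlonglongrightarrow> 0" unfolding \<delta>_def by real_asymp
  \<comment> \<open>The shift goes away from the real axis, hence its imaginary part has modulus at least \<open>\<delta> n\<close>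
    also when k is not real.\<close>
  define \<sigma> :: real where "\<sigma> = (if Im k \<ge> 0 then 1 else - 1)"
  have \<sigma>1: "\<bar>\<sigma>\<bar> = 1" by (simp add: \<sigma>_def)
  define \<kappa> where "\<kappa> = (\<lambda>n. k + \<i> * of_real (\<sigma> * \<delta> n))"
  define \<nu> where "\<nu> = (\<lambda>n. csqrt ((\<kappa> n)\<^sup>2 - (of_real m)\<^sup>2))"
  have \<nu>sq: "(\<nu> n)\<^sup>2 = (\<kappa> n)\<^sup>2 - (of_real m)\<^sup>2" for n by (simp add: \<nu>_def)
  have Im\<kappa>: "\<bar>Im (\<kappa> n)\<bar> \<ge> \<delta> n" for n using \<delta>0[of n] by (simp add: \<kappa>_def \<sigma>_def)
  have Im\<nu>: "\<bar>Im (\<nu> n)\<bar> \<ge> \<delta> n" for n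
    using abs_Im_ge_of_square_diff[OF \<nu>sq[of n]] Im\<kappa>[of n] by linarith
  then have Im\<nu>0: "Im (\<nu> n) \<noteq> 0" for n using \<delta>0[of n] by (metis abs_zero not_le)
  have \<nu>pos: "cmod (\<nu> n) > 0" for n using Im\<nu>0[of n] by auto
  have k\<kappa>: "cmod (k - \<kappa> n) = \<delta> n" for n
    using \<delta>0[of n] \<sigma>1 by (simp add: \<kappa>_def norm_mult abs_mult)
  have \<kappa>lim: "\<kappa> \<longlonglongrightarrow> k"
  proof -
    have "\<kappa> \<longlonglongrightarrow> k + \<i> * of_real (\<sigma> * 0)" unfolding \<kappa>_def by (intro tendsto_intros \<delta>lim)
    then show ?thesis by simp
  qed
  have \<nu>lim: "(\<lambda>n. cmod (\<nu> n)) \<longlonglongrightarrow> cmod \<mu>"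
  proof -
    have "(\<lambda>n. sqrt (cmod ((\<kappa> n)\<^sup>2 - (of_real m)\<^sup>2))) \<longlonglongrightarrow> sqrt (cmod (k\<^sup>2 - (of_real m)\<^sup>2))"
      by (intro tendsto_intros \<kappa>lim)
    also have "sqrt (cmod (k\<^sup>2 - (of_real m)\<^sup>2)) = cmod \<mu>"
      unfolding \<mu>(1)[symmetric] norm_power by simp
    finally show ?thesis by (simp add: \<nu>_def cmod_csqrt)
  qed
  define A where "A = (\<lambda>n. 7 / kernel_mass * (cmod (\<kappa> n + of_real m) / cmod (\<nu> n) + cmod (\<kappa> n - of_real m) / cmod (\<nu> n) + 2))"
  have A0: "A n \<ge> 0" for n
    unfolding A_def using kernel_mass_pos by (intro mult_nonneg_nonneg add_nonneg_nonneg) auto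
  have Alim: "A \<longlonglongrightarrow> 7 / kernel_mass * (cmod (k + of_real m) / cmod \<mu> + cmod (k - of_real m) / cmod \<mu> + 2)"
    unfolding A_def using \<mu>(2) by (intro tendsto_intros \<kappa>lim \<nu>lim) auto
  define Q where "Q = (\<lambda>n (G :: real ^ 2 \<Rightarrow> real) (X :: real).
      (AE z in lborel. 0 \<le> G z \<and> G z \<le> 2 * (\<delta> n * w z + v z * w z)) \<and>
      (\<forall>x. (LINT z|lborel. resolvent_decay (\<nu> n) (norm (z - x)) * G z) \<le> X) \<and>
      (AE x in lborel. w x \<le> A n * (LINT z|lborel. resolvent_decay (\<nu> n) (norm (z - x)) * G z)))"
  have "\<exists>G X. Q n G X" for n
    using shifted_bound[OF V u eq \<nu>sq[of n] Im\<nu>0[of n] u'1 u'2 v(3)] unfolding k\<kappa> Q_def w_def A_def .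
  then obtain G X where Q: "\<And>n. Q n (G n) (X n)" by metis
  have G: "\<And>n. AE z in lborel. 0 \<le> G n z \<and> G n z \<le> 2 * (\<delta> n * w z + v z * w z)"
    and X: "\<And>n x. (LINT z|lborel. resolvent_decay (\<nu> n) (norm (z - x)) * G n z) \<le> X n"
    and wG: "\<And>n. AE x in lborel. w x \<le> A n * (LINT z|lborel. resolvent_decay (\<nu> n) (norm (z - x)) * G n z)"
    using Q unfolding Q_def by blast+
  \<comment> \<open>Any single shift gives a finite bound on the eigenfunction; the iteration starts from it.\<close>
  define M0 where "M0 = \<bar>A 0 * X 0\<bar>"
  have wM0: "AE x in lborel. w x \<le> M0"
    using wG[of 0]
  proof eventually_elim
    case (elim x)
    have "A 0 * (LINT z|lborel. resolvent_decay (\<nu> 0) (norm (z - x)) * G 0 z) \<le> A 0 * X 0"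
      by (intro mult_left_mono X A0)
    then show ?case using elim by (simp add: M0_def)
  qed
  let ?E = "\<tau> powr s * decay_mass s / (cmod \<mu> * s) + \<tau> powr (- p) * I / p"
  define \<theta> where "\<theta> = 4 * (7 / kernel_mass) * (cmod (k + of_real m) / cmod \<mu> + cmod (k - of_real m) / cmod \<mu> + 1) * ?E"
  have s0: "s > 0" using p by (simp add: s)
  have E0: "?E \<ge> 0" using p I s0 decay_mass_nonneg[of s] by (intro add_nonneg_nonneg divide_nonneg_nonneg mult_nonneg_nonneg) auto
  have \<theta>0: "\<theta> \<ge> 0"
    unfolding \<theta>_def using kernel_mass_pos by (intro mult_nonneg_nonneg[OF _ E0]) auto
  \<comment> \<open>For each n the bound holds up to an error of order \<open>\<delta> n\<close> to the power 1/2; it disappears in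
    the limit.\<close>
  have contr: "AE x in lborel. w x \<le> \<theta> * M" if M: "M \<ge> 0" and wM: "AE x in lborel. w x \<le> M" for M
  proof -
    let ?E' = "\<lambda>n. \<tau> powr s * decay_mass s / (cmod (\<nu> n) * s) + \<tau> powr (- p) * I / p"
    let ?W = "2 * decay_mass2 + (LINT z|lborel. (w z)\<^sup>2)"
    have "AE x in lborel. w x \<le> A n * (sqrt (\<delta> n) * ?W + 2 * M * ?E' n)" for n
      using wG[of n]
    proof eventually_elim
      case (elim x)
      let ?\<rho> = "sqrt (cmod (\<nu> n))" and ?a = "\<bar>Im (\<nu> n)\<bar> / (2 * sqrt (cmod (\<nu> n)))"
      have \<rho>: "?\<rho> > 0" and a: "?a > 0" using \<nu>pos[of n] Im\<nu>0[of n] by auto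
      have \<rho>a: "\<delta> n / 2 \<le> ?\<rho> * ?a" using Im\<nu>[of n] \<nu>pos[of n] by simp
      have wae: "AE z in lborel. 0 \<le> w z \<and> w z \<le> M" using wM by eventually_elim (simp add: w0)
      have "(LINT z|lborel. resolvent_decay (\<nu> n) (norm (z - x)) * G n z)
         \<le> sqrt (\<delta> n) * ?W + 2 * M * (\<tau> powr s * decay_mass s / (?\<rho>\<^sup>2 * s) + \<tau> powr (- p) * (LINT z|lborel. v z powr p) / p)"
        unfolding resolvent_decay_def
        by (rule decay_integral_bound[OF \<rho> a p s \<delta>0 \<rho>a \<tau> M wae w2 v(1) vp G])
      also have "?\<rho>\<^sup>2 = cmod (\<nu> n)" by simp
      finally have "A n * (LINT z|lborel. resolvent_decay (\<nu> n) (norm (z - x)) * G n z) \<le> A n * (sqrt (\<delta> n) * ?W + 2 * M * ?E' n)"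
        unfolding vI by (intro mult_left_mono A0)
      then show ?case using elim by linarith
    qed
    then have "AE x in lborel. \<forall>n. w x \<le> A n * (sqrt (\<delta> n) * ?W + 2 * M * ?E' n)" unfolding AE_all_countable by blast
    then show ?thesis
    proof eventually_elim
      case (elim x)
      have "(\<lambda>n. A n * (sqrt (\<delta> n) * ?W + 2 * M * ?E' n)) \<longlonglongrightarrow>
         7 / kernel_mass * (cmod (k + of_real m) / cmod \<mu> + cmod (k - of_real m) / cmod \<mu> + 2) * (sqrt 0 * ?W + 2 * M * ?E)"
        using \<mu>(2) s0 by (intro tendsto_intros Alim \<delta>lim \<nu>lim) auto
      then have "w x \<le> 7 / kernel_mass * (cmod (k + of_real m) / cmod \<mu> + cmod (k - of_real m) / cmod \<mu> + 2) * (sqrt 0 * ?W + 2 * M * ?E)"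
        using elim by (intro LIMSEQ_le_const) auto
      also have "\<dots> = 7 / kernel_mass * (cmod (k + of_real m) / cmod \<mu> + cmod (k - of_real m) / cmod \<mu> + 2) * (2 * M * ?E)" by simp
      also have "\<dots> \<le> 7 / kernel_mass * (2 * (cmod (k + of_real m) / cmod \<mu> + cmod (k - of_real m) / cmod \<mu> + 1)) * (2 * M * ?E)"
      proof (intro mult_right_mono mult_left_mono)
        have "X + Y + 2 \<le> 2 * (X + Y + 1)" if "X \<ge> 0" "Y \<ge> 0" for X Y :: real using that by simp
        from this[OF divide_nonneg_nonneg[OF norm_ge_zero norm_ge_zero] divide_nonneg_nonneg[OF norm_ge_zero norm_ge_zero]]
        show "cmod (k + of_real m) / cmod \<mu> + cmod (k - of_real m) / cmod \<mu> + 2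
          \<le> 2 * (cmod (k + of_real m) / cmod \<mu> + cmod (k - of_real m) / cmod \<mu> + 1)" .
      qed (use kernel_mass_pos M E0 in auto)
      also have "\<dots> = \<theta> * M"
      proof -
        have "C * (2 * S) * (2 * M * E) = 4 * C * S * E * M" for C S E :: real by simp
        then show ?thesis unfolding \<theta>_def .
      qed
      finally show ?case .
    qed
  qed
  have "\<not> \<theta> < 1"
  proof
    assume "\<theta> < 1"
    have "AE x in lborel. w x \<le> 0"
      by (rule AE_eq_0_of_contraction[OF contr \<theta>0 \<open>\<theta> < 1\<close> _ wM0]) (simp_all add: M0_def)
    then have "AE x in lebesgue. w x \<le> 0" by (rule AE_completion)
    with u'2[of 1] u'2[of 2] have "AE x in lebesgue. u x = 0"
    proof eventually_elim
      case (elim x)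
      then have "cmod (u' 1 x) = 0" "cmod (u' 2 x) = 0"
        using norm_ge_zero[of "u' 1 x"] norm_ge_zero[of "u' 2 x"] unfolding w_def by linarith+
      then show ?case using elim by (simp add: vec_eq_iff forall_2)
    qed
    then show False using nz by blast
  qed
  then show ?thesis by (simp add: \<theta>_def)
qed

text \<open>If \<open>V\<close> vanished almost everywhere, \<open>u\<close> would be an eigenfunction of the free operator, and
  the resolvent estimate \<open>\<parallel>u\<parallel> \<le> c \<parallel>(D\<^sub>m - k) u\<parallel>\<close> would make it \<open>0\<close>.\<close>
lemma potential_integral_pos:
  fixes V :: "real ^ 2 \<Rightarrow> complex ^ 2 ^ 2"
  assumes p: "p > 0" and V: "potential V" and k: "k \<notin> spectrum H2 (D_free m)" and ev: "eigenvalue H2 (D_pert m V) k"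
  shows "potential_integral p V \<noteq> 0"
proof
  assume 0: "potential_integral p V = 0"
  obtain u where u: "u \<in> H2" and nz: "\<not> (AE x in lebesgue. u x = 0)" and eq: "AE x in lebesgue. D_pert m V u x = k *s u x"
    using ev by (auto simp: eigenvalue_def)
  obtain c where c: "\<And>u. u \<in> H2 \<Longrightarrow> L2_norm u \<le> c * L2_norm (\<lambda>x. D_free m u x - k *s u x)"
    using k by (auto simp: spectrum_def resolvent_set_def)
  have Vm: "V \<in> borel_measurable lebesgue" using V by (simp add: potential_def)
  have m: "(\<lambda>x. ennreal (mat_norm (V x) powr p)) \<in> borel_measurable lebesgue"
    using measurable_compose[OF Vm mat_norm_measurable] by measurable
  have "AE x in lebesgue. ennreal (mat_norm (V x) powr p) = 0"
    using 0 nn_integral_0_iff_AE[OF m] by (simp add: potential_integral_def)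
  with eq have "AE x in lebesgue. norm (D_free m u x - k *s u x) ^ 2 = 0"
  proof eventually_elim
    case (elim x)
    have "mat_norm (V x) powr p = 0" using elim(2) powr_ge_zero[of "mat_norm (V x)" p] by (simp add: ennreal_eq_0_iff)
    then have "mat_norm (V x) = 0" by simp
    then have "V x $ i $ j = 0" for i j using norm_entry_le_mat_norm[of "V x" i j] by simp
    then have "V x = 0" by (simp add: vec_eq_iff)
    then show ?case using elim(1) by (simp add: D_pert_def)
  qed
  then have "L2_norm (\<lambda>x. D_free m u x - k *s u x) = 0"
    unfolding L2_norm_def by (subst integral_eq_zero_AE) auto
  then have "L2_norm u \<le> 0" using c[OF u] by simp
  then have z: "(LINT x|lebesgue. (norm (u x))\<^sup>2) = 0"
    unfolding L2_norm_def by (intro antisym integral_nonneg_AE) auto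
  have uL: "(\<lambda>x. u x $ i) \<in> L2" for i using u by (simp add: H2_def H2_scalar_def)
  have n2: "(norm (u x))\<^sup>2 = (cmod (u x $ 1))\<^sup>2 + (cmod (u x $ 2))\<^sup>2" for x
    by (simp add: norm_vec_def L2_set_def sum_2)
  have "integrable lebesgue (\<lambda>x. (norm (u x))\<^sup>2)"
    unfolding n2 by (intro Bochner_Integration.integrable_add L2_complexD uL)
  then have "AE x in lebesgue. (norm (u x))\<^sup>2 = 0"
    using z by (subst (asm) integral_nonneg_eq_0_iff_AE) auto
  then have "AE x in lebesgue. u x = 0" by eventually_elim simp
  then show False using nz by blast
qed

text \<open>A consequence of \<open>|\<mu>|\<^sup>2 = |k - c| |k + c|\<close>.\<close>
lemma norm_ratio_eq_sqrt:
  assumes "\<mu>\<^sup>2 = k\<^sup>2 - c\<^sup>2" "\<mu> \<noteq> 0"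
  shows "cmod (k + c) / cmod \<mu> = sqrt (cmod ((k + c) / (k - c)))"
proof -
  have f: "\<mu>\<^sup>2 = (k + c) * (k - c)" using assms(1) by (simp add: algebra_simps power2_eq_square)
  have ne: "k + c \<noteq> 0" "k - c \<noteq> 0" using f assms(2) by auto
  have \<mu>2: "(cmod \<mu>)\<^sup>2 = cmod (k + c) * cmod (k - c)" using arg_cong[OF f, of cmod] by (simp add: norm_power norm_mult)
  have "(cmod (k + c) / cmod \<mu>)\<^sup>2 = cmod ((k + c) / (k - c))"
    unfolding power_divide \<mu>2 norm_divide using ne by (simp add: power2_eq_square)
  then show ?thesis by (metis divide_nonneg_nonneg norm_ge_zero real_sqrt_unique)
qed

text \<open>The choice of \<open>\<tau>\<close> makes the first summand equal to \<open>1 / s\<close>; as \<open>1 / s + 1 / p = 1\<close>, the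
  second must be at least \<open>1 / p\<close>.\<close>
lemma optimise_parameter:
  fixes p s K P N I :: real
  assumes p: "p > 1" and s: "s = p / (p - 1)" and pos: "K > 0" "P > 0" "N > 0"
    and ineq: "\<And>\<tau>. \<tau> > 0 \<Longrightarrow> 1 \<le> K * (\<tau> powr s * P / (N * s) + \<tau> powr (- p) * I / p)"
  shows "1 \<le> K powr p * P powr (p - 1) * I / N powr (p - 1)"
proof -
  have s0: "s > 0" using p by (simp add: s)
  define \<tau> where "\<tau> = (N / (K * P)) powr (1 / s)"
  have \<tau>: "\<tau> > 0" using pos by (simp add: \<tau>_def)
  have \<tau>s: "\<tau> powr s = N / (K * P)" using pos s0 by (simp add: \<tau>_def powr_powr)
  have \<tau>p: "\<tau> powr (- p) = (K * P / N) powr (p - 1)"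
  proof -
    have "\<tau> powr (- p) = (N / (K * P)) powr (- (p - 1))"
      unfolding \<tau>_def powr_powr using p by (simp add: s)
    also have "\<dots> = 1 / (N / (K * P)) powr (p - 1)" by (rule powr_minus_divide)
    also have "\<dots> = (K * P / N) powr (p - 1)"
      using pos by (simp add: powr_divide)
    finally show ?thesis .
  qed
  have "1 \<le> K * (\<tau> powr s * P / (N * s)) + K * (\<tau> powr (- p) * I / p)"
    using ineq[OF \<tau>] by (simp add: distrib_left)
  also have "K * (\<tau> powr s * P / (N * s)) = 1 / s" unfolding \<tau>s using pos by simp
  also have "1 / s = 1 - 1 / p" using p by (simp add: s field_simps)
  finally have "1 / p \<le> K * (\<tau> powr (- p) * I / p)" by simp
  then have "1 \<le> K * (\<tau> powr (- p) * I)" using p by (simp add: field_simps)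
  also have "\<dots> = (K * K powr (p - 1)) * P powr (p - 1) * I / N powr (p - 1)"
    unfolding \<tau>p using pos by (simp add: powr_divide powr_mult)
  also have "K * K powr (p - 1) = K powr p"
    using pos powr_add[of K 1 "p - 1"] by simp
  finally show ?thesis .
qed

theorem theorem1p1:
  fixes p :: real
  assumes "1 < p" and "p < 4 / 3"
  shows "\<exists>C::real. C > 0 \<and>
    (\<forall>(m::real) (V :: real ^ 2 \<Rightarrow> complex ^ 2 ^ 2) (k::complex) (\<mu>::complex).
       m \<ge> 0 \<longrightarrow> potential V \<longrightarrow>
       k \<notin> spectrum H2 (D_free m) \<longrightarrow> eigenvalue H2 (D_pert m V) k \<longrightarrow>
       \<mu>\<^sup>2 = k\<^sup>2 - (of_real m)\<^sup>2 \<longrightarrow>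
         ennreal C * potential_integral p V / ennreal (cmod \<mu> powr (p - 1)) *
           ennreal ((sqrt (cmod ((k - of_real m) / (k + of_real m))) +
                     sqrt (cmod ((k + of_real m) / (k - of_real m))) + 1) powr p) \<ge> 1 \<and>
         (m = 0 \<longrightarrow>
           ennreal (cmod k powr (p - 1)) \<le> ennreal (3 powr p * C) * potential_integral p V))"
proof -
  define s where "s = p / (p - 1)"
  \<comment> \<open>Adding 1 only serves positivity.\<close>
  define P where "P = decay_mass s + 1"
  define c where "c = 4 * (7 / kernel_mass)"
  define C where "C = c powr p * P powr (p - 1)"
  have P: "P > 0" using decay_mass_nonneg[of s] by (simp add: P_def)
  have c: "c > 0" using kernel_mass_pos by (simp add: c_def)
  have C: "C > 0" using P c by (simp add: C_def)
  show ?thesis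
  proof (intro exI[of _ C] conjI C allI impI)
    fix m :: real and V :: "real ^ 2 \<Rightarrow> complex ^ 2 ^ 2" and k \<mu> :: complex
    assume m: "m \<ge> 0" and V: "potential V" and k: "k \<notin> spectrum H2 (D_free m)"
      and ev: "eigenvalue H2 (D_pert m V) k" and \<mu>: "\<mu>\<^sup>2 = k\<^sup>2 - (of_real m)\<^sup>2"
    define S where "S = sqrt (cmod ((k - of_real m) / (k + of_real m))) + sqrt (cmod ((k + of_real m) / (k - of_real m))) + 1"
    have S1: "S \<ge> 1" by (simp add: S_def)
    have Sp: "ennreal (S powr p) \<noteq> 0" using S1 by simp
    \<comment> \<open>If \<open>\<mu> = 0\<close>, the quotient in the claim is infinite as soon as its numerator is not 0.\<close>
    have I0: "potential_integral p V \<noteq> 0"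
      using assms by (intro potential_integral_pos[OF _ V k ev]) simp
    have ineq: "1 \<le> C * I * S powr p / cmod \<mu> powr (p - 1)"
      if I: "potential_integral p V = ennreal I" "I \<ge> 0" and \<mu>0: "\<mu> \<noteq> 0" for I
    proof -
      obtain u where u: "u \<in> H2" and nz: "\<not> (AE x in lebesgue. u x = 0)" and eq: "AE x in lebesgue. D_pert m V u x = k *s u x"
        using ev by (auto simp: eigenvalue_def)
      have "cmod (k + of_real m) / cmod \<mu> = sqrt (cmod ((k + of_real m) / (k - of_real m)))"
        by (rule norm_ratio_eq_sqrt[OF \<mu> \<mu>0])
      moreover have "cmod (k - of_real m) / cmod \<mu> = sqrt (cmod ((k - of_real m) / (k + of_real m)))"
        using norm_ratio_eq_sqrt[of \<mu> k "- of_real m"] \<mu> \<mu>0 by simp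
      ultimately have S_eq: "cmod (k + of_real m) / cmod \<mu> + cmod (k - of_real m) / cmod \<mu> + 1 = S"
        by (simp add: S_def)
      have "1 \<le> (c * S) powr p * P powr (p - 1) * I / cmod \<mu> powr (p - 1)"
      proof (rule optimise_parameter[OF assms(1) s_def])
        show "c * S > 0" "P > 0" "cmod \<mu> > 0" using c S1 P \<mu>0 by auto
        fix \<tau> :: real assume \<tau>: "\<tau> > 0"
        have "1 \<le> c * S * (\<tau> powr s * decay_mass s / (cmod \<mu> * s) + \<tau> powr (- p) * I / p)"
          using eigenvalue_inequality[OF assms s_def \<tau> V u nz eq \<mu> \<mu>0 I] unfolding S_eq c_def[symmetric] .
        also have "\<dots> \<le> c * S * (\<tau> powr s * P / (cmod \<mu> * s) + \<tau> powr (- p) * I / p)"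
          using c S1 assms by (intro mult_left_mono add_right_mono divide_right_mono) (auto simp: P_def s_def)
        finally show "1 \<le> c * S * (\<tau> powr s * P / (cmod \<mu> * s) + \<tau> powr (- p) * I / p)" .
      qed
      then show ?thesis using c S1 by (simp add: C_def powr_mult mult_ac)
    qed
    have main: "ennreal C * potential_integral p V / ennreal (cmod \<mu> powr (p - 1)) * ennreal (S powr p) \<ge> 1"
    proof (cases "potential_integral p V")
      case (real I)
      show ?thesis
      proof (cases "\<mu> = 0")
        case True
        have "ennreal C * potential_integral p V \<noteq> 0" using I0 C by simp
        then show ?thesis using True Sp by (simp add: ennreal_top_mult ennreal_divide_zero)
      next
        case False
        then have N: "cmod \<mu> powr (p - 1) > 0" by simp
        have "ennreal C * potential_integral p V / ennreal (cmod \<mu> powr (p - 1)) * ennreal (S powr p)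
          = ennreal (C * I / cmod \<mu> powr (p - 1) * S powr p)"
        proof -
          have "ennreal C * ennreal I = ennreal (C * I)"
            using C real(1) by (intro ennreal_mult[symmetric]) auto
          moreover have "ennreal (C * I) / ennreal (cmod \<mu> powr (p - 1)) = ennreal (C * I / cmod \<mu> powr (p - 1))"
            using C real(1) N by (intro divide_ennreal) auto
          moreover have "ennreal (C * I / cmod \<mu> powr (p - 1)) * ennreal (S powr p) = ennreal (C * I / cmod \<mu> powr (p - 1) * S powr p)"
            using C real(1) N by (intro ennreal_mult[symmetric]) auto
          ultimately show ?thesis by (simp only: real(2))
        qed
        moreover have "C * I / cmod \<mu> powr (p - 1) * S powr p \<ge> 1"
          using ineq[OF real(2) real(1) False] by simp
        ultimately show ?thesis by simp
      qed
    next
      case top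
      have "ennreal C * potential_integral p V = top" using top C by (simp add: ennreal_mult_top)
      then show ?thesis using Sp by (simp add: ennreal_top_divide ennreal_top_mult)
    qed
    then show "1 \<le> ennreal C * potential_integral p V / ennreal (cmod \<mu> powr (p - 1)) *
           ennreal ((sqrt (cmod ((k - of_real m) / (k + of_real m))) +
                     sqrt (cmod ((k + of_real m) / (k - of_real m))) + 1) powr p)"
      by (simp add: S_def)
    assume m0: "m = 0"
    show "ennreal (cmod k powr (p - 1)) \<le> ennreal (3 powr p * C) * potential_integral p V"
    proof (cases "potential_integral p V")
      case (real I)
      show ?thesis
      proof (cases "k = 0")
        case False
        have "(cmod \<mu>)\<^sup>2 = (cmod k)\<^sup>2" using arg_cong[OF \<mu>, of cmod] m0 by (simp add: norm_power)
        then have \<mu>k: "cmod \<mu> = cmod k" by simp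
        then have \<mu>0: "\<mu> \<noteq> 0" using False by auto
        have S3: "S = 3" using m0 False by (simp add: S_def)
        have "cmod k powr (p - 1) > 0" using False by simp
        then have "cmod k powr (p - 1) \<le> 3 powr p * C * I"
          using ineq[OF real(2) real(1) \<mu>0] unfolding \<mu>k S3 by (simp add: pos_le_divide_eq mult_ac)
        moreover have "ennreal (3 powr p * C) * potential_integral p V = ennreal (3 powr p * C * I)"
          unfolding real(2) using real(1) C by (intro ennreal_mult[symmetric]) auto
        ultimately show ?thesis by (simp only: ennreal_leI)
      qed (use assms in simp)
    next
      case top
      then show ?thesis using C by (simp add: ennreal_mult_top)
    qed
  qed
qed

end
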